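(* Let $\alpha,\beta>0$. Assume that $g,\gamma\in M^p(\mathbb{R})\setminus M^1(\mathbb{R})$ for some $1<p\le 2$ are such that $\big(\{M_{\beta n}T_{\alpha k}g\}_{k,n\in\mathbb{Z}},\{M_{\beta n}T_{\alpha k}\gamma\}_{k,n\in\mathbb{Z}}\big)$ is a Schauder frame for $L^2(\mathbb{R})$ (with respect to some ordering). Let $p'$ be the conjugate exponent of $p$. Then the following statements are equivalent. (a) $\big(\{M_{\beta n}T_{\alpha k}g\}_{k,n\in\mathbb{Z}},\{M_{\beta n}T_{\alpha k}\gamma\}_{k,n\in\mathbb{Z}}\big)$ is an unconditional Schauder frame for $M^q(\mathbb{R})$ for any $p\le q\le p'$. (b) $\big(\{M_{\beta n}T_{\alpha k}\gamma\}_{k,n\in\mathbb{Z}},\{M_{\beta n}T_{\alpha k}g\}_{k,n\in\mathbb{Z}}\big)$ is an unconditional Schauder frame for $M^q(\mathbb{R})$ for any $p\le q\le p'$. (c) For any $p\le q\le p'$, the series $\sum_{n,k\in\mathbb{Z}}\langle f,M_{\beta n}T_{\alpha k}\gamma\rangle\,M_{\beta n}T_{\alpha k}g$ is weakly unconditionally convergent in $M^q(\mathbb{R})$ for all $f\in M^q(\mathbb{R})$. (d) For any $p\le q\le p'$, the series $\sum_{n,k\in\mathbb{Z}}\langle f,M_{\beta n}T_{\alpha k}g\rangle\,M_{\beta n}T_{\alpha k}\gamma$ is weakly unconditionally convergent in $M^q(\mathbb{R})$ for all $f\in M^q(\mathbb{R})$. (e) The analysis operators $f\mapsto(\langle f,M_{\beta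 n}T_{\alpha k}g\rangle)_{k,n\in\mathbb{Z}}$ and $f\mapsto(\langle f,M_{\beta n}T_{\alpha k}\gamma\rangle)_{k,n\in\mathbb{Z}}$ are bounded linear operators from $M^q(\mathbb{R})$ to $\ell^q(\mathbb{Z}^2)$ for any $p\le q\le p'$. Consequently, there exist positive constants $A,B$ such that $$A\|f\|_{M^q(\mathbb{R})}\le\big\|(\langle f,M_{\beta n}T_{\alpha k}g\rangle)_{n,k\in\mathbb{Z}}\big\|_{\ell^q(\mathbb{Z}^2)}\le B\|f\|_{M^q(\mathbb{R})}$$ and $$A\|f\|_{M^q(\mathbb{R})}\le\big\|(\langle f,M_{\beta n}T_{\alpha k}\gamma\rangle)_{n,k\in\mathbb{Z}}\big\|_{\ell^q(\mathbb{Z}^2)}\le B\|f\|_{M^q(\mathbb{R})}$$ hold for all $f\in M^q(\mathbb{R})$, for any $p\le q\le p'$.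
   Context: For $x,\xi\in\mathbb{R}$, $(T_xg)(t)=g(t-x)$ and $(M_\xi g)(t)=e^{2\pi i\xi t}g(t)$. Fix a nonzero $\psi\in S(\mathbb{R})$ and put $V_\psi f(x,w)=\langle f,M_wT_x\psi\rangle$ for $f\in S'(\mathbb{R})$. For $1\le p\le\infty$, $M^p(\mathbb{R})$ is the space of $f\in S'(\mathbb{R})$ with $\|f\|_{M^p(\mathbb{R})}=\|V_\psi f\|_{L^p(\mathbb{R}^2)}<\infty$. For $1\le p\le p_1\le\infty$, $M^p(\mathbb{R})\subseteq M^{p_1}(\mathbb{R})$. For $1\le q<\infty$ the dual of $M^q(\mathbb{R})$ is identified with $M^{q'}(\mathbb{R})$ ($q'$ conjugate to $q$) via $\langle f,h\rangle=\iint V_\psi f\,\overline{V_\psi h}\,dx\,dw$ (with $\|\psi\|_{L^2}=1$), which extends the $L^2$ inner product. For a Banach space $X$ with dual $X^*$, write $\langle x,x^*\rangle=x^*(x)$. A Schauder frame for $X$ is a pair of sequences $((x_n)_{n\in\mathbb{N}},(x_n^* )_{n\in\mathbb{N}})\subseteq X\times X^*$ such that $x=\sum_{n=1}^\infty\langle x,x_n^*\rangle x_n$ with convergence in the norm of $X$ for every $x\in X$; it is unconditional if this series converges unconditionally (i.e. for every rearrangement) for every $x\in X$. A series $\sum x_n$ is weakly unconditionally convergent in $X$ if there is $C>0$ with $\sum_n|\langle x_n,x^*\rangle|\le C\|x^*\|_{X^*}$ for all $x^*\in X^*$. *)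

theory Defs
  imports "HOL-Analysis.Analysis"
begin

section \<open>Normed spaces of complex-valued functions\<close>

text \<open>All Banach spaces below (modulation spaces, the space of square integrable functions,
  sequence spaces) are subspaces of some \<open>'s \<Rightarrow> complex\<close> with pointwise operations. Since their norm
  depends on a real exponent, they are given by a carrier and a norm instead of a type.\<close>

record 's fspace =
  vectors :: "('s \<Rightarrow> complex) set"
  nrm :: "('s \<Rightarrow> complex) \<Rightarrow> real"

definition bounded_operator ::
    "'s fspace \<Rightarrow> 't fspace \<Rightarrow> (('s \<Rightarrow> complex) \<Rightarrow> ('t \<Rightarrow> complex)) \<Rightarrow> bool" where
  "bounded_operator X Y T \<longleftrightarrow>
     (\<forall>f\<in>vectors X. T f \<in> vectors Y) \<and>
     (\<forall>f\<in>vectors X. \<forall>h\<in>vectors X. T (\<lambda>s. f s + h s) = (\<lambda>t. T f t + T h t)) \<and>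
     (\<forall>c. \<forall>f\<in>vectors X. T (\<lambda>s. c * f s) = (\<lambda>t. c * T f t)) \<and>
     (\<exists>C. \<forall>f\<in>vectors X. nrm Y (T f) \<le> C * nrm X f)"

text \<open>A functional is a total function of which only the values on the carrier matter.\<close>

definition dual :: "'s fspace \<Rightarrow> (('s \<Rightarrow> complex) \<Rightarrow> complex) set" where
  "dual X = {l.
     (\<forall>f\<in>vectors X. \<forall>h\<in>vectors X. l (\<lambda>s. f s + h s) = l f + l h) \<and>
     (\<forall>c. \<forall>f\<in>vectors X. l (\<lambda>s. c * f s) = c * l f) \<and>
     (\<exists>C. \<forall>f\<in>vectors X. norm (l f) \<le> C * nrm X f)}"

definition dual_norm :: "'s fspace \<Rightarrow> (('s \<Rightarrow> complex) \<Rightarrow> complex) \<Rightarrow> real" where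
  "dual_norm X l = (SUP f\<in>{f \<in> vectors X. nrm X f \<le> 1}. norm (l f))"

definition series_converges_to ::
    "'s fspace \<Rightarrow> (nat \<Rightarrow> 's \<Rightarrow> complex) \<Rightarrow> ('s \<Rightarrow> complex) \<Rightarrow> bool" where
  "series_converges_to X a f \<longleftrightarrow>
     f \<in> vectors X \<and> (\<lambda>N. nrm X (\<lambda>s. f s - (\<Sum>n<N. a n s))) \<longlonglongrightarrow> 0"

definition unconditionally_convergent :: "'s fspace \<Rightarrow> (nat \<Rightarrow> 's \<Rightarrow> complex) \<Rightarrow> bool" where
  "unconditionally_convergent X a \<longleftrightarrow>
     (\<forall>\<pi>::nat \<Rightarrow> nat. bij \<pi> \<longrightarrow> (\<exists>f. series_converges_to X (\<lambda>n. a (\<pi> n)) f))"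

definition Schauder_frame ::
    "'s fspace \<Rightarrow> (nat \<Rightarrow> 's \<Rightarrow> complex) \<Rightarrow> (nat \<Rightarrow> ('s \<Rightarrow> complex) \<Rightarrow> complex) \<Rightarrow> bool" where
  "Schauder_frame X x x' \<longleftrightarrow>
     (\<forall>n. x n \<in> vectors X) \<and> (\<forall>n. x' n \<in> dual X) \<and>
     (\<forall>f\<in>vectors X. series_converges_to X (\<lambda>n s. x' n f * x n s) f)"

definition unconditional_Schauder_frame ::
    "'s fspace \<Rightarrow> (nat \<Rightarrow> 's \<Rightarrow> complex) \<Rightarrow> (nat \<Rightarrow> ('s \<Rightarrow> complex) \<Rightarrow> complex) \<Rightarrow> bool" where
  "unconditional_Schauder_frame X x x' \<longleftrightarrow>
     Schauder_frame X x x' \<and>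
     (\<forall>f\<in>vectors X. unconditionally_convergent X (\<lambda>n s. x' n f * x n s))"

text \<open>The index type is arbitrary: the sums involved have nonnegative terms.\<close>

definition weakly_unconditionally_convergent :: "'s fspace \<Rightarrow> ('i \<Rightarrow> 's \<Rightarrow> complex) \<Rightarrow> bool" where
  "weakly_unconditionally_convergent X a \<longleftrightarrow>
     (\<forall>i. a i \<in> vectors X) \<and>
     (\<exists>C>0. \<forall>l\<in>dual X. (\<lambda>i. norm (l (a i))) summable_on UNIV \<and>
        (\<Sum>\<^sub>\<infinity>i. norm (l (a i))) \<le> C * dual_norm X l)"

definition lq_space :: "real \<Rightarrow> 'i fspace" where
  "lq_space q =
     \<lparr>vectors = {a. (\<lambda>i. norm (a i) powr q) summable_on UNIV},
      nrm = (\<lambda>a. (\<Sum>\<^sub>\<infinity>i. norm (a i) powr q) powr (1 / q))\<rparr>"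


section \<open>Schwartz functions and tempered distributions\<close>

definition nth_deriv :: "nat \<Rightarrow> (real \<Rightarrow> complex) \<Rightarrow> real \<Rightarrow> complex" where
  "nth_deriv n = (\<lambda>\<phi> t. vector_derivative \<phi> (at t)) ^^ n"

definition Schwartz :: "(real \<Rightarrow> complex) set" where
  "Schwartz = {\<phi>. (\<forall>n t. nth_deriv n \<phi> differentiable (at t)) \<and>
     (\<forall>m n. \<exists>C. \<forall>t. \<bar>t\<bar> ^ m * norm (nth_deriv n \<phi> t) \<le> C)}"

definition Schwartz_seminorm :: "nat \<Rightarrow> nat \<Rightarrow> (real \<Rightarrow> complex) \<Rightarrow> real" where
  "Schwartz_seminorm m n \<phi> = (SUP t. \<bar>t\<bar> ^ m * norm (nth_deriv n \<phi> t))"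

definition translate :: "real \<Rightarrow> (real \<Rightarrow> complex) \<Rightarrow> real \<Rightarrow> complex" where
  "translate x \<phi> = (\<lambda>t. \<phi> (t - x))"

definition modulate :: "real \<Rightarrow> (real \<Rightarrow> complex) \<Rightarrow> real \<Rightarrow> complex" where
  "modulate \<xi> \<phi> = (\<lambda>t. exp (2 * of_real pi * \<i> * of_real \<xi> * of_real t) * \<phi> t)"

type_synonym distribution = "(real \<Rightarrow> complex) \<Rightarrow> complex"

text \<open>A tempered distribution is a continuous linear functional on the Schwartz space. It is given
  the value 0 outside of the Schwartz space, so that equality of distributions is equality of
  functions.\<close>

definition tempered :: "distribution set" where
  "tempered = {u.
     (\<forall>\<phi>. \<phi> \<notin> Schwartz \<longrightarrow> u \<phi> = 0) \<and>
     (\<forall>\<phi>\<in>Schwartz. \<forall>\<eta>\<in>Schwartz. u (\<lambda>t. \<phi> t + \<eta> t) = u \<phi> + u \<eta>) \<and>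
     (\<forall>c. \<forall>\<phi>\<in>Schwartz. u (\<lambda>t. c * \<phi> t) = c * u \<phi>) \<and>
     (\<exists>C K. \<forall>\<phi>\<in>Schwartz. norm (u \<phi>) \<le> C * (\<Sum>m\<le>K. \<Sum>n\<le>K. Schwartz_seminorm m n \<phi>))}"

text \<open>The pairing \<open>\<langle>u, \<phi>\<rangle>\<close> extends the \<open>L\<^sup>2\<close> inner product, hence is conjugate linear in \<open>\<phi>\<close>.\<close>

definition dist_pairing :: "distribution \<Rightarrow> (real \<Rightarrow> complex) \<Rightarrow> complex" where
  "dist_pairing u \<phi> = u (\<lambda>t. cnj (\<phi> t))"

definition dist_translate :: "real \<Rightarrow> distribution \<Rightarrow> distribution" where
  "dist_translate x u = (\<lambda>\<phi>. u (translate (- x) \<phi>))"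

definition dist_modulate :: "real \<Rightarrow> distribution \<Rightarrow> distribution" where
  "dist_modulate \<xi> u = (\<lambda>\<phi>. u (modulate \<xi> \<phi>))"

definition dist_of_fun :: "(real \<Rightarrow> complex) \<Rightarrow> distribution" where
  "dist_of_fun f = (\<lambda>\<phi>. if \<phi> \<in> Schwartz then (\<integral>t. f t * \<phi> t \<partial>lborel) else 0)"


section \<open>Square integrable functions, as tempered distributions\<close>

definition square_integrable :: "(real \<Rightarrow> complex) set" where
  "square_integrable = {f \<in> borel_measurable lborel. integrable lborel (\<lambda>t. (norm (f t))\<^sup>2)}"

definition fun_L2_norm :: "(real \<Rightarrow> complex) \<Rightarrow> real" where
  "fun_L2_norm f = sqrt (\<integral>t. (norm (f t))\<^sup>2 \<partial>lborel)"

text \<open>The representing function is unique up to a null set, so the norm and the inner product below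
  do not depend on the choice.\<close>

definition L2_rep :: "distribution \<Rightarrow> real \<Rightarrow> complex" where
  "L2_rep u = (SOME f. f \<in> square_integrable \<and> dist_of_fun f = u)"

definition L2_space :: "(real \<Rightarrow> complex) fspace" where
  "L2_space =
     \<lparr>vectors = dist_of_fun ` square_integrable, nrm = (\<lambda>u. fun_L2_norm (L2_rep u))\<rparr>"

definition L2_inner :: "distribution \<Rightarrow> distribution \<Rightarrow> complex" where
  "L2_inner u v = (\<integral>t. L2_rep u t * cnj (L2_rep v t) \<partial>lborel)"


section \<open>Modulation spaces\<close>

definition stft :: "(real \<Rightarrow> complex) \<Rightarrow> distribution \<Rightarrow> real \<times> real \<Rightarrow> complex" where
  "stft \<psi> u = (\<lambda>(x, w). dist_pairing u (modulate w (translate x \<psi>)))"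

text \<open>Only meant for \<open>1 \<le> p < \<infinity>\<close>.\<close>

definition modulation_space :: "(real \<Rightarrow> complex) \<Rightarrow> real \<Rightarrow> (real \<Rightarrow> complex) fspace" where
  "modulation_space \<psi> p =
     \<lparr>vectors = {u \<in> tempered. integrable lborel (\<lambda>z. norm (stft \<psi> u z) powr p)},
      nrm = (\<lambda>u. (\<integral>z. norm (stft \<psi> u z) powr p \<partial>lborel) powr (1 / p))\<rparr>"

text \<open>The duality between \<open>M\<^sup>q\<close> and \<open>M\<^sup>q\<^sup>'\<close> uses the normalised window \<open>\<psi> / \<parallel>\<psi>\<parallel>\<^sub>2\<close>; this accounts for
  the denominator.\<close>

definition modulation_pairing ::
    "(real \<Rightarrow> complex) \<Rightarrow> distribution \<Rightarrow> distribution \<Rightarrow> complex" where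
  "modulation_pairing \<psi> u v =
     (\<integral>z. stft \<psi> u z * cnj (stft \<psi> v z) \<partial>lborel) / of_real ((fun_L2_norm \<psi>)\<^sup>2)"

definition gabor :: "real \<Rightarrow> real \<Rightarrow> distribution \<Rightarrow> int \<times> int \<Rightarrow> distribution" where
  "gabor \<alpha> \<beta> g =
     (\<lambda>(k, n). dist_modulate (\<beta> * of_int n) (dist_translate (\<alpha> * of_int k) g))"

definition analysis_operator ::
    "(real \<Rightarrow> complex) \<Rightarrow> (int \<times> int \<Rightarrow> distribution) \<Rightarrow> distribution \<Rightarrow> int \<times> int \<Rightarrow> complex" where
  "analysis_operator \<psi> h f = (\<lambda>i. modulation_pairing \<psi> f (h i))"

end

theory Submission
  imports Defs "HOL-Probability.Probability"
begin

text \<open>All five conditions amount to Bessel bounds: both analysis operators map \<open>M\<^sup>q\<close> to \<open>\<ell>\<^sup>q\<close> for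
  \<open>p \<le> q \<le> p'\<close>.

  Suppose that \<open>\<Sum>\<^sub>i c\<^sub>i G\<^sub>i\<close> is weakly unconditionally convergent in \<open>M\<^sup>q\<close>, where \<open>c\<^sub>i = \<langle>f, \<Gamma>\<^sub>i\<rangle>\<close>. By uniform
  boundedness the finite sums \<open>\<Sum>\<^sub>i \<plusminus>c\<^sub>i G\<^sub>i\<close> are bounded in \<open>M\<^sup>q\<close>. Averaged over all signs, the modulus of
  the short-time Fourier transform of such a sum is at least \<open>|c\<^sub>j| |V\<^sub>\<psi>G\<^sub>j|\<close> for each \<open>j\<close>; as these are
  translates of \<open>|V\<^sub>\<psi>g|\<close> along the lattice, integrating over disjoint translates of a small cell gives
  \<open>\<Sum>\<^sub>j |c\<^sub>j|\<^sup>q < \<infinity>\<close>. The bound for \<open>g\<close> comes from the transposed series.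

  Conversely, \<open>M\<^sup>p \<subseteq> M\<^sup>2 = L\<^sup>2\<close>, and the frame expansion in \<open>L\<^sup>2\<close>, tested on Schwartz functions, yields
  \<open>\<langle>f, h\<rangle> = \<Sum>\<^sub>i \<langle>f, \<Gamma>\<^sub>i\<rangle> \<langle>G\<^sub>i, h\<rangle>\<close> on dense subspaces of \<open>M\<^sup>q\<close> and \<open>M\<^sup>q\<^sup>'\<close>. Under the Bessel bounds this
  identity extends by continuity, with absolute convergence, and by duality it gives unconditional
  convergence in norm and the lower bounds. The constants are made uniform in \<open>q\<close> by real interpolation
  between \<open>p\<close> and \<open>p'\<close>.\<close>

section \<open>Integrability exponents\<close>

text \<open>Everything about \<open>M^q\<close> is pulled back from \<open>L^q\<close> on the plane.
  The reproducing formula makes \<open>synth\<close> a left inverse of \<open>stft\<close>, and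
  \<open>stft\<close> after \<open>synth\<close> is dominated by convolution with a fixed integrable
  envelope. So modulation spaces are retracts of Lebesgue spaces with constant
  \<open>kmass / energy\<close>, the same for all exponents. Completeness, norming functionals,
  density and the splitting for interpolation are obtained by working with arbitrary functions in
  \<open>L^q\<close> and synthesising afterwards.

  The price is the reproducing formula for tempered distributions: a distribution must be taken
  under an integral of time-frequency shifts, and it is continuous only in Schwartz seminorms. Hence
  the polynomial growth and local Lipschitz estimates for shifts in those seminorms.

  Two features of the statement shape the rest. Unconditional convergence is defined by
  rearrangements, so the boundedness of finite sums has to be extracted from a permutation built
  against it. And \<open>[p, p']\<close> is closed under conjugation, so a bound for one generator
  on \<open>M^q\<close> and for the other on \<open>M^q'\<close> cover the whole range for
  both.\<close>

definition Lp :: "'z measure \<Rightarrow> real \<Rightarrow> ('z \<Rightarrow> complex) set" where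
  "Lp M q = {f \<in> borel_measurable M. integrable M (\<lambda>z. norm (f z) powr q)}"

definition Lp_norm :: "'z measure \<Rightarrow> real \<Rightarrow> ('z \<Rightarrow> complex) \<Rightarrow> real" where
  "Lp_norm M q f = (\<integral>z. norm (f z) powr q \<partial>M) powr (1 / q)"

lemma LpD [measurable_dest]: "f \<in> Lp M q \<Longrightarrow> f \<in> borel_measurable M"
  by (simp add: Lp_def)

lemma Lp_integrable: "f \<in> Lp M q \<Longrightarrow> integrable M (\<lambda>z. norm (f z) powr q)"
  by (simp add: Lp_def)

lemma Lp_norm_nonneg [simp]: "0 \<le> Lp_norm M q f"
  by (simp add: Lp_norm_def)

lemma Lp_norm_powr:
  assumes "q > 0"
  shows "Lp_norm M q f powr q = (\<integral>z. norm (f z) powr q \<partial>M)"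
proof -
  have "(\<integral>z. norm (f z) powr q \<partial>M) \<ge> 0"
    by (intro Bochner_Integration.integral_nonneg) auto
  then show ?thesis
    using assms by (simp add: Lp_norm_def powr_powr)
qed

lemma Lp_norm_eq_0D:
  assumes "f \<in> Lp M q" "q > 0" "Lp_norm M q f = 0"
  shows "AE z in M. f z = 0"
proof -
  have "(\<integral>z. norm (f z) powr q \<partial>M) = 0"
    using assms Lp_norm_powr[of q M f] by simp
  then have "AE z in M. norm (f z) powr q = 0"
    using Lp_integrable[OF assms(1)] by (subst (asm) integral_nonneg_eq_0_iff_AE) auto
  then show ?thesis by simp
qed

lemma Lp_norm_mono:
  assumes "f \<in> borel_measurable M" "g \<in> Lp M q" "q > 0" "\<And>z. norm (f z) \<le> norm (g z)"
  shows "f \<in> Lp M q" "Lp_norm M q f \<le> Lp_norm M q g"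
proof -
  have le: "norm (f z) powr q \<le> norm (g z) powr q" for z
    using assms by (intro powr_mono2) auto
  show f: "f \<in> Lp M q"
    unfolding Lp_def using assms le Lp_integrable[OF assms(2)]
    by (auto intro!: Bochner_Integration.integrable_bound[of M "\<lambda>z. norm (g z) powr q"])
  show "Lp_norm M q f \<le> Lp_norm M q g"
    unfolding Lp_norm_def using assms le f
    by (intro powr_mono2 integral_mono Lp_integrable) auto
qed

lemma powr_add_le:
  fixes a b :: real
  assumes "a \<ge> 0" "b \<ge> 0" "q > 0"
  shows "(a + b) powr q \<le> 2 powr q * (a powr q + b powr q)"
proof -
  have "(a + b) powr q \<le> (2 * max a b) powr q"
    using assms by (intro powr_mono2) auto
  also have "\<dots> = 2 powr q * max a b powr q"
    using assms by (simp add: powr_mult)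
  also have "max a b powr q \<le> a powr q + b powr q"
    by (auto simp: max_def)
  finally show ?thesis by simp
qed

lemma Lp_add:
  assumes "f \<in> Lp M q" "g \<in> Lp M q" "q > 0"
  shows "(\<lambda>z. f z + g z) \<in> Lp M q"
proof -
  have le: "norm (f z + g z) powr q \<le> 2 powr q * (norm (f z) powr q + norm (g z) powr q)" for z
    by (rule order_trans[OF powr_mono2 powr_add_le]) (use assms norm_triangle_ineq in auto)
  have "integrable M (\<lambda>z. 2 powr q * (norm (f z) powr q + norm (g z) powr q))"
    using assms by (intro integrable_mult_right Bochner_Integration.integrable_add Lp_integrable)
  then have "integrable M (\<lambda>z. norm (f z + g z) powr q)"
    by (rule Bochner_Integration.integrable_bound) (use assms le in auto)
  then show ?thesis using assms by (auto simp: Lp_def)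
qed

lemma Lp_scale:
  assumes "f \<in> Lp M q" "q > 0"
  shows "(\<lambda>z. c * f z) \<in> Lp M q" "Lp_norm M q (\<lambda>z. c * f z) = norm c * Lp_norm M q f"
proof -
  have eq: "norm (c * f z) powr q = norm c powr q * norm (f z) powr q" for z
    by (simp add: norm_mult powr_mult)
  show "(\<lambda>z. c * f z) \<in> Lp M q"
    using assms by (auto simp: Lp_def eq)
  show "Lp_norm M q (\<lambda>z. c * f z) = norm c * Lp_norm M q f"
    using assms by (simp add: Lp_norm_def eq powr_mult powr_powr)
qed

lemma Lp_diff:
  assumes "f \<in> Lp M q" "g \<in> Lp M q" "q > 0"
  shows "(\<lambda>z. f z - g z) \<in> Lp M q"
  using Lp_add[OF assms(1) Lp_scale(1)[OF assms(2,3), of "-1"] assms(3)] by simp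

text \<open>Young's inequality is integrated and then applied to both functions scaled to norm one.
  If one of the norms vanishes, scaling is impossible, but the product is zero almost
  everywhere.\<close>

lemma Holder_integrable:
  assumes "f \<in> Lp M q" "g \<in> Lp M r" "q > 1" "1 / q + 1 / r = 1"
  shows "integrable M (\<lambda>z. norm (f z) * norm (g z))" (is ?A)
    and "(\<integral>z. norm (f z) * norm (g z) \<partial>M) \<le> Lp_norm M q f * Lp_norm M r g" (is ?B)
proof -
  have r: "r > 1"
  proof -
    have "1 / r = 1 - 1 / q" "1 / q < 1" "1 / q > 0" using assms by auto
    then have "1 / r > 0" "1 / r < 1" by linarith+
    then show ?thesis by (cases "r > 0") (auto simp: divide_simps split: if_splits)
  qed
  have Young: "a * b \<le> a powr q / q + b powr r / r" if "a \<ge> 0" "b \<ge> 0" for a b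
    using that assms r by (intro Youngs_inequality) auto
  have int: "integrable M (\<lambda>z. norm (f z) * norm (g z)) \<and>
      (\<integral>z. norm (f z) * norm (g z) \<partial>M) \<le> (\<integral>z. norm (f z) powr q \<partial>M) / q + (\<integral>z. norm (g z) powr r \<partial>M) / r"
    if "f \<in> Lp M q" "g \<in> Lp M r" for f g
  proof -
    have i: "integrable M (\<lambda>z. norm (f z) powr q / q + norm (g z) powr r / r)"
      using that by (auto intro!: Bochner_Integration.integrable_add Lp_integrable integrable_divide)
    then have j: "integrable M (\<lambda>z. norm (f z) * norm (g z))"
      by (rule Bochner_Integration.integrable_bound) (use that in \<open>auto intro!: order_trans[OF Young] AE_I2\<close>)
    have "(\<integral>z. norm (f z) * norm (g z) \<partial>M) \<le> (\<integral>z. norm (f z) powr q / q + norm (g z) powr r / r \<partial>M)"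
      by (intro integral_mono i j Young) auto
    also have "\<dots> = (\<integral>z. norm (f z) powr q \<partial>M) / q + (\<integral>z. norm (g z) powr r \<partial>M) / r"
      using that by (subst Bochner_Integration.integral_add)
        (auto intro!: Lp_integrable integrable_divide)
    finally show ?thesis using j by blast
  qed
  show ?A using int assms by blast
  show ?B
  proof (cases "Lp_norm M q f = 0 \<or> Lp_norm M r g = 0")
    case True
    then have "(AE z in M. f z = 0) \<or> (AE z in M. g z = 0)"
      using Lp_norm_eq_0D assms r by (metis less_trans zero_less_one)
    then have "AE z in M. norm (f z) * norm (g z) = 0"
      by auto
    then have "(\<integral>z. norm (f z) * norm (g z) \<partial>M) = 0"
      by (rule integral_eq_zero_AE)
    then show ?thesis by simp
  next
    case False
    let ?a = "Lp_norm M q f" and ?b = "Lp_norm M r g"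
    have pos: "?a > 0" "?b > 0" using False by (auto simp: less_le)
    define f' where "f' = (\<lambda>z. of_real (inverse ?a) * f z)"
    define g' where "g' = (\<lambda>z. of_real (inverse ?b) * g z)"
    have f': "f' \<in> Lp M q" "Lp_norm M q f' = 1"
      using Lp_scale[OF assms(1), of "of_real (inverse ?a)"] assms(3) pos by (auto simp: f'_def norm_divide norm_inverse)
    have g': "g' \<in> Lp M r" "Lp_norm M r g' = 1"
      using Lp_scale[OF assms(2), of "of_real (inverse ?b)"] r pos by (auto simp: g'_def norm_divide norm_inverse)
    have "(\<integral>z. norm (f' z) * norm (g' z) \<partial>M) \<le> 1 / q + 1 / r"
      using int[OF f'(1) g'(1)] Lp_norm_powr[of q M f'] Lp_norm_powr[of r M g'] f' g' assms r by simp
    moreover have "(\<integral>z. norm (f' z) * norm (g' z) \<partial>M) = inverse (?a * ?b) * (\<integral>z. norm (f z) * norm (g z) \<partial>M)"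
      using pos by (subst integral_mult_right_zero[symmetric])
        (simp add: f'_def g'_def norm_mult mult_ac norm_inverse)
    ultimately show ?thesis
      using pos assms by (simp add: field_simps)
  qed
qed

lemma Holder:
  assumes "f \<in> Lp M q" "g \<in> Lp M r" "q > 1" "1 / q + 1 / r = 1"
  shows "integrable M (\<lambda>z. f z * cnj (g z))"
    and "norm (\<integral>z. f z * cnj (g z) \<partial>M) \<le> Lp_norm M q f * Lp_norm M r g"
proof -
  note H = Holder_integrable[OF assms]
  show i: "integrable M (\<lambda>z. f z * cnj (g z))"
  proof (rule Bochner_Integration.integrable_bound[OF H(1)])
    have [measurable]: "f \<in> borel_measurable M" "g \<in> borel_measurable M" using assms by auto
    have [measurable]: "cnj \<in> borel_measurable borel"
      by (intro borel_measurable_continuous_onI continuous_intros)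
    show "(\<lambda>z. f z * cnj (g z)) \<in> borel_measurable M" by measurable
  qed (auto simp: norm_mult)
  have "norm (\<integral>z. f z * cnj (g z) \<partial>M) \<le> (\<integral>z. norm (f z * cnj (g z)) \<partial>M)"
    by (rule integral_norm_bound)
  then show "norm (\<integral>z. f z * cnj (g z) \<partial>M) \<le> Lp_norm M q f * Lp_norm M r g"
    using H(2) by (simp add: norm_mult)
qed

lemma Holder_mult:
  assumes "f \<in> Lp M q" "g \<in> Lp M r" "q > 1" "1 / q + 1 / r = 1"
  shows "integrable M (\<lambda>z. f z * g z)" "norm (\<integral>z. f z * g z \<partial>M) \<le> Lp_norm M q f * Lp_norm M r g"
proof -
  have [measurable]: "cnj \<in> borel_measurable borel"
    by (intro borel_measurable_continuous_onI continuous_intros)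
  have [measurable]: "g \<in> borel_measurable M" using assms by auto
  have "(\<lambda>z. cnj (g z)) \<in> Lp M r" "Lp_norm M r (\<lambda>z. cnj (g z)) = Lp_norm M r g"
    using Lp_integrable[OF assms(2)] by (auto simp: Lp_def Lp_norm_def)
  from Holder[OF assms(1) this(1) assms(3,4)] this(2)
  show "integrable M (\<lambda>z. f z * g z)" "norm (\<integral>z. f z * g z \<partial>M) \<le> Lp_norm M q f * Lp_norm M r g"
    by simp_all
qed

lemma conj_exponent_eqs:
  fixes q r :: real
  assumes "q > 1" "1 / q + 1 / r = 1"
  shows "r > 1" "r = q / (q - 1)" "(1 - q) * r = - q" "(q - 1) * r = q"
proof -
  have "1 / r = 1 - 1 / q" using assms by auto
  also have "\<dots> = (q - 1) / q" using assms by (simp add: field_simps)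
  finally show r: "r = q / (q - 1)" using assms by (metis divide_divide_eq_right div_by_1 mult_1 nonzero_divide_eq_eq)
  show "r > 1" "(1 - q) * r = - q" "(q - 1) * r = q"
    using assms by (auto simp: r field_simps)
qed

text \<open>The extremal function of Hoelder's inequality: a multiple of \<open>|f|^(q-2) f\<close>,
  with the power of \<open>N\<close> chosen so that \<open>|g|^r = N^(-q) |f|^q\<close> has integral
  1.\<close>

lemma Lp_norming:
  assumes f: "f \<in> Lp M q" and q: "q > 1" "1 / q + 1 / r = 1"
  obtains g where "g \<in> Lp M r" "Lp_norm M r g \<le> 1"
    "(\<integral>z. f z * cnj (g z) \<partial>M) = of_real (Lp_norm M q f)"
proof (cases "Lp_norm M q f = 0")
  case True
  show ?thesis
    by (rule that[of "\<lambda>_. 0"]) (use True q in \<open>auto simp: Lp_def Lp_norm_def\<close>)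
next
  case False
  define N where "N = Lp_norm M q f"
  have N: "N > 0" using False by (simp add: N_def less_le)
  note r = conj_exponent_eqs[OF q]
  \<comment> \<open>Where \<open>f\<close> vanishes, \<open>powr\<close> gives 0 even if the
    exponent \<open>q - 2\<close> is negative, so \<open>g\<close> vanishes there too.\<close>
  define g where "g = (\<lambda>z. of_real (N powr (1 - q) * norm (f z) powr (q - 2)) * f z)"
  have ng: "norm (g z) = N powr (1 - q) * norm (f z) powr (q - 1)" for z
    using powr_mult_base[of "norm (f z)" "q - 2"] by (simp add: g_def norm_mult mult_ac)
  have ngr: "norm (g z) powr r = N powr (- q) * norm (f z) powr q" for z
    using r by (simp add: ng powr_mult powr_powr)
  have fg: "f z * cnj (g z) = of_real (N powr (1 - q) * norm (f z) powr q)" for z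
  proof -
    have "f z * cnj (g z) = of_real (N powr (1 - q) * norm (f z) powr (q - 2)) * (f z * cnj (f z))"
      by (simp add: g_def)
    also have "f z * cnj (f z) = of_real ((norm (f z))\<^sup>2)" by (simp only: complex_norm_square)
    also have "norm (f z) powr (q - 2) * (norm (f z))\<^sup>2 = norm (f z) powr q"
    proof (cases "f z = 0")
      case False
      then show ?thesis
        using powr_add[of "norm (f z)" "q - 2" 2] by (simp add: powr_numeral)
    qed (use q in auto)
    then have "of_real (N powr (1 - q) * norm (f z) powr (q - 2)) * complex_of_real ((norm (f z))\<^sup>2) =
       of_real (N powr (1 - q) * norm (f z) powr q)"
      by (metis (no_types) mult.assoc of_real_mult)
    finally show ?thesis .
  qed
  have Nq: "(\<integral>z. norm (f z) powr q \<partial>M) = N powr q"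
    unfolding N_def using q by (intro Lp_norm_powr[symmetric]) simp
  show ?thesis
  proof (rule that[of g])
    have [measurable]: "g \<in> borel_measurable M"
      unfolding g_def using f by measurable
    show gr: "g \<in> Lp M r"
      using Lp_integrable[OF f] by (simp add: Lp_def ngr)
    have "(\<integral>z. norm (g z) powr r \<partial>M) = 1"
      using N by (simp add: ngr Nq powr_minus)
    then show "Lp_norm M r g \<le> 1" by (simp add: Lp_norm_def)
    have "(\<integral>z. f z * cnj (g z) \<partial>M) = of_real (N powr (1 - q) * N powr q)"
      by (simp add: fg Nq del: of_real_mult)
    also have "N powr (1 - q) * N powr q = N"
      using N by (simp add: powr_add[symmetric])
    finally show "(\<integral>z. f z * cnj (g z) \<partial>M) = of_real (Lp_norm M q f)"
      by (simp add: N_def)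
  qed
qed

text \<open>Minkowski's inequality by duality: the sum is tested against its own norming function,
  and each summand is bounded by Hoelder.\<close>

lemma Lp_norm_triangle:
  assumes "f \<in> Lp M q" "g \<in> Lp M q" "q > 1"
  shows "Lp_norm M q (\<lambda>z. f z + g z) \<le> Lp_norm M q f + Lp_norm M q g"
proof -
  define r where "r = q / (q - 1)"
  have r: "1 / q + 1 / r = 1" using assms by (simp add: r_def field_simps)
  obtain h where h: "h \<in> Lp M r" "Lp_norm M r h \<le> 1"
    "(\<integral>z. (f z + g z) * cnj (h z) \<partial>M) = of_real (Lp_norm M q (\<lambda>z. f z + g z))"
    using Lp_norming[OF Lp_add[OF assms(1,2)] assms(3) r] assms(3) by auto
  have "(\<integral>z. (f z + g z) * cnj (h z) \<partial>M) = (\<integral>z. f z * cnj (h z) \<partial>M) + (\<integral>z. g z * cnj (h z) \<partial>M)"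
    using Holder(1)[OF assms(1) h(1) assms(3) r] Holder(1)[OF assms(2) h(1) assms(3) r]
    by (simp add: ring_distribs)
  then have "Lp_norm M q (\<lambda>z. f z + g z) = norm ((\<integral>z. f z * cnj (h z) \<partial>M) + (\<integral>z. g z * cnj (h z) \<partial>M))"
    using h(3) by (metis Lp_norm_nonneg abs_of_nonneg norm_of_real)
  also have "\<dots> \<le> Lp_norm M q f * Lp_norm M r h + Lp_norm M q g * Lp_norm M r h"
    by (intro norm_triangle_le add_mono Holder assms h r)
  also have "\<dots> \<le> Lp_norm M q f * 1 + Lp_norm M q g * 1"
    by (intro add_mono mult_left_mono h) auto
  finally show ?thesis by simp
qed

section \<open>Hoelder's inequality and duality for finite sums\<close>

lemma Lp_count_space:
  assumes "finite F"
  shows "a \<in> Lp (count_space F) q"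
    and "Lp_norm (count_space F) q a = (\<Sum>i\<in>F. norm (a i) powr q) powr (1 / q)"
  using assms by (simp_all add: Lp_def Lp_norm_def integrable_count_space lebesgue_integral_count_space_finite)

text \<open>Finite sums are integrals for the counting measure, so this inequality, like
  \<open>norming_sum\<close>, is an instance of the one for \<open>Lp\<close>.\<close>

lemma Holder_sum_complex:
  assumes "finite F" "q > 1" "1 / q + 1 / r = 1"
  shows "(\<Sum>i\<in>F. norm (a i) * norm (b i)) \<le>
    (\<Sum>i\<in>F. norm (a i :: complex) powr q) powr (1 / q) * (\<Sum>i\<in>F. norm (b i :: complex) powr r) powr (1 / r)"
  using Holder_integrable(2)[of a "count_space F" q b r] assms
  by (simp add: Lp_count_space lebesgue_integral_count_space_finite)

lemma norming_sum:
  assumes "finite F" "q > 1" "1 / q + 1 / r = 1"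
  obtains b :: "'i \<Rightarrow> complex" where "(\<Sum>i\<in>F. norm (b i) powr r) powr (1 / r) \<le> 1"
    "(\<Sum>i\<in>F. a i * cnj (b i)) = of_real ((\<Sum>i\<in>F. norm (a i :: complex) powr q) powr (1 / q))"
  using Lp_norming[of a "count_space F" q r] assms
  by (auto simp: Lp_count_space lebesgue_integral_count_space_finite)


section \<open>Normed and Banach spaces given by a carrier\<close>

text \<open>The record carries no laws; these are the laws of a seminorm on a complex vector space
  of functions. Definiteness fails in \<open>Lp_space M q\<close>, whose elements are functions and
  not classes.\<close>

locale normed_fspace =
  fixes X :: "'s fspace"
  assumes zero_mem: "(\<lambda>_. 0) \<in> vectors X"
    and add_mem: "f \<in> vectors X \<Longrightarrow> h \<in> vectors X \<Longrightarrow> (\<lambda>s. f s + h s) \<in> vectors X"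
    and scale_mem: "f \<in> vectors X \<Longrightarrow> (\<lambda>s. c * f s) \<in> vectors X"
    and nrm_nonneg: "f \<in> vectors X \<Longrightarrow> 0 \<le> nrm X f"
    and nrm_scale: "f \<in> vectors X \<Longrightarrow> nrm X (\<lambda>s. c * f s) = norm c * nrm X f"
    and nrm_triangle: "f \<in> vectors X \<Longrightarrow> h \<in> vectors X \<Longrightarrow> nrm X (\<lambda>s. f s + h s) \<le> nrm X f + nrm X h"
begin

lemma diff_mem: "f \<in> vectors X \<Longrightarrow> h \<in> vectors X \<Longrightarrow> (\<lambda>s. f s - h s) \<in> vectors X"
  using add_mem[OF _ scale_mem[of h "-1"], of f] by simp

lemma sum_mem: "(\<And>i. i \<in> F \<Longrightarrow> x i \<in> vectors X) \<Longrightarrow> (\<lambda>s. \<Sum>i\<in>F. x i s) \<in> vectors X"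
  by (induction F rule: infinite_finite_induct) (auto simp: zero_mem add_mem)

lemma nrm_zero: "nrm X (\<lambda>_. 0) = 0"
  using nrm_scale[OF zero_mem, of 0] by simp

lemma nrm_diff_triangle:
  "f \<in> vectors X \<Longrightarrow> h \<in> vectors X \<Longrightarrow> nrm X (\<lambda>s. f s - h s) \<le> nrm X f + nrm X h"
  using nrm_triangle[OF _ scale_mem[of h "-1"], of f] nrm_scale[of h "-1"] by simp

lemma nrm_minus: "f \<in> vectors X \<Longrightarrow> h \<in> vectors X \<Longrightarrow> nrm X (\<lambda>s. f s - h s) = nrm X (\<lambda>s. h s - f s)"
  using nrm_scale[OF diff_mem, of h f "-1"] by simp

lemma nrm_triangle_diff:
  assumes "f \<in> vectors X" "h \<in> vectors X" "k \<in> vectors X"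
  shows "nrm X (\<lambda>s. f s - k s) \<le> nrm X (\<lambda>s. f s - h s) + nrm X (\<lambda>s. h s - k s)"
  using nrm_triangle[OF diff_mem[OF assms(1,2)] diff_mem[OF assms(2,3)]] by simp

lemma nrm_sum: "(\<And>i. i \<in> F \<Longrightarrow> x i \<in> vectors X) \<Longrightarrow> nrm X (\<lambda>s. \<Sum>i\<in>F. x i s) \<le> (\<Sum>i\<in>F. nrm X (x i))"
proof (induction F rule: infinite_finite_induct)
  case (insert i F)
  have "nrm X (\<lambda>s. x i s + (\<Sum>i\<in>F. x i s)) \<le> nrm X (x i) + nrm X (\<lambda>s. \<Sum>i\<in>F. x i s)"
    using insert by (intro nrm_triangle sum_mem) auto
  then show ?case using insert by force
qed (auto simp: nrm_zero)

lemma dual_add: "l \<in> dual X \<Longrightarrow> f \<in> vectors X \<Longrightarrow> h \<in> vectors X \<Longrightarrow> l (\<lambda>s. f s + h s) = l f + l h"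
  by (simp add: dual_def)

lemma dual_scale: "l \<in> dual X \<Longrightarrow> f \<in> vectors X \<Longrightarrow> l (\<lambda>s. c * f s) = c * l f"
  by (simp add: dual_def)

lemma dual_zero: "l \<in> dual X \<Longrightarrow> l (\<lambda>_. 0) = 0"
  using dual_scale[OF _ zero_mem, of l 0] by simp

lemma dual_diff: "l \<in> dual X \<Longrightarrow> f \<in> vectors X \<Longrightarrow> h \<in> vectors X \<Longrightarrow> l (\<lambda>s. f s - h s) = l f - l h"
  using dual_add[OF _ _ scale_mem[of h "-1"], of l f] dual_scale[of l h "-1"] by simp

lemma dual_sum:
  "l \<in> dual X \<Longrightarrow> (\<And>i. i \<in> F \<Longrightarrow> x i \<in> vectors X) \<Longrightarrow> l (\<lambda>s. \<Sum>i\<in>F. x i s) = (\<Sum>i\<in>F. l (x i))"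
proof (induction F rule: infinite_finite_induct)
  case (insert i F)
  have "l (\<lambda>s. x i s + (\<Sum>i\<in>F. x i s)) = l (x i) + l (\<lambda>s. \<Sum>i\<in>F. x i s)"
    using insert by (intro dual_add sum_mem) auto
  then show ?case using insert by simp
qed (auto simp: dual_zero)

lemma dual_bound:
  assumes "l \<in> dual X"
  obtains C where "C \<ge> 0" "\<And>f. f \<in> vectors X \<Longrightarrow> norm (l f) \<le> C * nrm X f"
proof -
  obtain C where C: "\<And>f. f \<in> vectors X \<Longrightarrow> norm (l f) \<le> C * nrm X f"
    using assms unfolding dual_def by blast
  show ?thesis
    by (rule that[of "\<bar>C\<bar>"]) (auto intro!: order_trans[OF C] mult_right_mono nrm_nonneg)
qed

lemma bdd_above_dual_norm: "l \<in> dual X \<Longrightarrow> bdd_above ((\<lambda>f. norm (l f)) ` {f \<in> vectors X. nrm X f \<le> 1})"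
proof (erule dual_bound)
  fix C :: real assume C: "C \<ge> 0" "\<And>f. f \<in> vectors X \<Longrightarrow> norm (l f) \<le> C * nrm X f"
  show ?thesis
  proof (rule bdd_aboveI2)
    fix f assume "f \<in> {f \<in> vectors X. nrm X f \<le> 1}"
    then show "norm (l f) \<le> C" using C by (auto intro!: order_trans[OF C(2) mult_left_le])
  qed
qed

lemma dual_norm_nonneg: "l \<in> dual X \<Longrightarrow> 0 \<le> dual_norm X l"
  unfolding dual_norm_def
  by (rule cSUP_upper2[OF bdd_above_dual_norm, of _ "\<lambda>_. 0"]) (auto simp: zero_mem nrm_zero)

lemma dual_norm_bound:
  assumes l: "l \<in> dual X" and f: "f \<in> vectors X"
  shows "norm (l f) \<le> dual_norm X l * nrm X f"
proof (cases "nrm X f = 0")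
  \<comment> \<open>A vector of norm zero cannot be normalised; the bound in the definition of
    \<open>dual\<close> forces \<open>l f = 0\<close> there.\<close>
  case True
  with l f show ?thesis by (metis dual_bound mult_zero_right)
next
  case False
  then have pos: "nrm X f > 0" using nrm_nonneg[OF f] by simp
  define h where "h = (\<lambda>s. of_real (inverse (nrm X f)) * f s)"
  have h: "h \<in> vectors X" "nrm X h = 1"
    using scale_mem[OF f] nrm_scale[OF f] pos by (auto simp: h_def norm_inverse)
  have "norm (l h) \<le> dual_norm X l"
    unfolding dual_norm_def by (rule cSUP_upper[OF _ bdd_above_dual_norm[OF l]]) (use h in auto)
  moreover have "norm (l h) = norm (l f) / nrm X f"
    unfolding h_def using pos by (subst dual_scale[OF l f]) (simp add: norm_mult norm_inverse norm_divide field_simps)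
  ultimately show ?thesis using pos by (simp add: field_simps)
qed

lemma dual_norm_le:
  assumes "\<And>f. f \<in> vectors X \<Longrightarrow> norm (l f) \<le> C * nrm X f" "C \<ge> 0"
  shows "dual_norm X l \<le> C"
  unfolding dual_norm_def
proof (rule cSUP_least)
  show "{f \<in> vectors X. nrm X f \<le> 1} \<noteq> {}" using zero_mem nrm_zero by fastforce
next
  fix f assume "f \<in> {f \<in> vectors X. nrm X f \<le> 1}"
  then have "norm (l f) \<le> C * nrm X f" "nrm X f \<le> 1" using assms by auto
  then show "norm (l f) \<le> C" using assms(2) by (meson mult_left_le order_trans)
qed

end

text \<open>Completeness in terms of absolutely convergent series: monotone convergence in
  \<open>Lp\<close> delivers this form, and the gliding hump consumes it, its increments having norm
  at most \<open>(1/3) ^ n\<close>.\<close>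

locale banach_fspace = normed_fspace +
  assumes complete: "(\<And>n. y n \<in> vectors X) \<Longrightarrow> summable (\<lambda>n. nrm X (y n)) \<Longrightarrow>
     \<exists>f. series_converges_to X y f"
begin

text \<open>Sokal's gliding hump: if the functionals \<open>l\<^sub>n\<close> have norm at least \<open>4\<^sup>n\<close>, a suitable choice of
  signs makes \<open>l\<^sub>n\<close> large, of order \<open>(4/3)\<^sup>n\<close>, at \<open>\<Sum>\<^sub>k \<plusminus> 3\<^sup>-\<^sup>k f\<^sub>k\<close>.\<close>

theorem uniform_boundedness:
  assumes \<Lambda>: "\<Lambda> \<subseteq> dual X" and pt: "\<And>f. f \<in> vectors X \<Longrightarrow> \<exists>C. \<forall>l\<in>\<Lambda>. norm (l f) \<le> C"
  shows "\<exists>C. \<forall>l\<in>\<Lambda>. dual_norm X l \<le> C"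
proof (rule ccontr)
  assume "\<nexists>C. \<forall>l\<in>\<Lambda>. dual_norm X l \<le> C"
  then have "\<forall>n. \<exists>l\<in>\<Lambda>. dual_norm X l > (4 :: real) ^ n" by (meson not_le)
  then obtain l where l: "\<And>n. l n \<in> \<Lambda>" "\<And>n. dual_norm X (l n) > (4 :: real) ^ n" by metis
  define M where "M = (\<lambda>n. dual_norm X (l n))"
  have lM: "4 ^ n < M n" for n using l(2)[of n] by (simp add: M_def)
  have ld: "l n \<in> dual X" for n using l \<Lambda> by auto
  have Mpos: "M n > 0" for n using less_trans[OF _ l(2), of 0 n] by (simp add: M_def)
  \<comment> \<open>Any factor strictly between 1/2 and 1 would do in place of 2/3: it has to beat
    the later increments, which cost up to \<open>M n / 2\<close> in units of
    \<open>(1/3) ^ n\<close>.\<close>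
  have "\<exists>f. f \<in> vectors X \<and> nrm X f \<le> 1 \<and> norm (l n f) > 2/3 * M n" for n
  proof (rule ccontr)
    assume neg: "\<not> ?thesis"
    then have "M n \<le> 2/3 * M n"
      unfolding M_def dual_norm_def[of X "l n"]
    proof (intro cSUP_least)
      show "{f \<in> vectors X. nrm X f \<le> 1} \<noteq> {}" using zero_mem nrm_zero by fastforce
    qed (use neg in \<open>auto simp: M_def not_less\<close>)
    then show False using Mpos[of n] by simp
  qed
  then obtain f where f: "\<And>n. f n \<in> vectors X" "\<And>n. nrm X (f n) \<le> 1" "\<And>n. norm (l n (f n)) > 2/3 * M n"
    by metis
  define y where "y = (\<lambda>n s. of_real ((1/3) ^ n) * f n s)"
  have y: "y n \<in> vectors X" "nrm X (y n) \<le> (1/3) ^ n" "norm (l n (y n)) \<ge> 2/3 * (1/3) ^ n * M n" for n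
  proof -
    show "y n \<in> vectors X" using scale_mem[OF f(1)] by (simp add: y_def)
    have "nrm X (y n) = (1/3) ^ n * nrm X (f n)"
      unfolding y_def by (subst nrm_scale[OF f(1)]) (simp add: norm_power norm_divide)
    then show "nrm X (y n) \<le> (1/3) ^ n" using f(2)[of n] by (simp add: mult_left_le)
    have "norm (l n (y n)) = (1/3) ^ n * norm (l n (f n))"
      unfolding y_def by (subst dual_scale[OF ld f(1)]) (simp add: norm_mult norm_power norm_divide)
    moreover have "(1/3) ^ n * (2/3 * M n) \<le> (1/3) ^ n * norm (l n (f n))"
      using f(3)[of n] by (intro mult_left_mono) auto
    ultimately show "norm (l n (y n)) \<ge> 2/3 * (1/3) ^ n * M n" by (simp add: mult_ac)
  qed
  define x where "x = rec_nat (\<lambda>_. 0 :: complex)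
    (\<lambda>n v. if norm (l n (\<lambda>s. v s + y n s)) \<ge> 2/3 * (1/3) ^ n * M n then (\<lambda>s. v s + y n s) else (\<lambda>s. v s - y n s))"
  have x0: "x 0 = (\<lambda>_. 0)" by (simp add: x_def)
  have xSuc: "x (Suc n) = (if norm (l n (\<lambda>s. x n s + y n s)) \<ge> 2/3 * (1/3) ^ n * M n
     then (\<lambda>s. x n s + y n s) else (\<lambda>s. x n s - y n s))" for n
    by (simp add: x_def)
  have xm: "x n \<in> vectors X" for n
    by (induction n) (auto simp: x0 xSuc zero_mem intro!: add_mem diff_mem y)
  \<comment> \<open>The values of \<open>l n\<close> at \<open>x n + y n\<close> and at
    \<open>x n - y n\<close> differ by \<open>2 * l n (y n)\<close>, so they cannot both be small;
    the definition of \<open>x\<close> picks a sign for which the value is large.\<close>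
  have lx: "norm (l n (x (Suc n))) \<ge> 2/3 * (1/3) ^ n * M n" for n
  proof -
    have "2 * norm (l n (y n)) \<le> norm (l n (\<lambda>s. x n s + y n s)) + norm (l n (\<lambda>s. x n s - y n s))"
    proof -
      have "2 * l n (y n) = l n (\<lambda>s. x n s + y n s) - l n (\<lambda>s. x n s - y n s)"
        by (simp add: dual_add[OF ld xm y(1)] dual_diff[OF ld xm y(1)])
      then have "norm (2 * l n (y n)) \<le> norm (l n (\<lambda>s. x n s + y n s)) + norm (l n (\<lambda>s. x n s - y n s))"
        by (metis norm_triangle_ineq4)
      then show ?thesis by (simp add: norm_mult)
    qed
    with y(3)[of n] show ?thesis by (auto simp: xSuc)
  qed
  define d where "d = (\<lambda>n s. x (Suc n) s - x n s)"
  have dm: "d n \<in> vectors X" for n unfolding d_def by (intro diff_mem xm)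
  have dn: "nrm X (d n) \<le> (1/3) ^ n" for n
  proof -
    have "d n = y n \<or> d n = (\<lambda>s. - 1 * y n s)" by (auto simp: d_def xSuc)
    then show ?thesis using y(2)[of n] nrm_scale[OF y(1), of "-1" n] by auto
  qed
  have "summable (\<lambda>n. nrm X (d n))"
    by (rule summable_comparison_test[OF _ summable_geometric[of "1/3"]])
      (use dn nrm_nonneg[OF dm] in auto)
  from complete[OF dm this] obtain v where v: "v \<in> vectors X"
    "(\<lambda>N. nrm X (\<lambda>s. v s - (\<Sum>n<N. d n s))) \<longlonglongrightarrow> 0"
    by (auto simp: series_converges_to_def)
  have sd: "(\<Sum>n<N. d n s) = x N s" for N s
    unfolding d_def by (induction N) (auto simp: x0)
  have v2: "(\<lambda>N. nrm X (\<lambda>s. v s - x N s)) \<longlonglongrightarrow> 0" using v(2) by (simp add: sd)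
  have tail: "nrm X (\<lambda>s. x (m + k) s - x m s) \<le> 3/2 * (1/3) ^ m - 3/2 * (1/3) ^ (m + k)" for m k
  proof (induction k)
    case (Suc k)
    have "nrm X (\<lambda>s. x (m + Suc k) s - x m s) \<le> nrm X (d (m + k)) + nrm X (\<lambda>s. x (m + k) s - x m s)"
      using nrm_triangle_diff[OF xm[of "Suc (m + k)"] xm[of "m + k"] xm[of m]] by (simp add: d_def)
    also have "\<dots> \<le> (1/3) ^ (m + k) + (3/2 * (1/3) ^ m - 3/2 * (1/3) ^ (m + k))"
      using dn Suc by (intro add_mono) auto
    finally show ?case by (simp add: power_add)
  qed (simp add: nrm_zero)
  have vx: "nrm X (\<lambda>s. v s - x m s) \<le> 3/2 * (1/3) ^ m" for m
  proof (rule LIMSEQ_le_const)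
    show "(\<lambda>k. nrm X (\<lambda>s. v s - x (m + k) s) + 3/2 * (1/3) ^ m) \<longlonglongrightarrow> 3/2 * (1/3) ^ m"
      using tendsto_add[OF LIMSEQ_ignore_initial_segment[OF v2, of m] tendsto_const, of "3/2 * (1/3) ^ m"]
      by (simp add: add.commute)
    have "nrm X (\<lambda>s. v s - x m s) \<le> nrm X (\<lambda>s. v s - x (m + k) s) + 3/2 * (1/3) ^ m" for k
    proof -
      have "nrm X (\<lambda>s. v s - x m s) \<le> nrm X (\<lambda>s. v s - x (m + k) s) + nrm X (\<lambda>s. x (m + k) s - x m s)"
        by (rule nrm_triangle_diff[OF v(1) xm xm])
      moreover have "(3/2 :: real) * (1/3) ^ (m + k) \<ge> 0" by simp
      ultimately show ?thesis using tail[of m k] by linarith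
    qed
    then show "\<exists>N. \<forall>k\<ge>N. nrm X (\<lambda>s. v s - x m s) \<le> nrm X (\<lambda>s. v s - x (m + k) s) + 3/2 * (1/3) ^ m"
      by blast
  qed
  \<comment> \<open>Of the 2/3 reached at step \<open>n\<close>, the later increments destroy at
    most \<open>3/2 * 1/3 = 1/2\<close>, which leaves 1/6. Since \<open>M n\<close> exceeds
    \<open>4 ^ n\<close>, the factor \<open>(1/3) ^ n\<close> still leaves growth.\<close>
  have low: "norm (l n v) \<ge> (4/3) ^ n / 6" for n
  proof -
    have "norm (l n (x (Suc n))) \<le> norm (l n v) + norm (l n (\<lambda>s. v s - x (Suc n) s))"
      unfolding dual_diff[OF ld v(1) xm] by (metis norm_minus_commute norm_triangle_sub)
    also have "norm (l n (\<lambda>s. v s - x (Suc n) s)) \<le> M n * (3/2 * (1/3) ^ Suc n)"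
      unfolding M_def
      by (intro order_trans[OF dual_norm_bound[OF ld]] mult_left_mono vx diff_mem v xm dual_norm_nonneg ld)
    finally have "norm (l n v) \<ge> (1/3) ^ n * M n / 6" using lx[of n] by (simp add: mult_ac)
    moreover have "(1/3) ^ n * 4 ^ n \<le> (1/3) ^ n * M n"
      by (rule mult_left_mono[OF less_imp_le[OF lM]]) simp
    moreover have "(1/3 :: real) ^ n * 4 ^ n = (4/3) ^ n" by (simp flip: power_mult_distrib)
    ultimately show ?thesis by linarith
  qed
  obtain C where "\<forall>l\<in>\<Lambda>. norm (l v) \<le> C" using pt[OF v(1)] by blast
  then have "(4/3) ^ n / 6 \<le> C" for n using order_trans[OF low] l(1) by blast
  moreover obtain n where "(4/3 :: real) ^ n > 6 * C"
    using real_arch_pow[of "4/3" "6 * C"] by auto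
  ultimately show False by (metis leD divide_le_eq_numeral1(1) mult.commute)
qed

end

section \<open>Signs and rearrangements\<close>

text \<open>Sign patterns are paired by flipping the sign at \<open>j\<close>. In each pair the two
  sums are \<open>R - a j\<close> and \<open>R + a j\<close>, and the larger one has modulus at
  least \<open>norm (a j)\<close>. There are \<open>2 ^ (card F - 1)\<close> pairs, whence the
  factor 2 on the right.\<close>

lemma sum_signs_ge:
  fixes a :: "'i \<Rightarrow> complex"
  assumes F: "finite F" "j \<in> F" and q: "q > 0"
  shows "2 ^ card F * norm (a j) powr q \<le>
    2 * (\<Sum>S\<in>Pow F. norm (\<Sum>i\<in>F. (if i \<in> S then 1 else - 1) * a i) powr q)"
proof -
  define D where "D = F - {j}"
  have D: "finite D" "j \<notin> D" "F = insert j D" using F by (auto simp: D_def)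
  define R where "R = (\<lambda>S. \<Sum>i\<in>D. (if i \<in> S then 1 else - 1) * a i)"
  let ?f = "\<lambda>S. norm (\<Sum>i\<in>F. (if i \<in> S then 1 else - 1) * a i) powr q"
  have f1: "?f S = norm (R S - a j) powr q" if "S \<in> Pow D" for S
    using that D by (auto simp: R_def)
  have f2: "?f (insert j S) = norm (R S + a j) powr q" if "S \<in> Pow D" for S
  proof -
    have "(\<Sum>i\<in>D. (if i \<in> insert j S then 1 else - 1) * a i) = R S"
      unfolding R_def using D by (intro sum.cong) auto
    then show ?thesis using D by (simp add: add.commute)
  qed
  have "(\<Sum>S\<in>Pow F. ?f S) = (\<Sum>S\<in>Pow D. ?f S) + (\<Sum>S\<in>insert j ` Pow D. ?f S)"
    unfolding D(3) Pow_insert using D by (intro sum.union_disjoint) auto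
  also have "(\<Sum>S\<in>insert j ` Pow D. ?f S) = (\<Sum>S\<in>Pow D. ?f (insert j S))"
    using D by (subst sum.reindex) (auto intro!: inj_onI)
  also have "(\<Sum>S\<in>Pow D. ?f S) + \<dots> = (\<Sum>S\<in>Pow D. norm (R S - a j) powr q + norm (R S + a j) powr q)"
    unfolding sum.distrib by (intro arg_cong2[of _ _ _ _ "(+)"] sum.cong refl f1 f2)
  also have "\<dots> \<ge> (\<Sum>S\<in>Pow D. norm (a j) powr q)"
  proof (rule sum_mono)
    fix S
    have "2 * norm (a j) = norm ((R S + a j) - (R S - a j))" by (simp add: norm_mult flip: mult_2)
    also have "\<dots> \<le> norm (R S + a j) + norm (R S - a j)" by (rule norm_triangle_ineq4)
    finally have "norm (a j) \<le> norm (R S + a j) \<or> norm (a j) \<le> norm (R S - a j)" by linarith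
    then show "norm (a j) powr q \<le> norm (R S - a j) powr q + norm (R S + a j) powr q"
    proof
      assume "norm (a j) \<le> norm (R S + a j)"
      then have "norm (a j) powr q \<le> norm (R S + a j) powr q" using q by (intro powr_mono2) auto
      then show ?thesis by (simp add: add_increasing)
    next
      assume "norm (a j) \<le> norm (R S - a j)"
      then have "norm (a j) powr q \<le> norm (R S - a j) powr q" using q by (intro powr_mono2) auto
      then show ?thesis by (simp add: add_increasing2)
    qed
  qed
  finally have "(\<Sum>S\<in>Pow F. ?f S) \<ge> 2 ^ card D * norm (a j) powr q"
    using D by (simp add: card_Pow)
  moreover have "card F = Suc (card D)" using D by simp
  ultimately show ?thesis by simp
qed

text \<open>Real and imaginary parts are split according to sign; each of the four pieces is, up to
  sign, the real or imaginary part of a subset sum.\<close>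

lemma sum_norm_le_subset_sums:
  fixes b :: "'i \<Rightarrow> complex"
  assumes F: "finite F" and C: "\<And>S. S \<subseteq> F \<Longrightarrow> norm (\<Sum>i\<in>S. b i) \<le> C"
  shows "(\<Sum>i\<in>F. norm (b i)) \<le> 4 * C"
proof -
  have *: "(\<Sum>i\<in>F. \<bar>g (b i)\<bar>) \<le> 2 * C"
    if g: "\<And>x. \<bar>g x\<bar> \<le> norm x" "\<And>S. g (\<Sum>i\<in>S. b i) = (\<Sum>i\<in>S. g (b i))" for g :: "complex \<Rightarrow> real"
  proof -
    let ?P = "{i\<in>F. g (b i) \<ge> 0}"
    have "(\<Sum>i\<in>F. \<bar>g (b i)\<bar>) = (\<Sum>i\<in>?P. \<bar>g (b i)\<bar>) + (\<Sum>i\<in>F - ?P. \<bar>g (b i)\<bar>)"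
      using F by (subst sum.union_disjoint[symmetric]) (auto intro!: sum.cong)
    also have "(\<Sum>i\<in>?P. \<bar>g (b i)\<bar>) = g (\<Sum>i\<in>?P. b i)" by (simp add: g)
    also have "(\<Sum>i\<in>F - ?P. \<bar>g (b i)\<bar>) = - g (\<Sum>i\<in>F - ?P. b i)"
      by (subst g) (auto simp: sum_negf[symmetric] intro!: sum.cong)
    also have "g (\<Sum>i\<in>?P. b i) + - g (\<Sum>i\<in>F - ?P. b i) \<le> C + C"
      using C[of ?P] C[of "F - ?P"] g(1)[of "\<Sum>i\<in>?P. b i"] g(1)[of "\<Sum>i\<in>F - ?P. b i"] by (intro add_mono) force+
    finally show ?thesis by simp
  qed
  have "(\<Sum>i\<in>F. norm (b i)) \<le> (\<Sum>i\<in>F. \<bar>Re (b i)\<bar> + \<bar>Im (b i)\<bar>)"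
    by (intro sum_mono cmod_le)
  also have "\<dots> \<le> 2 * C + 2 * C"
    unfolding sum.distrib by (intro add_mono *) (auto simp: abs_Re_le_cmod abs_Im_le_cmod)
  finally show ?thesis by simp
qed

text \<open>A block of the rearrangement below lists \<open>\<Phi> E\<close>, where \<open>E\<close> consists of the numbers listed so far,
  and then the least number that is still missing.\<close>

lemma rearrangement_with_blocks:
  fixes \<Phi> :: "nat set \<Rightarrow> nat set"
  assumes \<Phi>: "\<And>E. finite E \<Longrightarrow> finite (\<Phi> E) \<and> \<Phi> E \<inter> E = {}"
  obtains \<pi> :: "nat \<Rightarrow> nat" where "bij \<pi>"
    "\<And>n. \<exists>k\<ge>n. \<exists>m. \<pi> ` {k..<m} = \<Phi> (\<pi> ` {..<k})"
proof -
  define B where "B = (\<lambda>xs. xs @ sorted_list_of_set (\<Phi> (set xs)))"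
  define L where "L = rec_nat [] (\<lambda>_ xs. B xs @ [LEAST m. m \<notin> set (B xs)])"
  have L0: "L 0 = []" and LS: "L (Suc n) = B (L n) @ [LEAST m. m \<notin> set (B (L n))]" for n
    by (simp_all add: L_def)
  have least: "(LEAST m. m \<notin> set xs) \<notin> set xs" for xs :: "nat list"
    by (rule LeastI_ex) (use infinite_UNIV_nat ex_new_if_finite in blast)
  have setB: "set (B xs) = set xs \<union> \<Phi> (set xs)" for xs using \<Phi> by (auto simp: B_def)
  have distB: "distinct xs \<Longrightarrow> distinct (B xs)" for xs
    using \<Phi>[of "set xs"] by (auto simp: B_def)
  have dist: "distinct (L n)" for n
    by (induction n) (use distB least in \<open>auto simp: L0 LS\<close>)
  have len: "length (L n) \<ge> n" for n
    by (induction n) (auto simp: L0 LS B_def)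
  have pre: "n \<le> m \<Longrightarrow> \<exists>ys. L m = L n @ ys" for n m
    by (induction m rule: dec_induct) (auto simp: LS B_def)
  have nth_pre: "i < length (L n) \<Longrightarrow> n \<le> m \<Longrightarrow> L m ! i = L n ! i" for i n m
    using pre[of n m] by (auto simp: nth_append)
  \<comment> \<open>The lists extend one another and \<open>L (Suc i)\<close> has more than
    \<open>i\<close> entries, so entry \<open>i\<close> is final by that stage.\<close>
  define \<pi> where "\<pi> = (\<lambda>i. L (Suc i) ! i)"
  have len': "i < length (L (Suc i))" for i using len[of "Suc i"] by simp
  have \<pi>: "\<pi> i = L n ! i" if "i < length (L n)" for i n
    unfolding \<pi>_def using nth_pre[OF that, of "Suc i"] nth_pre[OF len', of i n]
    by (cases "n \<le> Suc i") auto
  have \<pi>B: "\<pi> i = B (L n) ! i" if "i < length (B (L n))" for i n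
    using \<pi>[of i "Suc n"] that by (simp add: LS nth_append)
  \<comment> \<open>Each stage appends the least missing number, so that after \<open>n\<close>
    stages nothing below \<open>n\<close> is missing. This gives surjectivity.\<close>
  have cover: "k < n \<Longrightarrow> k \<in> set (L n)" for k n
  proof (induction n arbitrary: k)
    case (Suc n)
    show ?case
    proof (cases "k \<in> set (B (L n))")
      case False
      then have "(LEAST m. m \<notin> set (B (L n))) \<le> k" by (intro Least_le)
      moreover have "\<not> (LEAST m. m \<notin> set (B (L n))) < n"
      proof
        assume "(LEAST m. m \<notin> set (B (L n))) < n"
        then have "(LEAST m. m \<notin> set (B (L n))) \<in> set (B (L n))" using Suc.IH by (auto simp: setB)
        then show False using least by blast
      qed
      ultimately have "(LEAST m. m \<notin> set (B (L n))) = k" using Suc.prems by linarith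
      then show ?thesis by (simp add: LS)
    qed (simp add: LS)
  qed simp
  have img: "\<pi> ` {..<length (L n)} = set (L n)" for n
    using \<pi>[of _ n] by (auto simp: set_conv_nth image_iff)
  have imgB: "\<pi> ` {length (L n)..<length (B (L n))} = \<Phi> (set (L n))" for n
  proof -
    have fin: "finite (\<Phi> (set (L n)))" using \<Phi> by simp
    have "\<pi> (length (L n) + i) = sorted_list_of_set (\<Phi> (set (L n))) ! i"
      if "i < card (\<Phi> (set (L n)))" for i
      using that by (subst \<pi>B[of _ n]) (auto simp: B_def nth_append)
    then have "(\<lambda>i. \<pi> (length (L n) + i)) ` {..<card (\<Phi> (set (L n)))} =
       set (sorted_list_of_set (\<Phi> (set (L n))))"
      by (simp add: set_conv_nth image_def lessThan_def) blast
    moreover have "{length (L n)..<length (B (L n))} = (\<lambda>i. length (L n) + i) ` {..<card (\<Phi> (set (L n)))}"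
      by (auto simp: B_def image_add_atLeastLessThan lessThan_atLeast0)
    ultimately show ?thesis using fin by (simp add: image_image)
  qed
  show ?thesis
  proof (rule that)
    show "bij \<pi>"
    proof (rule bijI)
      show "inj \<pi>"
      proof (rule injI)
        fix i j assume eq: "\<pi> i = \<pi> j"
        define n where "n = Suc (max i j)"
        have "i < length (L n)" "j < length (L n)" using len[of n] by (auto simp: n_def)
        then show "i = j" using eq \<pi>[of i n] \<pi>[of j n] dist[of n] by (simp add: nth_eq_iff_index_eq)
      qed
      have "k \<in> range \<pi>" for k using cover[of k "Suc k"] img[of "Suc k"] by blast
      then show "surj \<pi>" by blast
    qed
    show "\<exists>k\<ge>n. \<exists>m. \<pi> ` {k..<m} = \<Phi> (\<pi> ` {..<k})" for n
      using len[of n] imgB[of n] img[of n] by metis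
  qed
qed

text \<open>If every finite set could be avoided by a finite block whose sum has norm greater than
  1, a rearrangement listing infinitely many such blocks consecutively would violate the Cauchy
  condition. So outside some finite \<open>E\<close> all finite sums have norm at most 1, and the
  terms indexed by \<open>E\<close> add a fixed amount.\<close>

lemma (in normed_fspace) unconditionally_convergent_bounded:
  assumes a: "\<And>n. a n \<in> vectors X" and uc: "unconditionally_convergent X a"
  obtains C where "\<And>F. finite F \<Longrightarrow> nrm X (\<lambda>s. \<Sum>n\<in>F. a n s) \<le> C"
proof -
  have "\<exists>E. finite E \<and> (\<forall>F. finite F \<longrightarrow> F \<inter> E = {} \<longrightarrow> nrm X (\<lambda>s. \<Sum>n\<in>F. a n s) \<le> 1)"
  proof (rule ccontr)
    assume "\<not> ?thesis"
    then have "\<forall>E. \<exists>F. finite E \<longrightarrow> finite F \<and> F \<inter> E = {} \<and> nrm X (\<lambda>s. \<Sum>n\<in>F. a n s) > 1"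
      by (meson not_le)
    then obtain \<Phi> where \<Phi>: "\<And>E. finite E \<Longrightarrow> finite (\<Phi> E) \<and> \<Phi> E \<inter> E = {} \<and> nrm X (\<lambda>s. \<Sum>n\<in>\<Phi> E. a n s) > 1"
      by - (drule choice, blast)
    obtain \<pi> :: "nat \<Rightarrow> nat" where \<pi>: "bij \<pi>" "\<And>n. \<exists>k\<ge>n. \<exists>m. \<pi> ` {k..<m} = \<Phi> (\<pi> ` {..<k})"
      by (rule rearrangement_with_blocks[of \<Phi>]) (use \<Phi> in blast)+
    obtain f where f: "f \<in> vectors X" "(\<lambda>N. nrm X (\<lambda>s. f s - (\<Sum>n<N. a (\<pi> n) s))) \<longlonglongrightarrow> 0"
      using uc \<pi>(1) by (auto simp: unconditionally_convergent_def series_converges_to_def)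
    define S where "S = (\<lambda>N s. \<Sum>n<N. a (\<pi> n) s)"
    have S: "S N \<in> vectors X" for N unfolding S_def by (intro sum_mem a)
    have "eventually (\<lambda>N. nrm X (\<lambda>s. f s - S N s) < 1/2) sequentially"
      using f(2) by (intro order_tendstoD) (auto simp: S_def)
    then obtain N0 where N0: "\<And>N. N \<ge> N0 \<Longrightarrow> nrm X (\<lambda>s. f s - S N s) < 1/2"
      by (auto simp: eventually_sequentially)
    obtain k m where km: "k \<ge> N0" "\<pi> ` {k..<m} = \<Phi> (\<pi> ` {..<k})" using \<pi>(2) by blast
    have gt: "nrm X (\<lambda>s. \<Sum>n\<in>\<pi> ` {k..<m}. a n s) > 1" using \<Phi>[of "\<pi> ` {..<k}"] km(2) by auto
    then have "k < m" using nrm_zero by (cases "k < m") auto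
    have "(\<Sum>n\<in>\<pi> ` {k..<m}. a n s) = S m s - S k s" for s
    proof -
      have "(\<Sum>n\<in>\<pi> ` {k..<m}. a n s) = (\<Sum>n\<in>{k..<m}. a (\<pi> n) s)"
        using bij_is_inj[OF \<pi>(1)] by (subst sum.reindex) (auto intro: inj_on_subset)
      also have "\<dots> = S m s - S k s"
        using sum_diff_nat_ivl[of 0 k m "\<lambda>n. a (\<pi> n) s"] \<open>k < m\<close> by (simp add: S_def atLeast0LessThan)
      finally show ?thesis .
    qed
    then have "1 < nrm X (\<lambda>s. S m s - S k s)" using gt by simp
    also have "\<dots> \<le> nrm X (\<lambda>s. S m s - f s) + nrm X (\<lambda>s. f s - S k s)"
      by (intro nrm_triangle_diff S f)
    also have "\<dots> < 1/2 + 1/2"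
      using N0[of k] N0[of m] km \<open>k < m\<close> nrm_minus[OF f(1) S] by (intro add_strict_mono) auto
    finally show False by simp
  qed
  then obtain E where E: "finite E" "\<And>F. finite F \<Longrightarrow> F \<inter> E = {} \<Longrightarrow> nrm X (\<lambda>s. \<Sum>n\<in>F. a n s) \<le> 1"
    by blast
  show ?thesis
  proof (rule that)
    fix F :: "nat set" assume F: "finite F"
    have "(\<Sum>n\<in>F. a n s) = (\<Sum>n\<in>F \<inter> E. a n s) + (\<Sum>n\<in>F - E. a n s)" for s
      using F by (subst sum.union_disjoint[symmetric]) (auto intro!: sum.cong)
    then have "nrm X (\<lambda>s. \<Sum>n\<in>F. a n s) \<le> nrm X (\<lambda>s. \<Sum>n\<in>F \<inter> E. a n s) + nrm X (\<lambda>s. \<Sum>n\<in>F - E. a n s)"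
      using nrm_triangle[OF sum_mem sum_mem, of "F \<inter> E" a "F - E" a] a by simp
    also have "\<dots> \<le> (\<Sum>n\<in>E. nrm X (a n)) + 1"
    proof (intro add_mono)
      have "nrm X (\<lambda>s. \<Sum>n\<in>F \<inter> E. a n s) \<le> (\<Sum>n\<in>F \<inter> E. nrm X (a n))" by (intro nrm_sum a)
      also have "\<dots> \<le> (\<Sum>n\<in>E. nrm X (a n))" using E a nrm_nonneg by (intro sum_mono2) auto
      finally show "nrm X (\<lambda>s. \<Sum>n\<in>F \<inter> E. a n s) \<le> (\<Sum>n\<in>E. nrm X (a n))" .
      show "nrm X (\<lambda>s. \<Sum>n\<in>F - E. a n s) \<le> 1" using F by (intro E(2)) blast+
    qed
    finally show "nrm X (\<lambda>s. \<Sum>n\<in>F. a n s) \<le> (\<Sum>n\<in>E. nrm X (a n)) + 1" .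
  qed
qed

section \<open>Schwartz functions\<close>

lemma nth_deriv_0 [simp]: "nth_deriv 0 \<phi> = \<phi>"
  by (simp add: nth_deriv_def)

lemma nth_deriv_Suc: "nth_deriv (Suc n) \<phi> = nth_deriv n (nth_deriv (Suc 0) \<phi>)"
  unfolding nth_deriv_def by (simp add: funpow_Suc_right del: funpow.simps(2))

lemma nth_deriv_Suc': "nth_deriv (Suc n) \<phi> = (\<lambda>t. vector_derivative (nth_deriv n \<phi>) (at t))"
  by (simp add: nth_deriv_def)

lemma nth_deriv_eqI:
  assumes "\<And>n t. (f n has_vector_derivative f (Suc n) t) (at t)"
  shows "nth_deriv n (f 0) = f n"
  by (induction n) (auto simp: nth_deriv_Suc' intro!: ext vector_derivative_at assms)

lemma SchwartzD_deriv:
  "\<phi> \<in> Schwartz \<Longrightarrow> (nth_deriv n \<phi> has_vector_derivative nth_deriv (Suc n) \<phi> t) (at t)"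
  by (simp add: Schwartz_def nth_deriv_Suc' vector_derivative_works[symmetric])

lemma Schwartz_deriv: "\<phi> \<in> Schwartz \<Longrightarrow> (\<phi> has_vector_derivative nth_deriv (Suc 0) \<phi> t) (at t)"
  using SchwartzD_deriv[of \<phi> 0 t] by simp

text \<open>A class of rapidly decaying functions that is stable under one derivative consists of
  Schwartz functions. This replaces Leibniz formulas for \<open>nth_deriv\<close> in all the closure
  properties below.\<close>

lemma Schwartz_coinduct:
  assumes "\<phi> \<in> A"
    and "\<And>\<eta> m. \<eta> \<in> A \<Longrightarrow> \<exists>C. \<forall>t. \<bar>t\<bar> ^ m * norm (\<eta> t) \<le> C"
    and "\<And>\<eta>. \<eta> \<in> A \<Longrightarrow> \<exists>\<eta>'\<in>A. \<forall>t. (\<eta> has_vector_derivative \<eta>' t) (at t)"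
  shows "\<phi> \<in> Schwartz"
proof -
  have A: "nth_deriv n \<phi> \<in> A" for n
  proof (induction n)
    case (Suc n)
    from assms(3)[OF this] obtain \<eta> where "\<eta> \<in> A" "\<forall>t. (nth_deriv n \<phi> has_vector_derivative \<eta> t) (at t)"
      by blast
    moreover from this have "nth_deriv (Suc n) \<phi> = \<eta>"
      by (auto simp: nth_deriv_Suc' intro!: ext vector_derivative_at)
    ultimately show ?case by simp
  qed (use assms in simp)
  have "nth_deriv n \<phi> differentiable (at t)" for n t
    using assms(3)[OF A[of n]] by (auto intro: differentiableI_vector)
  then show ?thesis using assms(2)[OF A] by (simp add: Schwartz_def)
qed

lemma Schwartz_bounded: "\<phi> \<in> Schwartz \<Longrightarrow> \<exists>C. \<forall>t. \<bar>t\<bar> ^ m * norm (\<phi> t) \<le> C"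
proof -
  assume "\<phi> \<in> Schwartz"
  then have "\<exists>C. \<forall>t. \<bar>t\<bar> ^ m * norm (nth_deriv 0 \<phi> t) \<le> C" unfolding Schwartz_def by blast
  then show ?thesis by simp
qed

lemma Schwartz_nth_deriv: "\<phi> \<in> Schwartz \<Longrightarrow> nth_deriv n \<phi> \<in> Schwartz"
proof (rule Schwartz_coinduct[of _ "{nth_deriv k \<phi> | k. True}"])
  assume \<phi>: "\<phi> \<in> Schwartz"
  fix \<eta> m assume "\<eta> \<in> {nth_deriv k \<phi> |k. True}"
  then obtain k where \<eta>: "\<eta> = nth_deriv k \<phi>" by blast
  show "\<exists>C. \<forall>t. \<bar>t\<bar> ^ m * norm (\<eta> t) \<le> C" using \<phi> unfolding \<eta> Schwartz_def by blast
next
  assume \<phi>: "\<phi> \<in> Schwartz"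
  fix \<eta> assume "\<eta> \<in> {nth_deriv k \<phi> |k. True}"
  then show "\<exists>\<eta>'\<in>{nth_deriv k \<phi> |k. True}. \<forall>t. (\<eta> has_vector_derivative \<eta>' t) (at t)"
    using SchwartzD_deriv[OF \<phi>] by blast
qed blast

lemma Schwartz_decay:
  assumes "\<phi> \<in> Schwartz"
  obtains C where "C > 0" "\<And>t. (1 + \<bar>t\<bar>) ^ m * norm (\<phi> t) \<le> C"
proof -
  obtain A B where A: "\<And>t. \<bar>t\<bar> ^ 0 * norm (\<phi> t) \<le> A" and B: "\<And>t. \<bar>t\<bar> ^ m * norm (\<phi> t) \<le> B"
    using Schwartz_bounded[OF assms] by meson
  have "(1 + \<bar>t\<bar>) ^ m * norm (\<phi> t) \<le> 2 ^ m * (A + B)" for t :: real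
  proof -
    have "(1 + \<bar>t\<bar>) ^ m \<le> (2 * max 1 \<bar>t\<bar>) ^ m" by (intro power_mono) auto
    also have "\<dots> \<le> 2 ^ m * (1 + \<bar>t\<bar> ^ m)"
      by (auto simp: power_mult_distrib max_def)
    finally have "(1 + \<bar>t\<bar>) ^ m * norm (\<phi> t) \<le> 2 ^ m * (1 + \<bar>t\<bar> ^ m) * norm (\<phi> t)"
      by (intro mult_right_mono) auto
    also have "\<dots> = 2 ^ m * (\<bar>t\<bar> ^ 0 * norm (\<phi> t) + \<bar>t\<bar> ^ m * norm (\<phi> t))" by (simp add: algebra_simps)
    also have "\<dots> \<le> 2 ^ m * (A + B)" by (intro mult_left_mono add_mono A B) auto
    finally show ?thesis .
  qed
  then show ?thesis by (intro that[of "max 1 (2 ^ m * (A + B))"]) (auto simp: le_max_iff_disj)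
qed

lemma bounded_add:
  fixes f g :: "real \<Rightarrow> complex"
  assumes "\<exists>C. \<forall>t. \<bar>t\<bar> ^ m * norm (f t) \<le> C" "\<exists>C. \<forall>t. \<bar>t\<bar> ^ m * norm (g t) \<le> C"
  shows "\<exists>C. \<forall>t. \<bar>t\<bar> ^ m * norm (f t + g t) \<le> C"
proof -
  obtain A B where A: "\<And>t. \<bar>t\<bar> ^ m * norm (f t) \<le> A" and B: "\<And>t. \<bar>t\<bar> ^ m * norm (g t) \<le> B"
    using assms by meson
  have "\<bar>t\<bar> ^ m * norm (f t + g t) \<le> A + B" for t
  proof -
    have "\<bar>t\<bar> ^ m * norm (f t + g t) \<le> \<bar>t\<bar> ^ m * (norm (f t) + norm (g t))"
      by (intro mult_left_mono norm_triangle_ineq) auto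
    then show ?thesis using A[of t] B[of t] by (simp add: distrib_left)
  qed
  then show ?thesis by blast
qed

lemma Schwartz_add:
  assumes "\<phi> \<in> Schwartz" "\<eta> \<in> Schwartz"
  shows "(\<lambda>t. \<phi> t + \<eta> t) \<in> Schwartz"
proof (rule Schwartz_coinduct[of _ "{\<lambda>t. \<phi> t + \<eta> t | \<phi> \<eta>. \<phi> \<in> Schwartz \<and> \<eta> \<in> Schwartz}"])
  fix f assume "f \<in> {\<lambda>t. \<phi> t + \<eta> t | \<phi> \<eta>. \<phi> \<in> Schwartz \<and> \<eta> \<in> Schwartz}"
  then obtain \<phi> \<eta> where f: "f = (\<lambda>t. \<phi> t + \<eta> t)" "\<phi> \<in> Schwartz" "\<eta> \<in> Schwartz" by blast
  show "\<exists>C. \<forall>t. \<bar>t\<bar> ^ m * norm (f t) \<le> C" for m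
    unfolding f by (intro bounded_add Schwartz_bounded f)
  show "\<exists>\<eta>'\<in>{\<lambda>t. \<phi> t + \<eta> t | \<phi> \<eta>. \<phi> \<in> Schwartz \<and> \<eta> \<in> Schwartz}. \<forall>t. (f has_vector_derivative \<eta>' t) (at t)"
    unfolding f using Schwartz_deriv[OF f(2)] Schwartz_deriv[OF f(3)] f(2,3) Schwartz_nth_deriv
    by (intro bexI[of _ "\<lambda>t. nth_deriv (Suc 0) \<phi> t + nth_deriv (Suc 0) \<eta> t"])
      (blast intro!: has_vector_derivative_add)+
qed (use assms in blast)

lemma Schwartz_scale:
  assumes "\<phi> \<in> Schwartz"
  shows "(\<lambda>t. c * \<phi> t) \<in> Schwartz"
proof (rule Schwartz_coinduct[of _ "{\<lambda>t. c * \<phi> t | \<phi>. \<phi> \<in> Schwartz}"])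
  fix f assume "f \<in> {\<lambda>t. c * \<phi> t | \<phi>. \<phi> \<in> Schwartz}"
  then obtain \<phi> where f: "f = (\<lambda>t. c * \<phi> t)" "\<phi> \<in> Schwartz" by blast
  show "\<exists>C. \<forall>t. \<bar>t\<bar> ^ m * norm (f t) \<le> C" for m
  proof -
    obtain C where C: "\<And>t. \<bar>t\<bar> ^ m * norm (\<phi> t) \<le> C" using Schwartz_bounded[OF f(2)] by meson
    have eq: "\<bar>t\<bar> ^ m * norm (f t) = norm c * (\<bar>t\<bar> ^ m * norm (\<phi> t))" for t by (simp add: f norm_mult)
    then have "\<bar>t\<bar> ^ m * norm (f t) \<le> norm c * C" for t unfolding eq by (intro mult_left_mono C) auto
    then show ?thesis by blast
  qed
  show "\<exists>\<eta>'\<in>{\<lambda>t. c * \<phi> t | \<phi>. \<phi> \<in> Schwartz}. \<forall>t. (f has_vector_derivative \<eta>' t) (at t)"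
    unfolding f using Schwartz_deriv[OF f(2)] f(2) Schwartz_nth_deriv
    by (intro bexI[of _ "\<lambda>t. c * nth_deriv (Suc 0) \<phi> t"])
      (blast intro!: has_vector_derivative_mult_right)+
qed (use assms in blast)

lemma Schwartz_cnj:
  assumes "\<phi> \<in> Schwartz"
  shows "(\<lambda>t. cnj (\<phi> t)) \<in> Schwartz"
proof (rule Schwartz_coinduct[of _ "{\<lambda>t. cnj (\<phi> t) | \<phi>. \<phi> \<in> Schwartz}"])
  fix f assume "f \<in> {\<lambda>t. cnj (\<phi> t) | \<phi>. \<phi> \<in> Schwartz}"
  then obtain \<phi> where f: "f = (\<lambda>t. cnj (\<phi> t))" "\<phi> \<in> Schwartz" by blast
  show "\<exists>C. \<forall>t. \<bar>t\<bar> ^ m * norm (f t) \<le> C" for m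
    using Schwartz_bounded[OF f(2)] by (simp add: f)
  show "\<exists>\<eta>'\<in>{\<lambda>t. cnj (\<phi> t) | \<phi>. \<phi> \<in> Schwartz}. \<forall>t. (f has_vector_derivative \<eta>' t) (at t)"
    unfolding f using Schwartz_deriv[OF f(2)] f(2) Schwartz_nth_deriv
    by (intro bexI[of _ "\<lambda>t. cnj (nth_deriv (Suc 0) \<phi> t)"])
      (blast intro!: has_vector_derivative_cnj)+
qed (use assms in blast)

lemma Schwartz_translate:
  assumes "\<phi> \<in> Schwartz"
  shows "translate x \<phi> \<in> Schwartz"
proof (rule Schwartz_coinduct[of _ "{translate x \<phi> | \<phi>. \<phi> \<in> Schwartz}"])
  fix f assume "f \<in> {translate x \<phi> | \<phi>. \<phi> \<in> Schwartz}"
  then obtain \<phi> where f: "f = translate x \<phi>" "\<phi> \<in> Schwartz" by blast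
  show "\<exists>C. \<forall>t. \<bar>t\<bar> ^ m * norm (f t) \<le> C" for m
  proof -
    obtain C where C: "C > 0" "\<And>t. (1 + \<bar>t\<bar>) ^ m * norm (\<phi> t) \<le> C" using Schwartz_decay[OF f(2)] by metis
    have "\<bar>t\<bar> ^ m * norm (f t) \<le> (1 + \<bar>x\<bar>) ^ m * C" for t
    proof -
      have "\<bar>t\<bar> \<le> (1 + \<bar>x\<bar>) * (1 + \<bar>t - x\<bar>)"
      proof -
        have "(1 + \<bar>x\<bar>) * (1 + \<bar>t - x\<bar>) = 1 + \<bar>x\<bar> + \<bar>t - x\<bar> + \<bar>x\<bar> * \<bar>t - x\<bar>" by algebra
        moreover have "\<bar>x\<bar> * \<bar>t - x\<bar> \<ge> 0" by simp
        ultimately show ?thesis by linarith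
      qed
      then have "\<bar>t\<bar> ^ m \<le> ((1 + \<bar>x\<bar>) * (1 + \<bar>t - x\<bar>)) ^ m" by (intro power_mono) auto
      then have "\<bar>t\<bar> ^ m * norm (f t) \<le> (1 + \<bar>x\<bar>) ^ m * ((1 + \<bar>t - x\<bar>) ^ m * norm (\<phi> (t - x)))"
        unfolding mult.assoc[symmetric] power_mult_distrib[symmetric]
        by (auto simp: f translate_def intro: mult_right_mono)
      also have "\<dots> \<le> (1 + \<bar>x\<bar>) ^ m * C" by (intro mult_left_mono C) auto
      finally show ?thesis .
    qed
    then show ?thesis by blast
  qed
  show "\<exists>\<eta>'\<in>{translate x \<phi> | \<phi>. \<phi> \<in> Schwartz}. \<forall>t. (f has_vector_derivative \<eta>' t) (at t)"
  proof (intro bexI[of _ "translate x (nth_deriv (Suc 0) \<phi>)"] allI)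
    fix t
    have "((\<phi> \<circ> (\<lambda>t. t - x)) has_vector_derivative (1 *\<^sub>R nth_deriv (Suc 0) \<phi> (t - x))) (at t)"
      by (rule vector_diff_chain_at) (auto intro!: derivative_eq_intros Schwartz_deriv f)
    then show "(f has_vector_derivative translate x (nth_deriv (Suc 0) \<phi>) t) (at t)"
      by (simp add: f translate_def o_def)
  qed (use f Schwartz_nth_deriv in blast)
qed (use assms in blast)

lemma has_vector_derivative_modulate:
  assumes "(\<phi> has_vector_derivative d) (at t)"
  shows "(modulate w \<phi> has_vector_derivative
     exp (2 * of_real pi * \<i> * of_real w * of_real t) * (2 * of_real pi * \<i> * of_real w * \<phi> t + d)) (at t)"
proof -
  have "((\<lambda>t. exp (2 * of_real pi * \<i> * of_real w * of_real t)) has_vector_derivative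
      exp (2 * of_real pi * \<i> * of_real w * of_real t) * (2 * of_real pi * \<i> * of_real w)) (at t)"
    by (rule has_vector_derivative_real_field) (auto intro!: derivative_eq_intros)
  from has_vector_derivative_mult[OF this assms] show ?thesis
    by (simp add: modulate_def algebra_simps)
qed

lemma norm_modulate [simp]: "norm (modulate w \<phi> t) = norm (\<phi> t)"
proof -
  have "2 * complex_of_real pi * \<i> * of_real w * of_real t = \<i> * of_real (2 * pi * w * t)" by simp
  then show ?thesis unfolding modulate_def by (metis mult_1 norm_exp_i_times norm_mult)
qed

lemma Schwartz_modulate:
  assumes "\<phi> \<in> Schwartz"
  shows "modulate w \<phi> \<in> Schwartz"
proof (rule Schwartz_coinduct[of _ "{modulate w \<phi> | \<phi>. \<phi> \<in> Schwartz}"])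
  fix f assume "f \<in> {modulate w \<phi> | \<phi>. \<phi> \<in> Schwartz}"
  then obtain \<phi> where f: "f = modulate w \<phi>" "\<phi> \<in> Schwartz" by blast
  show "\<exists>C. \<forall>t. \<bar>t\<bar> ^ m * norm (f t) \<le> C" for m
    using Schwartz_bounded[OF f(2)] by (simp add: f)
  show "\<exists>\<eta>'\<in>{modulate w \<phi> | \<phi>. \<phi> \<in> Schwartz}. \<forall>t. (f has_vector_derivative \<eta>' t) (at t)"
  \<comment> \<open>The derivative of the phase is absorbed into the modulated function, which keeps
    the class stable.\<close>
  proof (intro bexI[of _ "modulate w (\<lambda>t. 2 * of_real pi * \<i> * of_real w * \<phi> t + nth_deriv (Suc 0) \<phi> t)"] allI)
    show "(f has_vector_derivative
        modulate w (\<lambda>t. 2 * of_real pi * \<i> * of_real w * \<phi> t + nth_deriv (Suc 0) \<phi> t) t) (at t)" for t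
      using has_vector_derivative_modulate[OF Schwartz_deriv[OF f(2), of t]] by (simp add: f modulate_def)
  qed (use f Schwartz_add Schwartz_scale Schwartz_nth_deriv in blast)
qed (use assms in blast)

lemma Schwartz_zero: "(\<lambda>_. 0) \<in> Schwartz"
  by (rule Schwartz_coinduct[of _ "{\<lambda>_. 0}"]) auto

lemma Schwartz_diff: "\<phi> \<in> Schwartz \<Longrightarrow> \<eta> \<in> Schwartz \<Longrightarrow> (\<lambda>t. \<phi> t - \<eta> t) \<in> Schwartz"
  using Schwartz_add[OF _ Schwartz_scale[of \<eta> "-1"], of \<phi>] by simp

lemma Schwartz_sum: "(\<And>i. i \<in> I \<Longrightarrow> f i \<in> Schwartz) \<Longrightarrow> (\<lambda>t. \<Sum>i\<in>I. f i t) \<in> Schwartz"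
  by (induction I rule: infinite_finite_induct) (auto simp: Schwartz_zero Schwartz_add)

lemma nth_deriv_add:
  assumes "\<phi> \<in> Schwartz" "\<eta> \<in> Schwartz"
  shows "nth_deriv n (\<lambda>t. \<phi> t + \<eta> t) = (\<lambda>t. nth_deriv n \<phi> t + nth_deriv n \<eta> t)"
  using nth_deriv_eqI[of "\<lambda>n t. nth_deriv n \<phi> t + nth_deriv n \<eta> t" n]
  by (auto intro!: has_vector_derivative_add SchwartzD_deriv assms)

lemma nth_deriv_scale:
  assumes "\<phi> \<in> Schwartz"
  shows "nth_deriv n (\<lambda>t. c * \<phi> t) = (\<lambda>t. c * nth_deriv n \<phi> t)"
  using nth_deriv_eqI[of "\<lambda>n t. c * nth_deriv n \<phi> t" n]
  by (auto intro!: has_vector_derivative_mult_right SchwartzD_deriv assms)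

lemma nth_deriv_diff:
  assumes "\<phi> \<in> Schwartz" "\<eta> \<in> Schwartz"
  shows "nth_deriv n (\<lambda>t. \<phi> t - \<eta> t) = (\<lambda>t. nth_deriv n \<phi> t - nth_deriv n \<eta> t)"
  using nth_deriv_eqI[of "\<lambda>n t. nth_deriv n \<phi> t - nth_deriv n \<eta> t" n]
  by (auto intro!: has_vector_derivative_diff SchwartzD_deriv assms)

lemma Schwartz_continuous: "\<phi> \<in> Schwartz \<Longrightarrow> continuous_on S \<phi>"
  by (meson Schwartz_deriv continuous_at_imp_continuous_on has_vector_derivative_continuous)

lemma Schwartz_measurable [measurable_dest]: "\<phi> \<in> Schwartz \<Longrightarrow> \<phi> \<in> borel_measurable borel"
  by (intro borel_measurable_continuous_onI Schwartz_continuous)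

section \<open>Integrability and Schwartz norms\<close>

lemma integrable_inverse_square: "integrable lborel (\<lambda>t::real. inverse ((1 + \<bar>t\<bar>)\<^sup>2))"
proof (rule Bochner_Integration.integrable_bound)
  show "integrable lborel (\<lambda>x::real. inverse (1 + x\<^sup>2))"
    using integrable_inverse_1_plus_square by (simp add: set_integrable_def)
  have "inverse ((1 + \<bar>t\<bar>)\<^sup>2) \<le> inverse (1 + t\<^sup>2)" for t :: real
    by (intro le_imp_inverse_le) (auto simp: power2_eq_square algebra_simps intro: add_pos_nonneg)
  then show "AE t::real in lborel. norm (inverse ((1 + \<bar>t\<bar>)\<^sup>2)) \<le> norm (inverse (1 + t\<^sup>2))"
    by (auto intro: order_trans)
qed measurable

lemma integrable_Schwartz_weight:
  assumes "\<phi> \<in> Schwartz"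
  shows "integrable lborel (\<lambda>t. (1 + \<bar>t\<bar>) ^ m * norm (\<phi> t))"
proof -
  obtain C where C: "C > 0" "\<And>t. (1 + \<bar>t\<bar>) ^ (m + 2) * norm (\<phi> t) \<le> C" using Schwartz_decay[OF assms] by metis
  show ?thesis
  proof (rule Bochner_Integration.integrable_bound[OF integrable_mult_right[OF integrable_inverse_square, of C]])
    have "(1 + \<bar>t\<bar>) ^ m * norm (\<phi> t) \<le> C * inverse ((1 + \<bar>t\<bar>)\<^sup>2)" for t
    proof -
      have "(1 + \<bar>t\<bar>)\<^sup>2 > 0" by (simp add: add_pos_nonneg)
      moreover have "(1 + \<bar>t\<bar>) ^ m * norm (\<phi> t) * (1 + \<bar>t\<bar>)\<^sup>2 \<le> C"
        using C(2)[of t] by (simp add: power_add power2_eq_square mult_ac)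
      ultimately show ?thesis by (simp add: field_simps)
    qed
    then show "AE t in lborel. norm ((1 + \<bar>t\<bar>) ^ m * norm (\<phi> t)) \<le> norm (C * inverse ((1 + \<bar>t\<bar>)\<^sup>2))"
      using C(1) by (intro AE_I2) (auto simp: abs_mult intro: order_trans)
  qed (use assms in measurable)
qed

lemma Schwartz_integrable: "\<phi> \<in> Schwartz \<Longrightarrow> integrable lborel \<phi>"
  using integrable_Schwartz_weight[of \<phi> 0] by (simp add: integrable_norm_iff)

text \<open>The expression in the continuity bound of \<open>tempered\<close>, which then reads
  \<open>norm (u \<phi>) \<le> C * Schwartz_norm K \<phi>\<close>.\<close>

definition Schwartz_norm :: "nat \<Rightarrow> (real \<Rightarrow> complex) \<Rightarrow> real" where
  "Schwartz_norm K \<phi> = (\<Sum>m\<le>K. \<Sum>n\<le>K. Schwartz_seminorm m n \<phi>)"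

lemma Schwartz_seminorm_upper:
  assumes "\<phi> \<in> Schwartz"
  shows "\<bar>t\<bar> ^ m * norm (nth_deriv n \<phi> t) \<le> Schwartz_seminorm m n \<phi>"
  unfolding Schwartz_seminorm_def
proof (rule cSUP_upper)
  obtain C where "\<And>t. \<bar>t\<bar> ^ m * norm (nth_deriv n \<phi> t) \<le> C"
    using Schwartz_bounded[OF Schwartz_nth_deriv[OF assms]] by meson
  then show "bdd_above (range (\<lambda>t. \<bar>t\<bar> ^ m * norm (nth_deriv n \<phi> t)))" by (intro bdd_aboveI2)
qed simp

lemma Schwartz_seminorm_nonneg: "\<phi> \<in> Schwartz \<Longrightarrow> 0 \<le> Schwartz_seminorm m n \<phi>"
  by (rule order_trans[OF _ Schwartz_seminorm_upper[of _ 0]]) auto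

lemma Schwartz_seminorm_least:
  "(\<And>t. \<bar>t\<bar> ^ m * norm (nth_deriv n \<phi> t) \<le> C) \<Longrightarrow> Schwartz_seminorm m n \<phi> \<le> C"
  unfolding Schwartz_seminorm_def by (rule cSUP_least) auto

lemma Schwartz_seminorm_le_norm:
  assumes "\<phi> \<in> Schwartz" "m \<le> K" "n \<le> K"
  shows "Schwartz_seminorm m n \<phi> \<le> Schwartz_norm K \<phi>"
proof -
  have "Schwartz_seminorm m n \<phi> \<le> (\<Sum>n\<le>K. Schwartz_seminorm m n \<phi>)"
    using assms by (intro member_le_sum) (auto simp: Schwartz_seminorm_nonneg)
  also have "\<dots> \<le> Schwartz_norm K \<phi>"
    unfolding Schwartz_norm_def
    using assms by (intro member_le_sum[of _ _ "\<lambda>m. \<Sum>n\<le>K. Schwartz_seminorm m n \<phi>"])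
       (auto intro!: sum_nonneg Schwartz_seminorm_nonneg)
  finally show ?thesis .
qed

lemma Schwartz_norm_nonneg: "\<phi> \<in> Schwartz \<Longrightarrow> 0 \<le> Schwartz_norm K \<phi>"
  unfolding Schwartz_norm_def by (intro sum_nonneg Schwartz_seminorm_nonneg)

lemma Schwartz_norm_mono: "\<phi> \<in> Schwartz \<Longrightarrow> K \<le> L \<Longrightarrow> Schwartz_norm K \<phi> \<le> Schwartz_norm L \<phi>"
  unfolding Schwartz_norm_def
  by (intro order_trans[OF sum_mono[OF sum_mono2] sum_mono2] sum_nonneg Schwartz_seminorm_nonneg)
    (auto intro: sum_nonneg Schwartz_seminorm_nonneg)

lemma Schwartz_norm_deriv:
  assumes "\<phi> \<in> Schwartz"
  shows "Schwartz_norm K (nth_deriv (Suc 0) \<phi>) \<le> Schwartz_norm (Suc K) \<phi>"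
proof -
  have "Schwartz_seminorm m n (nth_deriv (Suc 0) \<phi>) = Schwartz_seminorm m (Suc n) \<phi>" for m n
    by (simp add: Schwartz_seminorm_def nth_deriv_Suc[of n])
  then have "Schwartz_norm K (nth_deriv (Suc 0) \<phi>) = (\<Sum>m\<le>K. \<Sum>n\<in>Suc ` {..K}. Schwartz_seminorm m n \<phi>)"
    by (simp add: Schwartz_norm_def sum.reindex)
  also have "\<dots> \<le> (\<Sum>m\<le>K. \<Sum>n\<le>Suc K. Schwartz_seminorm m n \<phi>)"
    by (intro sum_mono sum_mono2) (auto simp: Schwartz_seminorm_nonneg assms)
  also have "\<dots> \<le> Schwartz_norm (Suc K) \<phi>"
    unfolding Schwartz_norm_def
    by (intro sum_mono2) (auto intro!: add_nonneg_nonneg sum_nonneg Schwartz_seminorm_nonneg assms)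
  finally show ?thesis .
qed

text \<open>Unlike in \<open>Schwartz_decay\<close>, the constant is linear in a Schwartz norm of
  \<open>\<phi>\<close>; the continuity of synthesised distributions rests on this
  uniformity.\<close>

lemma Schwartz_norm_decay:
  assumes "\<phi> \<in> Schwartz"
  shows "(1 + \<bar>t\<bar>) ^ m * norm (\<phi> t) \<le> 2 ^ Suc m * Schwartz_norm m \<phi>"
proof -
  have "(1 + \<bar>t\<bar>) ^ m \<le> (2 * max 1 \<bar>t\<bar>) ^ m" by (intro power_mono) auto
  also have "\<dots> \<le> 2 ^ m * (1 + \<bar>t\<bar> ^ m)"
    by (auto simp: power_mult_distrib max_def)
  finally have "(1 + \<bar>t\<bar>) ^ m * norm (\<phi> t) \<le> 2 ^ m * (1 + \<bar>t\<bar> ^ m) * norm (\<phi> t)"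
    by (intro mult_right_mono) auto
  also have "\<dots> = 2 ^ m * (\<bar>t\<bar> ^ 0 * norm (nth_deriv 0 \<phi> t) + \<bar>t\<bar> ^ m * norm (nth_deriv 0 \<phi> t))"
    by (simp add: algebra_simps)
  also have "\<dots> \<le> 2 ^ m * (Schwartz_norm m \<phi> + Schwartz_norm m \<phi>)"
    by (intro mult_left_mono add_mono order_trans[OF Schwartz_seminorm_upper Schwartz_seminorm_le_norm] assms) auto
  finally show ?thesis by simp
qed

lemma tempered_bound:
  assumes "u \<in> tempered"
  obtains C K where "C \<ge> 0" "\<And>\<phi>. \<phi> \<in> Schwartz \<Longrightarrow> norm (u \<phi>) \<le> C * Schwartz_norm K \<phi>"
proof -
  obtain C K where "\<And>\<phi>. \<phi> \<in> Schwartz \<Longrightarrow> norm (u \<phi>) \<le> C * Schwartz_norm K \<phi>"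
    using assms unfolding tempered_def Schwartz_norm_def by blast
  then have "norm (u \<phi>) \<le> \<bar>C\<bar> * Schwartz_norm K \<phi>" if "\<phi> \<in> Schwartz" for \<phi>
    using that by (meson Schwartz_norm_nonneg abs_ge_self mult_right_mono order_trans)
  then show ?thesis by (intro that[of "\<bar>C\<bar>" K]) auto
qed

lemma tempered_add: "u \<in> tempered \<Longrightarrow> \<phi> \<in> Schwartz \<Longrightarrow> \<eta> \<in> Schwartz \<Longrightarrow> u (\<lambda>t. \<phi> t + \<eta> t) = u \<phi> + u \<eta>"
  by (simp add: tempered_def)

lemma tempered_scale: "u \<in> tempered \<Longrightarrow> \<phi> \<in> Schwartz \<Longrightarrow> u (\<lambda>t. c * \<phi> t) = c * u \<phi>"
  by (simp add: tempered_def)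

lemma tempered_diff: "u \<in> tempered \<Longrightarrow> \<phi> \<in> Schwartz \<Longrightarrow> \<eta> \<in> Schwartz \<Longrightarrow> u (\<lambda>t. \<phi> t - \<eta> t) = u \<phi> - u \<eta>"
  using tempered_add[OF _ _ Schwartz_scale[of \<eta> "-1"], of u \<phi>] tempered_scale[of u \<eta> "-1"] by simp

lemma tempered_sum:
  "u \<in> tempered \<Longrightarrow> (\<And>i. i \<in> I \<Longrightarrow> f i \<in> Schwartz) \<Longrightarrow> u (\<lambda>t. \<Sum>i\<in>I. f i t) = (\<Sum>i\<in>I. u (f i))"
proof (induction I rule: infinite_finite_induct)
  case (insert i I)
  then show ?case
    using tempered_add[of u "f i" "\<lambda>t. \<Sum>i\<in>I. f i t"] by (simp add: Schwartz_sum)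
qed (use tempered_scale[OF _ Schwartz_zero, of u 0] in auto)

section \<open>Superpositions of time-frequency shifts\<close>

text \<open>A product and not a function of the Euclidean norm, so that decay in time and in
  frequency can be proved one variable at a time and the integral of
  \<open>inverse (weight z ^ 2)\<close> factorises.\<close>

definition weight :: "real \<times> real \<Rightarrow> real" where
  "weight z = (1 + \<bar>fst z\<bar>) * (1 + \<bar>snd z\<bar>)"

text \<open>The frequency is negated because the pairing is conjugate linear: \<open>V\<^sub>\<psi>u(z)\<close> is \<open>u\<close> applied to the atom at
  \<open>z\<close> of the conjugate of \<open>\<psi>\<close>.\<close>

definition atom :: "(real \<Rightarrow> complex) \<Rightarrow> real \<times> real \<Rightarrow> real \<Rightarrow> complex" where
  "atom \<eta> z = modulate (- snd z) (translate (fst z) \<eta>)"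

lemma weight_ge_1: "1 \<le> weight z"
  using mult_mono[of 1 "1 + \<bar>fst z\<bar>" 1 "1 + \<bar>snd z\<bar>"] by (simp add: weight_def)

lemma weight_pos [simp]: "0 < weight z" "0 \<le> weight z" "weight z \<noteq> 0"
  using weight_ge_1[of z] by auto

lemma weight_measurable [measurable]: "weight \<in> borel_measurable borel"
proof -
  have "(\<lambda>z::real \<times> real. (1 + \<bar>fst z\<bar>) * (1 + \<bar>snd z\<bar>)) \<in> borel_measurable borel"
    by (intro borel_measurable_continuous_onI continuous_intros)
  then show ?thesis by (simp add: weight_def[abs_def])
qed

lemma abs_le_weight: "1 + \<bar>fst z\<bar> \<le> weight z" "1 + \<bar>snd z\<bar> \<le> weight z"
  using mult_mono[of "1 + \<bar>fst z\<bar>" "1 + \<bar>fst z\<bar>" 1 "1 + \<bar>snd z\<bar>"]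
    mult_mono[of 1 "1 + \<bar>fst z\<bar>" "1 + \<bar>snd z\<bar>" "1 + \<bar>snd z\<bar>"]
  by (simp_all add: weight_def)

lemma Schwartz_atom [simp]: "\<eta> \<in> Schwartz \<Longrightarrow> atom \<eta> z \<in> Schwartz"
  by (simp add: atom_def Schwartz_modulate Schwartz_translate)

lemma norm_atom [simp]: "norm (atom \<eta> z t) = norm (\<eta> (t - fst z))"
  by (simp add: atom_def translate_def)

text \<open>One derivative falls on the modulation and yields a frequency factor, or on the window
  and yields an atom of its derivative. The estimates below are inductions along this recursion; as
  it changes the window, they run over all windows at once.\<close>

lemma nth_deriv_atom:
  assumes "\<eta> \<in> Schwartz"
  shows "nth_deriv (Suc n) (atom \<eta> z) = (\<lambda>t. - (2 * of_real pi * \<i> * of_real (snd z)) * nth_deriv n (atom \<eta> z) t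
     + nth_deriv n (atom (nth_deriv (Suc 0) \<eta>) z) t)"
proof -
  note \<eta>' = Schwartz_nth_deriv[OF assms, of "Suc 0"]
  have "(translate (fst z) \<eta> has_vector_derivative translate (fst z) (nth_deriv (Suc 0) \<eta>) t) (at t)" for t
  proof -
    have "((\<eta> \<circ> (\<lambda>t. t - fst z)) has_vector_derivative (1 *\<^sub>R nth_deriv (Suc 0) \<eta> (t - fst z))) (at t)"
      by (rule vector_diff_chain_at) (auto intro!: derivative_eq_intros Schwartz_deriv assms)
    then show ?thesis by (simp add: translate_def o_def)
  qed
  note D = has_vector_derivative_modulate[OF this, of "- snd z"]
  have eq: "exp (2 * of_real pi * \<i> * of_real (- snd z) * of_real t) *
      (2 * of_real pi * \<i> * of_real (- snd z) * translate (fst z) \<eta> t + translate (fst z) (nth_deriv (Suc 0) \<eta>) t) =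
      - (2 * of_real pi * \<i> * of_real (snd z)) * atom \<eta> z t + atom (nth_deriv (Suc 0) \<eta>) z t" for t
  proof -
    have key: "x * (2 * p * \<i> * - w * f + d) = - (2 * p * \<i> * w) * (x * f) + x * d" for x p w f d :: complex
      by (simp add: algebra_simps)
    show ?thesis unfolding atom_def modulate_def of_real_minus by (rule key)
  qed
  have "(atom \<eta> z has_vector_derivative
      - (2 * of_real pi * \<i> * of_real (snd z)) * atom \<eta> z t + atom (nth_deriv (Suc 0) \<eta>) z t) (at t)" for t
    using D[of t] unfolding eq unfolding atom_def .
  then have "nth_deriv (Suc 0) (atom \<eta> z) =
      (\<lambda>t. - (2 * of_real pi * \<i> * of_real (snd z)) * atom \<eta> z t + atom (nth_deriv (Suc 0) \<eta>) z t)"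
    by (auto simp: nth_deriv_Suc' intro!: ext vector_derivative_at)
  then show ?thesis
    by (simp only: nth_deriv_Suc[of n] nth_deriv_add nth_deriv_scale Schwartz_scale Schwartz_atom assms \<eta>')
qed

text \<open>Used with \<open>d = 1\<close> for polynomial bounds and with a distance \<open>d\<close> for local Lipschitz estimates.\<close>

definition growth :: "('a \<Rightarrow> real) \<Rightarrow> ('a \<Rightarrow> real) \<Rightarrow> ('a \<Rightarrow> real) \<Rightarrow> bool" where
  "growth W d f \<longleftrightarrow> (\<exists>C\<ge>0. \<exists>L. \<forall>a. f a \<le> C * W a ^ L * d a)"

lemma growth_add:
  assumes f: "growth W d f" and g: "growth W d g" and W: "\<And>a. W a \<ge> 1" "\<And>a. d a \<ge> 0"
    and h: "\<And>a. h a \<le> f a + g a"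
  shows "growth W d h"
proof -
  obtain C L D M where C: "C \<ge> 0" "\<And>a. f a \<le> C * W a ^ L * d a" and D: "D \<ge> 0" "\<And>a. g a \<le> D * W a ^ M * d a"
    using f g by (auto simp: growth_def)
  have "h a \<le> (C + D) * W a ^ (L + M) * d a" for a
  proof -
    have p: "W a ^ L \<le> W a ^ (L + M)" "W a ^ M \<le> W a ^ (L + M)"
      using W(1) by (auto intro!: power_increasing)
    have "h a \<le> C * W a ^ L * d a + D * W a ^ M * d a" using h C D by (meson add_mono order_trans)
    also have "\<dots> \<le> C * W a ^ (L + M) * d a + D * W a ^ (L + M) * d a"
      using p C D W by (intro add_mono mult_right_mono mult_left_mono) auto
    finally show ?thesis by (simp add: algebra_simps)
  qed
  then show ?thesis unfolding growth_def using C(1) D(1) add_nonneg_nonneg by meson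
qed

lemma growth_mult:
  assumes f: "growth W d f" and g: "growth W (\<lambda>_. 1) g" and W: "\<And>a. W a \<ge> 1" "\<And>a. d a \<ge> 0"
    and h: "\<And>a. h a \<le> g a * f a" and nn: "\<And>a. g a \<ge> 0" "\<And>a. f a \<ge> 0"
  shows "growth W d h"
proof -
  obtain C L D M where C: "C \<ge> 0" "\<And>a. f a \<le> C * W a ^ L * d a" and D: "D \<ge> 0" "\<And>a. g a \<le> D * W a ^ M * 1"
    using f g by (auto simp: growth_def)
  have "h a \<le> (D * C) * W a ^ (M + L) * d a" for a
  proof -
    have "h a \<le> (D * W a ^ M * 1) * (C * W a ^ L * d a)"
      using W(1)[of a] by (intro order_trans[OF h] mult_mono C D nn mult_nonneg_nonneg) auto
    then show ?thesis by (simp add: power_add mult_ac)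
  qed
  then show ?thesis unfolding growth_def using mult_nonneg_nonneg[OF D(1) C(1)] by meson
qed

lemma growth_subst: "growth W d f \<Longrightarrow> growth (\<lambda>b. W (s b)) (\<lambda>b. d (s b)) (\<lambda>b. f (s b))"
  unfolding growth_def by meson

lemma growth_weight_mono:
  assumes "growth W d f" "\<And>a. W a \<le> V a" "\<And>a. W a \<ge> 1" "\<And>a. d a \<ge> 0"
  shows "growth V d f"
proof -
  obtain C L where C: "C \<ge> 0" "\<And>a. f a \<le> C * W a ^ L * d a" using assms by (auto simp: growth_def)
  have "f a \<le> C * V a ^ L * d a" for a
  proof -
    have "W a ^ L \<le> V a ^ L" using assms(2)[of a] assms(3)[of a] by (intro power_mono) auto
    then have "C * W a ^ L * d a \<le> C * V a ^ L * d a"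
      using C assms by (intro mult_right_mono mult_left_mono) auto
    then show ?thesis using C(2)[of a] by linarith
  qed
  then show ?thesis using C(1) unfolding growth_def by blast
qed

text \<open>An inequality of Peetre type: decay of a function around 0 becomes decay of its
  translate, at the cost of a power of \<open>1 + \<bar>s\<bar>\<close>.\<close>

lemma power_weight_shift: "\<bar>t\<bar> ^ m \<le> (1 + \<bar>s\<bar>) ^ m * (1 + \<bar>t - s\<bar>) ^ m" for t s :: real
proof -
  have "(1 + \<bar>s\<bar>) * (1 + \<bar>t - s\<bar>) = 1 + \<bar>s\<bar> + \<bar>t - s\<bar> + \<bar>s\<bar> * \<bar>t - s\<bar>" by algebra
  moreover have "\<bar>s\<bar> * \<bar>t - s\<bar> \<ge> 0" by simp
  ultimately have "\<bar>t\<bar> \<le> (1 + \<bar>s\<bar>) * (1 + \<bar>t - s\<bar>)" by linarith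
  then have "\<bar>t\<bar> ^ m \<le> ((1 + \<bar>s\<bar>) * (1 + \<bar>t - s\<bar>)) ^ m" by (intro power_mono) auto
  then show ?thesis by (simp add: power_mult_distrib)
qed

lemma atom_growth_0:
  assumes "\<eta> \<in> Schwartz"
  shows "growth (\<lambda>(z, t). weight z) (\<lambda>_. 1) (\<lambda>(z, t). \<bar>t\<bar> ^ m * norm (atom \<eta> z t))"
proof -
  obtain C where C: "C > 0" "\<And>t. (1 + \<bar>t\<bar>) ^ m * norm (\<eta> t) \<le> C" using Schwartz_decay[OF assms] by metis
  have "\<bar>t\<bar> ^ m * norm (atom \<eta> z t) \<le> C * weight z ^ m" for z t
  proof -
    have "\<bar>t\<bar> ^ m * norm (atom \<eta> z t) \<le> (1 + \<bar>fst z\<bar>) ^ m * ((1 + \<bar>t - fst z\<bar>) ^ m * norm (\<eta> (t - fst z)))"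
      using mult_right_mono[OF power_weight_shift[of t m "fst z"], of "norm (\<eta> (t - fst z))"]
      by (simp add: mult.assoc)
    also have "\<dots> \<le> weight z ^ m * C"
      using C abs_le_weight(1) by (intro mult_mono power_mono C) auto
    finally show ?thesis by (simp add: mult.commute)
  qed
  then show ?thesis unfolding growth_def using less_imp_le[OF C(1)] by (auto intro!: exI[of _ C] exI[of _ m])
qed

lemma growth_frequency:
  assumes "\<And>a. W a \<ge> 1 + \<bar>f a\<bar>"
  shows "growth W (\<lambda>_. 1) (\<lambda>a. norm (- (2 * of_real pi * \<i> * complex_of_real (f a))))"
  unfolding growth_def
proof (intro exI[of _ "2 * pi"] exI[of _ 1] conjI allI)
  fix a
  have "\<bar>f a\<bar> \<le> W a" using assms[of a] by simp
  then show "norm (- (2 * of_real pi * \<i> * complex_of_real (f a))) \<le> 2 * pi * W a ^ 1 * 1"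
    by (simp add: norm_mult)
qed simp

lemma atom_growth:
  assumes "\<eta> \<in> Schwartz"
  shows "growth (\<lambda>(z, t). weight z) (\<lambda>_. 1) (\<lambda>(z, t). \<bar>t\<bar> ^ m * norm (nth_deriv n (atom \<eta> z) t))"
  using assms
proof (induction n arbitrary: \<eta>)
  case 0
  then show ?case using atom_growth_0 by simp
next
  case (Suc n)
  have W: "(case a of (z, t) \<Rightarrow> weight z) \<ge> 1" for a :: "(real \<times> real) \<times> real"
    by (simp add: weight_ge_1 split: prod.split)
  note 1 = Suc.IH[OF Suc.prems] and 2 = Suc.IH[OF Schwartz_nth_deriv[OF Suc.prems, of "Suc 0"]]
  have f: "growth (\<lambda>(z, t::real). weight z) (\<lambda>_. 1) (\<lambda>a. norm (- (2 * of_real pi * \<i> * complex_of_real (snd (fst a)))))"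
    by (rule growth_frequency) (simp add: abs_le_weight split: prod.split)
  have 3: "growth (\<lambda>(z, t). weight z) (\<lambda>_. 1) (\<lambda>a. norm (- (2 * of_real pi * \<i> * complex_of_real (snd (fst a)))) *
      (case a of (z, t) \<Rightarrow> \<bar>t\<bar> ^ m * norm (nth_deriv n (atom \<eta> z) t)))"
    by (rule growth_mult[OF 1 f]) (auto simp: weight_ge_1)
  show ?case
  proof (rule growth_add[OF 3 2 W])
    fix a :: "(real \<times> real) \<times> real"
    obtain z t where a: "a = (z, t)" by (cases a) blast
    have "norm (nth_deriv (Suc n) (atom \<eta> z) t) \<le> norm (- (2 * of_real pi * \<i> * complex_of_real (snd z))) *
        norm (nth_deriv n (atom \<eta> z) t) + norm (nth_deriv n (atom (nth_deriv (Suc 0) \<eta>) z) t)"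
      unfolding nth_deriv_atom[OF Suc.prems] norm_mult[symmetric] by (rule norm_triangle_ineq)
    from mult_left_mono[OF this, of "\<bar>t\<bar> ^ m"]
    show "(case a of (z, t) \<Rightarrow> \<bar>t\<bar> ^ m * norm (nth_deriv (Suc n) (atom \<eta> z) t)) \<le>
       norm (- (2 * of_real pi * \<i> * complex_of_real (snd (fst a)))) *
         (case a of (z, t) \<Rightarrow> \<bar>t\<bar> ^ m * norm (nth_deriv n (atom \<eta> z) t)) +
       (case a of (z, t) \<Rightarrow> \<bar>t\<bar> ^ m * norm (nth_deriv n (atom (nth_deriv (Suc 0) \<eta>) z) t))"
      by (simp add: a algebra_simps)
  qed simp
qed

lemma norm_exp_diff_le: "norm (exp (\<i> * of_real a) - exp (\<i> * of_real b)) \<le> \<bar>a - b\<bar>"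
proof -
  have "norm (exp (\<i> * of_real a) - exp (\<i> * of_real b)) \<le> 1 * norm (a - b)"
  proof (rule differentiable_bound[of UNIV])
    fix x :: real
    have "((\<lambda>a. exp (\<i> * of_real a)) has_vector_derivative exp (\<i> * of_real x) * \<i>) (at x)"
      by (rule has_vector_derivative_real_field) (auto intro!: derivative_eq_intros)
    then show "((\<lambda>a. exp (\<i> * of_real a)) has_derivative (\<lambda>h. h *\<^sub>R (exp (\<i> * of_real x) * \<i>))) (at x within UNIV)"
      by (simp add: has_vector_derivative_def)
    show "onorm (\<lambda>h. h *\<^sub>R (exp (\<i> * complex_of_real x) * \<i>)) \<le> 1"
      by (rule onorm_bound) (auto simp: norm_mult)
  qed auto
  then show ?thesis by simp
qed

definition shift_dist :: "real \<times> real \<Rightarrow> real \<times> real \<Rightarrow> real" where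
  "shift_dist z z' = \<bar>fst z - fst z'\<bar> + \<bar>snd z - snd z'\<bar>"

text \<open>Position and frequency are moved separately. Moving the frequency varies the phase and
  costs a factor \<open>\<bar>t\<bar>\<close>, which is why decay of order \<open>Suc m\<close> is
  asked of the window.\<close>

lemma atom_Lipschitz_0:
  assumes "\<eta> \<in> Schwartz"
  shows "growth (\<lambda>(z, z', t). weight z * weight z') (\<lambda>(z, z', t). shift_dist z z')
     (\<lambda>(z, z', t). \<bar>t\<bar> ^ m * norm (atom \<eta> z t - atom \<eta> z' t))"
proof -
  obtain C where C: "C > 0" "\<And>t. (1 + \<bar>t\<bar>) ^ m * norm (nth_deriv (Suc 0) \<eta> t) \<le> C"
    using Schwartz_decay[OF Schwartz_nth_deriv[OF assms]] by metis
  obtain D where D: "D > 0" "\<And>t. (1 + \<bar>t\<bar>) ^ Suc m * norm (\<eta> t) \<le> D"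
    using Schwartz_decay[OF assms] by metis
  \<comment> \<open>The factor \<open>\<bar>t\<bar> ^ m\<close> stays inside the mean value
    estimate: along the segment from \<open>x\<close> to \<open>x'\<close> the decay of the
    derivative absorbs it, up to the two position weights.\<close>
  have 1: "\<bar>t\<bar> ^ m * norm (\<eta> (t - x) - \<eta> (t - x')) \<le> (1 + \<bar>x\<bar>) ^ m * (1 + \<bar>x'\<bar>) ^ m * C * \<bar>x - x'\<bar>" for t x x'
  proof -
    define B where "B = (1 + \<bar>x\<bar>) ^ m * (1 + \<bar>x'\<bar>) ^ m * C"
    have "norm ((\<bar>t\<bar> ^ m) *\<^sub>R \<eta> (t - x) - (\<bar>t\<bar> ^ m) *\<^sub>R \<eta> (t - x')) \<le> B * norm (x - x')"
    proof (rule differentiable_bound[of "closed_segment x x'"])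
      fix s assume s: "s \<in> closed_segment x x'"
      have "((\<eta> \<circ> (\<lambda>s. t - s)) has_vector_derivative ((-1) *\<^sub>R nth_deriv (Suc 0) \<eta> (t - s))) (at s)"
        by (rule vector_diff_chain_at) (auto intro!: derivative_eq_intros Schwartz_deriv assms)
      then have "((\<lambda>s. (\<bar>t\<bar> ^ m) *\<^sub>R \<eta> (t - s)) has_derivative (\<lambda>h. (\<bar>t\<bar> ^ m) *\<^sub>R (h *\<^sub>R ((-1) *\<^sub>R nth_deriv (Suc 0) \<eta> (t - s))))) (at s)"
        unfolding has_vector_derivative_def o_def by (rule has_derivative_scaleR_right)
      then show "((\<lambda>s. (\<bar>t\<bar> ^ m) *\<^sub>R \<eta> (t - s)) has_derivative (\<lambda>h. (\<bar>t\<bar> ^ m) *\<^sub>R (h *\<^sub>R ((-1) *\<^sub>R nth_deriv (Suc 0) \<eta> (t - s)))))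
        (at s within closed_segment x x')"
        by (rule has_derivative_at_withinI)
      have "\<bar>s\<bar> \<le> max \<bar>x\<bar> \<bar>x'\<bar>"
        using s by (auto simp: closed_segment_eq_real_ivl max_def split: if_splits)
      then have s': "(1 + \<bar>s\<bar>) ^ m \<le> (1 + \<bar>x\<bar>) ^ m * (1 + \<bar>x'\<bar>) ^ m"
      proof -
        have "1 + \<bar>s\<bar> \<le> (1 + \<bar>x\<bar>) * (1 + \<bar>x'\<bar>)"
        proof -
          have "(1 + \<bar>x\<bar>) * (1 + \<bar>x'\<bar>) = 1 + \<bar>x\<bar> + \<bar>x'\<bar> + \<bar>x\<bar> * \<bar>x'\<bar>" by algebra
          moreover have "\<bar>x\<bar> * \<bar>x'\<bar> \<ge> 0" by simp
          ultimately show ?thesis using \<open>\<bar>s\<bar> \<le> max \<bar>x\<bar> \<bar>x'\<bar>\<close> abs_ge_zero[of x] abs_ge_zero[of x'] by linarith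
        qed
        from power_mono[OF this, of m] show ?thesis by (simp add: power_mult_distrib)
      qed
      have "\<bar>t\<bar> ^ m * norm (nth_deriv (Suc 0) \<eta> (t - s)) \<le> (1 + \<bar>s\<bar>) ^ m * ((1 + \<bar>t - s\<bar>) ^ m * norm (nth_deriv (Suc 0) \<eta> (t - s)))"
        using mult_right_mono[OF power_weight_shift[of t m s], of "norm (nth_deriv (Suc 0) \<eta> (t - s))"]
        by (simp add: mult.assoc)
      also have "\<dots> \<le> B"
        unfolding B_def by (rule mult_mono[OF s' C(2)]) auto
      finally have B: "\<bar>t\<bar> ^ m * norm (nth_deriv (Suc 0) \<eta> (t - s)) \<le> B" .
      show "onorm (\<lambda>h. (\<bar>t\<bar> ^ m) *\<^sub>R (h *\<^sub>R ((-1) *\<^sub>R nth_deriv (Suc 0) \<eta> (t - s)))) \<le> B"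
      proof (rule onorm_bound)
        show "0 \<le> B" using C(1) by (simp add: B_def)
        fix h :: real
        from mult_right_mono[OF B, of "\<bar>h\<bar>"]
        show "norm ((\<bar>t\<bar> ^ m) *\<^sub>R (h *\<^sub>R ((-1) *\<^sub>R nth_deriv (Suc 0) \<eta> (t - s)))) \<le> B * norm h"
          by (simp add: mult_ac power_abs abs_mult)
      qed
    qed (auto)
    then show ?thesis by (simp add: B_def power_abs flip: scaleR_diff_right)
  qed
  define c where "c = (\<lambda>w t. exp (\<i> * of_real (- (2 * pi * w * t))))"
  have atom: "atom \<eta> z t = c (snd z) t * \<eta> (t - fst z)" for z t
    by (simp add: atom_def modulate_def translate_def c_def mult_ac)
  have nc: "norm (c w t) = 1" for w t unfolding c_def by (rule norm_exp_i_times)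
  have 2: "\<bar>t\<bar> ^ m * norm ((c w t - c w' t) * \<eta> (t - x')) \<le> 2 * pi * \<bar>w - w'\<bar> * ((1 + \<bar>x'\<bar>) ^ Suc m * D)" for t w w' x'
  proof -
    have "norm (c w t - c w' t) \<le> \<bar>- (2 * pi * w * t) - - (2 * pi * w' * t)\<bar>"
      unfolding c_def by (rule norm_exp_diff_le)
    also have "- (2 * pi * w * t) - - (2 * pi * w' * t) = 2 * pi * (w' - w) * t" by algebra
    also have "\<bar>2 * pi * (w' - w) * t\<bar> = 2 * pi * \<bar>w - w'\<bar> * \<bar>t\<bar>"
      by (simp add: abs_mult abs_minus_commute)
    finally have "\<bar>t\<bar> ^ m * norm ((c w t - c w' t) * \<eta> (t - x')) \<le> \<bar>t\<bar> ^ m * ((2 * pi * \<bar>w - w'\<bar> * \<bar>t\<bar>) * norm (\<eta> (t - x')))"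
      unfolding norm_mult by (intro mult_left_mono mult_right_mono) auto
    also have "\<dots> = 2 * pi * \<bar>w - w'\<bar> * (\<bar>t\<bar> ^ Suc m * norm (\<eta> (t - x')))" by (simp add: mult_ac)
    also have "\<dots> \<le> 2 * pi * \<bar>w - w'\<bar> * ((1 + \<bar>x'\<bar>) ^ Suc m * ((1 + \<bar>t - x'\<bar>) ^ Suc m * norm (\<eta> (t - x'))))"
      unfolding mult.assoc[of "(1 + \<bar>x'\<bar>) ^ Suc m", symmetric]
      by (intro mult_left_mono mult_right_mono power_weight_shift) auto
    also have "\<dots> \<le> 2 * pi * \<bar>w - w'\<bar> * ((1 + \<bar>x'\<bar>) ^ Suc m * D)"
      by (intro mult_left_mono D) auto
    finally show ?thesis .
  qed
  have "\<bar>t\<bar> ^ m * norm (atom \<eta> z t - atom \<eta> z' t) \<le> (C + 2 * pi * D) * (weight z * weight z') ^ Suc m * shift_dist z z'" for z z' t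
  proof -
    let ?W = "(weight z * weight z') ^ Suc m"
    have W1: "1 \<le> weight z * weight z'" using mult_mono[OF weight_ge_1[of z] weight_ge_1[of z']] by simp
    have Wm: "(weight z * weight z') ^ m \<le> ?W" using W1 by (intro power_increasing) auto
    have "atom \<eta> z t - atom \<eta> z' t = c (snd z) t * (\<eta> (t - fst z) - \<eta> (t - fst z')) + (c (snd z) t - c (snd z') t) * \<eta> (t - fst z')"
      by (simp add: atom algebra_simps)
    then have "norm (atom \<eta> z t - atom \<eta> z' t) \<le> norm (\<eta> (t - fst z) - \<eta> (t - fst z')) + norm ((c (snd z) t - c (snd z') t) * \<eta> (t - fst z'))"
      by (metis norm_triangle_ineq norm_mult nc mult_1)
    then have "\<bar>t\<bar> ^ m * norm (atom \<eta> z t - atom \<eta> z' t) \<le> \<bar>t\<bar> ^ m * (norm (\<eta> (t - fst z) - \<eta> (t - fst z')) + norm ((c (snd z) t - c (snd z') t) * \<eta> (t - fst z')))"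
      by (intro mult_left_mono) auto
    also have "\<dots> \<le> (1 + \<bar>fst z\<bar>) ^ m * (1 + \<bar>fst z'\<bar>) ^ m * C * \<bar>fst z - fst z'\<bar> + 2 * pi * \<bar>snd z - snd z'\<bar> * ((1 + \<bar>fst z'\<bar>) ^ Suc m * D)"
      unfolding distrib_left by (intro add_mono 1 2)
    also have "\<dots> \<le> (weight z ^ m * weight z' ^ m) * C * \<bar>fst z - fst z'\<bar> + 2 * pi * \<bar>snd z - snd z'\<bar> * (?W * D)"
    proof -
      have "(1 + \<bar>fst z'\<bar>) \<le> weight z * weight z'"
        using mult_mono[OF weight_ge_1[of z] abs_le_weight(1)[of z']] by simp
      then have A: "(1 + \<bar>fst z'\<bar>) ^ Suc m \<le> ?W" by (rule power_mono) simp
      have B: "(1 + \<bar>fst z\<bar>) ^ m * (1 + \<bar>fst z'\<bar>) ^ m \<le> weight z ^ m * weight z' ^ m"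
        by (intro mult_mono power_mono abs_le_weight) auto
      show ?thesis
        using C(1) D(1) by (intro add_mono mult_right_mono[OF mult_right_mono[OF B]] mult_left_mono[OF mult_right_mono[OF A]]) auto
    qed
    also have "\<dots> \<le> ?W * C * shift_dist z z' + 2 * pi * shift_dist z z' * (?W * D)"
      using Wm C D W1 by (intro add_mono mult_mono mult_right_mono mult_left_mono)
        (auto simp: shift_dist_def power_mult_distrib)
    finally show ?thesis by (simp add: algebra_simps)
  qed
  moreover have "C + 2 * pi * D \<ge> 0" using C(1) D(1) by (simp add: add_nonneg_nonneg)
  ultimately show ?thesis unfolding growth_def by (intro exI[of _ "C + 2 * pi * D"] conjI exI[of _ "Suc m"] allI) auto
qed

lemma atom_Lipschitz:
  assumes "\<eta> \<in> Schwartz"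
  shows "growth (\<lambda>(z, z', t). weight z * weight z') (\<lambda>(z, z', t). shift_dist z z')
     (\<lambda>(z, z', t). \<bar>t\<bar> ^ m * norm (nth_deriv n (atom \<eta> z) t - nth_deriv n (atom \<eta> z') t))"
  using assms
proof (induction n arbitrary: \<eta>)
  case 0
  then show ?case using atom_Lipschitz_0 by simp
next
  case (Suc n)
  let ?W = "\<lambda>(z, z', t::real). weight z * weight z'" and ?d = "\<lambda>(z, z', t::real). shift_dist z z'"
  let ?c = "\<lambda>w. - (2 * of_real pi * \<i> * complex_of_real w)"
  have W: "?W a \<ge> 1" for a
    using mult_mono[OF weight_ge_1 weight_ge_1] by (auto split: prod.split)
  have W2: "weight z' \<le> weight z * weight z'" "weight z \<le> weight z * weight z'" for z z'
    using mult_mono[OF weight_ge_1[of z], of "weight z'" "weight z'"]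
      mult_mono[OF _ weight_ge_1[of z'], of "weight z" "weight z"] by auto
  have d: "?d a \<ge> 0" for a by (auto simp: shift_dist_def split: prod.split)
  note 1 = Suc.IH[OF Suc.prems] and 2 = Suc.IH[OF Schwartz_nth_deriv[OF Suc.prems, of "Suc 0"]]
  have f: "growth ?W (\<lambda>_. 1) (\<lambda>a. norm (?c (snd (fst a))))"
    by (rule growth_frequency) (auto split: prod.split intro: order_trans[OF _ W2(2)] simp: abs_le_weight(2)[of "(_, _)", simplified])
  have 3: "growth ?W ?d (\<lambda>a. norm (?c (snd (fst a))) *
      (case a of (z, z', t) \<Rightarrow> \<bar>t\<bar> ^ m * norm (nth_deriv n (atom \<eta> z) t - nth_deriv n (atom \<eta> z') t)))"
    by (rule growth_mult[OF 1 f W d]) auto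
  have "growth (\<lambda>(z, z', t::real). weight z') (\<lambda>_. 1) (\<lambda>(z::real \<times> real, z', t). \<bar>t\<bar> ^ m * norm (nth_deriv n (atom \<eta> z') t))"
    using growth_subst[OF atom_growth[OF Suc.prems, of m n], of snd] by (simp add: case_prod_unfold)
  then have 4: "growth ?W (\<lambda>_. 1) (\<lambda>(z::real \<times> real, z', t). \<bar>t\<bar> ^ m * norm (nth_deriv n (atom \<eta> z') t))"
    by (rule growth_weight_mono) (auto simp: W2 weight_ge_1)
  have 5: "growth ?W ?d (\<lambda>(z, z', t). norm (?c (snd z - snd z')))"
    unfolding growth_def
    by (intro exI[of _ "2 * pi"] conjI exI[of _ 0] allI) (auto simp: norm_mult shift_dist_def simp flip: of_real_diff)
  have 6: "growth ?W ?d (\<lambda>a. (case a of (z, z', t) \<Rightarrow> \<bar>t\<bar> ^ m * norm (nth_deriv n (atom \<eta> z') t)) * (case a of (z, z', t) \<Rightarrow> norm (?c (snd z - snd z'))))"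
    by (rule growth_mult[OF 5 4 W d]) auto
  have 7: "growth ?W ?d (\<lambda>a. (case a of (z, z', t) \<Rightarrow> \<bar>t\<bar> ^ m * norm (nth_deriv n (atom \<eta> z') t)) * (case a of (z, z', t) \<Rightarrow> norm (?c (snd z - snd z'))) +
      norm (?c (snd (fst a))) * (case a of (z, z', t) \<Rightarrow> \<bar>t\<bar> ^ m * norm (nth_deriv n (atom \<eta> z) t - nth_deriv n (atom \<eta> z') t)))"
    by (rule growth_add[OF 6 3 W d]) simp
  show ?case
  proof (rule growth_add[OF 7 2 W d])
    fix a :: "(real \<times> real) \<times> (real \<times> real) \<times> real"
    obtain z z' t where a: "a = (z, z', t)" by (metis prod_cases3)
    let ?D = "\<lambda>z. nth_deriv n (atom \<eta> z) t" and ?E = "\<lambda>z. nth_deriv n (atom (nth_deriv (Suc 0) \<eta>) z) t"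
    \<comment> \<open>Difference of products: the frequency is varied with the derivative frozen at
      \<open>z'\<close>, then the derivative is varied with the frequency frozen at
      \<open>z\<close>.\<close>
    have "nth_deriv (Suc n) (atom \<eta> z) t - nth_deriv (Suc n) (atom \<eta> z') t =
        ?c (snd z - snd z') * ?D z' + ?c (snd z) * (?D z - ?D z') + (?E z - ?E z')"
      unfolding nth_deriv_atom[OF Suc.prems] of_real_diff by algebra
    then have "norm (nth_deriv (Suc n) (atom \<eta> z) t - nth_deriv (Suc n) (atom \<eta> z') t) \<le>
        norm (?c (snd z - snd z')) * norm (?D z') + norm (?c (snd z)) * norm (?D z - ?D z') + norm (?E z - ?E z')"
      by (metis (no_types) norm_add_rule_thm norm_mult norm_triangle_mono order_refl norm_triangle_ineq)
    from mult_left_mono[OF this zero_le_power[OF abs_ge_zero[of t]], of m]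
    show "(case a of (z, z', t) \<Rightarrow> \<bar>t\<bar> ^ m * norm (nth_deriv (Suc n) (atom \<eta> z) t - nth_deriv (Suc n) (atom \<eta> z') t)) \<le>
      ((case a of (z, z', t) \<Rightarrow> \<bar>t\<bar> ^ m * norm (nth_deriv n (atom \<eta> z') t)) * (case a of (z, z', t) \<Rightarrow> norm (?c (snd z - snd z'))) +
      norm (?c (snd (fst a))) * (case a of (z, z', t) \<Rightarrow> \<bar>t\<bar> ^ m * norm (nth_deriv n (atom \<eta> z) t - nth_deriv n (atom \<eta> z') t))) +
      (case a of (z, z', t) \<Rightarrow> \<bar>t\<bar> ^ m * norm (nth_deriv n (atom (nth_deriv (Suc 0) \<eta>) z) t - nth_deriv n (atom (nth_deriv (Suc 0) \<eta>) z') t))"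
      unfolding a prod.case fst_conv by (simp only: distrib_left mult_ac)
  qed
qed

lemma Schwartz_norm_growth:
  assumes "\<And>m n. \<exists>C\<ge>0. \<exists>L. \<forall>a t. \<bar>t\<bar> ^ m * norm (nth_deriv n (f a) t) \<le> C * W a ^ L * d a"
    and W: "\<And>a. (1::real) \<le> W a" and d: "\<And>a. 0 \<le> d a"
  shows "growth W d (\<lambda>a. Schwartz_norm K (f a))"
proof -
  have 1: "growth W d (\<lambda>a. Schwartz_seminorm m n (f a))" for m n
    using assms(1)[of m n] unfolding growth_def by (meson Schwartz_seminorm_least)
  have zero: "growth W d (\<lambda>a. 0)" unfolding growth_def by (intro exI[of _ 0]) auto
  have sum: "growth W d (\<lambda>a. \<Sum>i\<in>I. g i a)" if "finite I" "\<And>i. growth W d (g i)" for I :: "nat set" and g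
    using that(1)
  proof (induction I rule: finite_induct)
    case (insert i I)
    then show ?case by (intro growth_add[OF that(2)[of i] insert.IH W d]) simp
  qed (simp add: zero)
  show ?thesis unfolding Schwartz_norm_def by (intro sum finite_atMost 1)
qed

lemma Schwartz_norm_atom:
  assumes "\<eta> \<in> Schwartz"
  obtains C L where "C \<ge> 0" "\<And>z. Schwartz_norm K (atom \<eta> z) \<le> C * weight z ^ L"
proof -
  have "growth weight (\<lambda>_. 1) (\<lambda>z. Schwartz_norm K (atom \<eta> z))"
  proof (rule Schwartz_norm_growth)
    fix m n
    show "\<exists>C\<ge>0. \<exists>L. \<forall>z t. \<bar>t\<bar> ^ m * norm (nth_deriv n (atom \<eta> z) t) \<le> C * weight z ^ L * 1"
      using atom_growth[OF assms, of m n] by (auto simp: growth_def)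
  qed (auto simp: weight_ge_1)
  then show ?thesis using that by (auto simp: growth_def)
qed

lemma Schwartz_norm_atom_diff:
  assumes "\<eta> \<in> Schwartz"
  obtains C L where "C \<ge> 0"
    "\<And>z z'. Schwartz_norm K (\<lambda>t. atom \<eta> z t - atom \<eta> z' t) \<le> C * (weight z * weight z') ^ L * shift_dist z z'"
proof -
  have "growth (\<lambda>(z, z'). weight z * weight z') (\<lambda>(z, z'). shift_dist z z')
     (\<lambda>a. Schwartz_norm K (case a of (z, z') \<Rightarrow> \<lambda>t. atom \<eta> z t - atom \<eta> z' t))"
  proof (rule Schwartz_norm_growth)
    fix m n
    show "\<exists>C\<ge>0. \<exists>L. \<forall>a t. \<bar>t\<bar> ^ m * norm (nth_deriv n (case a of (z, z') \<Rightarrow> \<lambda>t. atom \<eta> z t - atom \<eta> z' t) t)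
       \<le> C * (case a of (z, z') \<Rightarrow> weight z * weight z') ^ L * (case a of (z, z') \<Rightarrow> shift_dist z z')"
      using atom_Lipschitz[OF assms, of m n] assms by (auto simp: growth_def nth_deriv_diff)
  next
    show "(1::real) \<le> (case a of (z, z') \<Rightarrow> weight z * weight z')" for a
      using mult_mono[OF weight_ge_1 weight_ge_1] by (auto split: prod.split)
  qed (auto simp: shift_dist_def split: prod.split)
  then show ?thesis using that by (auto simp: growth_def)
qed

text \<open>Dominated convergence of the difference quotients. The bound \<open>B\<close> on the
  derivative also bounds the increments by the mean value inequality, so quotient minus derivative
  is at most \<open>2 * B\<close>.\<close>

lemma has_vector_derivative_integral:
  fixes A :: "'z \<Rightarrow> real \<Rightarrow> complex"
  assumes D: "\<And>z t. (A z has_vector_derivative A' z t) (at t)"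
    and A: "\<And>t. integrable M (\<lambda>z. A z t)"
    and B: "\<And>z t. norm (A' z t) \<le> B z" "integrable M B"
    and [measurable]: "\<And>t. (\<lambda>z. A' z t) \<in> borel_measurable M"
  shows "((\<lambda>t. \<integral>z. A z t \<partial>M) has_vector_derivative (\<integral>z. A' z t \<partial>M)) (at t)"
proof -
  have A': "integrable M (\<lambda>z. A' z t)" for t
    by (rule Bochner_Integration.integrable_bound[OF B(2)]) (auto intro: order_trans[OF B(1) abs_ge_self])
  have lip: "norm (A z s - A z t) \<le> B z * \<bar>s - t\<bar>" for z s
  proof -
    have "norm (A z s - A z t) \<le> B z * norm (s - t)"
    proof (rule differentiable_bound[of UNIV])
      fix x
      show "(A z has_derivative (\<lambda>h. h *\<^sub>R A' z x)) (at x within UNIV)"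
        using D[of z x] by (simp add: has_vector_derivative_def)
      show "onorm (\<lambda>h. h *\<^sub>R A' z x) \<le> B z"
        using B(1)[of z x] order_trans[OF norm_ge_zero B(1)[of z x]]
        by (intro onorm_bound) (auto simp: mult.commute[of "B z"] mult_left_mono)
    qed auto
    then show ?thesis by simp
  qed
  let ?Q = "\<lambda>h z. (A z (t + h) - A z t - h *\<^sub>R A' z t) /\<^sub>R \<bar>h\<bar>"
  have "(\<lambda>h. norm ((\<integral>z. A z (t + h) \<partial>M) - (\<integral>z. A z t \<partial>M) - h *\<^sub>R (\<integral>z. A' z t \<partial>M)) / norm h) \<midarrow>0\<rightarrow> 0"
    unfolding tendsto_at_iff_sequentially
  proof (intro allI impI)
    fix X :: "nat \<Rightarrow> real" assume "\<forall>i. X i \<in> UNIV - {0}" and X: "X \<longlonglongrightarrow> 0"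
    then have X0: "X i \<noteq> 0" for i by simp
    have eq: "norm ((\<integral>z. A z (t + h) \<partial>M) - (\<integral>z. A z t \<partial>M) - h *\<^sub>R (\<integral>z. A' z t \<partial>M)) / norm h =
        norm (\<integral>z. ?Q h z \<partial>M)" for h
      by (simp add: A A' divide_inverse mult.commute)
    have "(\<lambda>i. \<integral>z. ?Q (X i) z \<partial>M) \<longlonglongrightarrow> (\<integral>z. 0 \<partial>M)"
    proof (rule integral_dominated_convergence[where w = "\<lambda>z. 2 * B z"])
      show "AE z in M. (\<lambda>i. ?Q (X i) z) \<longlonglongrightarrow> 0"
      proof (rule AE_I2)
        fix z
        have "(\<lambda>h. norm (A z (t + h) - A z t - h *\<^sub>R A' z t) / norm h) \<midarrow>0\<rightarrow> 0"
          using D[of z t] by (simp add: has_vector_derivative_def has_derivative_at)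
        then have "((\<lambda>h. norm (A z (t + h) - A z t - h *\<^sub>R A' z t) / norm h) \<circ> X) \<longlonglongrightarrow> 0"
          using X X0 by (auto simp: tendsto_at_iff_sequentially)
        then have "(\<lambda>i. norm (?Q (X i) z)) \<longlonglongrightarrow> 0"
          by (simp add: o_def divide_inverse mult.commute)
        then show "(\<lambda>i. ?Q (X i) z) \<longlonglongrightarrow> 0" by (rule tendsto_norm_zero_cancel)
      qed
      show "AE z in M. norm (?Q (X i) z) \<le> 2 * B z" for i
      proof (rule AE_I2)
        fix z
        have "norm (A z (t + X i) - A z t - X i *\<^sub>R A' z t) \<le> norm (A z (t + X i) - A z t) + norm (X i *\<^sub>R A' z t)"
          by (rule norm_triangle_ineq4)
        also have "\<dots> \<le> B z * \<bar>X i\<bar> + \<bar>X i\<bar> * B z"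
          using lip[of z "t + X i"] B(1)[of z t] by (intro add_mono) (auto intro: mult_left_mono)
        finally have "norm (A z (t + X i) - A z t - X i *\<^sub>R A' z t) / \<bar>X i\<bar> \<le> 2 * B z"
          using X0[of i] by (simp add: divide_le_eq algebra_simps)
        moreover have "norm (v /\<^sub>R \<bar>X i\<bar>) = norm v / \<bar>X i\<bar>" for v :: complex
          by (simp add: divide_inverse mult.commute)
        ultimately show "norm (?Q (X i) z) \<le> 2 * B z" by simp
      qed
    qed (use A A' B in \<open>auto intro!: borel_measurable_integrable\<close>)
    then show "((\<lambda>h. norm ((\<integral>z. A z (t + h) \<partial>M) - (\<integral>z. A z t \<partial>M) - h *\<^sub>R (\<integral>z. A' z t \<partial>M)) / norm h) \<circ> X) \<longlonglongrightarrow> 0"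
      unfolding eq o_def Bochner_Integration.integral_zero by (rule tendsto_norm_zero)
  qed
  then show ?thesis
    unfolding has_vector_derivative_def has_derivative_at by (simp add: bounded_linear_scaleR_left)
qed

lemma nth_deriv_sum:
  "finite I \<Longrightarrow> (\<And>i. i \<in> I \<Longrightarrow> f i \<in> Schwartz) \<Longrightarrow>
   nth_deriv n (\<lambda>t. \<Sum>i\<in>I. f i t) = (\<lambda>t. \<Sum>i\<in>I. nth_deriv n (f i) t)"
proof (induction I rule: finite_induct)
  case empty
  have "nth_deriv n (\<lambda>t. 0 * 0) = (\<lambda>t. 0 * nth_deriv n (\<lambda>_. 0) t)"
    by (rule nth_deriv_scale) (rule Schwartz_zero)
  then show ?case by simp
next
  case (insert i I)
  then show ?case by (simp add: nth_deriv_add Schwartz_sum)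
qed

lemma nth_deriv_atom_measurable:
  "\<eta> \<in> Schwartz \<Longrightarrow> (\<lambda>z. nth_deriv n (atom \<eta> z) t) \<in> borel_measurable borel"
proof (induction n arbitrary: \<eta>)
  case 0
  have "continuous_on UNIV (\<lambda>z. \<eta> (t - fst z))"
    by (rule continuous_on_compose2[OF Schwartz_continuous[OF 0, of UNIV]]) (auto intro!: continuous_intros)
  then show ?case
    unfolding atom_def modulate_def translate_def nth_deriv_0
    by (intro borel_measurable_continuous_onI continuous_intros)
next
  case (Suc n)
  have "(\<lambda>z::real \<times> real. - (2 * complex_of_real pi * \<i> * of_real (snd z))) \<in> borel_measurable borel"
    by (intro borel_measurable_continuous_onI continuous_intros)
  with Suc.IH[OF Suc.prems] Suc.IH[OF Schwartz_nth_deriv[OF Suc.prems, of "Suc 0"]] show ?case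
    unfolding nth_deriv_atom[OF Suc.prems] by (intro borel_measurable_add borel_measurable_times)
qed

text \<open>The atoms are locally Lipschitz in the Schwartz norm that controls \<open>u\<close>.
  Consequently every short-time Fourier transform is continuous.\<close>

lemma isCont_tempered_atom:
  assumes u: "u \<in> tempered" and \<eta>: "\<eta> \<in> Schwartz"
  shows "isCont (\<lambda>z. u (atom \<eta> z)) z0"
proof -
  obtain C K where C: "C \<ge> 0" "\<And>\<phi>. \<phi> \<in> Schwartz \<Longrightarrow> norm (u \<phi>) \<le> C * Schwartz_norm K \<phi>"
    using tempered_bound[OF u] by metis
  obtain D L where D: "D \<ge> 0"
    "\<And>z z'. Schwartz_norm K (\<lambda>t. atom \<eta> z t - atom \<eta> z' t) \<le> D * (weight z * weight z') ^ L * shift_dist z z'"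
    using Schwartz_norm_atom_diff[OF \<eta>] by metis
  have bd: "norm (u (atom \<eta> z) - u (atom \<eta> z0)) \<le> C * (D * (weight z * weight z0) ^ L * shift_dist z z0)" for z
    using C(2)[OF Schwartz_diff, of "atom \<eta> z" "atom \<eta> z0"] mult_left_mono[OF D(2) C(1), of z z0]
      tempered_diff[OF u, of "atom \<eta> z" "atom \<eta> z0"] \<eta> by auto
  have "((\<lambda>z. C * (D * (weight z * weight z0) ^ L * shift_dist z z0)) \<longlongrightarrow>
      C * (D * (weight z0 * weight z0) ^ L * shift_dist z0 z0)) (at z0)"
    unfolding weight_def shift_dist_def by (intro tendsto_intros)
  then have "((\<lambda>z. C * (D * (weight z * weight z0) ^ L * shift_dist z z0)) \<longlongrightarrow> 0) (at z0)"
    by (simp add: shift_dist_def)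
  then have "((\<lambda>z. u (atom \<eta> z) - u (atom \<eta> z0)) \<longlongrightarrow> 0) (at z0)"
    by (rule Lim_null_comparison[rotated]) (use bd in auto)
  then show ?thesis by (simp add: isCont_def LIM_zero_cancel)
qed

lemma continuous_tempered_atom:
  "u \<in> tempered \<Longrightarrow> \<eta> \<in> Schwartz \<Longrightarrow> continuous_on S (\<lambda>z. u (atom \<eta> z))"
  by (simp add: continuous_at_imp_continuous_on isCont_tempered_atom)

lemma measurable_tempered_atom:
  "u \<in> tempered \<Longrightarrow> \<eta> \<in> Schwartz \<Longrightarrow> (\<lambda>z. u (atom \<eta> z)) \<in> borel_measurable borel"
  by (intro borel_measurable_continuous_onI continuous_tempered_atom)

text \<open>When the argument of \<open>h\<close> runs through finitely many values, the integral is
  a finite combination of values of \<open>h\<close>, through which a linear functional can be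
  moved. The coefficients are integrals of \<open>F\<close> over level sets.\<close>

lemma integral_simple_subst:
  fixes F :: "'z \<Rightarrow> complex" and h :: "'z \<Rightarrow> complex"
  assumes s: "simple_function M s" and F: "integrable M F" and sp: "space M = UNIV"
  shows "integrable M (\<lambda>z. F z * h (s z))"
    and "(\<integral>z. F z * h (s z) \<partial>M) = (\<Sum>y\<in>range s. h y * (\<integral>z. indicator (s -` {y}) z *\<^sub>R F z \<partial>M))"
proof -
  have fin: "finite (range s)" using simple_functionD(1)[OF s] sp by simp
  have m: "s -` {y} \<in> sets M" for y using simple_functionD(2)[OF s, of "{y}"] sp by simp
  have i: "integrable M (\<lambda>z. indicator (s -` {y}) z *\<^sub>R F z)" for y
    by (intro integrable_mult_indicator m F)
  have eq: "F z * h (s z) = (\<Sum>y\<in>range s. h y * (indicator (s -` {y}) z *\<^sub>R F z))" for z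
  proof -
    have "(\<Sum>y\<in>range s. h y * (indicator (s -` {y}) z *\<^sub>R F z)) = (\<Sum>y\<in>range s. if y = s z then h y * F z else 0)"
      by (intro sum.cong) (auto simp: indicator_def)
    then show ?thesis using fin by (simp add: mult.commute)
  qed
  show "integrable M (\<lambda>z. F z * h (s z))"
    unfolding eq by (intro Bochner_Integration.integrable_sum integrable_mult_right i)
  show "(\<integral>z. F z * h (s z) \<partial>M) = (\<Sum>y\<in>range s. h y * (\<integral>z. indicator (s -` {y}) z *\<^sub>R F z \<partial>M))"
    unfolding eq by (simp only: Bochner_Integration.integral_sum integrable_mult_right i integral_mult_right_zero)
qed

text \<open>The simple approximations of the identity used below come with the bound
  \<open>norm y \<le> 2 * norm z\<close>; this converts it into polynomial weights.\<close>

lemma weight_le_norm: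
  assumes "norm y \<le> 2 * norm z"
  shows "weight y \<le> 4 * weight z ^ 2" "shift_dist z y \<le> 6 * weight z"
proof -
  have n: "norm z \<le> \<bar>fst z\<bar> + \<bar>snd z\<bar>"
    using norm_Pair_le[of "fst z" "snd z"] by simp
  have y: "\<bar>fst y\<bar> \<le> norm y" "\<bar>snd y\<bar> \<le> norm y"
    using norm_fst_le[of "fst y" "snd y"] norm_snd_le[of "snd y" "fst y"] by auto
  have w: "weight z = 1 + \<bar>fst z\<bar> + \<bar>snd z\<bar> + \<bar>fst z\<bar> * \<bar>snd z\<bar>" unfolding weight_def by algebra
  then have w': "1 + \<bar>fst z\<bar> + \<bar>snd z\<bar> \<le> weight z" by simp
  have "1 + \<bar>fst y\<bar> \<le> 2 * weight z" "1 + \<bar>snd y\<bar> \<le> 2 * weight z"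
    using n y w' assms by linarith+
  then have "weight y \<le> (2 * weight z) * (2 * weight z)"
    unfolding weight_def[of y] by (intro mult_mono) auto
  then show "weight y \<le> 4 * weight z ^ 2" by (simp add: power2_eq_square)
  show "shift_dist z y \<le> 6 * weight z"
    unfolding shift_dist_def using n y w' assms by linarith
qed

text \<open>A tempered distribution commutes with an absolutely convergent integral of atoms.
  Linearity covers finite sums, so the atom at \<open>z\<close> is replaced by the atom at
  \<open>s i z\<close> with \<open>s i\<close> simple; the error is controlled in Schwartz
  seminorms, where \<open>u\<close> is continuous.\<close>

lemma superposition:
  fixes F :: "real \<times> real \<Rightarrow> complex"
  assumes [measurable]: "F \<in> borel_measurable lborel"
    and F: "\<And>L. integrable lborel (\<lambda>z. norm (F z) * weight z ^ L)"
    and \<eta>: "\<eta> \<in> Schwartz"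
  shows superposition_Schwartz: "(\<lambda>t. \<integral>z. F z * atom \<eta> z t \<partial>lborel) \<in> Schwartz"
    and superposition_tempered: "\<And>u. u \<in> tempered \<Longrightarrow>
      u (\<lambda>t. \<integral>z. F z * atom \<eta> z t \<partial>lborel) = (\<integral>z. F z * u (atom \<eta> z) \<partial>lborel)"
proof -
  note [measurable] = nth_deriv_atom_measurable[OF \<eta>]
  have Fint: "integrable lborel F" using F[of 0] by (simp add: integrable_norm_iff)
  have bound: "\<exists>C\<ge>0. \<exists>L. \<forall>z t. \<bar>t\<bar> ^ m * norm (nth_deriv n (atom \<eta> z) t) \<le> C * weight z ^ L" for m n
    using atom_growth[OF \<eta>, of m n] by (auto simp: growth_def)
  define G where "G = (\<lambda>n t. \<integral>z. F z * nth_deriv n (atom \<eta> z) t \<partial>lborel)"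
  have i: "integrable lborel (\<lambda>z. F z * nth_deriv n (atom \<eta> z) t)" for n t
  proof -
    obtain C L where C: "C \<ge> 0" "\<And>z t. \<bar>t\<bar> ^ 0 * norm (nth_deriv n (atom \<eta> z) t) \<le> C * weight z ^ L"
      using bound by meson
    show ?thesis
    proof (rule Bochner_Integration.integrable_bound[OF integrable_mult_right[OF F[of L], of C]])
      show "AE z in lborel. norm (F z * nth_deriv n (atom \<eta> z) t) \<le> norm (C * (norm (F z) * weight z ^ L))"
        using mult_left_mono[OF C(2)[of t], of "norm (F _)"] C(1)
        by (intro AE_I2) (simp add: norm_mult mult_ac)
    qed measurable
  qed
  have G': "(G n has_vector_derivative G (Suc n) t) (at t)" for n t
  proof -
    obtain C L where C: "C \<ge> 0" "\<And>z t. \<bar>t\<bar> ^ 0 * norm (nth_deriv (Suc n) (atom \<eta> z) t) \<le> C * weight z ^ L"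
      using bound by meson
    show ?thesis
      unfolding G_def
    proof (rule has_vector_derivative_integral[where B = "\<lambda>z. C * (norm (F z) * weight z ^ L)"])
      show "norm (F z * nth_deriv (Suc n) (atom \<eta> z) t) \<le> C * (norm (F z) * weight z ^ L)" for z t
        using mult_left_mono[OF C(2)[of t z], of "norm (F z)"] by (simp add: norm_mult mult_ac)
      show "((\<lambda>t. F z * nth_deriv n (atom \<eta> z) t) has_vector_derivative F z * nth_deriv (Suc n) (atom \<eta> z) t) (at t)" for z t
        by (intro has_vector_derivative_mult_right SchwartzD_deriv Schwartz_atom \<eta>)
    qed (use i F in auto)
  qed
  have G0: "G 0 = (\<lambda>t. \<integral>z. F z * atom \<eta> z t \<partial>lborel)" by (simp add: G_def)
  have Gbound: "\<exists>C. \<forall>t. \<bar>t\<bar> ^ m * norm (G n t) \<le> C" for m n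
  proof -
    obtain C L where C: "C \<ge> 0" "\<And>z t. \<bar>t\<bar> ^ m * norm (nth_deriv n (atom \<eta> z) t) \<le> C * weight z ^ L"
      using bound by meson
    have "\<bar>t\<bar> ^ m * norm (G n t) \<le> (\<integral>z. C * (norm (F z) * weight z ^ L) \<partial>lborel)" for t
    proof -
      have "\<bar>t\<bar> ^ m * norm (G n t) = norm (\<integral>z. \<bar>t\<bar> ^ m *\<^sub>R (F z * nth_deriv n (atom \<eta> z) t) \<partial>lborel)"
        by (simp add: G_def)
      also have "\<dots> \<le> (\<integral>z. C * (norm (F z) * weight z ^ L) \<partial>lborel)"
      proof (rule Bochner_Integration.integral_norm_bound_integral)
        show "norm (\<bar>t\<bar> ^ m *\<^sub>R (F z * nth_deriv n (atom \<eta> z) t)) \<le> C * (norm (F z) * weight z ^ L)" for z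
          using mult_left_mono[OF C(2)[of t z], of "norm (F z)"] by (simp add: norm_mult mult_ac)
      qed (use i F in \<open>auto intro!: integrable_scaleR_right integrable_mult_right\<close>)
      finally show ?thesis .
    qed
    then show ?thesis by blast
  qed
  show S: "(\<lambda>t. \<integral>z. F z * atom \<eta> z t \<partial>lborel) \<in> Schwartz"
  proof (rule Schwartz_coinduct[of _ "range G"])
    show "(\<lambda>t. \<integral>z. F z * atom \<eta> z t \<partial>lborel) \<in> range G" using G0[symmetric] by simp
  next
    fix \<eta> assume "\<eta> \<in> range G"
    then show "\<exists>\<eta>'\<in>range G. \<forall>t. (\<eta> has_vector_derivative \<eta>' t) (at t)" using G' by blast
  qed (use Gbound in auto)
  have DG: "nth_deriv n (\<lambda>t. \<integral>z. F z * atom \<eta> z t \<partial>lborel) = G n" for n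
    using nth_deriv_eqI[of G n] G' unfolding G0 by blast
  fix u assume u: "u \<in> tempered"
  obtain C K where C: "C \<ge> 0" "\<And>\<phi>. \<phi> \<in> Schwartz \<Longrightarrow> norm (u \<phi>) \<le> C * Schwartz_norm K \<phi>"
    using tempered_bound[OF u] by metis
  obtain D L where D: "D \<ge> 0"
    "\<And>z z'. Schwartz_norm K (\<lambda>t. atom \<eta> z t - atom \<eta> z' t) \<le> D * (weight z * weight z') ^ L * shift_dist z z'"
    using Schwartz_norm_atom_diff[OF \<eta>] by metis
  obtain D' L' where D': "D' \<ge> 0" "\<And>z. Schwartz_norm K (atom \<eta> z) \<le> D' * weight z ^ L'"
    using Schwartz_norm_atom[OF \<eta>] by metis
  have [measurable]: "(\<lambda>z. u (atom \<eta> z)) \<in> borel_measurable borel"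
    by (rule measurable_tempered_atom[OF u \<eta>])
  obtain s :: "nat \<Rightarrow> real \<times> real \<Rightarrow> real \<times> real" where s: "\<And>i. simple_function lborel (s i)"
    "\<And>z. (\<lambda>i. s i z) \<longlonglongrightarrow> z" "\<And>i z. norm (s i z) \<le> 2 * norm z"
    using borel_measurable_implies_sequence_metric[of "\<lambda>z. z" "lborel :: (real \<times> real) measure" 0] by auto
  have [measurable]: "s i \<in> borel_measurable borel" for i
    using borel_measurable_simple_function[OF s(1)[of i]] by simp
  \<comment> \<open>\<open>F\<close> is kept and only the position of the atom is discretised, which
    makes \<open>\<Phi> i\<close> a finite linear combination of atoms.\<close>
  define \<Phi> where "\<Phi> = (\<lambda>i t. \<integral>z. F z * atom \<eta> (s i z) t \<partial>lborel)"
  define a where "a = (\<lambda>i y. \<integral>z. indicator (s i -` {y}) z *\<^sub>R F z \<partial>lborel)"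
  have fin: "finite (range (s i))" for i using simple_functionD(1)[OF s(1)[of i]] by simp
  have sub: "integrable lborel (\<lambda>z. F z * h (s i z))" "(\<integral>z. F z * h (s i z) \<partial>lborel) = (\<Sum>y\<in>range (s i). h y * a i y)" for h i
    unfolding a_def using integral_simple_subst[OF s(1)[of i] Fint] by auto
  have \<Phi>: "\<Phi> i = (\<lambda>t. \<Sum>y\<in>range (s i). a i y * atom \<eta> y t)" for i
    unfolding \<Phi>_def using sub(2)[of "\<lambda>y. atom \<eta> y _" i] by (simp add: mult.commute)
  have \<Phi>S: "\<Phi> i \<in> Schwartz" for i
    unfolding \<Phi> by (intro Schwartz_sum Schwartz_scale Schwartz_atom \<eta>)
  have D\<Phi>: "nth_deriv n (\<Phi> i) = (\<lambda>t. \<integral>z. F z * nth_deriv n (atom \<eta> (s i z)) t \<partial>lborel)" for n i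
    unfolding \<Phi> using sub(2)[of "\<lambda>y. nth_deriv n (atom \<eta> y) _" i]
    by (simp add: nth_deriv_sum fin Schwartz_scale \<eta> nth_deriv_scale mult.commute)
  have u\<Phi>: "u (\<Phi> i) = (\<integral>z. F z * u (atom \<eta> (s i z)) \<partial>lborel)" for i
  proof -
    have "u (\<Phi> i) = (\<Sum>y\<in>range (s i). u (\<lambda>t. a i y * atom \<eta> y t))"
      unfolding \<Phi> by (rule tempered_sum[OF u]) (intro Schwartz_scale Schwartz_atom \<eta>)
    then show ?thesis
      using sub(2)[of "\<lambda>y. u (atom \<eta> y)" i] by (simp add: u \<eta> tempered_scale mult.commute)
  qed
  \<comment> \<open>Each of the \<open>L\<close> factors contributes \<open>weight z\<close> once
    directly and twice through \<open>weight (s i z)\<close>; the distance contributes the last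
    power.\<close>
  have weight_s: "(weight z * weight (s i z)) ^ L * shift_dist z (s i z) \<le> 6 * 4 ^ L * weight z ^ (3 * L + 1)" for i z
  proof -
    have "(weight z * weight (s i z)) ^ L * shift_dist z (s i z) \<le> (weight z * (4 * weight z ^ 2)) ^ L * (6 * weight z)"
      using weight_le_norm[OF s(3)[of i z]]
      by (intro mult_mono power_mono) (auto simp: shift_dist_def)
    also have "(weight z * (4 * weight z ^ 2)) ^ L = 4 ^ L * weight z ^ (3 * L)"
      by (simp add: power_mult_distrib power_mult power3_eq_cube power2_eq_square mult_ac)
    finally show ?thesis by (simp add: mult_ac)
  qed
  define H where "H = (\<lambda>i z. norm (F z) * (D * ((weight z * weight (s i z)) ^ L * shift_dist z (s i z))))"
  have [measurable]: "(fst :: real \<times> real \<Rightarrow> real) \<in> borel_measurable borel" "(snd :: real \<times> real \<Rightarrow> real) \<in> borel_measurable borel"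
    by (intro borel_measurable_continuous_onI continuous_intros)+
  have [measurable]: "H i \<in> borel_measurable lborel" for i
    unfolding H_def shift_dist_def by measurable
  have Hb: "0 \<le> H i z" "H i z \<le> D * 6 * 4 ^ L * (norm (F z) * weight z ^ (3 * L + 1))" for i z
  proof -
    show "0 \<le> H i z"
      unfolding H_def using D(1) by (intro mult_nonneg_nonneg zero_le_power) (simp_all add: shift_dist_def)
    have "H i z \<le> norm (F z) * (D * (6 * 4 ^ L * weight z ^ (3 * L + 1)))"
      unfolding H_def by (intro mult_left_mono weight_s D(1) norm_ge_zero)
    then show "H i z \<le> D * 6 * 4 ^ L * (norm (F z) * weight z ^ (3 * L + 1))" by (simp only: mult_ac)
  qed
  have W: "integrable lborel (\<lambda>z. D * 6 * 4 ^ L * (norm (F z) * weight z ^ (3 * L + 1)))"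
    by (intro integrable_mult_right F)
  have Hint: "integrable lborel (H i)" for i
  proof (rule Bochner_Integration.integrable_bound[OF W])
    show "AE z in lborel. norm (H i z) \<le> norm (D * 6 * 4 ^ L * (norm (F z) * weight z ^ (3 * L + 1)))"
      unfolding real_norm_def using Hb(1)[of i] Hb(2)[of i]
      by (intro AE_I2) (metis abs_ge_self abs_of_nonneg order_trans)
  qed measurable
  have "(\<lambda>i. integral\<^sup>L lborel (H i)) \<longlonglongrightarrow> (\<integral>z. 0 \<partial>(lborel :: (real \<times> real) measure))"
  proof (rule integral_dominated_convergence[where w = "\<lambda>z. D * 6 * 4 ^ L * (norm (F z) * weight z ^ (3 * L + 1))"])
    show "AE z in lborel. (\<lambda>i. H i z) \<longlonglongrightarrow> 0"
    proof (rule AE_I2)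
      fix z
      have "(\<lambda>i. H i z) \<longlonglongrightarrow> norm (F z) * (D * ((weight z * weight z) ^ L * shift_dist z z))"
        unfolding H_def shift_dist_def weight_def by (intro tendsto_intros s(2))
      then show "(\<lambda>i. H i z) \<longlonglongrightarrow> 0" by (simp add: shift_dist_def)
    qed
    show "integrable lborel (\<lambda>z. D * 6 * 4 ^ L * (norm (F z) * weight z ^ (3 * L + 1)))"
      by (rule W)
    show "AE z in lborel. norm (H i z) \<le> D * 6 * 4 ^ L * (norm (F z) * weight z ^ (3 * L + 1))" for i
      using Hb by (intro AE_I2) auto
  qed measurable
  then have H0: "(\<lambda>i. integral\<^sup>L lborel (H i)) \<longlonglongrightarrow> 0" by simp
  let ?\<Phi> = "\<lambda>t. \<integral>z. F z * atom \<eta> z t \<partial>lborel"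
  \<comment> \<open>The bound is free of \<open>t\<close>: a seminorm of the error is at most the
    integral of the Schwartz norms of the atom differences, and that integral tends to 0.\<close>
  have semi: "Schwartz_seminorm m n (\<lambda>t. ?\<Phi> t - \<Phi> i t) \<le> integral\<^sup>L lborel (H i)" if "m \<le> K" "n \<le> K" for m n i
  proof (rule Schwartz_seminorm_least)
    fix t
    have int_s: "integrable lborel (\<lambda>z. F z * nth_deriv n (atom \<eta> (s i z)) t)"
      by (rule sub(1)[of "\<lambda>y. nth_deriv n (atom \<eta> y) t"])
    have "nth_deriv n (\<lambda>t. ?\<Phi> t - \<Phi> i t) t = (\<integral>z. F z * (nth_deriv n (atom \<eta> z) t - nth_deriv n (atom \<eta> (s i z)) t) \<partial>lborel)"
      using i[of n t] int_s by (simp add: nth_deriv_diff[OF S \<Phi>S] DG G_def D\<Phi> right_diff_distrib)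
    then have "\<bar>t\<bar> ^ m * norm (nth_deriv n (\<lambda>t. ?\<Phi> t - \<Phi> i t) t) =
       norm (\<integral>z. \<bar>t\<bar> ^ m *\<^sub>R (F z * (nth_deriv n (atom \<eta> z) t - nth_deriv n (atom \<eta> (s i z)) t)) \<partial>lborel)"
      by simp
    also have "\<dots> \<le> integral\<^sup>L lborel (H i)"
    proof (rule Bochner_Integration.integral_norm_bound_integral[OF _ Hint])
      show "integrable lborel (\<lambda>z. \<bar>t\<bar> ^ m *\<^sub>R (F z * (nth_deriv n (atom \<eta> z) t - nth_deriv n (atom \<eta> (s i z)) t)))"
        unfolding right_diff_distrib using i[of n t] int_s by (intro integrable_scaleR_right Bochner_Integration.integrable_diff)
      fix z
      have "\<bar>t\<bar> ^ m * norm (nth_deriv n (\<lambda>t. atom \<eta> z t - atom \<eta> (s i z) t) t) \<le> D * (weight z * weight (s i z)) ^ L * shift_dist z (s i z)"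
        by (rule order_trans[OF order_trans[OF Schwartz_seminorm_upper Schwartz_seminorm_le_norm] D(2)])
          (use \<eta> that in \<open>auto intro: Schwartz_diff\<close>)
      from mult_left_mono[OF this, of "norm (F z)"]
      show "norm (\<bar>t\<bar> ^ m *\<^sub>R (F z * (nth_deriv n (atom \<eta> z) t - nth_deriv n (atom \<eta> (s i z)) t))) \<le> H i z"
        by (simp add: H_def nth_deriv_diff \<eta> norm_mult mult_ac)
    qed
    finally show "\<bar>t\<bar> ^ m * norm (nth_deriv n (\<lambda>t. ?\<Phi> t - \<Phi> i t) t) \<le> integral\<^sup>L lborel (H i)" .
  qed
  \<comment> \<open>The Schwartz norm of order \<open>K\<close> is a sum of
    \<open>Suc K * Suc K\<close> seminorms, each bounded by the same integral.\<close>
  have "norm (u ?\<Phi> - u (\<Phi> i)) \<le> C * (real ((Suc K) * (Suc K)) * integral\<^sup>L lborel (H i))" for i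
  proof -
    have "u ?\<Phi> - u (\<Phi> i) = u (\<lambda>t. ?\<Phi> t - \<Phi> i t)" by (rule tempered_diff[OF u S \<Phi>S, symmetric])
    moreover have "Schwartz_norm K (\<lambda>t. ?\<Phi> t - \<Phi> i t) \<le> (\<Sum>m\<le>K. \<Sum>n\<le>K. integral\<^sup>L lborel (H i))"
      unfolding Schwartz_norm_def by (intro sum_mono semi) auto
    then have "Schwartz_norm K (\<lambda>t. ?\<Phi> t - \<Phi> i t) \<le> real ((Suc K) * (Suc K)) * integral\<^sup>L lborel (H i)"
      by (simp add: algebra_simps)
    ultimately show ?thesis
      using order_trans[OF C(2)[OF Schwartz_diff[OF S \<Phi>S]] mult_left_mono[OF _ C(1)]] by simp
  qed
  moreover have "(\<lambda>i. C * (real ((Suc K) * (Suc K)) * integral\<^sup>L lborel (H i))) \<longlonglongrightarrow> C * (real ((Suc K) * (Suc K)) * 0)"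
    by (intro tendsto_intros H0)
  ultimately have "(\<lambda>i. u ?\<Phi> - u (\<Phi> i)) \<longlonglongrightarrow> 0"
    by (intro Lim_null_comparison[of "\<lambda>i. u ?\<Phi> - u (\<Phi> i)"]) auto
  then have lim1: "(\<lambda>i. u (\<Phi> i)) \<longlonglongrightarrow> u ?\<Phi>"
    using tendsto_diff[OF tendsto_const[of "u ?\<Phi>"], of "\<lambda>i. u ?\<Phi> - u (\<Phi> i)" 0] by simp
  have lim2: "(\<lambda>i. \<integral>z. F z * u (atom \<eta> (s i z)) \<partial>lborel) \<longlonglongrightarrow> (\<integral>z. F z * u (atom \<eta> z) \<partial>lborel)"
  proof (rule integral_dominated_convergence[where w = "\<lambda>z. C * D' * 4 ^ L' * (norm (F z) * weight z ^ (2 * L'))"])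
    show "AE z in lborel. (\<lambda>i. F z * u (atom \<eta> (s i z))) \<longlonglongrightarrow> F z * u (atom \<eta> z)"
      by (intro AE_I2 tendsto_mult tendsto_const isCont_tendsto_compose[OF isCont_tempered_atom[OF u \<eta>]] s(2))
    show "AE z in lborel. norm (F z * u (atom \<eta> (s i z))) \<le> C * D' * 4 ^ L' * (norm (F z) * weight z ^ (2 * L'))" for i
    proof (rule AE_I2)
      fix z
      have "norm (u (atom \<eta> (s i z))) \<le> C * (D' * weight (s i z) ^ L')"
        by (rule order_trans[OF C(2) mult_left_mono[OF D'(2) C(1)]]) (use \<eta> in auto)
      also have "weight (s i z) ^ L' \<le> (4 * weight z ^ 2) ^ L'"
        by (intro power_mono weight_le_norm s(3)) auto
      finally have "norm (u (atom \<eta> (s i z))) \<le> C * (D' * (4 ^ L' * weight z ^ (2 * L')))"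
        using C(1) D'(1) by (auto simp: power_mult_distrib power_mult intro: mult_left_mono)
      from mult_left_mono[OF this, of "norm (F z)"]
      show "norm (F z * u (atom \<eta> (s i z))) \<le> C * D' * 4 ^ L' * (norm (F z) * weight z ^ (2 * L'))"
        by (simp add: norm_mult mult_ac)
    qed
  qed (use F in auto)
  show "u ?\<Phi> = (\<integral>z. F z * u (atom \<eta> z) \<partial>lborel)"
    using lim1 lim2 unfolding u\<Phi> by (rule LIMSEQ_unique)
qed

section \<open>Inversion of the short-time Fourier transform\<close>

lemma borel_measurable_fst [measurable]: "fst \<in> borel_measurable (borel :: ('a::topological_space \<times> 'b::topological_space) measure)"
  and borel_measurable_snd [measurable]: "snd \<in> borel_measurable (borel :: ('a::topological_space \<times> 'b::topological_space) measure)"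
  by (intro borel_measurable_continuous_onI continuous_intros)+

lemma Fubini_lborel:
  fixes f :: "'a::euclidean_space \<Rightarrow> 'b::euclidean_space \<Rightarrow> complex"
  assumes m: "(\<lambda>(x, y). f x y) \<in> borel_measurable borel"
    and 1: "\<And>x. integrable lborel (f x)"
    and 2: "integrable lborel (\<lambda>x. \<integral>y. norm (f x y) \<partial>lborel)"
  shows "(\<integral>x. (\<integral>y. f x y \<partial>lborel) \<partial>lborel) = (\<integral>y. (\<integral>x. f x y \<partial>lborel) \<partial>lborel)"
    and "integrable lborel (\<lambda>(x, y). f x y)"
    and "AE y in lborel. integrable lborel (\<lambda>x. f x y)"
    and "integrable lborel (\<lambda>x. \<integral>y. f x y \<partial>lborel)"
    and "integrable lborel (\<lambda>y. \<integral>x. f x y \<partial>lborel)"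
proof -
  have i: "integrable (lborel \<Otimes>\<^sub>M lborel) (\<lambda>(x, y). f x y)"
  proof (rule lborel_pair.Fubini_integrable)
    show "(\<lambda>(x, y). f x y) \<in> borel_measurable (lborel \<Otimes>\<^sub>M lborel)"
      using m by (simp add: lborel_prod)
  qed (use 1 2 in auto)
  show "(\<integral>x. (\<integral>y. f x y \<partial>lborel) \<partial>lborel) = (\<integral>y. (\<integral>x. f x y \<partial>lborel) \<partial>lborel)"
    using lborel_pair.Fubini_integral[OF i] by simp
  show "integrable lborel (\<lambda>(x, y). f x y)" using i by (simp add: lborel_prod)
  show "AE y in lborel. integrable lborel (\<lambda>x. f x y)"
    using lborel_pair.AE_integrable_snd[OF i] by simp
  show "integrable lborel (\<lambda>x. \<integral>y. f x y \<partial>lborel)"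
    using lborel_pair.integrable_fst[OF i] by simp
  show "integrable lborel (\<lambda>y. \<integral>x. f x y \<partial>lborel)"
    using lborel_pair.integrable_snd[OF i] by simp
qed

section \<open>Coefficients of Schwartz functions and their decay\<close>

lemma integral_derivative_zero:
  fixes F :: "real \<Rightarrow> complex"
  assumes "\<And>t. (F has_vector_derivative f t) (at t)" "\<And>t. isCont f t" "integrable lborel f"
    and "(F \<longlongrightarrow> 0) at_top" "(F \<longlongrightarrow> 0) at_bot"
  shows "(\<integral>t. f t \<partial>lborel) = 0"
proof -
  have "(LBINT x=-\<infinity>..\<infinity>. f x) = 0 - 0"
  proof (rule interval_integral_FTC_integrable)
    show "((F \<circ> real_of_ereal) \<longlongrightarrow> 0) (at_right (- \<infinity>))" "((F \<circ> real_of_ereal) \<longlongrightarrow> 0) (at_left \<infinity>)"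
      using assms by (simp_all add: ereal_tendsto_simps)
  qed (use assms in \<open>auto simp: set_integrable_def\<close>)
  then show ?thesis by (simp add: interval_lebesgue_integral_def set_lebesgue_integral_def)
qed

text \<open>Without conjugation, hence linear in \<open>\<phi>\<close>: the conjugate of the
  short-time Fourier transform of the conjugate of \<open>\<phi>\<close>. In this form test
  functions are integrated against \<open>stft \<psi> u\<close>.\<close>

definition coef :: "(real \<Rightarrow> complex) \<Rightarrow> (real \<Rightarrow> complex) \<Rightarrow> real \<times> real \<Rightarrow> complex" where
  "coef \<psi> \<phi> z = (\<integral>t. modulate (snd z) (translate (fst z) \<psi>) t * \<phi> t \<partial>lborel)"

lemma norm_translate: "norm (translate x \<psi> t) = norm (\<psi> (t - x))"
  by (simp add: translate_def)

lemma integrable_Schwartz_mult: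
  assumes "\<psi> \<in> Schwartz" "\<phi> \<in> Schwartz"
  shows "integrable lborel (\<lambda>t. \<psi> t * \<phi> t)"
proof -
  obtain C where C: "C > 0" "\<And>t. (1 + \<bar>t\<bar>) ^ 0 * norm (\<psi> t) \<le> C" using Schwartz_decay[OF assms(1)] by metis
  note [measurable] = Schwartz_measurable[OF assms(1)] Schwartz_measurable[OF assms(2)]
  have "integrable lborel (\<lambda>t. C * norm (\<phi> t))"
    using Schwartz_integrable[OF assms(2)] by simp
  then show ?thesis
    by (rule Bochner_Integration.integrable_bound)
      (use C in \<open>auto simp: norm_mult abs_mult intro!: mult_right_mono\<close>)
qed

lemma Schwartz_shift: "\<psi> \<in> Schwartz \<Longrightarrow> modulate w (translate x \<psi>) \<in> Schwartz"
  by (simp add: Schwartz_modulate Schwartz_translate)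

lemma nth_deriv_translate:
  assumes "\<psi> \<in> Schwartz"
  shows "nth_deriv (Suc 0) (translate x \<psi>) = translate x (nth_deriv (Suc 0) \<psi>)"
  unfolding nth_deriv_Suc' nth_deriv_0
proof (intro ext vector_derivative_at)
  fix t
  have "((\<psi> \<circ> (\<lambda>t. t - x)) has_vector_derivative (1 *\<^sub>R nth_deriv (Suc 0) \<psi> (t - x))) (at t)"
    by (rule vector_diff_chain_at) (auto intro!: derivative_eq_intros Schwartz_deriv assms)
  then show "(translate x \<psi> has_vector_derivative translate x (\<lambda>t. vector_derivative \<psi> (at t)) t) (at t)"
    by (simp add: translate_def o_def nth_deriv_Suc')
qed

text \<open>Integration by parts trades a factor of the frequency for a derivative on the window or
  on \<open>\<phi>\<close>; this is the source of decay in frequency.\<close>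

lemma coef_by_parts:
  assumes \<psi>: "\<psi> \<in> Schwartz" and \<phi>: "\<phi> \<in> Schwartz"
  shows "2 * of_real pi * \<i> * of_real (snd z) * coef \<psi> \<phi> z =
    - (coef (nth_deriv (Suc 0) \<psi>) \<phi> z + coef \<psi> (nth_deriv (Suc 0) \<phi>) z)"
proof -
  let ?c = "2 * of_real pi * \<i> * complex_of_real (snd z)"
  let ?T = "\<lambda>\<psi>. modulate (snd z) (translate (fst z) \<psi>)"
  let ?\<psi>' = "nth_deriv (Suc 0) \<psi>" and ?\<phi>' = "nth_deriv (Suc 0) \<phi>"
  note S = Schwartz_shift[OF \<psi>] Schwartz_shift[OF Schwartz_nth_deriv[OF \<psi>]] \<phi> Schwartz_nth_deriv[OF \<phi>]
  have D: "(?T \<psi> has_vector_derivative ?c * ?T \<psi> t + ?T ?\<psi>' t) (at t)" for t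
    using has_vector_derivative_modulate[OF Schwartz_deriv[OF Schwartz_translate[OF \<psi>]], of "snd z" "fst z" t]
    by (simp add: nth_deriv_translate \<psi> modulate_def algebra_simps)
  define f where "f = (\<lambda>t. ?T \<psi> t * ?\<phi>' t + (?c * ?T \<psi> t + ?T ?\<psi>' t) * \<phi> t)"
  have F: "((\<lambda>t. ?T \<psi> t * \<phi> t) has_vector_derivative f t) (at t)" for t
    unfolding f_def by (intro has_vector_derivative_mult D Schwartz_deriv \<phi>)
  have i: "integrable lborel (\<lambda>t. ?T \<psi> t * ?\<phi>' t)" "integrable lborel (\<lambda>t. ?T \<psi> t * \<phi> t)"
    "integrable lborel (\<lambda>t. ?T ?\<psi>' t * \<phi> t)"
    by (intro integrable_Schwartz_mult S)+
  have f_eq: "f t = ?T \<psi> t * ?\<phi>' t + (?c * (?T \<psi> t * \<phi> t) + ?T ?\<psi>' t * \<phi> t)" for t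
    by (simp add: f_def algebra_simps)
  have "(\<integral>t. f t \<partial>lborel) = 0"
  proof (rule integral_derivative_zero[OF F])
    show "isCont f t" for t
    proof -
      have "continuous_on UNIV f"
        unfolding f_def by (intro continuous_intros Schwartz_continuous S)
      then show ?thesis by (simp add: continuous_on_eq_continuous_at)
    qed
    show "integrable lborel f"
      unfolding f_eq[abs_def] using i by (intro Bochner_Integration.integrable_add integrable_mult_right)
    obtain C where C: "C > 0" "\<And>t. (1 + \<bar>t\<bar>) ^ 0 * norm (?T \<psi> t) \<le> C" using Schwartz_decay[OF S(1)] by metis
    obtain D where D: "D > 0" "\<And>t. (1 + \<bar>t\<bar>) ^ 1 * norm (\<phi> t) \<le> D" using Schwartz_decay[OF \<phi>] by metis
    have b: "norm (?T \<psi> t * \<phi> t) \<le> C * D / (1 + \<bar>t\<bar>)" for t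
    proof -
      have "norm (\<phi> t) \<le> D / (1 + \<bar>t\<bar>)" using D(2)[of t] by (simp add: field_simps)
      then have "norm (?T \<psi> t) * norm (\<phi> t) \<le> C * (D / (1 + \<bar>t\<bar>))"
        using C(2)[of t] C(1) by (intro mult_mono) auto
      then show ?thesis by (simp add: norm_mult)
    qed
    have "((\<lambda>t::real. C * D / (1 + \<bar>t\<bar>)) \<longlongrightarrow> 0) at_top" by real_asymp
    then show "((\<lambda>t. ?T \<psi> t * \<phi> t) \<longlongrightarrow> 0) at_top"
      by (rule Lim_null_comparison[rotated]) (use b in auto)
    have "((\<lambda>t::real. C * D / (1 + \<bar>t\<bar>)) \<longlongrightarrow> 0) at_bot" by real_asymp
    then show "((\<lambda>t. ?T \<psi> t * \<phi> t) \<longlongrightarrow> 0) at_bot"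
      by (rule Lim_null_comparison[rotated]) (use b in auto)
  qed
  moreover have "(\<integral>t. f t \<partial>lborel) = coef \<psi> ?\<phi>' z + (?c * coef \<psi> \<phi> z + coef ?\<psi>' \<phi> z)"
    unfolding f_eq coef_def using i by simp
  ultimately show ?thesis by (simp add: add_eq_0_iff algebra_simps)
qed

lemma coef_decay_time:
  assumes \<psi>: "\<psi> \<in> Schwartz"
  obtains C where "C \<ge> 0"
    "\<And>\<phi> z. \<phi> \<in> Schwartz \<Longrightarrow> (1 + \<bar>fst z\<bar>) ^ a * norm (coef \<psi> \<phi> z) \<le> C * Schwartz_norm a \<phi>"
proof -
  define I where "I = (\<integral>t. (1 + \<bar>t\<bar>) ^ a * norm (\<psi> t) \<partial>lborel)"
  have I: "I \<ge> 0" unfolding I_def by (intro Bochner_Integration.integral_nonneg) auto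
  note int = integrable_Schwartz_weight[OF \<psi>, of a]
  show ?thesis
  proof (rule that[of "2 ^ Suc a * I"])
    show "2 ^ Suc a * I \<ge> 0" using I by simp
    fix \<phi> and z :: "real \<times> real" assume \<phi>: "\<phi> \<in> Schwartz"
    let ?x = "fst z"
    have ib: "integrable lborel (\<lambda>t. 2 ^ Suc a * Schwartz_norm a \<phi> * ((1 + \<bar>t - ?x\<bar>) ^ a * norm (\<psi> (t - ?x))))"
      using lborel_integrable_real_affine[OF int, of 1 "- ?x"] by (intro integrable_mult_right) simp
    have "(1 + \<bar>?x\<bar>) ^ a * norm (coef \<psi> \<phi> z) =
        norm (\<integral>t. (1 + \<bar>?x\<bar>) ^ a *\<^sub>R (modulate (snd z) (translate ?x \<psi>) t * \<phi> t) \<partial>lborel)"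
      by (simp add: coef_def)
    also have "\<dots> \<le> (\<integral>t. 2 ^ Suc a * Schwartz_norm a \<phi> * ((1 + \<bar>t - ?x\<bar>) ^ a * norm (\<psi> (t - ?x))) \<partial>lborel)"
    proof (rule Bochner_Integration.integral_norm_bound_integral[OF _ ib])
      show "integrable lborel (\<lambda>t. (1 + \<bar>?x\<bar>) ^ a *\<^sub>R (modulate (snd z) (translate ?x \<psi>) t * \<phi> t))"
        by (intro integrable_scaleR_right integrable_Schwartz_mult Schwartz_shift \<psi> \<phi>)
      fix t
      have "1 + \<bar>?x\<bar> \<le> (1 + \<bar>t\<bar>) * (1 + \<bar>t - ?x\<bar>)"
      proof -
        have "(1 + \<bar>t\<bar>) * (1 + \<bar>t - ?x\<bar>) = 1 + \<bar>t\<bar> + \<bar>t - ?x\<bar> + \<bar>t\<bar> * \<bar>t - ?x\<bar>" by algebra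
        moreover have "\<bar>t\<bar> * \<bar>t - ?x\<bar> \<ge> 0" by simp
        ultimately show ?thesis by linarith
      qed
      then have "(1 + \<bar>?x\<bar>) ^ a \<le> (1 + \<bar>t\<bar>) ^ a * (1 + \<bar>t - ?x\<bar>) ^ a"
        unfolding power_mult_distrib[symmetric] by (rule power_mono) simp
      then have "(1 + \<bar>?x\<bar>) ^ a * (norm (\<psi> (t - ?x)) * norm (\<phi> t)) \<le> ((1 + \<bar>t\<bar>) ^ a * (1 + \<bar>t - ?x\<bar>) ^ a) * (norm (\<psi> (t - ?x)) * norm (\<phi> t))"
        by (intro mult_right_mono) auto
      also have "\<dots> = ((1 + \<bar>t\<bar>) ^ a * norm (\<phi> t)) * ((1 + \<bar>t - ?x\<bar>) ^ a * norm (\<psi> (t - ?x)))" by (simp add: mult_ac)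
      also have "\<dots> \<le> (2 ^ Suc a * Schwartz_norm a \<phi>) * ((1 + \<bar>t - ?x\<bar>) ^ a * norm (\<psi> (t - ?x)))"
        by (intro mult_right_mono Schwartz_norm_decay \<phi>) auto
      finally show "norm ((1 + \<bar>?x\<bar>) ^ a *\<^sub>R (modulate (snd z) (translate ?x \<psi>) t * \<phi> t)) \<le>
          2 ^ Suc a * Schwartz_norm a \<phi> * ((1 + \<bar>t - ?x\<bar>) ^ a * norm (\<psi> (t - ?x)))"
        by (simp add: norm_mult norm_translate)
    qed
    also have "\<dots> = 2 ^ Suc a * Schwartz_norm a \<phi> * I"
      unfolding I_def using lborel_integral_real_affine[of 1 "\<lambda>t. (1 + \<bar>t\<bar>) ^ a * norm (\<psi> t)" "- ?x"] by simp
    finally show "(1 + \<bar>?x\<bar>) ^ a * norm (coef \<psi> \<phi> z) \<le> 2 ^ Suc a * I * Schwartz_norm a \<phi>"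
      by (simp add: mult_ac)
  qed
qed

text \<open>Each power of the frequency costs one application of \<open>coef_by_parts\<close>. Since
  this differentiates the window as well, the induction runs over all windows.\<close>

lemma coef_decay_frequency:
  assumes "\<psi> \<in> Schwartz"
  shows "\<exists>C\<ge>0. \<exists>K. \<forall>\<phi>\<in>Schwartz. \<forall>z.
    (1 + \<bar>fst z\<bar>) ^ a * ((1 + \<bar>snd z\<bar>) ^ b * norm (coef \<psi> \<phi> z)) \<le> C * Schwartz_norm K \<phi>"
  using assms
proof (induction b arbitrary: \<psi>)
  case 0
  obtain C where "C \<ge> 0" "\<And>\<phi> z. \<phi> \<in> Schwartz \<Longrightarrow> (1 + \<bar>fst z\<bar>) ^ a * norm (coef \<psi> \<phi> z) \<le> C * Schwartz_norm a \<phi>"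
    using coef_decay_time[OF 0, of a] by metis
  then show ?case by (intro exI[of _ C] conjI exI[of _ a]) auto
next
  case (Suc b)
  let ?W = "\<lambda>z::real \<times> real. (1 + \<bar>fst z\<bar>) ^ a * (1 + \<bar>snd z\<bar>) ^ b"
  obtain C1 K1 where 1: "C1 \<ge> 0" "\<And>\<phi> z. \<phi> \<in> Schwartz \<Longrightarrow> ?W z * norm (coef \<psi> \<phi> z) \<le> C1 * Schwartz_norm K1 \<phi>"
    using Suc.IH[OF Suc.prems] unfolding mult.assoc by blast
  obtain C2 K2 where 2: "C2 \<ge> 0" "\<And>\<phi> z. \<phi> \<in> Schwartz \<Longrightarrow> ?W z * norm (coef (nth_deriv (Suc 0) \<psi>) \<phi> z) \<le> C2 * Schwartz_norm K2 \<phi>"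
    using Suc.IH[OF Schwartz_nth_deriv[OF Suc.prems]] unfolding mult.assoc by blast
  define K where "K = max (Suc K1) K2"
  have "?W z * ((1 + \<bar>snd z\<bar>) * norm (coef \<psi> \<phi> z)) \<le> (C1 + (C2 + C1)) * Schwartz_norm K \<phi>" if \<phi>: "\<phi> \<in> Schwartz" for \<phi> z
  proof -
    have "\<bar>snd z\<bar> * norm (coef \<psi> \<phi> z) \<le> norm (2 * of_real pi * \<i> * of_real (snd z) * coef \<psi> \<phi> z)"
    proof -
      have "\<bar>snd z\<bar> * norm (coef \<psi> \<phi> z) \<le> 2 * pi * (\<bar>snd z\<bar> * norm (coef \<psi> \<phi> z))"
        using pi_ge_two mult_right_mono[of 1 "2 * pi" "\<bar>snd z\<bar> * norm (coef \<psi> \<phi> z)"] by simp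
      then show ?thesis by (simp add: norm_mult)
    qed
    also have "\<dots> \<le> norm (coef (nth_deriv (Suc 0) \<psi>) \<phi> z) + norm (coef \<psi> (nth_deriv (Suc 0) \<phi>) z)"
      unfolding coef_by_parts[OF Suc.prems \<phi>] norm_minus_cancel by (rule norm_triangle_ineq)
    finally have "?W z * ((1 + \<bar>snd z\<bar>) * norm (coef \<psi> \<phi> z)) \<le>
        ?W z * (norm (coef \<psi> \<phi> z) + (norm (coef (nth_deriv (Suc 0) \<psi>) \<phi> z) + norm (coef \<psi> (nth_deriv (Suc 0) \<phi>) z)))"
      by (intro mult_left_mono) (auto simp: algebra_simps)
    also have "\<dots> \<le> C1 * Schwartz_norm K1 \<phi> + (C2 * Schwartz_norm K2 \<phi> + C1 * Schwartz_norm K1 (nth_deriv (Suc 0) \<phi>))"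
      unfolding distrib_left by (intro add_mono 1 2 Schwartz_nth_deriv \<phi>)
    also have "\<dots> \<le> C1 * Schwartz_norm K \<phi> + (C2 * Schwartz_norm K \<phi> + C1 * Schwartz_norm K \<phi>)"
    proof (intro add_mono mult_left_mono 1(1) 2(1))
      show "Schwartz_norm K1 (nth_deriv (Suc 0) \<phi>) \<le> Schwartz_norm K \<phi>"
        by (rule order_trans[OF Schwartz_norm_deriv[OF \<phi>] Schwartz_norm_mono[OF \<phi>]]) (simp add: K_def)
    qed (auto intro!: Schwartz_norm_mono \<phi> simp: K_def)
    finally show ?thesis by (simp add: algebra_simps)
  qed
  moreover have "C1 + (C2 + C1) \<ge> 0" using 1 2 by simp
  ultimately show ?case
    by (intro exI[of _ "C1 + (C2 + C1)"] conjI exI[of _ K]) (auto simp: mult_ac)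
qed

lemma coef_decay:
  assumes "\<psi> \<in> Schwartz"
  obtains C K where "C \<ge> 0"
    "\<And>\<phi> z. \<phi> \<in> Schwartz \<Longrightarrow> weight z ^ a * norm (coef \<psi> \<phi> z) \<le> C * Schwartz_norm K \<phi>"
  using coef_decay_frequency[OF assms, of a a] that
  unfolding weight_def power_mult_distrib mult.assoc by blast

lemma integrable_weight: "integrable lborel (\<lambda>z. inverse (weight z ^ 2))"
proof -
  have "integrable (lborel \<Otimes>\<^sub>M lborel) (\<lambda>(x::real, y::real). inverse ((1 + \<bar>x\<bar>)\<^sup>2) * inverse ((1 + \<bar>y\<bar>)\<^sup>2))"
    by (rule lborel_pair.Fubini_integrable) (auto simp: integrable_inverse_square)
  then show ?thesis by (simp add: lborel_prod weight_def power_mult_distrib case_prod_unfold)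
qed

text \<open>\<open>h (t + \<delta> v)\<close> is averaged against the Gaussian density in \<open>v\<close>,
  which is its own Fourier transform up to a constant, and then \<open>\<delta> \<rightarrow> 0\<close>.\<close>

theorem Fourier_inversion:
  fixes h :: "real \<Rightarrow> complex"
  defines "H \<equiv> \<lambda>w. \<integral>s. exp (2 * of_real pi * \<i> * of_real w * of_real s) * h s \<partial>lborel"
  assumes cont: "continuous_on UNIV h" and h: "integrable lborel h" and M: "\<And>t. norm (h t) \<le> M"
    and H: "integrable lborel H"
  shows "(\<integral>w. exp (- (2 * of_real pi * \<i> * of_real w * of_real t)) * H w \<partial>lborel) = h t"
proof -
  let ?n = "std_normal_density"
  define k where "k = 1 / sqrt (2 * pi)"
  have k: "k > 0" by (simp add: k_def)
  have [measurable]: "h \<in> borel_measurable borel" using cont by (rule borel_measurable_continuous_onI)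
  have nn: "?n v = k * exp (- v\<^sup>2 / 2)" for v by (simp add: std_normal_density_def k_def)
  have n1: "integrable lborel ?n" "(\<integral>v. ?n v \<partial>lborel) = 1"
    using integrable_normal_density[of 1 0] integral_normal_density[of 1 0] by auto
  have char: "of_real (exp (- v\<^sup>2 / 2)) = (\<integral>x. iexp (v * x) * of_real (?n x) \<partial>lborel)" for v
  proof -
    have "(\<integral>x. iexp (v * x) * of_real (?n x) \<partial>lborel) = char std_normal_distribution v"
      unfolding char_def by (subst integral_density) (auto simp: scaleR_conv_of_real mult.commute)
    then show ?thesis by (simp add: char_std_normal_distribution)
  qed
  define G where "G = (\<lambda>\<delta>. \<integral>v. of_real (?n v) * h (t + \<delta> * v) \<partial>lborel)"
  define J where "J = (\<lambda>\<delta>. \<integral>w. of_real (?n (2 * pi * \<delta> * w)) * (exp (- (2 * of_real pi * \<i> * of_real w * of_real t)) * H w) \<partial>lborel)"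
  \<comment> \<open>The density in \<open>v\<close> is written as a Fourier integral over
    \<open>x\<close> and the integrals are interchanged; the inner one gives \<open>H\<close> at
    \<open>x / (2 * pi * \<delta>)\<close>. Substituting \<open>x = 2 * pi * \<delta> * w\<close>
    moves \<open>\<delta>\<close> into the Gaussian factor.\<close>
  have GJ: "G \<delta> = of_real (2 * pi * k) * J \<delta>" if \<delta>: "\<delta> > 0" for \<delta>
  proof -
    have hd: "integrable lborel (\<lambda>v. h (t + \<delta> * v))"
      using \<delta> by (intro lborel_integrable_real_affine h) simp
    have inner: "(\<integral>v. iexp (v * x) * h (t + \<delta> * v) \<partial>lborel) =
        of_real (1 / \<delta>) * (exp (- (2 * of_real pi * \<i> * of_real (x / (2 * pi * \<delta>)) * of_real t)) * H (x / (2 * pi * \<delta>)))" for x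
    proof -
      define w where "w = x / (2 * pi * \<delta>)"
      have x: "x = 2 * pi * \<delta> * w" using \<delta> by (simp add: w_def)
      have "H w = \<delta> *\<^sub>R (\<integral>v. exp (2 * of_real pi * \<i> * of_real w * of_real (t + \<delta> * v)) * h (t + \<delta> * v) \<partial>lborel)"
        unfolding H_def using \<delta> lborel_integral_real_affine[of \<delta> "\<lambda>s. exp (2 * of_real pi * \<i> * of_real w * of_real s) * h s" t] by simp
      also have "(\<integral>v. exp (2 * of_real pi * \<i> * of_real w * of_real (t + \<delta> * v)) * h (t + \<delta> * v) \<partial>lborel) =
          (\<integral>v. exp (2 * of_real pi * \<i> * of_real w * of_real t) * (iexp (v * x) * h (t + \<delta> * v)) \<partial>lborel)"
      proof (intro Bochner_Integration.integral_cong refl)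
        fix v
        have "2 * of_real pi * \<i> * complex_of_real w * of_real (t + \<delta> * v) =
            2 * of_real pi * \<i> * of_real w * of_real t + \<i> * of_real (v * x)"
          by (simp add: x distrib_left mult_ac)
        then show "exp (2 * of_real pi * \<i> * of_real w * of_real (t + \<delta> * v)) * h (t + \<delta> * v) =
            exp (2 * of_real pi * \<i> * of_real w * of_real t) * (iexp (v * x) * h (t + \<delta> * v))"
          by (simp only: exp_add mult.assoc)
      qed
      finally show ?thesis
        using \<delta> by (simp add: w_def[symmetric] exp_minus scaleR_conv_of_real)
    qed
    have "G \<delta> = of_real k * (\<integral>v. (\<integral>x. (iexp (v * x) * of_real (?n x)) * h (t + \<delta> * v) \<partial>lborel) \<partial>lborel)"
    proof -
      have nk: "complex_of_real (?n v) = of_real k * (\<integral>x. iexp (v * x) * of_real (?n x) \<partial>lborel)" for v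
        unfolding char[symmetric] by (simp add: nn)
      have nk': "of_real (?n v) * h (t + \<delta> * v) = of_real k * ((\<integral>x. iexp (v * x) * of_real (?n x) \<partial>lborel) * h (t + \<delta> * v))" for v
        by (subst nk) (rule mult.assoc)
      have "G \<delta> = (\<integral>v. of_real k * ((\<integral>x. iexp (v * x) * of_real (?n x) \<partial>lborel) * h (t + \<delta> * v)) \<partial>lborel)"
        unfolding G_def by (rule Bochner_Integration.integral_cong[OF refl nk'])
      then show ?thesis by (simp only: integral_mult_right_zero integral_mult_left_zero)
    qed
    also have "(\<integral>v. (\<integral>x. (iexp (v * x) * of_real (?n x)) * h (t + \<delta> * v) \<partial>lborel) \<partial>lborel) =
        (\<integral>x. (\<integral>v. (iexp (v * x) * of_real (?n x)) * h (t + \<delta> * v) \<partial>lborel) \<partial>lborel)"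
    proof (rule Fubini_lborel(1))
      have [measurable]: "(\<lambda>z::real \<times> real. iexp (fst z * snd z)) \<in> borel_measurable borel"
        by (intro borel_measurable_continuous_onI continuous_intros)
      show "(\<lambda>(v, x). (iexp (v * x) * of_real (?n x)) * h (t + \<delta> * v)) \<in> borel_measurable borel"
        unfolding case_prod_unfold by measurable
      have "integrable lborel (\<lambda>x. iexp (v * x) * complex_of_real (?n x))" for v
        by (rule Bochner_Integration.integrable_bound[OF n1(1)]) (auto simp: norm_mult)
      then show "integrable lborel (\<lambda>x. (iexp (v * x) * of_real (?n x)) * h (t + \<delta> * v))" for v
        by (rule integrable_mult_left)
      have "(\<lambda>v. \<integral>x. norm ((iexp (v * x) * of_real (?n x)) * h (t + \<delta> * v)) \<partial>lborel) = (\<lambda>v. norm (h (t + \<delta> * v)))"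
        by (simp add: norm_mult n1)
      then show "integrable lborel (\<lambda>v. \<integral>x. norm ((iexp (v * x) * of_real (?n x)) * h (t + \<delta> * v)) \<partial>lborel)"
        using hd by simp
    qed
    also have "\<dots> = (\<integral>x. of_real (?n x) * (of_real (1 / \<delta>) * (exp (- (2 * of_real pi * \<i> * of_real (x / (2 * pi * \<delta>)) * of_real t)) * H (x / (2 * pi * \<delta>)))) \<partial>lborel)"
      unfolding inner[symmetric] integral_mult_right_zero[symmetric] by (simp only: mult_ac)
    also have "\<dots> = (2 * pi * \<delta>) *\<^sub>R (\<integral>w. of_real (?n (2 * pi * \<delta> * w)) * (of_real (1 / \<delta>) * (exp (- (2 * of_real pi * \<i> * of_real w * of_real t)) * H w)) \<partial>lborel)"
      using \<delta> by (subst lborel_integral_real_affine[of "2 * pi * \<delta>" _ 0]) simp_all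
    also have "\<dots> = of_real (2 * pi) * J \<delta>"
    proof -
      have "(\<integral>w. of_real (?n (2 * pi * \<delta> * w)) * (of_real (1 / \<delta>) * (exp (- (2 * of_real pi * \<i> * of_real w * of_real t)) * H w)) \<partial>lborel) = of_real (1 / \<delta>) * J \<delta>"
        unfolding J_def by (subst integral_mult_right_zero[symmetric]) (simp add: mult_ac)
      then show ?thesis using \<delta> by (simp add: scaleR_conv_of_real)
    qed
    finally show ?thesis by (simp add: mult_ac)
  qed
  define \<delta> where "\<delta> = (\<lambda>i. 1 / real (Suc i))"
  have \<delta>: "\<delta> i > 0" "\<delta> \<longlonglongrightarrow> 0" for i
    using LIMSEQ_Suc[OF lim_1_over_n] by (auto simp: \<delta>_def)
  have isCont: "isCont h s" for s using cont by (simp add: continuous_on_eq_continuous_at)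
  have "(\<lambda>i. G (\<delta> i)) \<longlonglongrightarrow> (\<integral>v. of_real (?n v) * h t \<partial>lborel)"
    unfolding G_def
  proof (rule integral_dominated_convergence[where w = "\<lambda>v. M * ?n v"])
    show "AE v in lborel. (\<lambda>i. of_real (?n v) * h (t + \<delta> i * v)) \<longlonglongrightarrow> of_real (?n v) * h t"
    proof (rule AE_I2)
      fix v
      have "(\<lambda>i. t + \<delta> i * v) \<longlonglongrightarrow> t + 0 * v" by (intro tendsto_intros \<delta>)
      then show "(\<lambda>i. of_real (?n v) * h (t + \<delta> i * v)) \<longlonglongrightarrow> of_real (?n v) * h t"
        using isCont_tendsto_compose[OF isCont] by (intro tendsto_mult tendsto_const) simp
    qed
    show "AE v in lborel. norm (of_real (?n v) * h (t + \<delta> i * v)) \<le> M * ?n v" for i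
    proof (rule AE_I2)
      fix v
      have "?n v * norm (h (t + \<delta> i * v)) \<le> ?n v * M" by (intro mult_left_mono M) simp
      then show "norm (of_real (?n v) * h (t + \<delta> i * v)) \<le> M * ?n v" by (simp add: norm_mult mult.commute)
    qed
  qed (use n1 in auto)
  also have "(\<integral>v. of_real (?n v) * h t \<partial>lborel) = h t"
    using n1 by simp
  finally have limG: "(\<lambda>i. G (\<delta> i)) \<longlonglongrightarrow> h t" .
  have [measurable]: "H \<in> borel_measurable borel" using H by auto
  have [measurable]: "(\<lambda>w. exp (- (2 * of_real pi * \<i> * of_real w * of_real t))) \<in> borel_measurable borel"
    by (intro borel_measurable_continuous_onI continuous_intros)
  have nexp: "norm (exp (- (2 * of_real pi * \<i> * complex_of_real w * of_real t))) = 1" for w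
  proof -
    have "- (2 * of_real pi * \<i> * complex_of_real w * of_real t) = \<i> * of_real (- (2 * pi * w * t))" by simp
    then show ?thesis by (metis norm_exp_i_times)
  qed
  \<comment> \<open>The Gaussian factor tends to its value \<open>k\<close> at 0, and the
    integrability of \<open>H\<close> provides the domination. This \<open>k\<close> and the one in
    \<open>GJ\<close> cancel against \<open>2 * pi\<close>.\<close>
  have "(\<lambda>i. J (\<delta> i)) \<longlonglongrightarrow> (\<integral>w. of_real k * (exp (- (2 * of_real pi * \<i> * of_real w * of_real t)) * H w) \<partial>lborel)"
    unfolding J_def
  proof (rule integral_dominated_convergence[where w = "\<lambda>w. k * norm (H w)"])
    show "AE w in lborel. (\<lambda>i. of_real (?n (2 * pi * \<delta> i * w)) * (exp (- (2 * of_real pi * \<i> * of_real w * of_real t)) * H w))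
       \<longlonglongrightarrow> of_real k * (exp (- (2 * of_real pi * \<i> * of_real w * of_real t)) * H w)"
    proof (rule AE_I2)
      fix w
      have "(\<lambda>i. k * exp (- (2 * pi * \<delta> i * w)\<^sup>2 / 2)) \<longlonglongrightarrow> k * exp (- (2 * pi * 0 * w)\<^sup>2 / 2)"
        by (intro tendsto_intros \<delta>) simp
      then have "(\<lambda>i. ?n (2 * pi * \<delta> i * w)) \<longlonglongrightarrow> k" by (simp add: nn)
      then show "(\<lambda>i. of_real (?n (2 * pi * \<delta> i * w)) * (exp (- (2 * of_real pi * \<i> * of_real w * of_real t)) * H w))
       \<longlonglongrightarrow> of_real k * (exp (- (2 * of_real pi * \<i> * of_real w * of_real t)) * H w)"
        by (intro tendsto_mult tendsto_of_real tendsto_const)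
    qed
    show "AE w in lborel. norm (of_real (?n (2 * pi * \<delta> i * w)) * (exp (- (2 * of_real pi * \<i> * of_real w * of_real t)) * H w)) \<le> k * norm (H w)" for i
      using k by (intro AE_I2) (auto simp: norm_mult nexp nn intro!: mult_left_le_one_le)
  qed (use H in auto)
  then have "(\<lambda>i. of_real (2 * pi * k) * J (\<delta> i)) \<longlonglongrightarrow>
      of_real (2 * pi * k) * (of_real k * (\<integral>w. exp (- (2 * of_real pi * \<i> * of_real w * of_real t)) * H w \<partial>lborel))"
    by (intro tendsto_mult tendsto_const) simp
  moreover have "2 * pi * k * k = 1"
    unfolding k_def by (simp add: real_sqrt_mult_self[symmetric] field_simps power2_eq_square[symmetric] real_sqrt_pow2)
  then have "complex_of_real (2 * pi * k) * of_real k = 1" by (metis of_real_1 of_real_mult)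
  ultimately have "(\<lambda>i. G (\<delta> i)) \<longlonglongrightarrow> (\<integral>w. exp (- (2 * of_real pi * \<i> * of_real w * of_real t)) * H w \<partial>lborel)"
    using GJ[OF \<delta>(1)] by (simp add: mult.assoc[symmetric])
  then show ?thesis using limG LIMSEQ_unique by blast
qed

section \<open>Translation invariance and convolution with an integrable kernel\<close>

lemma lborel_translate:
  fixes f :: "'a::euclidean_space \<Rightarrow> 'b::{banach, second_countable_topology}"
  shows "(\<integral>z. f (z + a) \<partial>lborel) = (\<integral>z. f z \<partial>lborel)"
    and "integrable lborel (\<lambda>z. f (z + a)) \<longleftrightarrow> integrable lborel f"
proof -
  have eq: "distr lborel borel (\<lambda>z. z + a) = (lborel :: 'a measure)" for a
  proof -
    have "(\<lambda>z. z + a) = (+) a" by (auto simp: add.commute)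
    then show ?thesis using lborel_distr_plus[of a] by simp
  qed
  have 1: "integrable lborel f \<Longrightarrow> integrable lborel (\<lambda>z. f (z + a))" for f :: "'a \<Rightarrow> 'b" and a
  proof -
    assume "integrable lborel f"
    then have "integrable (distr lborel borel (\<lambda>z. z + a)) f" by (simp add: eq)
    then show ?thesis by (rule integrable_distr[rotated]) measurable
  qed
  show iff: "integrable lborel (\<lambda>z. f (z + a)) \<longleftrightarrow> integrable lborel f"
    using 1[of f a] 1[of "\<lambda>z. f (z + a)" "- a"] by auto
  show "(\<integral>z. f (z + a) \<partial>lborel) = (\<integral>z. f z \<partial>lborel)"
  proof (cases "integrable lborel f")
    case True
    then have "(\<integral>z. f z \<partial>distr lborel borel (\<lambda>z. z + a)) = (\<integral>z. f (z + a) \<partial>lborel)"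
      by (intro integral_distr) auto
    then show ?thesis by (simp add: eq)
  next
    case False
    then show ?thesis using iff by (simp add: not_integrable_integral_eq)
  qed
qed

lemma integrable_boundI:
  fixes f :: "'z \<Rightarrow> 'b::{banach, second_countable_topology}"
  assumes "integrable M g" "f \<in> borel_measurable M" "\<And>x. norm (f x) \<le> g x"
  shows "integrable M f"
  using assms(1,2) by (rule Bochner_Integration.integrable_bound) (simp add: order_trans[OF assms(3) abs_ge_self])

text \<open>The Schur test: the kernel is split as \<open>k^(1/q) k^(1/r)\<close>, Hoelder's
  inequality is applied at almost every \<open>z'\<close>, and Fubini evaluates the remaining double
  integral. Symmetry of \<open>k\<close> makes its mass the same in both variables, so the bound is
  \<open>A\<close> for every exponent.\<close>

lemma Schur_convolution:
  fixes F :: "'a::euclidean_space \<Rightarrow> complex" and k :: "'a \<Rightarrow> real"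
  assumes F: "F \<in> Lp lborel q" and q: "q > 1"
    and k: "integrable lborel k" "\<And>z. 0 \<le> k z" "\<And>z. k (- z) = k z" and A: "A = (\<integral>z. k z \<partial>lborel)"
  defines "T \<equiv> \<lambda>z'. \<integral>z. norm (F z) * k (z - z') \<partial>lborel"
  assumes int: "\<And>z'. integrable lborel (\<lambda>z. norm (F z) * k (z - z'))"
  shows "(\<lambda>z'. of_real (T z')) \<in> Lp lborel q" "Lp_norm lborel q (\<lambda>z'. of_real (T z')) \<le> A * Lp_norm lborel q F"
proof -
  define r where "r = q / (q - 1)"
  have r: "1 / q + 1 / r = 1" using q by (simp add: r_def field_simps)
  note r1 = conj_exponent_eqs(1)[OF q r]
  have A0: "A \<ge> 0" unfolding A using k(2) by (intro Bochner_Integration.integral_nonneg) auto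
  have [measurable]: "F \<in> borel_measurable borel" "k \<in> borel_measurable borel"
    using F k(1) by (auto simp: Lp_def)
  have kz: "integrable lborel (\<lambda>z. k (z - z'))" "(\<integral>z. k (z - z') \<partial>lborel) = A" for z'
    using lborel_translate[of k "- z'"] k(1) A by auto
  have Fq: "integrable lborel (\<lambda>z. norm (F z) powr q)" by (rule Lp_integrable[OF F])
  define S where "S = (\<lambda>z'. \<integral>z. norm (F z) powr q * k (z - z') \<partial>lborel)"
  have ms: "(\<lambda>(z, z'). norm (F z) powr q * k (z - z')) \<in> borel_measurable (lborel \<Otimes>\<^sub>M lborel)"
    by measurable
  have pi: "integrable (lborel \<Otimes>\<^sub>M lborel) (\<lambda>(z, z'). norm (F z) powr q * k (z - z'))"
  proof (rule lborel_pair.Fubini_integrable[OF ms])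
    have kz': "integrable lborel (\<lambda>z'. k (z - z'))" "(\<integral>z'. k (z - z') \<partial>lborel) = A" for z
      using kz[of z] k(3)[of "z - _"] by (simp_all add: minus_diff_eq) 
    have "(\<lambda>z. \<integral>z'. norm (case (z, z') of (z, z') \<Rightarrow> norm (F z) powr q * k (z - z')) \<partial>lborel) = (\<lambda>z. norm (F z) powr q * A)"
      using kz' k(2) by (simp add: abs_mult)
    then show "integrable lborel (\<lambda>z. \<integral>z'. norm (case (z, z') of (z, z') \<Rightarrow> norm (F z) powr q * k (z - z')) \<partial>lborel)"
      using Fq by simp
    show "AE z in lborel. integrable lborel (\<lambda>z'. case (z, z') of (z, z') \<Rightarrow> norm (F z) powr q * k (z - z'))"
      using kz' by auto
  qed
  have Si: "integrable lborel S" and SI: "(\<integral>z'. S z' \<partial>lborel) = A * (\<integral>z. norm (F z) powr q \<partial>lborel)"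
  proof -
    show "integrable lborel S" unfolding S_def using lborel_pair.integrable_snd[OF pi] by simp
    have kz': "(\<integral>z'. k (z - z') \<partial>lborel) = A" for z
      using kz(2)[of z] k(3)[of "z - _"] by (simp add: minus_diff_eq)
    have "(\<integral>z'. S z' \<partial>lborel) = (\<integral>z. (\<integral>z'. norm (F z) powr q * k (z - z') \<partial>lborel) \<partial>lborel)"
      unfolding S_def using lborel_pair.Fubini_integral[OF pi] by simp
    also have "\<dots> = (\<integral>z. norm (F z) powr q * A \<partial>lborel)" by (simp add: kz')
    finally show "(\<integral>z'. S z' \<partial>lborel) = A * (\<integral>z. norm (F z) powr q \<partial>lborel)" by simp
  qed
  have AES: "AE z' in lborel. integrable lborel (\<lambda>z. norm (F z) powr q * k (z - z'))"
    using lborel_pair.AE_integrable_snd[OF pi] by simp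
  have T0: "T z' \<ge> 0" for z' unfolding T_def using k(2) by (intro Bochner_Integration.integral_nonneg) auto
  have TS: "AE z' in lborel. T z' powr q \<le> A powr (q - 1) * S z'"
    using AES
  proof eventually_elim
    fix z' assume i: "integrable lborel (\<lambda>z. norm (F z) powr q * k (z - z'))"
    define a where "a = (\<lambda>z. of_real (norm (F z) * k (z - z') powr (1 / q)) :: complex)"
    define b where "b = (\<lambda>z. of_real (k (z - z') powr (1 / r)) :: complex)"
    have aq: "norm (a z) powr q = norm (F z) powr q * k (z - z')" for z
      using q k(2)[of "z - z'"] by (simp add: a_def norm_mult powr_mult powr_powr)
    have br: "norm (b z) powr r = k (z - z')" for z
      using r1 k(2)[of "z - z'"] by (simp add: b_def powr_powr)
    have ab: "norm (a z) * norm (b z) = norm (F z) * k (z - z')" for z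
      using k(2)[of "z - z'"] r by (simp add: a_def b_def norm_mult powr_add[symmetric])
    have [measurable]: "a \<in> borel_measurable lborel" "b \<in> borel_measurable lborel"
      unfolding a_def b_def by measurable
    have "a \<in> Lp lborel q" "b \<in> Lp lborel r"
      using i kz(1) by (simp_all add: Lp_def aq br)
    from Holder_integrable(2)[OF this q r] have "T z' \<le> Lp_norm lborel q a * Lp_norm lborel r b"
      by (simp add: ab T_def)
    also have "Lp_norm lborel q a = S z' powr (1 / q)" by (simp add: Lp_norm_def aq S_def)
    also have "Lp_norm lborel r b = A powr (1 / r)" by (simp add: Lp_norm_def br kz)
    finally have "T z' powr q \<le> (S z' powr (1 / q) * A powr (1 / r)) powr q"
      using q T0 by (intro powr_mono2) auto
    also have "\<dots> = S z' * A powr (q / r)"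
      using q A0 Bochner_Integration.integral_nonneg[of lborel "\<lambda>z. norm (F z) powr q * k (z - z')"] k(2)
      by (simp add: powr_mult powr_powr S_def)
    also have "q / r = q - 1" using r q by (simp add: r_def)
    finally show "T z' powr q \<le> A powr (q - 1) * S z'" by (simp add: mult.commute)
  qed
  have [measurable]: "T \<in> borel_measurable borel" unfolding T_def by measurable
  have Ti: "integrable lborel (\<lambda>z'. T z' powr q)"
  proof (rule Bochner_Integration.integrable_bound[OF integrable_mult_right[OF Si, of "A powr (q - 1)"]])
    show "AE z' in lborel. norm (T z' powr q) \<le> norm (A powr (q - 1) * S z')"
      using TS by eventually_elim auto
  qed measurable
  then show "(\<lambda>z'. of_real (T z')) \<in> Lp lborel q" using T0 by (simp add: Lp_def)
  have "(\<integral>z'. T z' powr q \<partial>lborel) \<le> (\<integral>z'. A powr (q - 1) * S z' \<partial>lborel)"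
    by (rule integral_mono_AE[OF Ti integrable_mult_right[OF Si] TS])
  also have "\<dots> = A powr (q - 1) * A powr 1 * (\<integral>z. norm (F z) powr q \<partial>lborel)" using A0 by (simp add: SI)
  also have "A powr (q - 1) * A powr 1 = A powr q" by (simp only: powr_add[symmetric]) simp
  finally have "(\<integral>z'. T z' powr q \<partial>lborel) powr (1 / q) \<le> (A powr q * (\<integral>z. norm (F z) powr q \<partial>lborel)) powr (1 / q)"
    using q by (intro powr_mono2) (auto intro!: Bochner_Integration.integral_nonneg)
  also have "\<dots> = A * Lp_norm lborel q F"
    using q A0 by (simp add: Lp_norm_def powr_mult powr_powr Bochner_Integration.integral_nonneg)
  finally show "Lp_norm lborel q (\<lambda>z'. of_real (T z')) \<le> A * Lp_norm lborel q F"
    using T0 by (simp add: Lp_norm_def)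
qed

section \<open>The inversion formula for a fixed window\<close>

locale window =
  fixes \<psi> :: "real \<Rightarrow> complex"
  assumes \<psi>: "\<psi> \<in> Schwartz" and \<psi>_nonzero: "\<psi> \<noteq> (\<lambda>_. 0)"
begin

definition cw :: "real \<Rightarrow> complex" where "cw = (\<lambda>t. cnj (\<psi> t))"

text \<open>The constant of the inversion formula, and the denominator in
  \<open>modulation_pairing\<close>.\<close>

definition energy :: real where "energy = (fun_L2_norm \<psi>)\<^sup>2"

lemma cw: "cw \<in> Schwartz"
  unfolding cw_def by (rule Schwartz_cnj[OF \<psi>])

lemma energy_eq: "energy = (\<integral>t. (norm (\<psi> t))\<^sup>2 \<partial>lborel)"
  unfolding energy_def fun_L2_norm_def by (rule real_sqrt_pow2) (auto intro: Bochner_Integration.integral_nonneg)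

lemma energy_pos: "energy > 0"
proof -
  have i: "integrable lborel (\<lambda>t. (norm (\<psi> t))\<^sup>2)"
    using integrable_norm[OF integrable_Schwartz_mult[OF \<psi> \<psi>]] by (simp add: norm_mult power2_eq_square)
  have "energy \<noteq> 0"
  proof
    assume "energy = 0"
    then have "AE t in lborel. (norm (\<psi> t))\<^sup>2 = 0"
      using i by (simp add: energy_eq integral_nonneg_eq_0_iff_AE)
    then have ae: "AE t in lborel. \<psi> t = 0" by simp
    obtain t0 where t0: "\<psi> t0 \<noteq> 0" using \<psi>_nonzero by auto
    \<comment> \<open>A continuous function that vanishes almost everywhere vanishes identically,
      because a nonempty open set is not negligible.\<close>
    have "open (\<psi> -` (- {0}))" by (intro open_vimage Schwartz_continuous \<psi>) auto
    moreover have "\<psi> -` (- {0}) \<in> null_sets lborel"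
      using ae calculation AE_iff_null_sets[of "\<psi> -` (- {0})" lborel] by (simp add: borel_open vimage_def)
    ultimately have "negligible (\<psi> -` (- {0}))"
      using negligible_iff_null_sets null_sets_completionI by blast
    with \<open>open (\<psi> -` (- {0}))\<close> have "\<psi> -` (- {0}) = {}" by (meson open_not_negligible)
    then show False using t0 by auto
  qed
  moreover have "energy \<ge> 0" unfolding energy_eq by (intro Bochner_Integration.integral_nonneg) auto
  ultimately show ?thesis by simp
qed

lemma atom_cw: "atom cw z t = cnj (modulate (snd z) (translate (fst z) \<psi>) t)"
  by (simp add: atom_def cw_def modulate_def translate_def exp_cnj)

lemma stft_eq: "stft \<psi> u z = u (atom cw z)"
proof -
  have "atom cw z = (\<lambda>t. cnj (modulate (snd z) (translate (fst z) \<psi>) t))" by (rule ext) (rule atom_cw)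
  then show ?thesis by (simp add: stft_def dist_pairing_def case_prod_unfold)
qed

lemma coef_eq: "coef \<psi> \<phi> z = (\<integral>t. cnj (atom cw z t) * \<phi> t \<partial>lborel)"
  by (simp add: coef_def atom_cw)

lemma coef_integrable: "\<phi> \<in> Schwartz \<Longrightarrow> integrable lborel (\<lambda>t. modulate (snd z) (translate (fst z) \<psi>) t * \<phi> t)"
  by (intro integrable_Schwartz_mult Schwartz_shift \<psi>)

lemma coef_add: "\<phi> \<in> Schwartz \<Longrightarrow> \<eta> \<in> Schwartz \<Longrightarrow> coef \<psi> (\<lambda>t. \<phi> t + \<eta> t) z = coef \<psi> \<phi> z + coef \<psi> \<eta> z"
  using coef_integrable by (simp add: coef_def distrib_left)

lemma coef_scale: "coef \<psi> (\<lambda>t. c * \<phi> t) z = c * coef \<psi> \<phi> z"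
  unfolding coef_def by (simp add: mult.left_commute)

lemma measurable_shift: "(\<lambda>(z, t). modulate (snd z) (translate (fst z) \<psi>) t) \<in> borel_measurable borel"
proof -
  have "continuous_on UNIV (\<lambda>a::(real \<times> real) \<times> real. \<psi> (snd a - fst (fst a)))"
    by (rule continuous_on_compose2[OF Schwartz_continuous[OF \<psi>, of UNIV]]) (auto intro!: continuous_intros)
  then show ?thesis
    unfolding case_prod_unfold modulate_def translate_def
    by (intro borel_measurable_continuous_onI continuous_intros)
qed

lemma coef_measurable:
  assumes "\<phi> \<in> Schwartz"
  shows "coef \<psi> \<phi> \<in> borel_measurable borel"
proof -
  note [measurable] = Schwartz_measurable[OF assms] measurable_shift[unfolded case_prod_unfold]
  have "(\<lambda>(z, t). modulate (snd z) (translate (fst z) \<psi>) t * \<phi> t) \<in> borel_measurable borel"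
    unfolding case_prod_unfold by measurable
  then have "(\<lambda>(z, t). modulate (snd z) (translate (fst z) \<psi>) t * \<phi> t) \<in> borel_measurable (borel \<Otimes>\<^sub>M lborel)"
    by (subst measurable_cong_sets[OF sets_pair_measure_cong[OF refl sets_lborel] refl]) (simp add: borel_prod)
  then show ?thesis
    unfolding coef_def[abs_def] by (rule lborel.borel_measurable_lebesgue_integral)
qed

lemma coef_decay_integrable:
  assumes "\<phi> \<in> Schwartz"
  shows "integrable lborel (\<lambda>z. norm (coef \<psi> \<phi> z) * weight z ^ L)"
proof -
  obtain C K where C: "C \<ge> 0" "\<And>\<phi> z. \<phi> \<in> Schwartz \<Longrightarrow> weight z ^ (L + 2) * norm (coef \<psi> \<phi> z) \<le> C * Schwartz_norm K \<phi>"
    using coef_decay[OF \<psi>, of "L + 2"] by metis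
  note [measurable] = coef_measurable[OF assms]
  show ?thesis
  proof (rule integrable_boundI[OF integrable_mult_right[OF integrable_weight, of "C * Schwartz_norm K \<phi>"]])
    show "norm (norm (coef \<psi> \<phi> z) * weight z ^ L) \<le> C * Schwartz_norm K \<phi> * inverse (weight z ^ 2)" for z
    proof -
      have "norm (coef \<psi> \<phi> z) * weight z ^ L * weight z ^ 2 \<le> C * Schwartz_norm K \<phi>"
        using C(2)[OF assms, of z] by (simp only: power_add mult_ac)
      then show ?thesis using zero_less_power[OF weight_pos(1)[of z], of 2]
        by (simp add: divide_inverse[symmetric] pos_le_divide_eq abs_mult)
    qed
  qed measurable
qed

text \<open>For fixed \<open>x\<close> the coefficients are the Fourier transform of
  \<open>translate x \<psi>\<close> times \<open>\<phi>\<close>. Inverting in the frequency leaves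
  \<open>\<phi> t\<close> times the squared modulus of \<open>\<psi> (t - x)\<close>, whose integral
  over \<open>x\<close> is the energy.\<close>

theorem stft_inversion_Schwartz:
  assumes \<phi>: "\<phi> \<in> Schwartz"
  shows "(\<integral>z. coef \<psi> \<phi> z * atom cw z t \<partial>lborel) = of_real energy * \<phi> t"
proof -
  have i1: "integrable lborel (\<lambda>z. coef \<psi> \<phi> z * atom cw z t)"
  proof -
    obtain C where C: "C > 0" "\<And>t. (1 + \<bar>t\<bar>) ^ 0 * norm (cw t) \<le> C" using Schwartz_decay[OF cw] by metis
    have [measurable]: "(\<lambda>z. atom cw z t) \<in> borel_measurable borel" using nth_deriv_atom_measurable[OF cw, of 0] by simp
    note [measurable] = coef_measurable[OF \<phi>]
    show ?thesis
    proof (rule integrable_boundI[OF integrable_mult_right[OF coef_decay_integrable[OF \<phi>, of 0], of C]])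
      show "norm (coef \<psi> \<phi> z * atom cw z t) \<le> C * (norm (coef \<psi> \<phi> z) * weight z ^ 0)" for z
        using mult_left_mono[OF C(2)[of "t - fst z"], of "norm (coef \<psi> \<phi> z)"] by (simp add: norm_mult mult.commute)
    qed measurable
  qed
  have i2: "integrable lborel (\<lambda>w. coef \<psi> \<phi> (x, w))" for x
  proof -
    obtain C K where C: "C \<ge> 0" "\<And>\<phi> z. \<phi> \<in> Schwartz \<Longrightarrow> weight z ^ 2 * norm (coef \<psi> \<phi> z) \<le> C * Schwartz_norm K \<phi>"
      using coef_decay[OF \<psi>, of 2] by metis
    have [measurable]: "(\<lambda>w. coef \<psi> \<phi> (x, w)) \<in> borel_measurable borel"
      by (rule measurable_compose[OF _ coef_measurable[OF \<phi>]]) (simp add: borel_prod[symmetric])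
    show ?thesis
    proof (rule integrable_boundI[OF integrable_mult_right[OF integrable_inverse_square, of "C * Schwartz_norm K \<phi>"]])
      show "norm (coef \<psi> \<phi> (x, w)) \<le> C * Schwartz_norm K \<phi> * inverse ((1 + \<bar>w\<bar>)\<^sup>2)" for w
      proof -
        have "(1 + \<bar>w\<bar>)\<^sup>2 * norm (coef \<psi> \<phi> (x, w)) \<le> weight (x, w) ^ 2 * norm (coef \<psi> \<phi> (x, w))"
          using abs_le_weight(2)[of "(x, w)"] by (intro mult_right_mono power_mono) auto
        also have "\<dots> \<le> C * Schwartz_norm K \<phi>" by (rule C(2)[OF \<phi>])
        finally show ?thesis
          by (simp add: divide_inverse[symmetric] pos_le_divide_eq mult.commute zero_less_power add_pos_nonneg)
      qed
    qed measurable
  qed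
  obtain B where B: "B > 0" "\<And>t. (1 + \<bar>t\<bar>) ^ 0 * norm (\<psi> t) \<le> B" using Schwartz_decay[OF \<psi>] by metis
  obtain B' where B': "B' > 0" "\<And>t. (1 + \<bar>t\<bar>) ^ 0 * norm (\<phi> t) \<le> B'" using Schwartz_decay[OF \<phi>] by metis
  have inner: "(\<integral>w. coef \<psi> \<phi> (x, w) * atom cw (x, w) t \<partial>lborel) = \<psi> (t - x) * \<phi> t * cnj (\<psi> (t - x))" for x
  proof -
    let ?h = "\<lambda>s. translate x \<psi> s * \<phi> s"
    have c: "(\<integral>s. exp (2 * of_real pi * \<i> * of_real w * of_real s) * ?h s \<partial>lborel) = coef \<psi> \<phi> (x, w)" for w
      by (simp add: coef_def modulate_def mult.assoc)
    have e1: "(\<integral>w. exp (- (2 * of_real pi * \<i> * of_real w * of_real t)) * coef \<psi> \<phi> (x, w) \<partial>lborel) = ?h t"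
      unfolding c[symmetric]
    proof (rule Fourier_inversion)
      show "continuous_on UNIV ?h"
        by (intro continuous_intros Schwartz_continuous Schwartz_translate \<psi> \<phi>)
      show "integrable lborel ?h" by (intro integrable_Schwartz_mult Schwartz_translate \<psi> \<phi>)
      show "norm (?h t) \<le> B * B'" for t
        using B B' by (auto simp: norm_mult translate_def intro!: mult_mono)
      show "integrable lborel (\<lambda>w. \<integral>s. exp (2 * of_real pi * \<i> * of_real w * of_real s) * ?h s \<partial>lborel)"
        unfolding c by (rule i2)
    qed
    have e2: "coef \<psi> \<phi> (x, w) * atom cw (x, w) t =
        cnj (\<psi> (t - x)) * (exp (- (2 * of_real pi * \<i> * of_real w * of_real t)) * coef \<psi> \<phi> (x, w))" for w
      by (simp add: atom_def cw_def modulate_def translate_def)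
    show ?thesis unfolding e2 integral_mult_right_zero e1 by (simp add: translate_def mult.commute)
  qed
  have "(\<integral>z. coef \<psi> \<phi> z * atom cw z t \<partial>lborel) = (\<integral>x. (\<integral>w. coef \<psi> \<phi> (x, w) * atom cw (x, w) t \<partial>lborel) \<partial>lborel)"
    using lborel_pair.integral_fst'[of "\<lambda>z. coef \<psi> \<phi> z * atom cw z t"] i1 by (simp add: lborel_prod)
  also have "\<dots> = (\<integral>x. of_real ((norm (\<psi> (t - x)))\<^sup>2) * \<phi> t \<partial>lborel)"
    unfolding inner complex_norm_square by (simp add: mult_ac)
  also have "\<dots> = of_real (\<integral>x. (norm (\<psi> (t - x)))\<^sup>2 \<partial>lborel) * \<phi> t"
    by (simp only: integral_mult_left_zero integral_complex_of_real)
  also have "(\<integral>x. (norm (\<psi> (t - x)))\<^sup>2 \<partial>lborel) = energy"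
    unfolding energy_eq using lborel_integral_real_affine[of "-1" "\<lambda>x. (norm (\<psi> x))\<^sup>2" t] by simp
  finally show ?thesis .
qed

text \<open>\<open>u\<close> is applied to the reproducing formula for \<open>\<phi>\<close>;
  \<open>superposition\<close> moves it under the integral, where it meets the atoms and becomes
  \<open>stft \<psi> u\<close>.\<close>

theorem stft_inversion:
  assumes u: "u \<in> tempered" and \<phi>: "\<phi> \<in> Schwartz"
  shows "(\<integral>z. stft \<psi> u z * coef \<psi> \<phi> z \<partial>lborel) = of_real energy * u \<phi>"
proof -
  have "u (\<lambda>t. \<integral>z. coef \<psi> \<phi> z * atom cw z t \<partial>lborel) = (\<integral>z. coef \<psi> \<phi> z * u (atom cw z) \<partial>lborel)"
    using coef_measurable[OF \<phi>] by (intro superposition_tempered coef_decay_integrable \<phi> u cw) simp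
  then show ?thesis
    unfolding stft_inversion_Schwartz[OF \<phi>] tempered_scale[OF u \<phi>] stft_eq by (simp only: mult.commute)
qed

end

section \<open>Completeness of the Lebesgue spaces\<close>

definition Lp_space :: "'z measure \<Rightarrow> real \<Rightarrow> 'z fspace" where
  "Lp_space M q = \<lparr>vectors = Lp M q, nrm = Lp_norm M q\<rparr>"

lemma Lp_space_simps [simp]: "vectors (Lp_space M q) = Lp M q" "nrm (Lp_space M q) = Lp_norm M q"
  by (simp_all add: Lp_space_def)

lemma normed_Lp: "q > 1 \<Longrightarrow> normed_fspace (Lp_space M q)"
  by unfold_locales (auto simp: Lp_scale Lp_norm_triangle intro: Lp_add, auto simp: Lp_def)

lemma Lp_norm_tendsto_0:
  assumes q: "q > 0" and g: "integrable M (\<lambda>z. g z powr q)" "\<And>z. g z \<ge> (0::real)"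
    and [measurable]: "\<And>n. f n \<in> borel_measurable M"
    and b: "\<And>n. AE z in M. norm (f n z) \<le> g z" and lim: "AE z in M. (\<lambda>n. f n z) \<longlonglongrightarrow> 0"
  shows "(\<lambda>n. Lp_norm M q (f n)) \<longlonglongrightarrow> 0"
proof -
  have "(\<lambda>n. \<integral>z. norm (f n z) powr q \<partial>M) \<longlonglongrightarrow> (\<integral>z. 0 \<partial>M)"
  proof (rule integral_dominated_convergence[OF _ _ g(1)])
    show "AE z in M. (\<lambda>n. norm (f n z) powr q) \<longlonglongrightarrow> 0"
      using lim by eventually_elim (intro tendsto_zero_powrI[OF tendsto_norm_zero tendsto_const], auto simp: q)
    show "AE z in M. norm (norm (f n z) powr q) \<le> g z powr q" for n
      using b[of n] by eventually_elim (simp add: powr_mono2 q less_imp_le)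
  qed auto
  then have "(\<lambda>n. (\<integral>z. norm (f n z) powr q \<partial>M) powr (1 / q)) \<longlonglongrightarrow> 0"
    using q by (intro tendsto_zero_powrI[OF _ tendsto_const])
      (auto intro!: always_eventually Bochner_Integration.integral_nonneg)
  then show ?thesis by (simp add: Lp_norm_def)
qed

text \<open>Riesz-Fischer: the partial sums of the moduli are bounded in norm by \<open>T\<close>,
  so by monotone convergence their limit lies in \<open>Lp\<close>; it dominates all remainders of
  the series.\<close>

lemma Lp_complete:
  assumes q: "q > 1" and a: "\<And>n. a n \<in> Lp M q" and sm: "summable (\<lambda>n. Lp_norm M q (a n))"
  shows "\<exists>F\<in>Lp M q. (\<lambda>N. Lp_norm M q (\<lambda>z. F z - (\<Sum>n<N. a n z))) \<longlonglongrightarrow> 0"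
proof -
  interpret L: normed_fspace "Lp_space M q" by (rule normed_Lp[OF q])
  note [measurable] = LpD[OF a]
  define g where "g = (\<lambda>N z. \<Sum>n<N. norm (a n z))"
  define T where "T = (\<Sum>n. Lp_norm M q (a n))"
  have g0: "g N z \<ge> 0" for N z unfolding g_def by (intro sum_nonneg) auto
  have na: "(\<lambda>z. complex_of_real (norm (a n z))) \<in> Lp M q" "Lp_norm M q (\<lambda>z. complex_of_real (norm (a n z))) = Lp_norm M q (a n)" for n
    using Lp_integrable[OF a[of n]] by (auto simp: Lp_def Lp_norm_def)
  have gL: "(\<lambda>z. complex_of_real (g N z)) \<in> Lp M q" "Lp_norm M q (\<lambda>z. complex_of_real (g N z)) \<le> T" for N
  proof -
    show "(\<lambda>z. complex_of_real (g N z)) \<in> Lp M q"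
      using L.sum_mem[of "{..<N}" "\<lambda>n z. complex_of_real (norm (a n z))"] na(1) by (simp add: g_def)
    have "Lp_norm M q (\<lambda>z. complex_of_real (g N z)) \<le> (\<Sum>n<N. Lp_norm M q (a n))"
      using L.nrm_sum[of "{..<N}" "\<lambda>n z. complex_of_real (norm (a n z))"] na by (simp add: g_def)
    also have "\<dots> \<le> T" unfolding T_def by (intro sum_le_suminf sm) auto
    finally show "Lp_norm M q (\<lambda>z. complex_of_real (g N z)) \<le> T" .
  qed
  have T0: "T \<ge> 0" unfolding T_def by (intro suminf_nonneg sm) auto
  have gi: "integrable M (\<lambda>z. g N z powr q)" "(\<integral>z. g N z powr q \<partial>M) \<le> T powr q" for N
  proof -
    show "integrable M (\<lambda>z. g N z powr q)" using Lp_integrable[OF gL(1)[of N]] g0 by simp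
    have "(\<integral>z. g N z powr q \<partial>M) = Lp_norm M q (\<lambda>z. complex_of_real (g N z)) powr q"
      using Lp_norm_powr[of q M "\<lambda>z. complex_of_real (g N z)"] q g0 by simp
    also have "\<dots> \<le> T powr q" using gL(2) q by (intro powr_mono2) auto
    finally show "(\<integral>z. g N z powr q \<partial>M) \<le> T powr q" .
  qed
  have gmono: "g N z \<le> g (Suc N) z" for N z by (simp add: g_def)
  \<comment> \<open>The supremum is taken in the extended reals, since the series may diverge on a
    null set. \<open>G\<close> below is the real sum of moduli, set to 0 where it diverges.\<close>
  define U where "U = (\<lambda>z. SUP N. ennreal (g N z powr q))"
  have [measurable]: "g N \<in> borel_measurable M" for N unfolding g_def by measurable
  have [measurable]: "U \<in> borel_measurable M" unfolding U_def by measurable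
  have Uint: "(\<integral>\<^sup>+z. U z \<partial>M) \<le> ennreal (T powr q)"
  proof -
    have "(\<integral>\<^sup>+z. U z \<partial>M) = (SUP N. \<integral>\<^sup>+z. ennreal (g N z powr q) \<partial>M)"
      unfolding U_def
    proof (rule nn_integral_monotone_convergence_SUP)
      show "incseq (\<lambda>N z. ennreal (g N z powr q))"
        using gmono g0 q by (intro incseq_SucI le_funI ennreal_leI powr_mono2) auto
    qed measurable
    also have "\<dots> \<le> ennreal (T powr q)"
      using gi by (intro SUP_least) (simp add: nn_integral_eq_integral)
    finally show ?thesis .
  qed
  have "AE z in M. U z \<noteq> \<infinity>"
    by (rule nn_integral_PInf_AE) (use Uint in \<open>auto simp: top_unique\<close>)
  then have summ: "AE z in M. summable (\<lambda>n. norm (a n z))"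
  proof eventually_elim
    fix z assume "U z \<noteq> \<infinity>"
    then obtain u where u: "u \<ge> 0" "U z = ennreal u" by (cases "U z") auto
    have "g N z \<le> u powr (1 / q)" for N
    proof -
      have "ennreal (g N z powr q) \<le> U z" unfolding U_def by (rule SUP_upper) simp
      then have "g N z powr q \<le> u" using u by simp
      then have "(g N z powr q) powr (1 / q) \<le> u powr (1 / q)" using q by (intro powr_mono2) auto
      then show ?thesis using q g0 by (simp add: powr_powr)
    qed
    then show "summable (\<lambda>n. norm (a n z))"
      by (intro bounded_imp_summable[of _ "u powr (1/q)"]) (simp_all only: norm_ge_zero lessThan_Suc_atMost[symmetric] g_def)
  qed
  define G where "G = (\<lambda>z. if summable (\<lambda>n. norm (a n z)) then \<Sum>n. norm (a n z) else 0)"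
  have G0: "G z \<ge> 0" for z by (simp add: G_def suminf_nonneg)
  have [measurable]: "(\<lambda>z. \<Sum>n. norm (a n z)) \<in> borel_measurable M" by measurable
  have GU: "AE z in M. ennreal (G z powr q) \<le> U z"
    using summ
  proof eventually_elim
    fix z assume s: "summable (\<lambda>n. norm (a n z))"
    then have "(\<lambda>N. g N z) \<longlonglongrightarrow> G z" by (simp add: g_def G_def summable_LIMSEQ)
    then have "(\<lambda>N. ennreal (g N z powr q)) \<longlonglongrightarrow> ennreal (G z powr q)"
      using q g0 by (intro tendsto_ennrealI tendsto_powr2 tendsto_const) auto
    then show "ennreal (G z powr q) \<le> U z"
      by (rule LIMSEQ_le_const2) (intro exI allI impI, unfold U_def, rule SUP_upper, simp)
  qed
  have Gm: "G \<in> borel_measurable M"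
  proof -
    have "(\<lambda>z. if Cauchy (\<lambda>N. g N z) then \<Sum>n. norm (a n z) else 0) \<in> borel_measurable M"
      by measurable
    moreover have "Cauchy (\<lambda>N. g N z) \<longleftrightarrow> summable (\<lambda>n. norm (a n z))" for z
      by (simp add: g_def summable_iff_convergent Cauchy_convergent_iff)
    ultimately show ?thesis by (simp add: G_def[abs_def])
  qed
  note [measurable] = Gm
  have Gi: "integrable M (\<lambda>z. G z powr q)"
  proof (rule integrableI_bounded)
    have "(\<integral>\<^sup>+z. ennreal (norm (G z powr q)) \<partial>M) \<le> (\<integral>\<^sup>+z. U z \<partial>M)"
      using GU by (intro nn_integral_mono_AE) auto
    also have "\<dots> < \<infinity>" using Uint by (rule order.strict_trans1) simp
    finally show "(\<integral>\<^sup>+z. ennreal (norm (G z powr q)) \<partial>M) < \<infinity>" .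
  qed measurable
  define F where "F = (\<lambda>z. \<Sum>n. a n z)"
  have [measurable]: "F \<in> borel_measurable M" unfolding F_def by measurable
  have bd: "AE z in M. norm (F z - (\<Sum>n<N. a n z)) \<le> G z" for N
    using summ
  proof eventually_elim
    fix z assume s: "summable (\<lambda>n. norm (a n z))"
    then have s': "summable (\<lambda>n. a n z)" by (rule summable_norm_cancel)
    have s2: "summable (\<lambda>n. norm (a (n + N) z))" using s summable_iff_shift[of "\<lambda>n. norm (a n z)"] by blast
    have "F z - (\<Sum>n<N. a n z) = (\<Sum>n. a (n + N) z)"
      unfolding F_def using suminf_minus_initial_segment[OF s'] by simp
    also have "norm \<dots> \<le> (\<Sum>n. norm (a (n + N) z))" by (rule summable_norm[OF s2])
    also have "\<dots> = (\<Sum>n. norm (a n z)) - (\<Sum>n<N. norm (a n z))" by (rule suminf_minus_initial_segment[OF s])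
    also have "\<dots> \<le> G z" using s by (simp add: G_def sum_nonneg)
    finally show "norm (F z - (\<Sum>n<N. a n z)) \<le> G z" .
  qed
  show ?thesis
  proof (intro bexI)
    show "(\<lambda>N. Lp_norm M q (\<lambda>z. F z - (\<Sum>n<N. a n z))) \<longlonglongrightarrow> 0"
    proof (rule Lp_norm_tendsto_0[OF _ Gi G0 _ bd])
      show "AE z in M. (\<lambda>N. F z - (\<Sum>n<N. a n z)) \<longlonglongrightarrow> 0"
        using summ
      proof eventually_elim
        fix z assume "summable (\<lambda>n. norm (a n z))"
        then have "(\<lambda>N. \<Sum>n<N. a n z) \<longlonglongrightarrow> F z"
          unfolding F_def by (rule summable_LIMSEQ[OF summable_norm_cancel])
        from tendsto_diff[OF tendsto_const[of "F z"] this, unfolded diff_self]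
        show "(\<lambda>N. F z - (\<Sum>n<N. a n z)) \<longlonglongrightarrow> 0" .
      qed
    next
      show "0 < q" using q by simp
      show "(\<lambda>z. F z - (\<Sum>n<N. a n z)) \<in> borel_measurable M" for N by measurable
    qed
    have "integrable M (\<lambda>z. norm (F z) powr q)"
    proof (rule Bochner_Integration.integrable_bound[OF Gi])
      show "AE z in M. norm (norm (F z) powr q) \<le> norm (G z powr q)"
        using bd[of 0]
      proof eventually_elim
        fix z assume "norm (F z - (\<Sum>n<0. a n z)) \<le> G z"
        then have "norm (F z) powr q \<le> G z powr q" using q by (intro powr_mono2) auto
        then show "norm (norm (F z) powr q) \<le> norm (G z powr q)" by simp
      qed
    qed measurable
    then show "F \<in> Lp M q" by (simp add: Lp_def)
  qed
qed

section \<open>Modulation spaces\<close>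

context window
begin

text \<open>The reproducing kernel: up to the factor \<open>energy\<close>, integration against it
  fixes every short-time Fourier transform. Its values are inner products of atoms.\<close>

definition kern :: "real \<times> real \<Rightarrow> real \<times> real \<Rightarrow> complex" where
  "kern z' z = coef \<psi> (atom cw z') z"

lemma kern_eq: "kern z' z = (\<integral>t. cnj (atom cw z t) * atom cw z' t \<partial>lborel)"
  by (simp add: kern_def coef_eq)

lemma kern_cnj: "cnj (kern z' z) = kern z z'"
proof -
  have "cnj (kern z' z) = (\<integral>t. cnj (cnj (atom cw z t) * atom cw z' t) \<partial>lborel)"
    unfolding kern_eq by (rule Bochner_Integration.integral_cnj[symmetric])
  also have "\<dots> = kern z z'"
    unfolding kern_eq complex_cnj_mult complex_cnj_cnj by (simp only: mult.commute)
  finally show ?thesis .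
qed

text \<open>The kernel is that of a twisted convolution: after shifting the integration variable,
  only a unimodular phase depends on more than \<open>z - z'\<close>.\<close>

lemma norm_kern: "norm (kern z' z) = norm (coef \<psi> cw (z - z'))"
proof -
  obtain x w where z: "z = (x, w)" by (cases z)
  obtain x' w' where z': "z' = (x', w')" by (cases z')
  let ?e = "\<lambda>s. exp (2 * of_real pi * \<i> * complex_of_real s)"
  have "kern z' z = (\<integral>t. cnj (atom cw z (t + x')) * atom cw z' (t + x') \<partial>lborel)"
    unfolding kern_eq by (rule lborel_translate(1)[symmetric])
  also have "\<dots> = (\<integral>t. ?e ((w - w') * x') * (modulate (w - w') (translate (x - x') \<psi>) t * cw t) \<partial>lborel)"
  proof (rule Bochner_Integration.integral_cong[OF refl])
    fix t
    have e1: "?e ((w - w') * x') * exp (2 * of_real pi * \<i> * of_real (w - w') * of_real t) =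
        exp (2 * of_real pi * \<i> * of_real w * of_real (t + x')) * exp (2 * of_real pi * \<i> * of_real (- w') * of_real (t + x'))"
      unfolding exp_add[symmetric] by (rule arg_cong[of _ _ exp]) (simp add: algebra_simps)
    have "cnj (atom cw z (t + x')) * atom cw z' (t + x') =
        (exp (2 * of_real pi * \<i> * of_real w * of_real (t + x')) * exp (2 * of_real pi * \<i> * of_real (- w') * of_real (t + x'))) *
        (\<psi> (t + x' - x) * cw t)"
      by (simp add: z z' atom_cw[of "(x, w)"] modulate_def translate_def) (simp add: atom_def modulate_def translate_def)
    also have "\<dots> = ?e ((w - w') * x') * (modulate (w - w') (translate (x - x') \<psi>) t * cw t)"
      unfolding e1[symmetric] by (simp add: modulate_def translate_def algebra_simps)
    finally show "cnj (atom cw z (t + x')) * atom cw z' (t + x') =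
        ?e ((w - w') * x') * (modulate (w - w') (translate (x - x') \<psi>) t * cw t)" .
  qed
  also have "\<dots> = ?e ((w - w') * x') * coef \<psi> cw (z - z')"
    by (simp add: coef_def z z')
  also have "norm \<dots> = norm (?e ((w - w') * x')) * norm (coef \<psi> cw (z - z'))" by (rule norm_mult)
  also have "2 * of_real pi * \<i> * complex_of_real ((w - w') * x') = \<i> * of_real (2 * pi * ((w - w') * x'))" by simp
  then have "norm (?e ((w - w') * x')) = 1" by (metis norm_exp_i_times)
  finally show ?thesis by simp
qed

text \<open>Chosen once for the window, so that \<open>env\<close> and \<open>kmass\<close> do not
  depend on an exponent and later constants can be uniform in \<open>q\<close>.\<close>

definition kbound :: real where
  "kbound = (SOME C. \<forall>z. weight z ^ 2 * norm (coef \<psi> cw z) \<le> C)"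

definition env :: "real \<times> real \<Rightarrow> real" where
  "env z = kbound * inverse (weight z ^ 2)"

definition kmass :: real where
  "kmass = (\<integral>z. env z \<partial>lborel)"

lemma coef_cw_bound: "weight z ^ 2 * norm (coef \<psi> cw z) \<le> kbound"
proof -
  have "\<exists>C. \<forall>z. weight z ^ 2 * norm (coef \<psi> cw z) \<le> C"
    by (rule coef_decay[OF \<psi>, of 2]) (use cw in blast)
  from someI_ex[OF this] show ?thesis unfolding kbound_def by blast
qed

lemma kbound_nonneg: "kbound \<ge> 0"
  by (rule order_trans[OF _ coef_cw_bound[of 0]]) simp

lemma env: "integrable lborel env" "0 \<le> env z" "env (- z) = env z" "env \<in> borel_measurable borel"
proof -
  show "integrable lborel env" unfolding env_def[abs_def] by (intro integrable_mult_right integrable_weight)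
  show "env \<in> borel_measurable borel" unfolding env_def[abs_def] by measurable
qed (auto simp: env_def weight_def kbound_nonneg)

lemma kmass_nonneg: "kmass \<ge> 0"
  unfolding kmass_def by (intro Bochner_Integration.integral_nonneg env)

lemma norm_kern_le: "norm (kern z' z) \<le> env (z - z')"
proof -
  have "norm (coef \<psi> cw (z - z')) \<le> kbound / weight (z - z') ^ 2"
    using coef_cw_bound[of "z - z'"] by (simp add: pos_le_divide_eq mult.commute)
  then show ?thesis by (simp add: norm_kern env_def divide_inverse)
qed

lemma inverse_weight_Lp:
  assumes "r > 1"
  shows "(\<lambda>z. of_real (inverse (weight z ^ 2))) \<in> Lp lborel r"
proof -
  have "integrable lborel (\<lambda>z. norm (complex_of_real (inverse (weight z ^ 2))) powr r)"
  proof (rule integrable_boundI[OF integrable_weight])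
    fix z
    have "inverse (weight z ^ 2) \<le> 1" using one_le_power[OF weight_ge_1[of z], of 2] by (simp add: inverse_le_1_iff)
    then have "inverse (weight z ^ 2) powr r \<le> inverse (weight z ^ 2) powr 1"
      using assms by (intro powr_mono') auto
    then show "norm (norm (complex_of_real (inverse (weight z ^ 2))) powr r) \<le> inverse (weight z ^ 2)"
      by (simp del: of_real_inverse of_real_power add: norm_of_real)
  qed measurable
  then show ?thesis by (simp add: Lp_def)
qed

text \<open>Combined with Hoelder, the bound by a Schwartz norm of \<open>\<phi>\<close> is the
  continuity of \<open>synth F\<close>, hence its temperedness.\<close>

lemma coef_Lp:
  assumes r: "r > 1"
  obtains C K where "C \<ge> 0" "\<And>\<phi>. \<phi> \<in> Schwartz \<Longrightarrow> coef \<psi> \<phi> \<in> Lp lborel r"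
    "\<And>\<phi>. \<phi> \<in> Schwartz \<Longrightarrow> Lp_norm lborel r (coef \<psi> \<phi>) \<le> C * Schwartz_norm K \<phi>"
proof -
  obtain C K where C: "C \<ge> 0" "\<And>\<phi> z. \<phi> \<in> Schwartz \<Longrightarrow> weight z ^ 2 * norm (coef \<psi> \<phi> z) \<le> C * Schwartz_norm K \<phi>"
    using coef_decay[OF \<psi>, of 2] by metis
  let ?w = "\<lambda>z. complex_of_real (inverse (weight z ^ 2))"
  have *: "coef \<psi> \<phi> \<in> Lp lborel r \<and> Lp_norm lborel r (coef \<psi> \<phi>) \<le> C * Lp_norm lborel r ?w * Schwartz_norm K \<phi>"
    if \<phi>: "\<phi> \<in> Schwartz" for \<phi>
  proof -
    let ?g = "\<lambda>z. complex_of_real (C * Schwartz_norm K \<phi>) * ?w z"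
    have g: "?g \<in> Lp lborel r" "Lp_norm lborel r ?g = C * Schwartz_norm K \<phi> * Lp_norm lborel r ?w"
      using Lp_scale[OF inverse_weight_Lp[OF r], of "complex_of_real (C * Schwartz_norm K \<phi>)"] r C(1) Schwartz_norm_nonneg[OF \<phi>]
      by (auto simp: abs_mult simp del: of_real_mult)
    have le: "norm (coef \<psi> \<phi> z) \<le> norm (?g z)" for z
    proof -
      have "norm (coef \<psi> \<phi> z) \<le> C * Schwartz_norm K \<phi> / weight z ^ 2"
        using C(2)[OF \<phi>, of z] by (simp add: pos_le_divide_eq mult.commute)
      also have "\<dots> = norm (?g z)"
        using C(1) Schwartz_norm_nonneg[OF \<phi>, of K]
        by (simp add: divide_inverse abs_mult norm_mult norm_inverse norm_power)
      finally show ?thesis .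
    qed
    show ?thesis
      using Lp_norm_mono[OF _ g(1) _ le] coef_measurable[OF \<phi>] r g(2) by (simp add: mult_ac)
  qed
  show ?thesis by (rule that[of "C * Lp_norm lborel r ?w" K]) (use * C(1) in auto)
qed

lemma env_shift_Lp:
  assumes "r > 1"
  shows "(\<lambda>z. complex_of_real (env (z - z'))) \<in> Lp lborel r"
    "Lp_norm lborel r (\<lambda>z. complex_of_real (env (z - z'))) = Lp_norm lborel r (\<lambda>z. complex_of_real (env z))"
proof -
  have e: "(\<lambda>z. complex_of_real (env z)) \<in> Lp lborel r"
    using Lp_scale(1)[OF inverse_weight_Lp[OF assms], of "of_real kbound"] assms by (simp add: env_def)
  note [measurable] = env(4)
  show "(\<lambda>z. complex_of_real (env (z - z'))) \<in> Lp lborel r"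
    using Lp_integrable[OF e] lborel_translate(2)[of "\<lambda>z. norm (complex_of_real (env z)) powr r" "- z'"]
    by (simp add: Lp_def)
  show "Lp_norm lborel r (\<lambda>z. complex_of_real (env (z - z'))) = Lp_norm lborel r (\<lambda>z. complex_of_real (env z))"
    using lborel_translate(1)[of "\<lambda>z. norm (complex_of_real (env z)) powr r" "- z'"] by (simp add: Lp_norm_def)
qed

lemma kern_measurable: "(\<lambda>(z', z). kern z' z) \<in> borel_measurable borel"
proof -
  note [measurable] = measurable_shift[unfolded case_prod_unfold]
  have cnj [measurable]: "cnj \<in> borel_measurable borel"
    by (intro borel_measurable_continuous_onI continuous_intros)
  have "(\<lambda>((z', z), t). modulate (snd z) (translate (fst z) \<psi>) t * cnj (modulate (snd z') (translate (fst z') \<psi>) t)) \<in> borel_measurable borel"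
  proof -
    have p: "(\<lambda>a::((real \<times> real) \<times> real \<times> real) \<times> real. (snd (fst a), snd a)) \<in> borel_measurable borel"
      "(\<lambda>a::((real \<times> real) \<times> real \<times> real) \<times> real. (fst (fst a), snd a)) \<in> borel_measurable borel"
      by (intro borel_measurable_continuous_onI continuous_intros)+
    show ?thesis
      using measurable_compose[OF p(1) measurable_shift] measurable_compose[OF measurable_compose[OF p(2) measurable_shift] cnj]
      by (simp add: case_prod_unfold)
  qed
  then have "(\<lambda>(a, t). (\<lambda>(z', z). modulate (snd z) (translate (fst z) \<psi>) t * cnj (modulate (snd z') (translate (fst z') \<psi>) t)) a)
      \<in> borel_measurable (borel \<Otimes>\<^sub>M lborel)"
    by (subst measurable_cong_sets[OF sets_pair_measure_cong[OF refl sets_lborel] refl])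
      (simp add: borel_prod case_prod_unfold)
  then have "(\<lambda>a. \<integral>t. (\<lambda>(z', z). modulate (snd z) (translate (fst z) \<psi>) t * cnj (modulate (snd z') (translate (fst z') \<psi>) t)) a \<partial>lborel)
      \<in> borel_measurable borel"
    by (rule lborel.borel_measurable_lebesgue_integral)
  then show ?thesis by (simp add: kern_eq atom_cw case_prod_unfold)
qed

lemma kern_measurable_snd: "kern z' \<in> borel_measurable borel"
  using coef_measurable[of "atom cw z'"] cw by (simp add: kern_def[abs_def])

lemma kern_Lp:
  assumes "r > 1"
  shows "kern z' \<in> Lp lborel r" "Lp_norm lborel r (kern z') \<le> Lp_norm lborel r (\<lambda>z. complex_of_real (env z))"
  using Lp_norm_mono[OF _ env_shift_Lp(1)[OF assms], of "kern z'" z'] kern_measurable_snd norm_kern_le env(2) assms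
    env_shift_Lp(2)[OF assms, of z'] by auto

text \<open>The distribution with coefficient function \<open>F\<close>, which may be any function
  in \<open>Lp\<close> and not just a transform. Division by \<open>energy\<close> makes it a left
  inverse of \<open>stft\<close>; the value 0 off the Schwartz space is demanded by
  \<open>tempered\<close>.\<close>

definition synth :: "(real \<times> real \<Rightarrow> complex) \<Rightarrow> distribution" where
  "synth F \<phi> = (if \<phi> \<in> Schwartz then (\<integral>z. F z * coef \<psi> \<phi> z \<partial>lborel) / of_real energy else 0)"

lemma conj_exponent: "q > 1 \<Longrightarrow> 1 / q + 1 / (q / (q - 1)) = (1::real)" "q > 1 \<Longrightarrow> q / (q - 1) > 1"
  by (auto simp: field_simps)

lemma synth_integrable:
  assumes F: "F \<in> Lp lborel q" "q > 1" and \<phi>: "\<phi> \<in> Schwartz"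
  shows "integrable lborel (\<lambda>z. F z * coef \<psi> \<phi> z)"
proof -
  have "coef \<psi> \<phi> \<in> Lp lborel (q / (q - 1))"
    by (rule coef_Lp[OF conj_exponent(2)[OF F(2)]]) (use \<phi> in blast)
  then show ?thesis using Holder_mult(1)[OF F(1) _ F(2) conj_exponent(1)[OF F(2)]] by blast
qed

lemma synth_tempered:
  assumes F: "F \<in> Lp lborel q" "q > 1"
  shows "synth F \<in> tempered"
proof -
  let ?r = "q / (q - 1)"
  obtain C K where C: "C \<ge> 0" "\<And>\<phi>. \<phi> \<in> Schwartz \<Longrightarrow> coef \<psi> \<phi> \<in> Lp lborel ?r"
    "\<And>\<phi>. \<phi> \<in> Schwartz \<Longrightarrow> Lp_norm lborel ?r (coef \<psi> \<phi>) \<le> C * Schwartz_norm K \<phi>"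
    using coef_Lp[OF conj_exponent(2)[OF F(2)]] by metis
  have i: "integrable lborel (\<lambda>z. F z * coef \<psi> \<phi> z)" if "\<phi> \<in> Schwartz" for \<phi>
    using synth_integrable[OF F that] .
  have "norm (synth F \<phi>) \<le> Lp_norm lborel q F * C / energy * (\<Sum>m\<le>K. \<Sum>n\<le>K. Schwartz_seminorm m n \<phi>)" if \<phi>: "\<phi> \<in> Schwartz" for \<phi>
  proof -
    have "norm (\<integral>z. F z * coef \<psi> \<phi> z \<partial>lborel) \<le> Lp_norm lborel q F * Lp_norm lborel ?r (coef \<psi> \<phi>)"
      by (rule Holder_mult(2)[OF F(1) C(2)[OF \<phi>] F(2) conj_exponent(1)[OF F(2)]])
    also have "\<dots> \<le> Lp_norm lborel q F * (C * Schwartz_norm K \<phi>)"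
      by (intro mult_left_mono C(3) \<phi>) simp
    finally have "norm (\<integral>z. F z * coef \<psi> \<phi> z \<partial>lborel) / energy \<le> Lp_norm lborel q F * (C * Schwartz_norm K \<phi>) / energy"
      using energy_pos by (intro divide_right_mono) auto
    then show ?thesis
      using \<phi> energy_pos by (simp add: synth_def norm_divide Schwartz_norm_def mult.assoc)
  qed
  then have "\<exists>C K. \<forall>\<phi>\<in>Schwartz. norm (synth F \<phi>) \<le> C * (\<Sum>m\<le>K. \<Sum>n\<le>K. Schwartz_seminorm m n \<phi>)" by blast
  moreover have "synth F (\<lambda>t. \<phi> t + \<eta> t) = synth F \<phi> + synth F \<eta>" if "\<phi> \<in> Schwartz" "\<eta> \<in> Schwartz" for \<phi> \<eta>
    using that i[OF that(1)] i[OF that(2)] by (simp add: synth_def Schwartz_add coef_add distrib_left add_divide_distrib)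
  moreover have "synth F (\<lambda>t. c * \<phi> t) = c * synth F \<phi>" if "\<phi> \<in> Schwartz" for \<phi> c
    using that by (simp add: synth_def Schwartz_scale coef_scale mult.left_commute)
  ultimately show ?thesis by (auto simp: tempered_def synth_def)
qed

lemma tempered_outside: "u \<in> tempered \<Longrightarrow> \<phi> \<notin> Schwartz \<Longrightarrow> u \<phi> = 0"
  by (simp add: tempered_def)

lemma synth_stft: "u \<in> tempered \<Longrightarrow> synth (stft \<psi> u) = u"
  using stft_inversion[of u] energy_pos by (auto simp: synth_def tempered_outside)

lemma stft_synth: "stft \<psi> (synth F) z' = (\<integral>z. F z * kern z' z \<partial>lborel) / of_real energy"
  by (simp add: stft_eq synth_def kern_def cw)

lemma stft_measurable: "u \<in> tempered \<Longrightarrow> stft \<psi> u \<in> borel_measurable borel"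
  using measurable_tempered_atom[OF _ cw] by (simp add: stft_eq[abs_def])

lemma stft_continuous: "u \<in> tempered \<Longrightarrow> continuous_on S (stft \<psi> u)"
  using continuous_tempered_atom[OF _ cw] by (simp add: stft_eq[abs_def])

lemma norm_synth_integral_le:
  assumes F: "F \<in> Lp lborel q" "q > 1"
  shows "integrable lborel (\<lambda>z. norm (F z) * env (z - z'))"
    "norm (\<integral>z. F z * kern z' z \<partial>lborel) \<le> (\<integral>z. norm (F z) * env (z - z') \<partial>lborel)"
    "(\<integral>z. norm (F z * kern z' z) \<partial>lborel) \<le> (\<integral>z. norm (F z) * env (z - z') \<partial>lborel)"
    "integrable lborel (\<lambda>z. F z * kern z' z)"
proof -
  let ?r = "q / (q - 1)"
  note r = conj_exponent[OF F(2)]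
  show i1: "integrable lborel (\<lambda>z. norm (F z) * env (z - z'))"
    using Holder_integrable(1)[OF F(1) env_shift_Lp(1)[OF r(2)] F(2) r(1)] env(2) by simp
  show i2: "integrable lborel (\<lambda>z. F z * kern z' z)"
    by (rule Holder_mult(1)[OF F(1) kern_Lp(1)[OF r(2)] F(2) r(1)])
  have le: "norm (F z * kern z' z) \<le> norm (F z) * env (z - z')" for z
    unfolding norm_mult by (intro mult_left_mono norm_kern_le) simp
  show "norm (\<integral>z. F z * kern z' z \<partial>lborel) \<le> (\<integral>z. norm (F z) * env (z - z') \<partial>lborel)"
    by (rule Bochner_Integration.integral_norm_bound_integral[OF i2 i1 le])
  show "(\<integral>z. norm (F z * kern z' z) \<partial>lborel) \<le> (\<integral>z. norm (F z) * env (z - z') \<partial>lborel)"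
    by (rule integral_mono[OF integrable_norm[OF i2] i1 le])
qed

text \<open>\<open>stft\<close> after \<open>synth\<close> projects \<open>Lp\<close> onto the
  transforms. It is dominated by convolution with \<open>env\<close>, and the Schur test bounds it
  by \<open>kmass / energy\<close>, free of the exponent.\<close>

lemma stft_synth_Lp:
  assumes F: "F \<in> Lp lborel q" "q > 1"
  shows "stft \<psi> (synth F) \<in> Lp lborel q"
    "Lp_norm lborel q (stft \<psi> (synth F)) \<le> kmass / energy * Lp_norm lborel q F"
proof -
  define T where "T = (\<lambda>z'. complex_of_real (\<integral>z. norm (F z) * env (z - z') \<partial>lborel))"
  have T: "T \<in> Lp lborel q" "Lp_norm lborel q T \<le> kmass * Lp_norm lborel q F"
    unfolding T_def using Schur_convolution[OF F env(1-3) kmass_def] norm_synth_integral_le(1)[OF F] by auto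
  have T': "(\<lambda>z'. of_real (1 / energy) * T z') \<in> Lp lborel q"
    "Lp_norm lborel q (\<lambda>z'. of_real (1 / energy) * T z') = 1 / energy * Lp_norm lborel q T"
    using Lp_scale[OF T(1), of "of_real (1 / energy)"] F(2) energy_pos by (auto simp: norm_divide)
  have le: "norm (stft \<psi> (synth F) z') \<le> norm (of_real (1 / energy) * T z')" for z'
  proof -
    have "norm (T z') = (\<integral>z. norm (F z) * env (z - z') \<partial>lborel)"
      unfolding T_def using env(2) by (simp add: Bochner_Integration.integral_nonneg)
    then have "norm (\<integral>z. F z * kern z' z \<partial>lborel) / energy \<le> norm (T z') / energy"
      using norm_synth_integral_le(2)[OF F] energy_pos by (intro divide_right_mono) auto
    then show ?thesis using energy_pos by (simp add: stft_synth norm_divide norm_mult)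
  qed
  have m: "stft \<psi> (synth F) \<in> borel_measurable lborel"
    using stft_measurable[OF synth_tempered[OF F]] by simp
  show "stft \<psi> (synth F) \<in> Lp lborel q" using Lp_norm_mono(1)[OF m T'(1) _ le] F(2) by simp
  have "Lp_norm lborel q (stft \<psi> (synth F)) \<le> 1 / energy * Lp_norm lborel q T"
    using Lp_norm_mono(2)[OF m T'(1) _ le] F(2) T'(2) by simp
  also have "\<dots> \<le> 1 / energy * (kmass * Lp_norm lborel q F)" using energy_pos T(2) by (intro mult_left_mono) auto
  finally show "Lp_norm lborel q (stft \<psi> (synth F)) \<le> kmass / energy * Lp_norm lborel q F" by simp
qed

section \<open>Modulation spaces as retracts of Lebesgue spaces\<close>

abbreviation Mod :: "real \<Rightarrow> (real \<Rightarrow> complex) fspace" where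
  "Mod \<equiv> modulation_space \<psi>"

lemma Mod_iff: "u \<in> vectors (Mod q) \<longleftrightarrow> u \<in> tempered \<and> stft \<psi> u \<in> Lp lborel q"
  using stft_measurable by (auto simp: modulation_space_def Lp_def)

lemma Mod_nrm: "nrm (Mod q) u = Lp_norm lborel q (stft \<psi> u)"
  by (simp add: modulation_space_def Lp_norm_def)

lemma Mod_tempered: "u \<in> vectors (Mod q) \<Longrightarrow> u \<in> tempered" by (simp add: Mod_iff)

lemma Mod_Lp: "u \<in> vectors (Mod q) \<Longrightarrow> stft \<psi> u \<in> Lp lborel q" by (simp add: Mod_iff)

lemma synth_Mod:
  assumes "F \<in> Lp lborel q" "q > 1"
  shows "synth F \<in> vectors (Mod q)" "nrm (Mod q) (synth F) \<le> kmass / energy * Lp_norm lborel q F"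
  using synth_tempered[OF assms] stft_synth_Lp[OF assms] by (auto simp: Mod_iff Mod_nrm)

lemma stft_add: "stft \<psi> (\<lambda>s. u s + v s) = (\<lambda>z. stft \<psi> u z + stft \<psi> v z)"
  by (rule ext) (simp add: stft_eq)

lemma stft_scale: "stft \<psi> (\<lambda>s. c * u s) = (\<lambda>z. c * stft \<psi> u z)"
  by (rule ext) (simp add: stft_eq)

lemma stft_sum: "stft \<psi> (\<lambda>s. \<Sum>i\<in>I. u i s) = (\<lambda>z. \<Sum>i\<in>I. stft \<psi> (u i) z)"
  by (rule ext) (simp add: stft_eq)

lemma synth_add:
  assumes "F \<in> Lp lborel q" "q > 1" "G \<in> Lp lborel r" "r > 1"
  shows "synth (\<lambda>z. F z + G z) = (\<lambda>s. synth F s + synth G s)"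
  using synth_integrable[OF assms(1,2)] synth_integrable[OF assms(3,4)]
  by (auto simp: synth_def distrib_right add_divide_distrib)

lemma synth_diff:
  assumes "F \<in> Lp lborel q" "G \<in> Lp lborel q" "q > 1"
  shows "synth (\<lambda>z. F z - G z) = (\<lambda>s. synth F s - synth G s)"
  using synth_integrable[OF assms(1,3)] synth_integrable[OF assms(2,3)]
  by (auto simp: synth_def left_diff_distrib diff_divide_distrib)

lemma synth_scale: "synth (\<lambda>z. c * F z) = (\<lambda>s. c * synth F s)"
  by (auto simp: synth_def mult.assoc)

lemma normed_Mod:
  assumes q: "q > 1"
  shows "normed_fspace (Mod q)"
proof
  have z: "(\<lambda>_::real \<times> real. 0::complex) \<in> Lp lborel q" by (simp add: Lp_def)
  show "(\<lambda>_. 0) \<in> vectors (Mod q)"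
    using synth_Mod(1)[OF z q] by (simp add: synth_def[abs_def] cong: if_cong)
  fix f assume f: "f \<in> vectors (Mod q)"
  have fs: "synth (stft \<psi> f) = f" using f by (simp add: synth_stft Mod_iff)
  show "(\<lambda>s. c * f s) \<in> vectors (Mod q)" for c
    using synth_Mod(1)[OF Lp_scale(1)[OF Mod_Lp[OF f]] q, of c] q by (simp add: synth_scale fs)
  show "0 \<le> nrm (Mod q) f" by (simp add: Mod_nrm)
  show "nrm (Mod q) (\<lambda>s. c * f s) = norm c * nrm (Mod q) f" for c
    using Lp_scale(2)[OF Mod_Lp[OF f], of c] q by (simp add: Mod_nrm stft_scale)
  fix h assume h: "h \<in> vectors (Mod q)"
  have hs: "synth (stft \<psi> h) = h" using h by (simp add: synth_stft Mod_iff)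
  show "(\<lambda>s. f s + h s) \<in> vectors (Mod q)"
    using synth_Mod(1)[OF Lp_add[OF Mod_Lp[OF f] Mod_Lp[OF h]] q] synth_add[OF Mod_Lp[OF f] q Mod_Lp[OF h] q] q
    by (simp add: fs hs)
  show "nrm (Mod q) (\<lambda>s. f s + h s) \<le> nrm (Mod q) f + nrm (Mod q) h"
    using Lp_norm_triangle[OF Mod_Lp[OF f] Mod_Lp[OF h] q] by (simp add: Mod_nrm stft_add)
qed

text \<open>The transforms are summed in \<open>Lp\<close>. Since \<open>synth\<close> is bounded
  and maps the partial sums of transforms back to those of the series, the synthesised limit is the
  required sum, whether or not the limit in \<open>Lp\<close> is a transform.\<close>

lemma banach_Mod:
  assumes q: "q > 1"
  shows "banach_fspace (Mod q)"
proof -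
  interpret normed_fspace "Mod q" by (rule normed_Mod[OF q])
  interpret L: normed_fspace "Lp_space lborel q" by (rule normed_Lp[OF q])
  show ?thesis
  proof
    fix y assume y: "\<And>n. y n \<in> vectors (Mod q)" and "summable (\<lambda>n. nrm (Mod q) (y n))"
    then have "summable (\<lambda>n. Lp_norm lborel q (stft \<psi> (y n)))" by (simp add: Mod_nrm)
    from Lp_complete[OF q Mod_Lp[OF y] this] obtain F where F: "F \<in> Lp lborel q"
      "(\<lambda>N. Lp_norm lborel q (\<lambda>z. F z - (\<Sum>n<N. stft \<psi> (y n) z))) \<longlonglongrightarrow> 0" by blast
    have S: "(\<lambda>z. \<Sum>n<N. stft \<psi> (y n) z) \<in> Lp lborel q" for N
      using L.sum_mem[of "{..<N}" "\<lambda>n. stft \<psi> (y n)"] Mod_Lp[OF y] by simp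
    have synS: "synth (\<lambda>z. \<Sum>n<N. stft \<psi> (y n) z) = (\<lambda>s. \<Sum>n<N. y n s)" for N
      using synth_stft[OF Mod_tempered[OF sum_mem[of "{..<N}" y]]] y by (simp add: stft_sum)
    have eq: "(\<lambda>s. synth F s - (\<Sum>n<N. y n s)) = synth (\<lambda>z. F z - (\<Sum>n<N. stft \<psi> (y n) z))" for N
      by (simp add: synth_diff[OF F(1) S q] synS)
    have "(\<lambda>N. nrm (Mod q) (\<lambda>s. synth F s - (\<Sum>n<N. y n s))) \<longlonglongrightarrow> 0"
    proof (rule tendsto_sandwich[OF _ _ tendsto_const])
      show "\<forall>\<^sub>F N in sequentially. 0 \<le> nrm (Mod q) (\<lambda>s. synth F s - (\<Sum>n<N. y n s))"
        by (simp add: Mod_nrm)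
      show "\<forall>\<^sub>F N in sequentially. nrm (Mod q) (\<lambda>s. synth F s - (\<Sum>n<N. y n s)) \<le>
          kmass / energy * Lp_norm lborel q (\<lambda>z. F z - (\<Sum>n<N. stft \<psi> (y n) z))"
        unfolding eq using q by (intro always_eventually allI synth_Mod(2) Lp_diff F S) auto
      show "(\<lambda>N. kmass / energy * Lp_norm lborel q (\<lambda>z. F z - (\<Sum>n<N. stft \<psi> (y n) z))) \<longlonglongrightarrow> 0"
        using tendsto_mult_left[OF F(2), of "kmass / energy"] by simp
    qed
    then show "\<exists>f. series_converges_to (Mod q) y f"
      using synth_Mod(1)[OF F(1) q] by (auto simp: series_converges_to_def)
  qed
qed

section \<open>The duality pairing\<close>

lemma pairing_eq: "modulation_pairing \<psi> u v = (\<integral>z. stft \<psi> u z * cnj (stft \<psi> v z) \<partial>lborel) / of_real energy"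
  by (simp add: modulation_pairing_def energy_def)

lemma pairing_cnj: "cnj (modulation_pairing \<psi> u v) = modulation_pairing \<psi> v u"
proof -
  have "cnj (\<integral>z. stft \<psi> u z * cnj (stft \<psi> v z) \<partial>lborel) = (\<integral>z. cnj (stft \<psi> u z * cnj (stft \<psi> v z)) \<partial>lborel)"
    by (rule Bochner_Integration.integral_cnj[symmetric])
  then show ?thesis by (simp add: pairing_eq mult.commute)
qed

lemma pairing_bound:
  assumes "u \<in> vectors (Mod q)" "v \<in> vectors (Mod r)" "q > 1" "1 / q + 1 / r = 1"
  shows "norm (modulation_pairing \<psi> u v) \<le> nrm (Mod q) u * nrm (Mod r) v / energy"
  using Holder(2)[OF Mod_Lp[OF assms(1)] Mod_Lp[OF assms(2)] assms(3,4)] energy_pos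
  by (simp add: pairing_eq norm_divide Mod_nrm divide_right_mono)

lemma pairing_add:
  assumes "u \<in> vectors (Mod q)" "u' \<in> vectors (Mod q)" "v \<in> vectors (Mod r)" "q > 1" "1 / q + 1 / r = 1"
  shows "modulation_pairing \<psi> (\<lambda>s. u s + u' s) v = modulation_pairing \<psi> u v + modulation_pairing \<psi> u' v"
  using Holder(1)[OF Mod_Lp[OF assms(1)] Mod_Lp[OF assms(3)] assms(4,5)]
    Holder(1)[OF Mod_Lp[OF assms(2)] Mod_Lp[OF assms(3)] assms(4,5)]
  by (simp add: pairing_eq stft_add distrib_right add_divide_distrib)

lemma pairing_scale: "modulation_pairing \<psi> (\<lambda>s. c * u s) v = c * modulation_pairing \<psi> u v"
  by (simp add: pairing_eq stft_scale mult.assoc)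

lemma pairing_dual:
  assumes v: "v \<in> vectors (Mod r)" and q: "q > 1" "1 / q + 1 / r = 1"
  shows "(\<lambda>u. modulation_pairing \<psi> u v) \<in> dual (Mod q)"
proof -
  have "norm (modulation_pairing \<psi> u v) \<le> nrm (Mod r) v / energy * nrm (Mod q) u" if "u \<in> vectors (Mod q)" for u
    using pairing_bound[OF that v q] by (simp add: mult.commute)
  then show ?thesis
    unfolding dual_def using pairing_add[OF _ _ v q] pairing_scale by blast
qed

text \<open>\<open>synth\<close> is, up to \<open>energy\<close>, the adjoint of
  \<open>stft\<close>. Fubini moves the kernel onto the transform of \<open>v\<close>, which it
  reproduces; absolute integrability comes from replacing the kernel by its envelope.\<close>

theorem pairing_synth:
  assumes F: "F \<in> Lp lborel q" and v: "v \<in> vectors (Mod r)" and q: "q > 1" "1 / q + 1 / r = 1"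
  shows "modulation_pairing \<psi> (synth F) v = (\<integral>z. F z * cnj (stft \<psi> v z) \<partial>lborel) / of_real energy"
proof -
  note r = conj_exponent_eqs(1,2)[OF q]
  let ?V = "stft \<psi> v"
  have V: "?V \<in> Lp lborel r" by (rule Mod_Lp[OF v])
  note [measurable] = kern_measurable[unfolded case_prod_unfold]
  have [measurable]: "cnj \<in> borel_measurable borel"
    by (intro borel_measurable_continuous_onI continuous_intros)
  have [measurable]: "F \<in> borel_measurable borel" "?V \<in> borel_measurable borel"
    using LpD[OF F] LpD[OF V] by auto
  define f where "f = (\<lambda>z' z. F z * kern z' z * cnj (?V z'))"
  have fub: "(\<integral>z'. (\<integral>z. f z' z \<partial>lborel) \<partial>lborel) = (\<integral>z. (\<integral>z'. f z' z \<partial>lborel) \<partial>lborel)"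
  proof (rule Fubini_lborel(1))
    show m: "(\<lambda>(z', z). f z' z) \<in> borel_measurable borel"
      unfolding f_def case_prod_unfold by measurable
    show "integrable lborel (f z')" for z'
      unfolding f_def by (intro integrable_mult_left norm_synth_integral_le(4)[OF F q(1)])
    define T where "T = (\<lambda>z'. complex_of_real (\<integral>z. norm (F z) * env (z - z') \<partial>lborel))"
    have T: "T \<in> Lp lborel q"
      unfolding T_def using Schur_convolution(1)[OF F q(1) env(1-3) kmass_def] norm_synth_integral_le(1)[OF F q(1)] by auto
    show "integrable lborel (\<lambda>z'. \<integral>z. norm (f z' z) \<partial>lborel)"
    proof (rule integrable_boundI[OF Holder_integrable(1)[OF T V q]])
      have "(\<lambda>(z', z). norm (f z' z)) \<in> borel_measurable borel"
        using m by (simp add: case_prod_unfold)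
      then have "(\<lambda>(z', z). norm (f z' z)) \<in> borel_measurable (borel \<Otimes>\<^sub>M lborel)"
        by (subst measurable_cong_sets[OF sets_pair_measure_cong[OF refl sets_lborel] refl]) (simp add: borel_prod)
      from lborel.borel_measurable_lebesgue_integral[OF this]
      show "(\<lambda>z'. \<integral>z. norm (f z' z) \<partial>lborel) \<in> borel_measurable lborel" by simp
      fix z'
      have "(\<integral>z. norm (f z' z) \<partial>lborel) = (\<integral>z. norm (F z * kern z' z) \<partial>lborel) * norm (?V z')"
        by (simp add: f_def norm_mult)
      also have "\<dots> \<le> (\<integral>z. norm (F z) * env (z - z') \<partial>lborel) * norm (?V z')"
        by (intro mult_right_mono norm_synth_integral_le(3)[OF F q(1)]) simp
      also have "(\<integral>z. norm (F z) * env (z - z') \<partial>lborel) = norm (T z')"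
        unfolding T_def using env(2) by (simp add: Bochner_Integration.integral_nonneg)
      finally show "norm (\<integral>z. norm (f z' z) \<partial>lborel) \<le> norm (T z') * norm (?V z')"
        by (simp add: Bochner_Integration.integral_nonneg)
    qed
  qed
  have inner: "(\<integral>z'. f z' z \<partial>lborel) = of_real energy * (F z * cnj (?V z))" for z
  proof -
    have "(\<integral>z'. kern z' z * cnj (?V z') \<partial>lborel) = (\<integral>z'. cnj (?V z' * kern z z') \<partial>lborel)"
      by (simp add: kern_cnj mult.commute)
    also have "\<dots> = cnj (\<integral>z'. ?V z' * kern z z' \<partial>lborel)" by (rule Bochner_Integration.integral_cnj)
    also have "(\<integral>z'. ?V z' * kern z z' \<partial>lborel) = of_real energy * ?V z"
      unfolding kern_def using stft_inversion[OF Mod_tempered[OF v], of "atom cw z"] cw by (simp add: stft_eq)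
    finally show ?thesis by (simp add: f_def mult.assoc mult.left_commute)
  qed
  have "(\<integral>z'. stft \<psi> (synth F) z' * cnj (?V z') \<partial>lborel) = (\<integral>z'. (\<integral>z. f z' z \<partial>lborel) \<partial>lborel) / of_real energy"
    by (simp add: stft_synth f_def)
  also have "\<dots> = (\<integral>z. F z * cnj (?V z) \<partial>lborel)"
    unfolding fub inner using energy_pos by simp
  finally show ?thesis by (simp add: pairing_eq)
qed

text \<open>The norming function of \<open>stft \<psi> u\<close> in \<open>Lp\<close> is in general
  not a transform. Synthesising it keeps its pairing with \<open>u\<close> by
  \<open>pairing_synth\<close>, while its norm is only bounded by
  \<open>kmass / energy\<close>.\<close>

lemma norming_Mod:
  assumes u: "u \<in> vectors (Mod q)" and q: "q > 1" "1 / q + 1 / r = 1"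
  obtains h where "h \<in> vectors (Mod r)" "nrm (Mod r) h \<le> kmass / energy"
    "modulation_pairing \<psi> u h = of_real (nrm (Mod q) u / energy)"
proof -
  note r = conj_exponent_eqs(1,2)[OF q]
  have rq: "1 / r + 1 / q = 1" using q by simp
  obtain G where G: "G \<in> Lp lborel r" "Lp_norm lborel r G \<le> 1"
    "(\<integral>z. stft \<psi> u z * cnj (G z) \<partial>lborel) = of_real (Lp_norm lborel q (stft \<psi> u))"
    by (rule Lp_norming[OF Mod_Lp[OF u] q])
  show ?thesis
  proof (rule that[of "synth G"])
    show "synth G \<in> vectors (Mod r)" by (rule synth_Mod(1)[OF G(1) r(1)])
    have "nrm (Mod r) (synth G) \<le> kmass / energy * Lp_norm lborel r G" by (rule synth_Mod(2)[OF G(1) r(1)])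
    also have "\<dots> \<le> kmass / energy * 1"
      using G(2) kmass_nonneg energy_pos by (intro mult_left_mono) auto
    finally show "nrm (Mod r) (synth G) \<le> kmass / energy" by simp
    have "modulation_pairing \<psi> u (synth G) = cnj (modulation_pairing \<psi> (synth G) u)" by (simp add: pairing_cnj)
    also have "\<dots> = cnj (\<integral>z. G z * cnj (stft \<psi> u z) \<partial>lborel) / of_real energy"
      by (simp add: pairing_synth[OF G(1) u r(1) rq])
    also have "cnj (\<integral>z. G z * cnj (stft \<psi> u z) \<partial>lborel) = (\<integral>z. cnj (G z * cnj (stft \<psi> u z)) \<partial>lborel)"
      by (rule Bochner_Integration.integral_cnj[symmetric])
    also have "\<dots> = of_real (nrm (Mod q) u)"
      unfolding Mod_nrm G(3)[symmetric] by (simp add: mult.commute)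
    finally show "modulation_pairing \<psi> u (synth G) = of_real (nrm (Mod q) u / energy)" by simp
  qed
qed

text \<open>Here the norming function itself serves as a functional on transforms, which keeps the
  constant 1.\<close>

lemma norming_dual:
  assumes u: "u \<in> vectors (Mod q)" and q: "q > 1"
  obtains l where "l \<in> dual (Mod q)" "dual_norm (Mod q) l \<le> 1" "l u = of_real (nrm (Mod q) u)"
proof -
  let ?r = "q / (q - 1)"
  note r = conj_exponent[OF q]
  interpret normed_fspace "Mod q" by (rule normed_Mod[OF q])
  obtain G where G: "G \<in> Lp lborel ?r" "Lp_norm lborel ?r G \<le> 1"
    "(\<integral>z. stft \<psi> u z * cnj (G z) \<partial>lborel) = of_real (Lp_norm lborel q (stft \<psi> u))"
    by (rule Lp_norming[OF Mod_Lp[OF u] q r(1)])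
  define l where "l = (\<lambda>f. \<integral>z. stft \<psi> f z * cnj (G z) \<partial>lborel)"
  have b: "norm (l f) \<le> 1 * nrm (Mod q) f" if "f \<in> vectors (Mod q)" for f
  proof -
    have "norm (l f) \<le> Lp_norm lborel q (stft \<psi> f) * Lp_norm lborel ?r G"
      unfolding l_def by (rule Holder(2)[OF Mod_Lp[OF that] G(1) q r(1)])
    also have "\<dots> \<le> Lp_norm lborel q (stft \<psi> f) * 1" by (intro mult_left_mono G(2)) simp
    finally show ?thesis by (simp add: Mod_nrm)
  qed
  show ?thesis
  proof (rule that)
    have "l (\<lambda>s. f s + h s) = l f + l h" if "f \<in> vectors (Mod q)" "h \<in> vectors (Mod q)" for f h
      using Holder(1)[OF Mod_Lp[OF that(1)] G(1) q r(1)] Holder(1)[OF Mod_Lp[OF that(2)] G(1) q r(1)]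
      by (simp add: l_def stft_add distrib_right)
    moreover have "l (\<lambda>s. c * f s) = c * l f" for c f by (simp add: l_def stft_scale mult.assoc)
    ultimately show "l \<in> dual (Mod q)" unfolding dual_def using b by blast
    show "dual_norm (Mod q) l \<le> 1" by (rule dual_norm_le[OF b]) auto
    show "l u = of_real (nrm (Mod q) u)" using G(3) by (simp add: l_def Mod_nrm)
  qed
qed

text \<open>By the reproducing formula and Hoelder the transform is bounded by some
  \<open>B\<close>; then its \<open>q\<close>-th power is at most \<open>B powr (q - p)\<close>
  times its \<open>p\<close>-th power.\<close>

lemma Mod_mono:
  assumes u: "u \<in> vectors (Mod p)" and p: "1 < p" "p \<le> q"
  shows "u \<in> vectors (Mod q)"
proof -
  let ?r = "p / (p - 1)"
  note r = conj_exponent[OF p(1)]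
  define B where "B = Lp_norm lborel p (stft \<psi> u) * Lp_norm lborel ?r (\<lambda>z. complex_of_real (env z)) / energy"
  have B0: "B \<ge> 0" using energy_pos by (simp add: B_def)
  have B: "norm (stft \<psi> u z') \<le> B" for z'
  proof -
    have "stft \<psi> u z' = (\<integral>z. stft \<psi> u z * kern z' z \<partial>lborel) / of_real energy"
      using stft_synth[of "stft \<psi> u" z'] synth_stft[OF Mod_tempered[OF u]] by simp
    also have "norm \<dots> \<le> B"
      unfolding B_def norm_divide
      using energy_pos order_trans[OF Holder_mult(2)[OF Mod_Lp[OF u] kern_Lp(1)[OF r(2), of z'] p(1) r(1)]
        mult_left_mono[OF kern_Lp(2)[OF r(2), of z'] Lp_norm_nonneg]]
      by (simp add: divide_right_mono)
    finally show ?thesis .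
  qed
  have "integrable lborel (\<lambda>z. norm (stft \<psi> u z) powr q)"
  proof (rule integrable_boundI[OF integrable_mult_right[OF Lp_integrable[OF Mod_Lp[OF u]], of "B powr (q - p)"]])
    show "(\<lambda>z. norm (stft \<psi> u z) powr q) \<in> borel_measurable lborel"
      using LpD[OF Mod_Lp[OF u]] by simp
    fix z
    have "norm (stft \<psi> u z) powr q = norm (stft \<psi> u z) powr (q - p) * norm (stft \<psi> u z) powr p"
      by (simp add: powr_add[symmetric])
    also have "\<dots> \<le> B powr (q - p) * norm (stft \<psi> u z) powr p"
      using B p by (intro mult_right_mono powr_mono2) auto
    finally show "norm (norm (stft \<psi> u z) powr q) \<le> B powr (q - p) * norm (stft \<psi> u z) powr p" by simp
  qed
  then show ?thesis
    using Mod_tempered[OF u] stft_measurable[OF Mod_tempered[OF u]] by (simp add: Mod_iff Lp_def)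
qed

section \<open>Time-frequency shifts\<close>

definition tfshift :: "real \<times> real \<Rightarrow> distribution \<Rightarrow> distribution" where
  "tfshift l u = dist_modulate (snd l) (dist_translate (fst l) u)"

lemma tfshift_apply: "tfshift l u \<phi> = u (translate (- fst l) (modulate (snd l) \<phi>))"
  by (simp add: tfshift_def dist_modulate_def dist_translate_def)

lemma tfshift_atom:
  "translate (- fst l) (modulate (snd l) (atom cw z)) =
    (\<lambda>t. exp (\<i> * of_real (2 * pi * (snd l - snd z) * fst l)) * atom cw (z - l) t)"
proof
  fix t
  have "exp (2 * of_real pi * \<i> * of_real (snd l) * of_real (t + fst l)) * exp (2 * of_real pi * \<i> * of_real (- snd z) * of_real (t + fst l)) =
      exp (\<i> * of_real (2 * pi * (snd l - snd z) * fst l)) * exp (2 * of_real pi * \<i> * of_real (- (snd z - snd l)) * of_real t)"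
    unfolding exp_add[symmetric] by (rule arg_cong[of _ _ exp]) (simp add: algebra_simps)
  then have "exp (2 * of_real pi * \<i> * of_real (snd l) * of_real (t + fst l)) * (exp (2 * of_real pi * \<i> * of_real (- snd z) * of_real (t + fst l)) * c) =
      exp (\<i> * of_real (2 * pi * (snd l - snd z) * fst l)) * (exp (2 * of_real pi * \<i> * of_real (- (snd z - snd l)) * of_real t) * c)" for c
    unfolding mult.assoc[symmetric] by simp
  moreover have "t + fst l - fst z = t - (fst z - fst l)" by simp
  ultimately show "translate (- fst l) (modulate (snd l) (atom cw z)) t =
      exp (\<i> * of_real (2 * pi * (snd l - snd z) * fst l)) * atom cw (z - l) t"
    unfolding atom_def modulate_def translate_def diff_minus_eq_add fst_diff snd_diff by metis
qed

lemma norm_stft_tfshift: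
  assumes "u \<in> tempered"
  shows "norm (stft \<psi> (tfshift l u) z) = norm (stft \<psi> u (z - l))"
  using tempered_scale[OF assms, of "atom cw (z - l)"] cw
  by (simp add: stft_eq tfshift_apply tfshift_atom norm_mult norm_exp_i_times del: of_real_mult of_real_diff)

lemma coef_tfshift:
  "coef \<psi> (translate (- fst l) (modulate (snd l) \<phi>)) z =
    exp (- (\<i> * of_real (2 * pi * snd z * fst l))) * coef \<psi> \<phi> (z + l)"
proof -
  let ?f = "\<lambda>t. modulate (snd z) (translate (fst z) \<psi>) (t - fst l) * modulate (snd l) \<phi> t"
  have "coef \<psi> (translate (- fst l) (modulate (snd l) \<phi>)) z = (\<integral>t. ?f (t + fst l) \<partial>lborel)"
    by (simp add: coef_def translate_def)
  also have "\<dots> = (\<integral>t. ?f t \<partial>lborel)" by (rule lborel_translate)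
  also have "\<dots> = (\<integral>t. exp (- (\<i> * of_real (2 * pi * snd z * fst l))) * (modulate (snd (z + l)) (translate (fst (z + l)) \<psi>) t * \<phi> t) \<partial>lborel)"
  proof (rule Bochner_Integration.integral_cong[OF refl])
    fix t
    have "exp (2 * of_real pi * \<i> * of_real (snd z) * of_real (t - fst l)) * exp (2 * of_real pi * \<i> * of_real (snd l) * of_real t) =
        exp (- (\<i> * of_real (2 * pi * snd z * fst l))) * exp (2 * of_real pi * \<i> * of_real (snd z + snd l) * of_real t)"
      unfolding exp_add[symmetric] by (rule arg_cong[of _ _ exp]) (simp add: algebra_simps)
    then have key: "(exp (2 * of_real pi * \<i> * of_real (snd z) * of_real (t - fst l)) * c) * (exp (2 * of_real pi * \<i> * of_real (snd l) * of_real t) * d) =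
        exp (- (\<i> * of_real (2 * pi * snd z * fst l))) * ((exp (2 * of_real pi * \<i> * of_real (snd z + snd l) * of_real t) * c) * d)" for c d
      by (simp only: mult_ac)
    have "t - fst l - fst z = t - (fst z + fst l)" by simp
    then show "?f t = exp (- (\<i> * of_real (2 * pi * snd z * fst l))) * (modulate (snd (z + l)) (translate (fst (z + l)) \<psi>) t * \<phi> t)"
      unfolding modulate_def translate_def fst_add snd_add by (simp only: key)
  qed
  also have "\<dots> = exp (- (\<i> * of_real (2 * pi * snd z * fst l))) * coef \<psi> \<phi> (z + l)"
    unfolding coef_def by (rule integral_mult_right_zero)
  finally show ?thesis .
qed

text \<open>The shifted distribution is exhibited as \<open>synth H\<close>, where \<open>H\<close>
  is the shifted transform times a phase. This gives temperedness and integrability together,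
  without Schwartz seminorms of shifted test functions.\<close>

lemma tfshift_Mod:
  assumes u: "u \<in> vectors (Mod p)" and p: "p > 1"
  shows "tfshift l u \<in> vectors (Mod p)"
proof -
  note ut = Mod_tempered[OF u]
  define H where "H = (\<lambda>z. stft \<psi> u (z - l) * exp (- (\<i> * of_real (2 * pi * snd (z - l) * fst l))))"
  have nH: "norm (H z) = norm (stft \<psi> u (z - l))" for z
  proof -
    have "- (\<i> * of_real (2 * pi * snd (z - l) * fst l)) = \<i> * complex_of_real (- (2 * pi * snd (z - l) * fst l))" by simp
    then show ?thesis unfolding H_def norm_mult by (metis norm_exp_i_times mult_1_right)
  qed
  have "continuous_on UNIV H"
    unfolding H_def
    by (intro continuous_intros continuous_on_compose2[OF stft_continuous[OF ut, of UNIV]]) auto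
  then have "H \<in> borel_measurable lborel" using borel_measurable_continuous_onI by simp
  moreover have "integrable lborel (\<lambda>z. norm (H z) powr p)"
    unfolding nH using Lp_integrable[OF Mod_Lp[OF u]] lborel_translate(2)[of "\<lambda>z. norm (stft \<psi> u z) powr p" "- l"] by simp
  ultimately have H: "H \<in> Lp lborel p" by (simp add: Lp_def)
  have "tfshift l u = synth H"
  proof
    fix \<phi>
    show "tfshift l u \<phi> = synth H \<phi>"
    proof (cases "\<phi> \<in> Schwartz")
      case True
      have "u (translate (- fst l) (modulate (snd l) \<phi>)) =
          synth (stft \<psi> u) (translate (- fst l) (modulate (snd l) \<phi>))"
        by (simp add: synth_stft[OF ut])
      also have "\<dots> = (\<integral>z. stft \<psi> u z * (exp (- (\<i> * of_real (2 * pi * snd z * fst l))) * coef \<psi> \<phi> (z + l)) \<partial>lborel) / of_real energy"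
        using True by (simp only: synth_def coef_tfshift Schwartz_translate Schwartz_modulate if_True)
      also have "(\<integral>z. stft \<psi> u z * (exp (- (\<i> * of_real (2 * pi * snd z * fst l))) * coef \<psi> \<phi> (z + l)) \<partial>lborel) = (\<integral>z. H z * coef \<psi> \<phi> z \<partial>lborel)"
        using lborel_translate(1)[of "\<lambda>z. H z * coef \<psi> \<phi> z" l] by (simp add: H_def mult.assoc)
      finally show ?thesis using True by (simp add: tfshift_apply synth_def)
    next
      \<comment> \<open>Distributions are total functions with value 0 off the Schwartz space. The
        shift of test functions is undone by another shift, so a function outside that space stays
        outside.\<close>
      case False
      have "translate (- fst l) (modulate (snd l) \<phi>) \<notin> Schwartz"
      proof
        assume "translate (- fst l) (modulate (snd l) \<phi>) \<in> Schwartz"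
        then have "modulate (- snd l) (translate (fst l) (translate (- fst l) (modulate (snd l) \<phi>))) \<in> Schwartz"
          by (intro Schwartz_shift)
        moreover have "modulate (- snd l) (translate (fst l) (translate (- fst l) (modulate (snd l) \<phi>))) = \<phi>"
          by (rule ext) (simp add: modulate_def translate_def mult.assoc[symmetric] exp_add[symmetric])
        ultimately show False using False by simp
      qed
      then show ?thesis using False ut by (simp add: tfshift_apply synth_def tempered_outside)
    qed
  qed
  then show ?thesis using synth_Mod(1)[OF H p] by simp
qed

lemma gabor_tfshift: "gabor \<alpha> \<beta> g i = tfshift (\<alpha> * of_int (fst i), \<beta> * of_int (snd i)) g"
  by (simp add: gabor_def tfshift_def case_prod_unfold)

text \<open>Coefficient functions to which \<open>superposition\<close> applies: what they
  synthesise is a Schwartz function, and by \<open>moments_approx\<close> these are dense.\<close>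

definition moments :: "(real \<times> real \<Rightarrow> complex) set" where
  "moments = {F \<in> borel_measurable lborel. \<forall>L. integrable lborel (\<lambda>z. norm (F z) * weight z ^ L)}"

text \<open>A transform is continuous, so its truncations to balls have all moments. They converge
  in \<open>Lp\<close> by dominated convergence, and \<open>synth\<close> carries the convergence
  over.\<close>

lemma moments_approx:
  assumes f: "f \<in> vectors (Mod q)" and q: "q > 1"
  obtains F where "\<And>n. F n \<in> moments" "\<And>n. F n \<in> Lp lborel q"
    "(\<lambda>n. nrm (Mod q) (\<lambda>s. f s - synth (F n) s)) \<longlonglongrightarrow> 0"
proof -
  let ?V = "stft \<psi> f"
  have V: "?V \<in> Lp lborel q" by (rule Mod_Lp[OF f])
  have [measurable]: "?V \<in> borel_measurable borel" using LpD[OF V] by simp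
  define F where "F = (\<lambda>n (z :: real \<times> real). indicator (cball 0 (real n)) z *\<^sub>R ?V z)"
  have [measurable]: "F n \<in> borel_measurable borel" for n
    unfolding F_def by (intro borel_measurable_scaleR borel_measurable_indicator) auto
  have "F n \<in> moments" for n
    unfolding moments_def
  proof (intro CollectI conjI allI)
    fix L
    have c: "continuous_on (cball 0 (real n)) (\<lambda>z. norm (?V z) * weight z ^ L)"
      unfolding weight_def by (intro continuous_intros stft_continuous Mod_tempered[OF f])
    have "integrable lborel (\<lambda>z. indicator (cball 0 (real n)) z *\<^sub>R (norm (?V z) * weight z ^ L))"
      by (rule borel_integrable_compact[OF _ c]) simp
    then show "integrable lborel (\<lambda>z. norm (F n z) * weight z ^ L)"
      by (rule Bochner_Integration.integrable_cong[THEN iffD1, rotated -1]) (auto simp: F_def indicator_def)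
  qed measurable
  moreover have FL: "F n \<in> Lp lborel q" for n
    by (rule Lp_norm_mono(1)[OF _ V]) (use q in \<open>auto simp: F_def indicator_def\<close>)
  moreover have "(\<lambda>n. nrm (Mod q) (\<lambda>s. f s - synth (F n) s)) \<longlonglongrightarrow> 0"
  proof -
    have "(\<lambda>n. Lp_norm lborel q (\<lambda>z. ?V z - F n z)) \<longlonglongrightarrow> 0"
    proof (rule Lp_norm_tendsto_0[OF _ Lp_integrable[OF V]])
      show "AE z in lborel. norm (?V z - F n z) \<le> norm (?V z)" for n
        by (intro AE_I2) (auto simp: F_def indicator_def)
      show "AE z in lborel. (\<lambda>n. ?V z - F n z) \<longlonglongrightarrow> 0"
      proof (rule AE_I2)
        fix z :: "real \<times> real"
        obtain N where N: "norm z \<le> real N" using real_arch_simple by blast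
        have "?V z - F n z = 0" if "n \<ge> N" for n using N that by (auto simp: F_def indicator_def)
        then show "(\<lambda>n. ?V z - F n z) \<longlonglongrightarrow> 0"
          by (intro tendsto_eventually) (auto simp: eventually_sequentially)
      qed
    qed (use q in auto)
    then have "(\<lambda>n. kmass / energy * Lp_norm lborel q (\<lambda>z. ?V z - F n z)) \<longlonglongrightarrow> 0"
      by (rule tendsto_mult_right_zero)
    then show ?thesis
    proof (rule tendsto_sandwich[OF always_eventually always_eventually tendsto_const, rotated -1]; intro allI)
      fix n
      show "0 \<le> nrm (Mod q) (\<lambda>s. f s - synth (F n) s)" by (simp add: Mod_nrm)
      show "nrm (Mod q) (\<lambda>s. f s - synth (F n) s) \<le> kmass / energy * Lp_norm lborel q (\<lambda>z. ?V z - F n z)"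
        using synth_Mod(2)[OF Lp_diff[OF V FL] q, of n] q
        unfolding synth_diff[OF V FL q] synth_stft[OF Mod_tempered[OF f]] by simp
    qed
  qed
  ultimately show ?thesis using that by blast
qed

text \<open>The Schwartz function that represents \<open>synth F\<close>. Conjugating the atom gives
  back the unconjugated shift of \<open>\<psi>\<close> that occurs in \<open>coef\<close>.\<close>

definition wave :: "(real \<times> real \<Rightarrow> complex) \<Rightarrow> real \<Rightarrow> complex" where
  "wave F t = (\<integral>z. F z * cnj (atom cw z t) \<partial>lborel) / of_real energy"

lemma Schwartz_wave:
  assumes "F \<in> moments"
  shows "wave F \<in> Schwartz"
proof -
  have m: "F \<in> borel_measurable lborel" "\<And>L. integrable lborel (\<lambda>z. norm (F z) * weight z ^ L)"
    using assms by (auto simp: moments_def)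
  have "cnj \<in> borel_measurable borel"
    by (intro borel_measurable_continuous_onI continuous_intros)
  from measurable_compose[OF m(1) this]
  have m': "(\<lambda>z. cnj (F z)) \<in> borel_measurable lborel" .
  have "(\<lambda>t. \<integral>z. cnj (F z) * atom cw z t \<partial>lborel) \<in> Schwartz"
    by (rule superposition_Schwartz[OF m' _ cw]) (simp add: m)
  from Schwartz_scale[OF Schwartz_cnj[OF this], of "of_real (1 / energy)"]
  show ?thesis
    unfolding wave_def[abs_def] Bochner_Integration.integral_cnj[symmetric] by simp
qed

lemma synth_wave:
  assumes F: "F \<in> moments"
  shows "synth F = dist_of_fun (wave F)"
proof
  fix \<phi>
  show "synth F \<phi> = dist_of_fun (wave F) \<phi>"
  proof (cases "\<phi> \<in> Schwartz")
    case \<phi>: True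
    have [measurable]: "F \<in> borel_measurable borel" and Fi: "integrable lborel (\<lambda>z. norm (F z))"
      using F spec[of "\<lambda>L. integrable lborel (\<lambda>z. norm (F z) * weight z ^ L)" 0] by (auto simp: moments_def)
    note [measurable] = measurable_shift[unfolded case_prod_unfold] Schwartz_measurable[OF \<phi>]
    let ?s = "\<lambda>z t. modulate (snd z) (translate (fst z) \<psi>) t"
    obtain B where B: "B > 0" "\<And>t. (1 + \<bar>t\<bar>) ^ 0 * norm (\<psi> t) \<le> B" using Schwartz_decay[OF \<psi>] by metis
    have fub: "(\<integral>z. (\<integral>t. F z * (?s z t * \<phi> t) \<partial>lborel) \<partial>lborel) = (\<integral>t. (\<integral>z. F z * (?s z t * \<phi> t) \<partial>lborel) \<partial>lborel)"
    proof (rule Fubini_lborel(1))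
      show m: "(\<lambda>(z, t). F z * (?s z t * \<phi> t)) \<in> borel_measurable borel"
        unfolding case_prod_unfold by measurable
      show "integrable lborel (\<lambda>t. F z * (?s z t * \<phi> t))" for z
        by (intro integrable_mult_right coef_integrable \<phi>)
      have ib: "integrable lborel (\<lambda>t. B * norm (\<phi> t))"
        using integrable_norm[OF Schwartz_integrable[OF \<phi>]] by simp
      show "integrable lborel (\<lambda>z. \<integral>t. norm (F z * (?s z t * \<phi> t)) \<partial>lborel)"
      proof (rule integrable_boundI[OF integrable_mult_left[OF Fi, of "\<integral>t. B * norm (\<phi> t) \<partial>lborel"]])
        have "(\<lambda>(z, t). norm (F z * (?s z t * \<phi> t))) \<in> borel_measurable borel"
          unfolding case_prod_unfold by measurable
        then have "(\<lambda>(z, t). norm (F z * (?s z t * \<phi> t))) \<in> borel_measurable (borel \<Otimes>\<^sub>M lborel)"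
          by (subst measurable_cong_sets[OF sets_pair_measure_cong[OF refl sets_lborel] refl]) (simp add: borel_prod)
        from lborel.borel_measurable_lebesgue_integral[OF this]
        show "(\<lambda>z. \<integral>t. norm (F z * (?s z t * \<phi> t)) \<partial>lborel) \<in> borel_measurable lborel" by simp
        fix z
        have "(\<integral>t. norm (F z * (?s z t * \<phi> t)) \<partial>lborel) = norm (F z) * (\<integral>t. norm (?s z t * \<phi> t) \<partial>lborel)"
          by (simp only: norm_mult[of "F z"] integral_mult_right_zero)
        also have "\<dots> \<le> norm (F z) * (\<integral>t. B * norm (\<phi> t) \<partial>lborel)"
          using B by (intro mult_left_mono integral_mono ib integrable_norm coef_integrable \<phi>)
            (auto simp: norm_mult translate_def intro: mult_right_mono)
        finally show "norm (\<integral>t. norm (F z * (?s z t * \<phi> t)) \<partial>lborel) \<le> norm (F z) * (\<integral>t. B * norm (\<phi> t) \<partial>lborel)"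
          by (simp add: Bochner_Integration.integral_nonneg)
      qed
    qed
    have "synth F \<phi> = (\<integral>z. (\<integral>t. F z * (?s z t * \<phi> t) \<partial>lborel) \<partial>lborel) / of_real energy"
      using \<phi> by (simp add: synth_def coef_def)
    also have "\<dots> = (\<integral>t. (\<integral>z. F z * ?s z t \<partial>lborel) * \<phi> t \<partial>lborel) / of_real energy"
      unfolding fub integral_mult_left_zero[symmetric] by (simp only: mult.assoc)
    also have "\<dots> = (\<integral>t. wave F t * \<phi> t \<partial>lborel)"
      by (simp add: wave_def atom_cw)
    finally show ?thesis using \<phi> by (simp add: dist_of_fun_def)
  qed (simp add: synth_def dist_of_fun_def)
qed

end

lemma (in normed_fspace) dual_lincomb:
  assumes "finite F" "\<And>i. i \<in> F \<Longrightarrow> l i \<in> dual X"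
  shows "(\<lambda>f. \<Sum>i\<in>F. c i * l i f) \<in> dual X"
proof -
  have "norm (\<Sum>i\<in>F. c i * l i f) \<le> (\<Sum>i\<in>F. norm (c i) * dual_norm X (l i)) * nrm X f" if f: "f \<in> vectors X" for f
  proof -
    have "norm (\<Sum>i\<in>F. c i * l i f) \<le> (\<Sum>i\<in>F. norm (c i) * (dual_norm X (l i) * nrm X f))"
      using assms(2) f by (intro sum_norm_le) (simp add: norm_mult mult_left_mono dual_norm_bound)
    then show ?thesis by (simp add: sum_distrib_right mult.assoc)
  qed
  moreover have "(\<Sum>i\<in>F. c i * l i (\<lambda>s. f s + h s)) = (\<Sum>i\<in>F. c i * l i f) + (\<Sum>i\<in>F. c i * l i h)"
    if "f \<in> vectors X" "h \<in> vectors X" for f h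
    using assms(2) that by (simp add: dual_add distrib_left sum.distrib)
  moreover have "(\<Sum>i\<in>F. c i * l i (\<lambda>s. d * f s)) = d * (\<Sum>i\<in>F. c i * l i f)" if "f \<in> vectors X" for d f
    using assms(2) that by (simp add: dual_scale sum_distrib_left mult.left_commute)
  ultimately show ?thesis unfolding dual_def by blast
qed

section \<open>Coefficients of Gabor expansions\<close>

definition lattice_point :: "real \<Rightarrow> real \<Rightarrow> int \<times> int \<Rightarrow> real \<times> real" where
  "lattice_point \<alpha> \<beta> i = (\<alpha> * of_int (fst i), \<beta> * of_int (snd i))"

context window
begin

lemma gabor_Mod: "g \<in> vectors (Mod q) \<Longrightarrow> q > 1 \<Longrightarrow> gabor \<alpha> \<beta> g i \<in> vectors (Mod q)"
  by (simp add: gabor_tfshift tfshift_Mod)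

lemma norm_stft_gabor:
  "g \<in> tempered \<Longrightarrow> norm (stft \<psi> (gabor \<alpha> \<beta> g i) z) = norm (stft \<psi> g (z - lattice_point \<alpha> \<beta> i))"
  by (simp add: gabor_tfshift norm_stft_tfshift lattice_point_def)

text \<open>On the \<open>j\<close>-th translate of a fundamental cell around a point where \<open>V\<^sub>\<psi>g\<close> does not vanish, the
  average over all signs of a finite Gabor sum dominates its \<open>j\<close>-th term.\<close>

lemma signed_sums_bound_coefficients:
  assumes g: "g \<in> vectors (Mod q)" and q: "q > 1" and z0: "stft \<psi> g z0 \<noteq> 0" and \<alpha>\<beta>: "\<alpha> > 0" "\<beta> > 0"
  obtains I where "I > 0"
    "\<And>F b K. finite F \<Longrightarrow> (\<And>S. S \<subseteq> F \<Longrightarrow> nrm (Mod q)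
        (\<lambda>s. \<Sum>i\<in>F. ((if i \<in> S then 1 else - 1) * b i) * gabor \<alpha> \<beta> g i s) \<le> K) \<Longrightarrow>
      (\<Sum>i\<in>F. norm (b i) powr q) * I \<le> 2 * K powr q"
proof -
  interpret normed_fspace "Mod q" by (rule normed_Mod[OF q])
  have gt: "g \<in> tempered" by (rule Mod_tempered[OF g])
  let ?V = "stft \<psi> g" and ?L = "lattice_point \<alpha> \<beta>"
  have [measurable]: "?V \<in> borel_measurable borel" by (rule stft_measurable[OF gt])
  \<comment> \<open>Half-open sides of the lattice lengths make the lattice translates of the cell
    disjoint; centring it at \<open>z0\<close> gives it positive mass \<open>I\<close>.\<close>
  define Q where "Q = {fst z0 - \<alpha> / 2..<fst z0 + \<alpha> / 2} \<times> {snd z0 - \<beta> / 2..<snd z0 + \<beta> / 2}"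
  have Q: "Q \<in> sets borel"
    unfolding Q_def borel_prod[symmetric] by (intro pair_measureI) auto
  note [measurable] = Q
  define k where "k = (\<lambda>z. indicator Q z * norm (?V z) powr q)"
  have [measurable]: "k \<in> borel_measurable borel"
    unfolding k_def by (intro borel_measurable_times borel_measurable_indicator Q) measurable
  have k0: "k z \<ge> 0" for z by (simp add: k_def)
  have ki: "integrable lborel k"
    by (rule integrable_boundI[OF Lp_integrable[OF Mod_Lp[OF g]]]) (auto simp: k_def indicator_def)
  define I where "I = (\<integral>z. k z \<partial>lborel)"
  have I: "I > 0"
  proof -
    have "I \<noteq> 0"
    proof
      assume "I = 0"
      then have ae: "AE z in lborel. k z = 0"
        using ki k0 by (simp add: I_def integral_nonneg_eq_0_iff_AE)
      \<comment> \<open>If the mass were zero, the transform would vanish almost everywhere on the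
        interior of the cell, but it is continuous and nonzero at the centre.\<close>
      define U where "U = ({fst z0 - \<alpha> / 2<..<fst z0 + \<alpha> / 2} \<times> {snd z0 - \<beta> / 2<..<snd z0 + \<beta> / 2}) \<inter> ?V -` (- {0})"
      have U: "open U"
        unfolding U_def by (intro open_Int open_Times open_vimage stft_continuous gt) auto
      have "z0 \<in> U" using z0 \<alpha>\<beta> by (auto simp: U_def mem_Times_iff)
      have "AE z in lborel. z \<notin> U"
        using ae by eventually_elim (auto simp: k_def U_def Q_def indicator_def)
      then have "U \<in> null_sets lborel"
        using AE_iff_null_sets[of U lborel] U by (simp add: borel_open)
      then have "negligible U" using negligible_iff_null_sets null_sets_completionI by blast
      moreover have "U \<noteq> {}" using \<open>z0 \<in> U\<close> by blast
      ultimately show False using open_not_negligible[OF U] by blast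
    qed
    moreover have "I \<ge> 0" unfolding I_def by (intro Bochner_Integration.integral_nonneg k0)
    ultimately show ?thesis by simp
  qed
  have cell: "i = j" if "z - ?L i \<in> Q" "z - ?L j \<in> Q" for z i j
  proof -
    have *: "m = n" if "c - d / 2 \<le> x - d * of_int m" "x - d * of_int m < c + d / 2"
      "c - d / 2 \<le> x - d * of_int n" "x - d * of_int n < c + d / 2" "d > 0" for c d x :: real and m n :: int
    proof -
      have "d * (of_int m - of_int n) < d * 1" "d * (of_int n - of_int m) < d * 1"
        using that by (simp_all add: algebra_simps)
      then have "of_int m - of_int n < (1::real)" "of_int n - of_int m < (1::real)"
        using that(5) by (simp_all only: mult_less_cancel_left_pos)
      then show ?thesis by linarith
    qed
    show ?thesis
      using that \<alpha>\<beta> *[of "fst z0" \<alpha> "fst z" "fst i" "fst j"] *[of "snd z0" \<beta> "snd z" "snd i" "snd j"]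
      by (auto simp: Q_def lattice_point_def mem_Times_iff prod_eq_iff)
  qed
  show ?thesis
  proof (rule that[OF I])
    fix F :: "(int \<times> int) set" and b K
    assume F: "finite F" and K: "\<And>S. S \<subseteq> F \<Longrightarrow> nrm (Mod q)
        (\<lambda>s. \<Sum>i\<in>F. ((if i \<in> S then 1 else - 1) * b i) * gabor \<alpha> \<beta> g i s) \<le> K"
    define s where "s = (\<lambda>S t. \<Sum>i\<in>F. ((if i \<in> S then 1 else - 1) * b i) * gabor \<alpha> \<beta> g i t)"
    have sm: "s S \<in> vectors (Mod q)" for S
      unfolding s_def by (intro sum_mem scale_mem gabor_Mod g q)
    have Vs: "stft \<psi> (s S) z = (\<Sum>i\<in>F. (if i \<in> S then 1 else - 1) * (b i * stft \<psi> (gabor \<alpha> \<beta> g i) z))" for S z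
      unfolding s_def stft_sum stft_scale by (simp only: mult.assoc)
    \<comment> \<open>At each \<open>z\<close> at most one term on the left survives, the one whose
      cell contains \<open>z\<close>, and to it the average over signs applies.\<close>
    have pw: "2 ^ card F * (\<Sum>j\<in>F. norm (b j) powr q * k (z - ?L j)) \<le> 2 * (\<Sum>S\<in>Pow F. norm (stft \<psi> (s S) z) powr q)" for z
    proof (cases "\<exists>j\<in>F. z - ?L j \<in> Q")
      case True
      then obtain j where j: "j \<in> F" "z - ?L j \<in> Q" by blast
      have "norm (b i) powr q * k (z - ?L i) = 0" if "i \<in> F - {j}" for i
        using that cell[of z i j] j(2) by (auto simp: k_def indicator_def)
      then have "(\<Sum>i\<in>F. norm (b i) powr q * k (z - ?L i)) = norm (b j) powr q * k (z - ?L j)"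
        unfolding sum.remove[OF F j(1)] by (subst sum.neutral) auto
      also have "\<dots> = norm (b j * stft \<psi> (gabor \<alpha> \<beta> g j) z) powr q"
        using j(2) by (simp add: k_def norm_mult powr_mult norm_stft_gabor gt)
      finally show ?thesis
        unfolding Vs using sum_signs_ge[OF F j(1), of q "\<lambda>i. b i * stft \<psi> (gabor \<alpha> \<beta> g i) z"] q by simp
    next
      case False
      then have "(\<Sum>i\<in>F. norm (b i) powr q * k (z - ?L i)) = 0"
        by (intro sum.neutral) (auto simp: k_def indicator_def)
      then show ?thesis by (simp add: sum_nonneg)
    qed
    have ksh: "integrable lborel (\<lambda>z. k (z - a))" "(\<integral>z. k (z - a) \<partial>lborel) = I" for a
      using lborel_translate[of k "- a"] ki by (auto simp: I_def)
    have i1: "integrable lborel (\<lambda>z. 2 ^ card F * (\<Sum>j\<in>F. norm (b j) powr q * k (z - ?L j)))"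
      by (intro integrable_mult_right Bochner_Integration.integrable_sum ksh)
    have i2: "integrable lborel (\<lambda>z. 2 * (\<Sum>S\<in>Pow F. norm (stft \<psi> (s S) z) powr q))"
      by (intro integrable_mult_right Bochner_Integration.integrable_sum Lp_integrable Mod_Lp sm)
    have sK: "nrm (Mod q) (s S) \<le> K" if "S \<subseteq> F" for S
      unfolding s_def by (rule K[OF that])
    have "2 ^ card F * ((\<Sum>j\<in>F. norm (b j) powr q) * I) = (\<integral>z. 2 ^ card F * (\<Sum>j\<in>F. norm (b j) powr q * k (z - ?L j)) \<partial>lborel)"
      using ksh by (simp add: sum_distrib_right)
    also have "\<dots> \<le> (\<integral>z. 2 * (\<Sum>S\<in>Pow F. norm (stft \<psi> (s S) z) powr q) \<partial>lborel)"
      by (rule integral_mono[OF i1 i2 pw])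
    also have "\<dots> = 2 * (\<Sum>S\<in>Pow F. nrm (Mod q) (s S) powr q)"
      using Lp_integrable[OF Mod_Lp[OF sm]] q by (simp add: Mod_nrm Lp_norm_powr)
    also have "\<dots> \<le> 2 * (\<Sum>S\<in>Pow F. K powr q)"
      using q sK by (intro mult_left_mono sum_mono powr_mono2) (auto simp: nrm_nonneg sm)
    also have "\<dots> = 2 ^ card F * (2 * K powr q)"
      using F by (simp add: card_Pow)
    finally show "(\<Sum>i\<in>F. norm (b i) powr q) * I \<le> 2 * K powr q" by simp
  qed
qed

text \<open>Stated for finite index sets, so that it makes sense before summability is known and can
  be tested by finite combinations of functionals.\<close>

definition bessel :: "real \<Rightarrow> (int \<times> int \<Rightarrow> distribution) \<Rightarrow> real \<Rightarrow> bool" where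
  "bessel q h B \<longleftrightarrow> (\<forall>f\<in>vectors (Mod q). \<forall>F. finite F \<longrightarrow>
     (\<Sum>i\<in>F. norm (modulation_pairing \<psi> f (h i)) powr q) powr (1 / q) \<le> B * nrm (Mod q) f)"

lemma besselD:
  "bessel q h B \<Longrightarrow> f \<in> vectors (Mod q) \<Longrightarrow> finite F \<Longrightarrow>
    (\<Sum>i\<in>F. norm (modulation_pairing \<psi> f (h i)) powr q) powr (1 / q) \<le> B * nrm (Mod q) f"
  by (simp add: bessel_def)

lemma bessel_mono:
  assumes "bessel q h B" "B \<le> B'" "q > 1"
  shows "bessel q h B'"
  unfolding bessel_def
proof (intro ballI allI impI)
  fix f and F :: "(int \<times> int) set" assume f: "f \<in> vectors (Mod q)" "finite F"
  have "B * nrm (Mod q) f \<le> B' * nrm (Mod q) f"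
    using assms(2) by (intro mult_right_mono) (auto simp: Mod_nrm)
  then show "(\<Sum>i\<in>F. norm (modulation_pairing \<psi> f (h i)) powr q) powr (1 / q) \<le> B' * nrm (Mod q) f"
    using besselD[OF assms(1) f] by linarith
qed

text \<open>Uniform boundedness for the functionals formed with finite vectors from the unit ball of
  the dual sequence space: Hoelder turns the hypothesis into pointwise boundedness, and a norming
  vector recovers the \<open>q\<close>-sum from the bound on functionals.\<close>

lemma bessel_of_pointwise:
  assumes h: "\<And>i. h i \<in> vectors (Mod r)" and q: "q > 1" "1 / q + 1 / r = 1"
    and pt: "\<And>f. f \<in> vectors (Mod q) \<Longrightarrow> \<exists>C. \<forall>F. finite F \<longrightarrow> (\<Sum>i\<in>F. norm (modulation_pairing \<psi> f (h i)) powr q) \<le> C"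
  shows "\<exists>B\<ge>0. bessel q h B"
proof -
  interpret banach_fspace "Mod q" by (rule banach_Mod[OF q(1)])
  define \<Lambda> where "\<Lambda> = {\<lambda>f. \<Sum>i\<in>F. cnj (b i) * modulation_pairing \<psi> f (h i) | F b.
     finite F \<and> (\<Sum>i\<in>F. norm (b i) powr r) powr (1 / r) \<le> 1}"
  have sub: "\<Lambda> \<subseteq> dual (Mod q)"
    unfolding \<Lambda>_def by (auto intro!: dual_lincomb pairing_dual[OF h q])
  have "\<exists>C. \<forall>l\<in>\<Lambda>. norm (l f) \<le> C" if f: "f \<in> vectors (Mod q)" for f
  proof -
    obtain C where C: "\<And>F. finite F \<Longrightarrow> (\<Sum>i\<in>F. norm (modulation_pairing \<psi> f (h i)) powr q) \<le> C" using pt[OF f] by blast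
    have "norm (l f) \<le> C powr (1 / q)" if l: "l \<in> \<Lambda>" for l
    proof -
      obtain F b where l: "l = (\<lambda>f. \<Sum>i\<in>F. cnj (b i) * modulation_pairing \<psi> f (h i))" "finite F"
        "(\<Sum>i\<in>F. norm (b i) powr r) powr (1 / r) \<le> 1" using l unfolding \<Lambda>_def by blast
      have "norm (l f) \<le> (\<Sum>i\<in>F. norm (modulation_pairing \<psi> f (h i)) * norm (b i))"
        unfolding l(1) by (rule sum_norm_le) (simp add: norm_mult mult.commute)
      also have "\<dots> \<le> (\<Sum>i\<in>F. norm (modulation_pairing \<psi> f (h i)) powr q) powr (1 / q) * (\<Sum>i\<in>F. norm (b i) powr r) powr (1 / r)"
        by (rule Holder_sum_complex[OF l(2) q])
      also have "\<dots> \<le> C powr (1 / q) * 1"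
        using C[OF l(2)] q(1) l(3) by (intro mult_mono powr_mono2) (auto intro: sum_nonneg)
      finally show ?thesis by simp
    qed
    then show ?thesis by blast
  qed
  from uniform_boundedness[OF sub this] obtain C where C: "\<And>l. l \<in> \<Lambda> \<Longrightarrow> dual_norm (Mod q) l \<le> C" by blast
  have "bessel q h (max 0 C)"
    unfolding bessel_def
  proof (intro ballI allI impI)
    fix f and F :: "(int \<times> int) set" assume f: "f \<in> vectors (Mod q)" and F: "finite F"
    obtain b where b: "(\<Sum>i\<in>F. norm (b i) powr r) powr (1 / r) \<le> 1"
      "(\<Sum>i\<in>F. modulation_pairing \<psi> f (h i) * cnj (b i)) =
        of_real ((\<Sum>i\<in>F. norm (modulation_pairing \<psi> f (h i)) powr q) powr (1 / q))"
      by (rule norming_sum[OF F q])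
    define l where "l = (\<lambda>f. \<Sum>i\<in>F. cnj (b i) * modulation_pairing \<psi> f (h i))"
    have l: "l \<in> \<Lambda>" unfolding \<Lambda>_def l_def using F b(1) by blast
    have lf: "l f = of_real ((\<Sum>i\<in>F. norm (modulation_pairing \<psi> f (h i)) powr q) powr (1 / q))"
      unfolding b(2)[symmetric] l_def by (simp only: mult.commute)
    have "(\<Sum>i\<in>F. norm (modulation_pairing \<psi> f (h i)) powr q) powr (1 / q) = norm (l f)"
      unfolding lf by simp
    also have "\<dots> \<le> dual_norm (Mod q) l * nrm (Mod q) f"
      using dual_norm_bound[OF _ f] l sub by blast
    also have "\<dots> \<le> max 0 C * nrm (Mod q) f"
      using C[OF l] nrm_nonneg[OF f] by (intro mult_right_mono) auto
    finally show "(\<Sum>i\<in>F. norm (modulation_pairing \<psi> f (h i)) powr q) powr (1 / q) \<le> max 0 C * nrm (Mod q) f" .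
  qed
  then show ?thesis by (intro exI[of _ "max 0 C"]) auto
qed

text \<open>A distribution with zero transform would lie in \<open>M^1\<close>. The point obtained
  here is the centre of the cell in \<open>signed_sums_bound_coefficients\<close>.\<close>

lemma stft_nonzero:
  assumes "g \<in> vectors (Mod p)" "g \<notin> vectors (Mod 1)"
  obtains z where "stft \<psi> g z \<noteq> 0"
proof -
  have "\<exists>z. stft \<psi> g z \<noteq> 0"
  proof (rule ccontr)
    assume "\<not> ?thesis"
    then have "stft \<psi> g = (\<lambda>_. 0)" by auto
    then have "stft \<psi> g \<in> Lp lborel 1" by (simp add: Lp_def)
    then show False using assms by (simp add: Mod_iff)
  qed
  then show ?thesis using that by blast
qed

text \<open>The second conclusion is obtained from the transposed series, which is weakly unconditionally
  convergent by uniform boundedness on \<open>M\<^sup>q\<close>.\<close>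

lemma bessel_of_weakly_unconditional:
  assumes q: "q > 1" "1 / q + 1 / r = 1" and \<alpha>\<beta>: "\<alpha> > 0" "\<beta> > 0"
    and g: "g \<in> vectors (Mod q)" "g \<in> vectors (Mod r)" "stft \<psi> g z1 \<noteq> 0"
    and \<gamma>: "\<gamma> \<in> vectors (Mod q)" "\<gamma> \<in> vectors (Mod r)" "stft \<psi> \<gamma> z2 \<noteq> 0"
    and wuc: "\<And>f. f \<in> vectors (Mod q) \<Longrightarrow> weakly_unconditionally_convergent (Mod q)
       (\<lambda>i s. modulation_pairing \<psi> f (gabor \<alpha> \<beta> \<gamma> i) * gabor \<alpha> \<beta> g i s)"
  shows "\<exists>B\<ge>0. bessel q (gabor \<alpha> \<beta> \<gamma>) B" "\<exists>B\<ge>0. bessel r (gabor \<alpha> \<beta> g) B"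
proof -
  note r = conj_exponent_eqs(1,2)[OF q]
  have rq: "1 / r + 1 / q = 1" using q by simp
  interpret X: banach_fspace "Mod q" by (rule banach_Mod[OF q(1)])
  interpret Y: banach_fspace "Mod r" by (rule banach_Mod[OF r(1)])
  let ?G = "gabor \<alpha> \<beta> g" and ?\<Gamma> = "gabor \<alpha> \<beta> \<gamma>"
  let ?P = "modulation_pairing \<psi>"
  have Gq: "?G i \<in> vectors (Mod q)" and Gr: "?G i \<in> vectors (Mod r)"
    and \<Gamma>q: "?\<Gamma> i \<in> vectors (Mod q)" and \<Gamma>r: "?\<Gamma> i \<in> vectors (Mod r)" for i
    using g \<gamma> q r by (auto intro: gabor_Mod)
  have C: "\<exists>C. \<forall>l\<in>dual (Mod q). \<forall>F. finite F \<longrightarrow> (\<Sum>i\<in>F. norm (?P f (?\<Gamma> i) * l (?G i))) \<le> C * dual_norm (Mod q) l"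
    if f: "f \<in> vectors (Mod q)" for f
  proof -
    obtain C where C: "\<And>l. l \<in> dual (Mod q) \<Longrightarrow> (\<lambda>i. norm (l (\<lambda>s. ?P f (?\<Gamma> i) * ?G i s))) summable_on UNIV \<and>
        (\<Sum>\<^sub>\<infinity>i. norm (l (\<lambda>s. ?P f (?\<Gamma> i) * ?G i s))) \<le> C * dual_norm (Mod q) l"
      using wuc[OF f] unfolding weakly_unconditionally_convergent_def by blast
    have "(\<Sum>i\<in>F. norm (?P f (?\<Gamma> i) * l (?G i))) \<le> C * dual_norm (Mod q) l" if l: "l \<in> dual (Mod q)" and F: "finite F" for l F
    proof -
      have "(\<Sum>i\<in>F. norm (?P f (?\<Gamma> i) * l (?G i))) = (\<Sum>i\<in>F. norm (l (\<lambda>s. ?P f (?\<Gamma> i) * ?G i s)))"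
        by (simp add: X.dual_scale[OF l Gq])
      also have "\<dots> \<le> (\<Sum>\<^sub>\<infinity>i. norm (l (\<lambda>s. ?P f (?\<Gamma> i) * ?G i s)))"
        using C[OF l] F by (intro finite_sum_le_infsum) auto
      finally show ?thesis using C[OF l] by linarith
    qed
    then show ?thesis by blast
  qed
  show "\<exists>B\<ge>0. bessel q ?\<Gamma> B"
  proof (rule bessel_of_pointwise[OF \<Gamma>r q])
    fix f assume f: "f \<in> vectors (Mod q)"
    obtain C where C: "\<And>l F. l \<in> dual (Mod q) \<Longrightarrow> finite F \<Longrightarrow> (\<Sum>i\<in>F. norm (?P f (?\<Gamma> i) * l (?G i))) \<le> C * dual_norm (Mod q) l"
      using C[OF f] by blast
    obtain I where I: "I > 0" "\<And>F b K. finite F \<Longrightarrow> (\<And>S. S \<subseteq> F \<Longrightarrow> nrm (Mod q)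
        (\<lambda>s. \<Sum>i\<in>F. ((if i \<in> S then 1 else - 1) * b i) * ?G i s) \<le> K) \<Longrightarrow>
      (\<Sum>i\<in>F. norm (b i) powr q) * I \<le> 2 * K powr q"
      by (rule signed_sums_bound_coefficients[OF g(1) q(1) g(3) \<alpha>\<beta>]) blast
    \<comment> \<open>Changing signs does not affect the weak bound, so every signed sum has norm at
      most \<open>\<bar>C\<bar>\<close>, as seen by a norming functional.\<close>
    have "(\<Sum>i\<in>F. norm (?P f (?\<Gamma> i)) powr q) \<le> 2 * \<bar>C\<bar> powr q / I" if F: "finite F" for F
    proof -
      have "(\<Sum>i\<in>F. norm (?P f (?\<Gamma> i)) powr q) * I \<le> 2 * \<bar>C\<bar> powr q"
      proof (rule I(2)[OF F])
        fix S assume "S \<subseteq> F"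
        define s where "s = (\<lambda>t. \<Sum>i\<in>F. ((if i \<in> S then 1 else - 1) * ?P f (?\<Gamma> i)) * ?G i t)"
        have sm: "s \<in> vectors (Mod q)" unfolding s_def by (intro X.sum_mem X.scale_mem Gq)
        obtain l where l: "l \<in> dual (Mod q)" "dual_norm (Mod q) l \<le> 1" "l s = of_real (nrm (Mod q) s)"
          by (rule norming_dual[OF sm q(1)])
        have "nrm (Mod q) s = norm (l s)" using l(3) X.nrm_nonneg[OF sm] by simp
        also have "l s = (\<Sum>i\<in>F. l (\<lambda>t. ((if i \<in> S then 1 else - 1) * ?P f (?\<Gamma> i)) * ?G i t))"
          unfolding s_def by (intro X.dual_sum[OF l(1)] X.scale_mem Gq)
        also have "\<dots> = (\<Sum>i\<in>F. ((if i \<in> S then 1 else - 1) * ?P f (?\<Gamma> i)) * l (?G i))"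
          by (simp only: X.dual_scale[OF l(1) Gq])
        also have "norm \<dots> \<le> (\<Sum>i\<in>F. norm (?P f (?\<Gamma> i) * l (?G i)))"
          by (rule sum_norm_le) (auto simp: norm_mult)
        also have "\<dots> \<le> C * dual_norm (Mod q) l" by (rule C[OF l(1) F])
        also have "\<dots> \<le> \<bar>C\<bar> * 1"
          using l(2) X.dual_norm_nonneg[OF l(1)] by (intro mult_mono) auto
        finally show "nrm (Mod q) (\<lambda>t. \<Sum>i\<in>F. ((if i \<in> S then 1 else - 1) * ?P f (?\<Gamma> i)) * ?G i t) \<le> \<bar>C\<bar>"
          by (simp add: s_def)
      qed
      then show ?thesis using I(1) by (simp add: pos_le_divide_eq)
    qed
    then show "\<exists>C. \<forall>F. finite F \<longrightarrow> (\<Sum>i\<in>F. norm (?P f (?\<Gamma> i)) powr q) \<le> C" by blast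
  qed
  show "\<exists>B\<ge>0. bessel r ?G B"
  proof (rule bessel_of_pointwise[OF Gq r(1) rq])
    fix h assume h: "h \<in> vectors (Mod r)"
    obtain I where I: "I > 0" "\<And>F b K. finite F \<Longrightarrow> (\<And>S. S \<subseteq> F \<Longrightarrow> nrm (Mod r)
        (\<lambda>s. \<Sum>i\<in>F. ((if i \<in> S then 1 else - 1) * b i) * ?\<Gamma> i s) \<le> K) \<Longrightarrow>
      (\<Sum>i\<in>F. norm (b i) powr r) * I \<le> 2 * K powr r"
      by (rule signed_sums_bound_coefficients[OF \<gamma>(2) r(1) \<gamma>(3) \<alpha>\<beta>]) blast
    define \<epsilon> where "\<epsilon> = (\<lambda>S (i :: int \<times> int). if i \<in> S then 1 else - 1 :: complex)"
    define s where "s = (\<lambda>F S t. \<Sum>i\<in>F. (\<epsilon> S i * ?P h (?G i)) * ?\<Gamma> i t)"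
    have sm: "s F S \<in> vectors (Mod r)" for F S unfolding s_def by (intro Y.sum_mem Y.scale_mem \<Gamma>r)
    \<comment> \<open>Pairing \<open>f\<close> with a signed sum of the transposed series gives
      signed terms of the original series for \<open>f\<close>, evaluated by the functional that
      \<open>h\<close> defines. Hence pointwise boundedness in \<open>f\<close>, and from it a bound
      on the transposed sums in \<open>M^r\<close>.\<close>
    define \<Lambda> where "\<Lambda> = {\<lambda>f. ?P f (s F S) | F S. finite F \<and> S \<subseteq> F}"
    have sub: "\<Lambda> \<subseteq> dual (Mod q)" unfolding \<Lambda>_def using pairing_dual[OF sm q] by blast
    have Ps: "?P f (s F S) = (\<Sum>i\<in>F. \<epsilon> S i * (?P f (?\<Gamma> i) * cnj (?P h (?G i))))"
      if f: "f \<in> vectors (Mod q)" and F: "finite F" for f F S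
    proof -
      have "?P f (s F S) = cnj (?P (s F S) f)" by (simp add: pairing_cnj)
      also have "?P (s F S) f = (\<Sum>i\<in>F. ?P (\<lambda>t. (\<epsilon> S i * ?P h (?G i)) * ?\<Gamma> i t) f)"
        unfolding s_def by (rule Y.dual_sum[OF pairing_dual[OF f r(1) rq]]) (intro Y.scale_mem \<Gamma>r)
      also have "\<dots> = (\<Sum>i\<in>F. (\<epsilon> S i * ?P h (?G i)) * ?P (?\<Gamma> i) f)" by (simp only: pairing_scale)
      also have "cnj \<dots> = (\<Sum>i\<in>F. cnj ((\<epsilon> S i * ?P h (?G i)) * ?P (?\<Gamma> i) f))" by (rule cnj_sum)
      also have "\<dots> = (\<Sum>i\<in>F. \<epsilon> S i * (?P f (?\<Gamma> i) * cnj (?P h (?G i))))"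
        by (intro sum.cong refl) (simp add: pairing_cnj \<epsilon>_def)
      finally show ?thesis .
    qed
    have "\<exists>C. \<forall>l\<in>\<Lambda>. norm (l f) \<le> C" if f: "f \<in> vectors (Mod q)" for f
    proof -
      obtain C where C: "\<And>l F. l \<in> dual (Mod q) \<Longrightarrow> finite F \<Longrightarrow> (\<Sum>i\<in>F. norm (?P f (?\<Gamma> i) * l (?G i))) \<le> C * dual_norm (Mod q) l"
        using C[OF f] by blast
      have "norm (?P f (s F S)) \<le> C * dual_norm (Mod q) (\<lambda>u. ?P u h)" if F: "finite F" for F S
      proof -
        have "norm (?P f (s F S)) \<le> (\<Sum>i\<in>F. norm (?P f (?\<Gamma> i) * ?P (?G i) h))"
          unfolding Ps[OF f F] by (rule sum_norm_le) (auto simp: \<epsilon>_def norm_mult pairing_cnj)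
        also have "\<dots> \<le> C * dual_norm (Mod q) (\<lambda>u. ?P u h)"
          by (rule C[OF pairing_dual[OF h q] F])
        finally show ?thesis .
      qed
      then show ?thesis unfolding \<Lambda>_def by blast
    qed
    from X.uniform_boundedness[OF sub this] obtain C where C: "\<And>l. l \<in> \<Lambda> \<Longrightarrow> dual_norm (Mod q) l \<le> C" by blast
    \<comment> \<open>The norm is read off from an \<open>f\<close> of norm at most
      \<open>kmass / energy\<close> supplied by \<open>norming_Mod\<close>; the energy
      cancels.\<close>
    have "nrm (Mod r) (s F S) \<le> \<bar>C\<bar> * kmass" if F: "finite F" "S \<subseteq> F" for F S
    proof -
      obtain f where f: "f \<in> vectors (Mod q)" "nrm (Mod q) f \<le> kmass / energy"
        "?P (s F S) f = of_real (nrm (Mod r) (s F S) / energy)"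
        by (rule norming_Mod[OF sm r(1) rq])
      have l: "(\<lambda>f. ?P f (s F S)) \<in> \<Lambda>" unfolding \<Lambda>_def using F by blast
      then have l': "(\<lambda>f. ?P f (s F S)) \<in> dual (Mod q)" using sub by blast
      have "nrm (Mod r) (s F S) / energy = norm (?P (s F S) f)"
        unfolding f(3) norm_of_real using Y.nrm_nonneg[OF sm] energy_pos by simp
      also have "\<dots> = norm (?P f (s F S))" by (metis pairing_cnj complex_mod_cnj)
      also have "\<dots> \<le> dual_norm (Mod q) (\<lambda>f. ?P f (s F S)) * nrm (Mod q) f"
        by (rule X.dual_norm_bound[OF l' f(1)])
      also have "\<dots> \<le> \<bar>C\<bar> * (kmass / energy)"
        using C[OF l] f X.nrm_nonneg[OF f(1)] by (intro mult_mono) auto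
      finally show ?thesis using energy_pos by (simp add: divide_le_eq)
    qed
    then have "(\<Sum>i\<in>F. norm (?P h (?G i)) powr r) * I \<le> 2 * (\<bar>C\<bar> * kmass) powr r" if F: "finite F" for F
      unfolding s_def \<epsilon>_def using F by (intro I(2)) blast+
    then have "(\<Sum>i\<in>F. norm (?P h (?G i)) powr r) \<le> 2 * (\<bar>C\<bar> * kmass) powr r / I" if F: "finite F" for F
      using I(1) F by (simp add: pos_le_divide_eq)
    then show "\<exists>C. \<forall>F. finite F \<longrightarrow> (\<Sum>i\<in>F. norm (?P h (?G i)) powr r) \<le> C" by blast
  qed
qed

end

text \<open>Bounded finite sums of vectors give bounded subset sums of scalars under each
  functional, and these bound the sum of the moduli up to the factor 4.\<close>

lemma (in normed_fspace) weakly_unconditionally_convergent_of_unconditional: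
  assumes \<sigma>: "bij (\<sigma> :: nat \<Rightarrow> 'i)" and x: "\<And>i. x i \<in> vectors X"
    and uc: "unconditionally_convergent X (\<lambda>n. x (\<sigma> n))"
  shows "weakly_unconditionally_convergent X x"
proof -
  obtain C where C: "\<And>F. finite F \<Longrightarrow> nrm X (\<lambda>s. \<Sum>n\<in>F. x (\<sigma> n) s) \<le> C"
    by (rule unconditionally_convergent_bounded[of "\<lambda>n. x (\<sigma> n)", OF x uc]) blast
  have C0: "C \<ge> 0" using C[of "{}"] nrm_zero by simp
  have C': "nrm X (\<lambda>s. \<Sum>i\<in>F. x i s) \<le> C" if F: "finite F" for F
  proof -
    have inj: "inj_on \<sigma> (\<sigma> -` F)" using bij_is_inj[OF \<sigma>] by (rule inj_on_subset) simp
    have img: "\<sigma> ` (\<sigma> -` F) = F" using bij_is_surj[OF \<sigma>] by auto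
    have "(\<Sum>i\<in>F. x i s) = (\<Sum>n\<in>\<sigma> -` F. x (\<sigma> n) s)" for s
      using sum.reindex[OF inj, of "\<lambda>i. x i s", unfolded img o_def] .
    then show ?thesis using C[of "\<sigma> -` F"] finite_vimageI[OF F bij_is_inj[OF \<sigma>]] by simp
  qed
  \<comment> \<open>\<open>C + 1\<close> in place of \<open>C\<close> makes the constant strictly
    positive even when \<open>C = 0\<close>.\<close>
  have b: "(\<Sum>i\<in>F. norm (l (x i))) \<le> 4 * (C + 1) * dual_norm X l" if l: "l \<in> dual X" and F: "finite F" for l F
  proof -
    have "(\<Sum>i\<in>F. norm (l (x i))) \<le> 4 * (dual_norm X l * (C + 1))"
    proof (rule sum_norm_le_subset_sums[OF F])
      fix S assume "S \<subseteq> F"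
      then have S: "finite S" using F by (rule finite_subset)
      have "(\<Sum>i\<in>S. l (x i)) = l (\<lambda>s. \<Sum>i\<in>S. x i s)" by (rule dual_sum[OF l x, symmetric])
      also have "norm \<dots> \<le> dual_norm X l * nrm X (\<lambda>s. \<Sum>i\<in>S. x i s)"
        by (rule dual_norm_bound[OF l sum_mem[OF x]])
      also have "\<dots> \<le> dual_norm X l * (C + 1)"
        using C'[OF S] by (intro mult_left_mono dual_norm_nonneg l) simp
      finally show "norm (\<Sum>i\<in>S. l (x i)) \<le> dual_norm X l * (C + 1)" .
    qed
    then show ?thesis by (simp add: mult_ac)
  qed
  show ?thesis
    unfolding weakly_unconditionally_convergent_def
  proof (intro conjI allI x exI[of _ "4 * (C + 1)"] ballI)
    show "4 * (C + 1) > 0" using C0 by simp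
    fix l assume l: "l \<in> dual X"
    show s: "(\<lambda>i. norm (l (x i))) summable_on UNIV"
      by (rule nonneg_bdd_above_summable_on) (use b[OF l] in \<open>auto intro!: bdd_aboveI2\<close>)
    show "(\<Sum>\<^sub>\<infinity>i. norm (l (x i))) \<le> 4 * (C + 1) * dual_norm X l"
      by (rule infsum_le_finite_sums[OF s]) (use b[OF l] in auto)
  qed
qed

section \<open>Analysis operators and reconstruction\<close>

context window
begin

text \<open>For nonnegative terms the infinite sum is the supremum of the finite ones; linearity of
  the analysis operator is that of the pairing.\<close>

lemma bounded_operator_iff_bessel:
  assumes h: "\<And>i. h i \<in> vectors (Mod r)" and q: "q > 1" "1 / q + 1 / r = 1"
  shows "bounded_operator (Mod q) (lq_space q) (analysis_operator \<psi> h) \<longleftrightarrow> (\<exists>B\<ge>0. bessel q h B)"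
proof -
  let ?P = "modulation_pairing \<psi>"
  have nrm: "nrm (Mod q) f \<ge> 0" for f by (simp add: Mod_nrm)
  show ?thesis
  proof
    assume L: "bounded_operator (Mod q) (lq_space q) (analysis_operator \<psi> h)"
    then obtain C where C': "\<And>f. f \<in> vectors (Mod q) \<Longrightarrow> analysis_operator \<psi> h f \<in> vectors (lq_space q) \<and>
        nrm (lq_space q) (analysis_operator \<psi> h f) \<le> C * nrm (Mod q) f"
      unfolding bounded_operator_def by blast
    have C: "(\<lambda>i. norm (?P f (h i)) powr q) summable_on UNIV \<and>
        (\<Sum>\<^sub>\<infinity>i. norm (?P f (h i)) powr q) powr (1 / q) \<le> C * nrm (Mod q) f" if "f \<in> vectors (Mod q)" for f
      using C'[OF that] by (simp add: lq_space_def analysis_operator_def)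
    have "bessel q h \<bar>C\<bar>"
      unfolding bessel_def
    proof (intro ballI allI impI)
      fix f and F :: "(int \<times> int) set" assume f: "f \<in> vectors (Mod q)" and F: "finite F"
      have "(\<Sum>i\<in>F. norm (?P f (h i)) powr q) powr (1 / q) \<le> (\<Sum>\<^sub>\<infinity>i. norm (?P f (h i)) powr q) powr (1 / q)"
        using C[OF f] F q(1) by (intro powr_mono2 finite_sum_le_infsum) (auto intro: sum_nonneg)
      also have "\<dots> \<le> C * nrm (Mod q) f" using C[OF f] by blast
      also have "\<dots> \<le> \<bar>C\<bar> * nrm (Mod q) f" using nrm by (intro mult_right_mono) auto
      finally show "(\<Sum>i\<in>F. norm (?P f (h i)) powr q) powr (1 / q) \<le> \<bar>C\<bar> * nrm (Mod q) f" .
    qed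
    then show "\<exists>B\<ge>0. bessel q h B" by (intro exI[of _ "\<bar>C\<bar>"]) auto
  next
    assume "\<exists>B\<ge>0. bessel q h B"
    then obtain B where B: "B \<ge> 0" "bessel q h B" by blast
    have fin: "(\<Sum>i\<in>F. norm (?P f (h i)) powr q) \<le> (B * nrm (Mod q) f) powr q" if "f \<in> vectors (Mod q)" "finite F" for f F
    proof -
      have "((\<Sum>i\<in>F. norm (?P f (h i)) powr q) powr (1 / q)) powr q \<le> (B * nrm (Mod q) f) powr q"
        using besselD[OF B(2) that] q(1) by (intro powr_mono2) auto
      then show ?thesis using q(1) by (simp add: powr_powr sum_nonneg)
    qed
    have summ: "(\<lambda>i. norm (?P f (h i)) powr q) summable_on UNIV" if "f \<in> vectors (Mod q)" for f
      by (rule nonneg_bdd_above_summable_on) (use fin[OF that] in \<open>auto intro!: bdd_aboveI2\<close>)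
    have "(\<Sum>\<^sub>\<infinity>i. norm (?P f (h i)) powr q) powr (1 / q) \<le> B * nrm (Mod q) f" if f: "f \<in> vectors (Mod q)" for f
    proof -
      have "(\<Sum>\<^sub>\<infinity>i. norm (?P f (h i)) powr q) \<le> (B * nrm (Mod q) f) powr q"
        by (rule infsum_le_finite_sums[OF summ[OF f]]) (use fin[OF f] in auto)
      then have "(\<Sum>\<^sub>\<infinity>i. norm (?P f (h i)) powr q) powr (1 / q) \<le> ((B * nrm (Mod q) f) powr q) powr (1 / q)"
        using q(1) by (intro powr_mono2) (auto intro: infsum_nonneg)
      then show ?thesis using q(1) B(1) nrm by (simp add: powr_powr)
    qed
    then show "bounded_operator (Mod q) (lq_space q) (analysis_operator \<psi> h)"
      unfolding bounded_operator_def lq_space_def analysis_operator_def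
      using summ pairing_add[OF _ _ h q] pairing_scale by auto
  qed
qed

lemma analysis_norm_bessel:
  assumes "bessel q h B" "B \<ge> 0" "q > 1" "f \<in> vectors (Mod q)"
  shows "(\<lambda>i. norm (modulation_pairing \<psi> f (h i)) powr q) summable_on UNIV"
    "nrm (lq_space q) (analysis_operator \<psi> h f) \<le> B * nrm (Mod q) f"
    "\<And>F. finite F \<Longrightarrow> (\<Sum>i\<in>F. norm (modulation_pairing \<psi> f (h i)) powr q) powr (1 / q) \<le> nrm (lq_space q) (analysis_operator \<psi> h f)"
proof -
  let ?P = "modulation_pairing \<psi>"
  have nrm: "nrm (Mod q) f \<ge> 0" by (simp add: Mod_nrm)
  have fin: "(\<Sum>i\<in>F. norm (?P f (h i)) powr q) \<le> (B * nrm (Mod q) f) powr q" if "finite F" for F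
  proof -
    have "((\<Sum>i\<in>F. norm (?P f (h i)) powr q) powr (1 / q)) powr q \<le> (B * nrm (Mod q) f) powr q"
      using besselD[OF assms(1,4) that] assms(3) by (intro powr_mono2) auto
    then show ?thesis using assms(3) by (simp add: powr_powr sum_nonneg)
  qed
  show summ: "(\<lambda>i. norm (?P f (h i)) powr q) summable_on UNIV"
    by (rule nonneg_bdd_above_summable_on) (use fin in \<open>auto intro!: bdd_aboveI2\<close>)
  have "(\<Sum>\<^sub>\<infinity>i. norm (?P f (h i)) powr q) \<le> (B * nrm (Mod q) f) powr q"
    by (rule infsum_le_finite_sums[OF summ]) (use fin in auto)
  then have "(\<Sum>\<^sub>\<infinity>i. norm (?P f (h i)) powr q) powr (1 / q) \<le> ((B * nrm (Mod q) f) powr q) powr (1 / q)"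
    using assms(3) by (intro powr_mono2) (auto intro: infsum_nonneg)
  then show "nrm (lq_space q) (analysis_operator \<psi> h f) \<le> B * nrm (Mod q) f"
    using assms nrm by (simp add: powr_powr lq_space_def analysis_operator_def)
  show "(\<Sum>i\<in>F. norm (?P f (h i)) powr q) powr (1 / q) \<le> nrm (lq_space q) (analysis_operator \<psi> h f)" if "finite F" for F
    unfolding lq_space_def analysis_operator_def fspace.simps
    using summ that assms(3) by (intro powr_mono2 finite_sum_le_infsum) (auto intro: sum_nonneg)
qed

text \<open>The coefficients of \<open>f\<close> and of \<open>h\<close> lie in conjugate sequence
  spaces, so Hoelder gives absolute summability.\<close>

lemma bessel_pair_summable:
  assumes q: "q > 1" "1 / q + 1 / r = 1" and B: "bessel q \<Gamma> B" "bessel r G B'" "B \<ge> 0"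
    and f: "f \<in> vectors (Mod q)" and h: "h \<in> vectors (Mod r)"
  shows "(\<lambda>i. norm (modulation_pairing \<psi> f (\<Gamma> i) * cnj (modulation_pairing \<psi> h (G i)))) summable_on UNIV"
    "norm (\<Sum>\<^sub>\<infinity>i. modulation_pairing \<psi> f (\<Gamma> i) * cnj (modulation_pairing \<psi> h (G i))) \<le>
      (B * nrm (Mod q) f) * (B' * nrm (Mod r) h)"
proof -
  let ?P = "modulation_pairing \<psi>"
  have fin: "(\<Sum>i\<in>F. norm (?P f (\<Gamma> i) * cnj (?P h (G i)))) \<le> (B * nrm (Mod q) f) * (B' * nrm (Mod r) h)" if F: "finite F" for F
  proof -
    have "(\<Sum>i\<in>F. norm (?P f (\<Gamma> i) * cnj (?P h (G i)))) \<le>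
        (\<Sum>i\<in>F. norm (?P f (\<Gamma> i)) powr q) powr (1 / q) * (\<Sum>i\<in>F. norm (?P h (G i)) powr r) powr (1 / r)"
      unfolding norm_mult complex_mod_cnj by (rule Holder_sum_complex[OF F q])
    also have "\<dots> \<le> (B * nrm (Mod q) f) * (B' * nrm (Mod r) h)"
      using B(3) by (intro mult_mono besselD[OF B(1) f F] besselD[OF B(2) h F]) (auto simp: Mod_nrm)
    finally show ?thesis .
  qed
  show s: "(\<lambda>i. norm (?P f (\<Gamma> i) * cnj (?P h (G i)))) summable_on UNIV"
    by (rule nonneg_bdd_above_summable_on) (use fin in \<open>auto intro!: bdd_aboveI2\<close>)
  show "norm (\<Sum>\<^sub>\<infinity>i. ?P f (\<Gamma> i) * cnj (?P h (G i))) \<le> (B * nrm (Mod q) f) * (B' * nrm (Mod r) h)"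
    by (rule order_trans[OF norm_infsum_bound[OF s] infsum_le_finite_sums[OF s]]) (use fin in auto)
qed

text \<open>Both sides are bounded sesquilinear forms on \<open>M^q\<close> times
  \<open>M^r\<close>, and they agree on synthesised functions with moments, which are dense in
  either factor. The hypothesis gives convergence along one enumeration; absolute summability
  identifies that limit with the unordered sum.\<close>

lemma frame_identity_extension:
  assumes q: "q > 1" "1 / q + 1 / r = 1"
    and \<Gamma>: "\<And>i. \<Gamma> i \<in> vectors (Mod r)" and G: "\<And>i. G i \<in> vectors (Mod q)"
    and B: "bessel q \<Gamma> B" "bessel r G B'" "B \<ge> 0" "B' \<ge> 0"
    and \<sigma>: "bij (\<sigma> :: nat \<Rightarrow> int \<times> int)"
    and base: "\<And>F H. F \<in> moments \<Longrightarrow> H \<in> moments \<Longrightarrow> F \<in> Lp lborel q \<Longrightarrow> H \<in> Lp lborel r \<Longrightarrow>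
      (\<lambda>N. \<Sum>j<N. modulation_pairing \<psi> (synth F) (\<Gamma> (\<sigma> j)) * cnj (modulation_pairing \<psi> (synth H) (G (\<sigma> j))))
        \<longlonglongrightarrow> modulation_pairing \<psi> (synth F) (synth H)"
    and f: "f \<in> vectors (Mod q)" and h: "h \<in> vectors (Mod r)"
  shows "((\<lambda>i. modulation_pairing \<psi> f (\<Gamma> i) * cnj (modulation_pairing \<psi> h (G i))) has_sum modulation_pairing \<psi> f h) UNIV"
proof -
  note r = conj_exponent_eqs(1,2)[OF q]
  have rq: "1 / r + 1 / q = 1" using q by simp
  interpret X: normed_fspace "Mod q" by (rule normed_Mod[OF q(1)])
  interpret Y: normed_fspace "Mod r" by (rule normed_Mod[OF r(1)])
  let ?P = "modulation_pairing \<psi>"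
  define S where "S = (\<lambda>f h. \<Sum>\<^sub>\<infinity>i. ?P f (\<Gamma> i) * cnj (?P h (G i)))"
  define D where "D = (\<lambda>f h. S f h - ?P f h)"
  define C where "C = B * B' + 1 / energy"
  have sm: "(\<lambda>i. ?P f (\<Gamma> i) * cnj (?P h (G i))) summable_on UNIV" if "f \<in> vectors (Mod q)" "h \<in> vectors (Mod r)" for f h
    by (rule abs_summable_summable[OF bessel_pair_summable(1)[OF q B(1-3) that]])
  have D: "norm (D f h) \<le> C * (nrm (Mod q) f * nrm (Mod r) h)" if "f \<in> vectors (Mod q)" "h \<in> vectors (Mod r)" for f h
  proof -
    have "norm (D f h) \<le> norm (S f h) + norm (?P f h)" unfolding D_def by (rule norm_triangle_ineq4)
    also have "\<dots> \<le> (B * nrm (Mod q) f) * (B' * nrm (Mod r) h) + nrm (Mod q) f * nrm (Mod r) h / energy"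
      unfolding S_def by (intro add_mono bessel_pair_summable(2)[OF q B(1-3) that] pairing_bound that q)
    finally show ?thesis by (simp add: C_def algebra_simps)
  qed
  have D1: "D f h = D f' h + D (\<lambda>s. f s - f' s) h" if "f \<in> vectors (Mod q)" "f' \<in> vectors (Mod q)" "h \<in> vectors (Mod r)" for f f' h
  proof -
    have e: "?P f v = ?P f' v + ?P (\<lambda>s. f s - f' s) v" if v: "v \<in> vectors (Mod r)" for v
      using X.dual_diff[OF pairing_dual[OF v q] \<open>f \<in> _\<close> \<open>f' \<in> _\<close>] by simp
    have "S f h = S f' h + S (\<lambda>s. f s - f' s) h"
      unfolding S_def e[OF \<Gamma>] distrib_right
      by (intro infsum_add sm X.diff_mem that)
    then show ?thesis using e[OF that(3)] by (simp add: D_def)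
  qed
  have D2: "D f h = D f h' + D f (\<lambda>s. h s - h' s)" if "f \<in> vectors (Mod q)" "h \<in> vectors (Mod r)" "h' \<in> vectors (Mod r)" for f h h'
  proof -
    have e': "?P h v = ?P h' v + ?P (\<lambda>s. h s - h' s) v" if v: "v \<in> vectors (Mod q)" for v
      using Y.dual_diff[OF pairing_dual[OF v r(1) rq] \<open>h \<in> _\<close> \<open>h' \<in> _\<close>] by simp
    have "S f h = S f h' + S f (\<lambda>s. h s - h' s)"
      unfolding S_def e'[OF G] complex_cnj_add distrib_left
      by (intro infsum_add sm Y.diff_mem that)
    moreover have "?P f h = ?P f h' + ?P f (\<lambda>s. h s - h' s)"
      using arg_cong[OF e'[OF that(1)], of cnj] by (simp add: pairing_cnj)
    ultimately show ?thesis by (simp add: D_def)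
  qed
  obtain F where F: "\<And>n. F n \<in> moments" "\<And>n. F n \<in> Lp lborel q"
    "(\<lambda>n. nrm (Mod q) (\<lambda>s. f s - synth (F n) s)) \<longlonglongrightarrow> 0" using moments_approx[OF f q(1)] by blast
  obtain H where H: "\<And>n. H n \<in> moments" "\<And>n. H n \<in> Lp lborel r"
    "(\<lambda>n. nrm (Mod r) (\<lambda>s. h s - synth (H n) s)) \<longlonglongrightarrow> 0" using moments_approx[OF h r(1)] by blast
  have Fm: "synth (F n) \<in> vectors (Mod q)" and Hm: "synth (H n) \<in> vectors (Mod r)" for n
    using synth_Mod(1) F(2) H(2) q(1) r(1) by auto
  have D0: "D (synth (F n)) (synth (H n)) = 0" for n
  proof -
    let ?a = "\<lambda>i. ?P (synth (F n)) (\<Gamma> i) * cnj (?P (synth (H n)) (G i))"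
    have "(?a has_sum S (synth (F n)) (synth (H n))) UNIV"
      unfolding S_def by (rule has_sum_infsum[OF sm[OF Fm Hm]])
    then have "((\<lambda>j. ?a (\<sigma> j)) has_sum S (synth (F n)) (synth (H n))) UNIV"
      using has_sum_reindex_bij_betw[of \<sigma> UNIV UNIV ?a] \<sigma> by simp
    then have "(\<lambda>j. ?a (\<sigma> j)) sums S (synth (F n)) (synth (H n))" by (rule has_sum_imp_sums)
    then have "(\<lambda>N. \<Sum>j<N. ?a (\<sigma> j)) \<longlonglongrightarrow> S (synth (F n)) (synth (H n))" by (simp add: sums_def)
    from LIMSEQ_unique[OF this base[OF F(1) H(1) F(2) H(2)]] show ?thesis by (simp add: D_def)
  qed
  define a where "a = (\<lambda>n. nrm (Mod q) (\<lambda>s. f s - synth (F n) s))"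
  define b where "b = (\<lambda>n. nrm (Mod r) (\<lambda>s. h s - synth (H n) s))"
  \<comment> \<open>The defect \<open>D\<close> vanishes on approximants. First \<open>h\<close> is
    approximated with the approximant of \<open>f\<close> in the other slot, whose norm is at most
    \<open>nrm (Mod q) f + a n\<close>; then \<open>f\<close> itself is approximated.\<close>
  have bound: "norm (D f h) \<le> C * (a n * nrm (Mod r) h) + C * ((nrm (Mod q) f + a n) * b n)" for n
  proof -
    have "nrm (Mod q) (synth (F n)) = nrm (Mod q) (\<lambda>s. f s - (f s - synth (F n) s))" by simp
    also have "\<dots> \<le> nrm (Mod q) f + a n"
      unfolding a_def by (rule X.nrm_diff_triangle[OF f X.diff_mem[OF f Fm]])
    finally have Fn: "nrm (Mod q) (synth (F n)) \<le> nrm (Mod q) f + a n" .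
    have C0: "C \<ge> 0" using B energy_pos by (simp add: C_def)
    have "D f h = (D (synth (F n)) (synth (H n)) + D (synth (F n)) (\<lambda>s. h s - synth (H n) s)) + D (\<lambda>s. f s - synth (F n) s) h"
      using D1[OF f Fm h, of n] D2[OF Fm h Hm, of n n] by simp
    then have "norm (D f h) \<le> norm (D (\<lambda>s. f s - synth (F n) s) h) + norm (D (synth (F n)) (\<lambda>s. h s - synth (H n) s))"
      unfolding D0 by (metis add.commute add_0 norm_triangle_ineq)
    also have "\<dots> \<le> C * (a n * nrm (Mod r) h) + C * (nrm (Mod q) (synth (F n)) * b n)"
      unfolding a_def b_def by (intro add_mono D X.diff_mem Y.diff_mem f h Fm Hm)
    also have "\<dots> \<le> C * (a n * nrm (Mod r) h) + C * ((nrm (Mod q) f + a n) * b n)"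
      using Fn C0 by (intro add_left_mono mult_left_mono mult_right_mono) (auto simp: b_def Mod_nrm)
    finally show ?thesis .
  qed
  have "(\<lambda>n. C * (a n * nrm (Mod r) h) + C * ((nrm (Mod q) f + a n) * b n)) \<longlonglongrightarrow>
      C * (0 * nrm (Mod r) h) + C * ((nrm (Mod q) f + 0) * 0)"
    using F(3) H(3) unfolding a_def b_def by (intro tendsto_intros)
  then have "norm (D f h) \<le> 0"
    by (intro LIMSEQ_le_const[of _ 0 "norm (D f h)"]) (use bound in auto)
  then have "S f h = ?P f h" by (simp add: D_def)
  then show ?thesis using has_sum_infsum[OF sm[OF f h]] by (simp add: S_def)
qed

text \<open>The remainder is tested against a norming \<open>h\<close>. What is left of the identity
  is a sum over the indices not yet used, and Hoelder bounds it by the tail of the coefficients of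
  \<open>f\<close> times the Bessel bound for \<open>h\<close>. The tail vanishes along every
  enumeration.\<close>

lemma unconditional_frame_of_identity:
  assumes q: "q > 1" "1 / q + 1 / r = 1"
    and \<Gamma>: "\<And>i. \<Gamma> i \<in> vectors (Mod r)" and G: "\<And>i. G i \<in> vectors (Mod q)"
    and B: "bessel q \<Gamma> B" "bessel r G B'" "B \<ge> 0" "B' \<ge> 0"
    and id: "\<And>f h. f \<in> vectors (Mod q) \<Longrightarrow> h \<in> vectors (Mod r) \<Longrightarrow>
      ((\<lambda>i. modulation_pairing \<psi> f (\<Gamma> i) * cnj (modulation_pairing \<psi> h (G i))) has_sum modulation_pairing \<psi> f h) UNIV"
    and \<sigma>: "bij (\<sigma> :: nat \<Rightarrow> int \<times> int)"
  shows "unconditional_Schauder_frame (Mod q) (\<lambda>j. G (\<sigma> j)) (\<lambda>j f. modulation_pairing \<psi> f (\<Gamma> (\<sigma> j)))"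
proof -
  note r = conj_exponent_eqs(1,2)[OF q]
  have rq: "1 / r + 1 / q = 1" using q by simp
  interpret X: normed_fspace "Mod q" by (rule normed_Mod[OF q(1)])
  interpret Y: normed_fspace "Mod r" by (rule normed_Mod[OF r(1)])
  let ?P = "modulation_pairing \<psi>"
  have conv: "series_converges_to (Mod q) (\<lambda>j s. ?P f (\<Gamma> (\<sigma> j)) * G (\<sigma> j) s) f"
    if f: "f \<in> vectors (Mod q)" and \<sigma>: "bij \<sigma>" for f and \<sigma> :: "nat \<Rightarrow> int \<times> int"
  proof -
    let ?a = "\<lambda>i. ?P f (\<Gamma> i)"
    have summ: "(\<lambda>i. norm (?a i) powr q) summable_on UNIV"
      by (rule analysis_norm_bessel(1)[OF B(1,3) q(1) f])
    define A where "A = (\<Sum>\<^sub>\<infinity>i. norm (?a i) powr q)"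
    define t where "t = (\<lambda>N. A - (\<Sum>j<N. norm (?a (\<sigma> j)) powr q))"
    have "((\<lambda>j. norm (?a (\<sigma> j)) powr q) has_sum A) UNIV"
      using has_sum_reindex_bij_betw[of \<sigma> UNIV UNIV "\<lambda>i. norm (?a i) powr q"] \<sigma> has_sum_infsum[OF summ]
      by (simp add: A_def)
    then have "(\<lambda>N. \<Sum>j<N. norm (?a (\<sigma> j)) powr q) \<longlonglongrightarrow> A" using has_sum_imp_sums sums_def by blast
    from tendsto_diff[OF tendsto_const[of A] this] have t0: "t \<longlonglongrightarrow> 0" by (simp add: t_def)
    have inj: "inj_on \<sigma> X" for X using bij_is_inj[OF \<sigma>] by (rule inj_on_subset) simp
    have tail: "(\<Sum>i\<in>F. norm (?a i) powr q) \<le> t N" if F: "finite F" "F \<inter> \<sigma> ` {..<N} = {}" for F N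
    proof -
      have "(\<Sum>i\<in>F. norm (?a i) powr q) + (\<Sum>j<N. norm (?a (\<sigma> j)) powr q) = (\<Sum>i\<in>F \<union> \<sigma> ` {..<N}. norm (?a i) powr q)"
        using F by (subst sum.union_disjoint) (auto simp: sum.reindex[OF inj])
      also have "\<dots> \<le> A" unfolding A_def using F by (intro finite_sum_le_infsum summ) auto
      finally show ?thesis by (simp add: t_def)
    qed
    have tnn: "t N \<ge> 0" for N using tail[of "{}" N] by simp
    define R where "R = (\<lambda>N s. f s - (\<Sum>j<N. ?a (\<sigma> j) * G (\<sigma> j) s))"
    have Sm: "(\<lambda>s. \<Sum>j<N. ?a (\<sigma> j) * G (\<sigma> j) s) \<in> vectors (Mod q)" for N
      by (intro X.sum_mem X.scale_mem G)
    have Rm: "R N \<in> vectors (Mod q)" for N unfolding R_def by (intro X.diff_mem f Sm)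
    have "nrm (Mod q) (R N) \<le> B' * kmass * t N powr (1 / q)" for N
    proof -
      obtain h where h: "h \<in> vectors (Mod r)" "nrm (Mod r) h \<le> kmass / energy"
        "?P (R N) h = of_real (nrm (Mod q) (R N) / energy)"
        by (rule norming_Mod[OF Rm q])
      let ?c = "\<lambda>i. ?a i * cnj (?P h (G i))"
      have "?P (R N) h = ?P f h - (\<Sum>j<N. ?P (\<lambda>s. ?a (\<sigma> j) * G (\<sigma> j) s) h)"
        unfolding R_def X.dual_diff[OF pairing_dual[OF h(1) q] f Sm]
        by (simp add: X.dual_sum[OF pairing_dual[OF h(1) q]] X.scale_mem G)
      also have "(\<Sum>j<N. ?P (\<lambda>s. ?a (\<sigma> j) * G (\<sigma> j) s) h) = (\<Sum>j<N. ?c (\<sigma> j))"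
        by (simp add: pairing_scale pairing_cnj)
      also have "\<dots> = (\<Sum>i\<in>\<sigma> ` {..<N}. ?c i)" by (simp add: sum.reindex[OF inj])
      finally have Pr: "?P (R N) h = ?P f h - (\<Sum>i\<in>\<sigma> ` {..<N}. ?c i)" .
      \<comment> \<open>Removing the finitely many indices already summed leaves exactly the pairing
        of the remainder with \<open>h\<close>.\<close>
      have "(?c has_sum (?P f h - (\<Sum>i\<in>\<sigma> ` {..<N}. ?c i))) (UNIV - \<sigma> ` {..<N})"
        by (rule has_sum_Diff[OF id[OF f h(1)] has_sum_finite]) auto
      then have lim: "(sum ?c \<longlongrightarrow> ?P (R N) h) (finite_subsets_at_top (UNIV - \<sigma> ` {..<N}))"
        by (simp add: has_sum_def Pr)
      have "norm (?P (R N) h) \<le> t N powr (1 / q) * (B' * nrm (Mod r) h)"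
      proof (rule tendsto_upperbound[OF tendsto_norm[OF lim]])
        show "\<forall>\<^sub>F F in finite_subsets_at_top (UNIV - \<sigma> ` {..<N}). norm (sum ?c F) \<le> t N powr (1 / q) * (B' * nrm (Mod r) h)"
        proof (rule eventually_finite_subsets_at_top_weakI)
          fix F assume F: "finite F" "F \<subseteq> UNIV - \<sigma> ` {..<N}"
          have "norm (sum ?c F) \<le> (\<Sum>i\<in>F. norm (?a i) * norm (?P h (G i)))"
            by (rule sum_norm_le) (simp add: norm_mult)
          also have "\<dots> \<le> (\<Sum>i\<in>F. norm (?a i) powr q) powr (1 / q) * (\<Sum>i\<in>F. norm (?P h (G i)) powr r) powr (1 / r)"
            by (rule Holder_sum_complex[OF F(1) q])
          also have "\<dots> \<le> t N powr (1 / q) * (B' * nrm (Mod r) h)"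
            using F q(1) by (intro mult_mono powr_mono2 tail besselD[OF B(2) h(1)]) (auto intro: sum_nonneg)
          finally show "norm (sum ?c F) \<le> t N powr (1 / q) * (B' * nrm (Mod r) h)" .
        qed
      qed (simp add: finite_subsets_at_top_neq_bot)
      also have "\<dots> \<le> t N powr (1 / q) * (B' * (kmass / energy))"
        using h(2) B(4) by (intro mult_left_mono) auto
      finally have "nrm (Mod q) (R N) / energy \<le> t N powr (1 / q) * (B' * (kmass / energy))"
        unfolding h(3) norm_of_real by linarith
      then show ?thesis using energy_pos by (simp add: field_simps)
    qed
    then have le: "nrm (Mod q) (R N) \<le> B' * kmass * t N powr (1 / q)" for N .
    have "(\<lambda>N. B' * kmass * t N powr (1 / q)) \<longlonglongrightarrow> 0"
      using q(1) t0 tnn by (intro tendsto_mult_right_zero tendsto_zero_powrI[OF _ tendsto_const]) auto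
    then have "(\<lambda>N. nrm (Mod q) (R N)) \<longlonglongrightarrow> 0"
    proof (rule tendsto_sandwich[OF always_eventually always_eventually tendsto_const, rotated -1]; intro allI)
      show "0 \<le> nrm (Mod q) (R N)" for N by (simp add: Mod_nrm)
    qed (rule le)
    then show ?thesis unfolding series_converges_to_def R_def using f by simp
  qed
  show ?thesis
    unfolding unconditional_Schauder_frame_def Schauder_frame_def unconditionally_convergent_def
  proof (intro conjI allI ballI impI)
    fix f and \<pi> :: "nat \<Rightarrow> nat" assume f: "f \<in> vectors (Mod q)" and "bij \<pi>"
    \<comment> \<open>A rearrangement of an enumeration is another enumeration, so
      \<open>conv\<close> applies again.\<close>
    then have "bij (\<sigma> \<circ> \<pi>)" using \<sigma> by (intro bij_comp)
    from conv[OF f this] show "\<exists>h. series_converges_to (Mod q) (\<lambda>n s. ?P f (\<Gamma> (\<sigma> (\<pi> n))) * G (\<sigma> (\<pi> n)) s) h"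
      by auto
  qed (use G conv \<sigma> pairing_dual[OF \<Gamma> q] in auto)
qed

end

section \<open>Uniform interpolation\<close>

text \<open>For \<open>0 < s\<close>, \<open>0 \<le> y\<close> and \<open>p \<le> p1\<close> this is
  the smaller of the two powers of \<open>y / s\<close>: values above the level \<open>s\<close> are
  charged with exponent \<open>p\<close>, the others with \<open>p1\<close>. It takes the place of
  the K-functional.\<close>

definition tail_power :: "real \<Rightarrow> real \<Rightarrow> real \<Rightarrow> real \<Rightarrow> real" where
  "tail_power p p1 s y = (if y > s then (y / s) powr p else (y / s) powr p1)"

text \<open>The larger of \<open>b\<close> and \<open>c\<close> is at least half of
  \<open>a\<close>. Either power of \<open>a / s\<close> is an upper bound, so the exponent can be
  chosen to match the larger summand.\<close>

lemma tail_power_le: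
  assumes "s > 0" "a \<ge> 0" "b \<ge> 0" "c \<ge> 0" "a \<le> b + c" "0 < p" "p \<le> p1"
  shows "tail_power p p1 s a \<le> 2 powr p1 * ((b / s) powr p + (c / s) powr p1)"
proof -
  have le: "tail_power p p1 s a \<le> (a / s) powr p" "tail_power p p1 s a \<le> (a / s) powr p1"
    using assms by (auto simp: tail_power_def powr_mono powr_mono')
  have two: "2 powr p \<le> 2 powr p1" using assms by (intro powr_mono) auto
  show ?thesis
  proof (cases "b \<ge> c")
    case True
    then have "(a / s) powr p \<le> (2 * (b / s)) powr p"
      using assms by (intro powr_mono2) (auto simp: divide_simps)
    also have "\<dots> = 2 powr p * (b / s) powr p" by (rule powr_mult)
    also have "\<dots> \<le> 2 powr p1 * ((b / s) powr p + (c / s) powr p1)"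
      using two by (intro mult_mono) auto
    finally show ?thesis using le(1) by linarith
  next
    case False
    then have "(a / s) powr p1 \<le> (2 * (c / s)) powr p1"
      using assms by (intro powr_mono2) (auto simp: divide_simps)
    also have "\<dots> = 2 powr p1 * (c / s) powr p1" by (rule powr_mult)
    also have "\<dots> \<le> 2 powr p1 * ((b / s) powr p + (c / s) powr p1)"
      by (intro mult_left_mono) auto
    finally show ?thesis using le(2) by linarith
  qed
qed

text \<open>The level \<open>s = e\<^sup>x\<close> runs over the multiplicative group, so that the integral is homogeneous in \<open>y\<close>.\<close>

lemma tail_power_integral:
  assumes "0 < p" "p < q" "q < p1"
  obtains \<kappa> where "0 < \<kappa>" "\<kappa> < \<top>"
    "\<And>y. y \<ge> 0 \<Longrightarrow> (\<integral>\<^sup>+x. ennreal (exp (q * x) * tail_power p p1 (exp x) y) \<partial>lborel) = ennreal (y powr q) * \<kappa>"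
proof -
  define w where "w = (\<lambda>x. exp (q * x) * tail_power p p1 (exp x) 1)"
  define \<kappa> where "\<kappa> = (\<integral>\<^sup>+x. ennreal (w x) \<partial>lborel)"
  have w: "w x = (if x < 0 then exp ((q - p) * x) else exp (- (p1 - q) * x))" for x
    by (auto simp: w_def tail_power_def powr_def ln_div exp_add[symmetric] algebra_simps)
  have [measurable]: "w \<in> borel_measurable borel" unfolding w by measurable
  have "\<kappa> > 0"
  proof -
    have "ennreal (exp (- (p1 - q))) = (\<integral>\<^sup>+x. ennreal (exp (- (p1 - q))) * indicator {0..1::real} x \<partial>lborel)"
      by (simp add: nn_integral_cmult)
    also have "\<dots> \<le> \<kappa>"
      unfolding \<kappa>_def using assms by (intro nn_integral_mono) (auto simp: w indicator_def mult_left_le)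
    finally show ?thesis by (rule order.strict_trans2[rotated]) simp
  qed
  moreover have "\<kappa> < \<top>"
  proof -
    \<comment> \<open>Half the slower decay rate, so that
      \<open>w x \<le> exp (- (2 * m * \<bar>x\<bar>))\<close>; this is compared with an inverse
      square through \<open>1 + m * \<bar>x\<bar> \<le> exp (m * \<bar>x\<bar>)\<close>. The cap at
      1 gives \<open>m * (1 + \<bar>x\<bar>) \<le> 1 + m * \<bar>x\<bar>\<close>.\<close>
    define m where "m = min 1 (min (q - p) (p1 - q) / 2)"
    have m: "m > 0" "m \<le> 1" "m \<le> (q - p) / 2" "m \<le> (p1 - q) / 2" using assms by (auto simp: m_def min_def)
    have b: "w x \<le> inverse (m\<^sup>2) * inverse ((1 + \<bar>x\<bar>)\<^sup>2)" for x
    proof -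
      have "m * (1 + \<bar>x\<bar>) \<le> 1 + m * \<bar>x\<bar>" using m by (simp add: algebra_simps)
      also have "\<dots> \<le> exp (m * \<bar>x\<bar>)" by (rule exp_ge_add_one_self)
      finally have "(m * (1 + \<bar>x\<bar>))\<^sup>2 \<le> (exp (m * \<bar>x\<bar>))\<^sup>2" using m by (intro power_mono) auto
      then have "(m * (1 + \<bar>x\<bar>))\<^sup>2 \<le> exp (2 * m * \<bar>x\<bar>)" by (simp add: exp_double[symmetric] mult.assoc)
      moreover have "(m * (1 + \<bar>x\<bar>))\<^sup>2 > 0" using m by (simp add: add_pos_nonneg)
      ultimately have "inverse (exp (2 * m * \<bar>x\<bar>)) \<le> inverse ((m * (1 + \<bar>x\<bar>))\<^sup>2)" by (intro le_imp_inverse_le)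
      moreover have "w x \<le> exp (- (2 * m * \<bar>x\<bar>))"
        using m mult_right_mono[of "2 * m" "q - p" "\<bar>x\<bar>"] mult_right_mono[of "2 * m" "p1 - q" "\<bar>x\<bar>"]
        by (auto simp: w algebra_simps)
      ultimately show ?thesis by (simp add: exp_minus power_mult_distrib)
    qed
    have "\<kappa> \<le> (\<integral>\<^sup>+x. ennreal (inverse (m\<^sup>2) * inverse ((1 + \<bar>x\<bar>)\<^sup>2)) \<partial>lborel)"
      unfolding \<kappa>_def by (intro nn_integral_mono ennreal_leI b)
    also have "\<dots> = ennreal (\<integral>x. inverse (m\<^sup>2) * inverse ((1 + \<bar>x\<bar>)\<^sup>2) \<partial>lborel)"
      by (intro nn_integral_eq_integral integrable_mult_right integrable_inverse_square) auto
    also have "\<dots> < \<top>" by simp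
    finally show ?thesis .
  qed
  moreover have "(\<integral>\<^sup>+x. ennreal (exp (q * x) * tail_power p p1 (exp x) y) \<partial>lborel) = ennreal (y powr q) * \<kappa>" if "y \<ge> 0" for y
  proof (cases "y = 0")
    case True
    then show ?thesis using assms by (simp add: tail_power_def not_less)
  next
    case False
    then have y: "y > 0" using that by simp
    have [measurable]: "(\<lambda>x. exp (q * x) * tail_power p p1 (exp x) y) \<in> borel_measurable borel"
      unfolding tail_power_def by measurable
    \<comment> \<open>Translating the logarithmic level by \<open>ln y\<close> reduces to the case
      \<open>y = 1\<close> and releases the factor \<open>y powr q\<close>.\<close>
    have sc: "exp (q * (ln y + x)) * tail_power p p1 (exp (ln y + x)) y = y powr q * w x" for x
    proof -
      have "tail_power p p1 (exp (ln y + x)) y = tail_power p p1 (exp x) 1"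
        using y by (simp add: tail_power_def exp_add)
      moreover have "exp (q * (ln y + x)) = y powr q * exp (q * x)"
        using y by (simp add: powr_def exp_add distrib_left)
      ultimately show ?thesis by (simp add: w_def)
    qed
    have "(\<integral>\<^sup>+x. ennreal (exp (q * x) * tail_power p p1 (exp x) y) \<partial>lborel) =
        (\<integral>\<^sup>+x. ennreal (exp (q * (ln y + x)) * tail_power p p1 (exp (ln y + x)) y) \<partial>lborel)"
      using nn_integral_real_affine[of "\<lambda>x. ennreal (exp (q * x) * tail_power p p1 (exp x) y)" 1 "ln y"] by simp
    also have "\<dots> = ennreal (y powr q) * \<kappa>"
      unfolding sc \<kappa>_def by (subst nn_integral_cmult[symmetric]) (auto simp: ennreal_mult')
    finally show ?thesis .
  qed
  ultimately show ?thesis using that by blast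
qed

context window
begin

text \<open>Real interpolation with a constant that does not degenerate at the endpoints: the factor \<open>\<kappa>\<close>,
  which blows up there, occurs on both sides and cancels.\<close>

lemma bessel_interpolation:
  assumes p: "1 < p" "p < q" "q < p1"
    and h: "\<And>i. h i \<in> vectors (Mod (p1 / (p1 - 1)))"
    and B: "bessel p h B0" "bessel p1 h B1" "B0 \<ge> 0" "B1 \<ge> 0"
    and C: "C = 2 powr p1 * max ((B0 * (kmass / energy)) powr p) ((B1 * (kmass / energy)) powr p1)"
  shows "bessel q h (max 1 C)"
  unfolding bessel_def
proof (intro ballI allI impI)
  fix f and A :: "(int \<times> int) set" assume f: "f \<in> vectors (Mod q)" and A: "finite A"
  have p1: "p1 > 1" and q: "q > 1" using p by auto
  let ?P = "modulation_pairing \<psi>" and ?F = "stft \<psi> f" and ?N = "kmass / energy"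
  note c1 = conj_exponent[OF p1]
  have FL: "?F \<in> Lp lborel q" by (rule Mod_Lp[OF f])
  have [measurable]: "?F \<in> borel_measurable borel" using LpD[OF FL] by simp
  have Fq: "integrable lborel (\<lambda>z. norm (?F z) powr q)" by (rule Lp_integrable[OF FL])
  define a where "a = (\<lambda>i. norm (?P f (h i)))"
  have C0: "C \<ge> 0" unfolding C by (simp add: le_max_iff_disj)
  have N0: "?N \<ge> 0" using kmass_nonneg energy_pos by simp
  have level: "ennreal (\<Sum>i\<in>A. tail_power p p1 s (a i)) \<le> ennreal C * (\<integral>\<^sup>+z. ennreal (tail_power p p1 s (norm (?F z))) \<partial>lborel)"
    if s: "s > 0" for s
  proof -
    \<comment> \<open>The transform is cut at height \<open>s\<close>: large values go to the
      exponent \<open>p\<close>, small ones to \<open>p1\<close>. The pieces are in general not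
      transforms, and synthesising them brings \<open>kmass / energy\<close> into
      \<open>C\<close>.\<close>
    define F0 where "F0 = (\<lambda>z. if norm (?F z) > s then ?F z else 0)"
    define F1 where "F1 = (\<lambda>z. if norm (?F z) > s then 0 else ?F z)"
    have [measurable]: "F0 \<in> borel_measurable borel" "F1 \<in> borel_measurable borel"
      unfolding F0_def F1_def by measurable
    have b0: "norm (F0 z) powr p \<le> s powr (p - q) * norm (?F z) powr q" for z
    proof (cases "norm (?F z) > s")
      case True
      have "norm (?F z) powr p = norm (?F z) powr (p - q) * norm (?F z) powr q"
        by (simp add: powr_add[symmetric])
      also have "norm (?F z) powr (p - q) \<le> s powr (p - q)"
        using True s p by (intro powr_mono2') auto
      finally show ?thesis using True by (simp add: F0_def mult_right_mono)
    qed (use p in \<open>simp add: F0_def\<close>)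
    have b1: "norm (F1 z) powr p1 \<le> s powr (p1 - q) * norm (?F z) powr q" for z
    proof (cases "norm (?F z) > s")
      case False
      have "norm (?F z) powr p1 = norm (?F z) powr (p1 - q) * norm (?F z) powr q"
        by (simp add: powr_add[symmetric])
      also have "norm (?F z) powr (p1 - q) \<le> s powr (p1 - q)"
        using False s p by (intro powr_mono2) auto
      finally show ?thesis using False by (simp add: F1_def mult_right_mono)
    qed (use p in \<open>simp add: F1_def\<close>)
    have i0: "integrable lborel (\<lambda>z. norm (F0 z) powr p)" and i1: "integrable lborel (\<lambda>z. norm (F1 z) powr p1)"
      using b0 b1 by (auto intro!: integrable_boundI[OF integrable_mult_right[OF Fq]])
    have L0: "F0 \<in> Lp lborel p" and L1: "F1 \<in> Lp lborel p1"
      using i0 i1 by (simp_all add: Lp_def)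
    note m0 = synth_Mod[OF L0 p(1)] and m1 = synth_Mod[OF L1 p1]
    have "f = synth (\<lambda>z. F0 z + F1 z)"
      using synth_stft[OF Mod_tempered[OF f]] by (simp add: F0_def F1_def if_distrib cong: if_cong)
    then have f_eq: "f = (\<lambda>t. synth F0 t + synth F1 t)"
      using synth_add[OF L0 p(1) L1 p1] by simp
    \<comment> \<open>Both synthesised pieces lie in \<open>M^p1\<close>, the first by
      \<open>Mod_mono\<close>, and there the pairing with \<open>h i\<close> is additive.\<close>
    have "?P f (h i) = ?P (synth F0) (h i) + ?P (synth F1) (h i)" for i
      unfolding f_eq using Mod_mono[OF m0(1) p(1)] p by (intro pairing_add[OF _ m1(1) h p1 c1(1)]) simp
    then have ai: "a i \<le> norm (?P (synth F0) (h i)) + norm (?P (synth F1) (h i))" for i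
      unfolding a_def by (metis norm_triangle_ineq)
    have sum_b: "(\<Sum>i\<in>A. (norm (?P (synth G) (h i)) / s) powr r) \<le> (B * ?N) powr r * (\<integral>z. (norm (G z) / s) powr r \<partial>lborel)"
      if G: "G \<in> Lp lborel r" "r > 1" and B: "bessel r h B" "B \<ge> 0" for G r B
    proof -
      note mG = synth_Mod[OF G]
      have "(\<Sum>i\<in>A. norm (?P (synth G) (h i)) powr r) = ((\<Sum>i\<in>A. norm (?P (synth G) (h i)) powr r) powr (1 / r)) powr r"
        using G(2) by (simp add: powr_powr sum_nonneg)
      also have "\<dots> \<le> (B * (?N * Lp_norm lborel r G)) powr r"
        using G(2) order_trans[OF besselD[OF B(1) mG(1) A] mult_left_mono[OF mG(2) B(2)]] by (intro powr_mono2) auto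
      also have "\<dots> = (B * ?N) powr r * (\<integral>z. norm (G z) powr r \<partial>lborel)"
        using G(2) Lp_norm_powr[of r lborel G] unfolding mult.assoc[symmetric] powr_mult by simp
      finally have "(\<Sum>i\<in>A. norm (?P (synth G) (h i)) powr r) / s powr r \<le> (B * ?N) powr r * (\<integral>z. norm (G z) powr r \<partial>lborel) / s powr r"
        by (rule divide_right_mono) simp
      then show ?thesis
        using s by (simp add: powr_divide sum_divide_distrib)
    qed
    have it: "integrable lborel (\<lambda>z. (norm (F0 z) / s) powr p + (norm (F1 z) / s) powr p1)"
      using s i0 i1 by (simp add: powr_divide)
    have tp: "tail_power p p1 s (norm (?F z)) = (norm (F0 z) / s) powr p + (norm (F1 z) / s) powr p1" for z
      using p by (auto simp: tail_power_def F0_def F1_def)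
    have "(\<Sum>i\<in>A. tail_power p p1 s (a i)) \<le> (\<Sum>i\<in>A. 2 powr p1 * ((norm (?P (synth F0) (h i)) / s) powr p + (norm (?P (synth F1) (h i)) / s) powr p1))"
      using s p ai by (intro sum_mono tail_power_le) (auto simp: a_def)
    also have "\<dots> = 2 powr p1 * ((\<Sum>i\<in>A. (norm (?P (synth F0) (h i)) / s) powr p) + (\<Sum>i\<in>A. (norm (?P (synth F1) (h i)) / s) powr p1))"
      by (simp add: sum_distrib_left sum.distrib distrib_left)
    also have "\<dots> \<le> 2 powr p1 * ((B0 * ?N) powr p * (\<integral>z. (norm (F0 z) / s) powr p \<partial>lborel) + (B1 * ?N) powr p1 * (\<integral>z. (norm (F1 z) / s) powr p1 \<partial>lborel))"
      by (intro mult_left_mono add_mono sum_b L0 L1 p p1 B) auto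
    also have "\<dots> \<le> 2 powr p1 * (max ((B0 * ?N) powr p) ((B1 * ?N) powr p1) * (\<integral>z. (norm (F0 z) / s) powr p \<partial>lborel) +
        max ((B0 * ?N) powr p) ((B1 * ?N) powr p1) * (\<integral>z. (norm (F1 z) / s) powr p1 \<partial>lborel))"
      by (intro mult_left_mono add_mono mult_right_mono Bochner_Integration.integral_nonneg) auto
    also have "\<dots> = C * (\<integral>z. tail_power p p1 s (norm (?F z)) \<partial>lborel)"
      unfolding tp C using s i0 i1 by (simp add: powr_divide distrib_left mult.assoc)
    finally have "ennreal (\<Sum>i\<in>A. tail_power p p1 s (a i)) \<le> ennreal (C * (\<integral>z. tail_power p p1 s (norm (?F z)) \<partial>lborel))"
      by (rule ennreal_leI)
    also have "\<dots> = ennreal C * (\<integral>\<^sup>+z. ennreal (tail_power p p1 s (norm (?F z))) \<partial>lborel)"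
      using it C0 unfolding tp by (subst nn_integral_eq_integral) (auto simp: ennreal_mult Bochner_Integration.integral_nonneg)
    finally show ?thesis .
  qed
  have p0: "0 < p" using p by simp
  obtain \<kappa> where \<kappa>: "0 < \<kappa>" "\<kappa> < \<top>"
    "\<And>y. y \<ge> 0 \<Longrightarrow> (\<integral>\<^sup>+x. ennreal (exp (q * x) * tail_power p p1 (exp x) y) \<partial>lborel) = ennreal (y powr q) * \<kappa>"
    by (rule tail_power_integral[OF p0 p(2,3)]) blast
  have tp0: "tail_power p p1 s y \<ge> 0" for s y by (simp add: tail_power_def)
  have [measurable]: "(\<lambda>x. tail_power p p1 (exp x) y) \<in> borel_measurable borel" for y
    unfolding tail_power_def by measurable
  have mz: "(\<lambda>(x, z). ennreal (exp (q * x) * tail_power p p1 (exp x) (norm (?F z)))) \<in> borel_measurable (lborel \<Otimes>\<^sub>M lborel)"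
    unfolding tail_power_def by measurable
  have [measurable]: "(\<lambda>z. tail_power p p1 s (norm (?F z))) \<in> borel_measurable borel" for s
    unfolding tail_power_def by measurable
  have se: "ennreal (\<Sum>i\<in>A. a i powr q) = (\<Sum>i\<in>A. ennreal (a i powr q))"
    by (rule sum_ennreal[symmetric]) simp
  have st: "(\<Sum>i\<in>A. ennreal (exp (q * x) * tail_power p p1 (exp x) (a i))) =
      ennreal (exp (q * x)) * ennreal (\<Sum>i\<in>A. tail_power p p1 (exp x) (a i))" for x
  proof -
    have "(\<Sum>i\<in>A. ennreal (exp (q * x) * tail_power p p1 (exp x) (a i))) =
        ennreal (\<Sum>i\<in>A. exp (q * x) * tail_power p p1 (exp x) (a i))"
      using tp0 by (intro sum_ennreal) simp
    also have "\<dots> = ennreal (exp (q * x) * (\<Sum>i\<in>A. tail_power p p1 (exp x) (a i)))"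
      by (simp only: sum_distrib_left)
    also have "\<dots> = ennreal (exp (q * x)) * ennreal (\<Sum>i\<in>A. tail_power p p1 (exp x) (a i))"
      using tp0 by (intro ennreal_mult sum_nonneg) auto
    finally show ?thesis .
  qed
  \<comment> \<open>The estimate at level \<open>exp x\<close> is multiplied by
    \<open>exp (q * x)\<close> and integrated over \<open>x\<close>. Tonelli turns the right-hand
    side into the integral of \<open>norm (?F z) powr q\<close>.\<close>
  have "ennreal (\<Sum>i\<in>A. a i powr q) * \<kappa> = (\<Sum>i\<in>A. ennreal (a i powr q) * \<kappa>)"
    unfolding se by (rule sum_distrib_right)
  also have "\<dots> = (\<Sum>i\<in>A. \<integral>\<^sup>+x. ennreal (exp (q * x) * tail_power p p1 (exp x) (a i)) \<partial>lborel)"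
    by (simp add: \<kappa>(3) a_def)
  also have "\<dots> = (\<integral>\<^sup>+x. (\<Sum>i\<in>A. ennreal (exp (q * x) * tail_power p p1 (exp x) (a i))) \<partial>lborel)"
    by (rule nn_integral_sum[symmetric]) measurable
  also have "\<dots> = (\<integral>\<^sup>+x. ennreal (exp (q * x)) * ennreal (\<Sum>i\<in>A. tail_power p p1 (exp x) (a i)) \<partial>lborel)"
    unfolding st by (rule refl)
  also have "\<dots> \<le> (\<integral>\<^sup>+x. ennreal (exp (q * x)) * (ennreal C * (\<integral>\<^sup>+z. ennreal (tail_power p p1 (exp x) (norm (?F z))) \<partial>lborel)) \<partial>lborel)"
    by (intro nn_integral_mono mult_left_mono level) auto
  also have "\<dots> = (\<integral>\<^sup>+x. ennreal C * (\<integral>\<^sup>+z. ennreal (exp (q * x) * tail_power p p1 (exp x) (norm (?F z))) \<partial>lborel) \<partial>lborel)"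
    by (simp add: ennreal_mult tp0 nn_integral_cmult mult.left_commute)
  also have "\<dots> = ennreal C * (\<integral>\<^sup>+x. (\<integral>\<^sup>+z. ennreal (exp (q * x) * tail_power p p1 (exp x) (norm (?F z))) \<partial>lborel) \<partial>lborel)"
    by (rule nn_integral_cmult) (use lborel.borel_measurable_nn_integral[OF mz] in simp)
  also have "(\<integral>\<^sup>+x. (\<integral>\<^sup>+z. ennreal (exp (q * x) * tail_power p p1 (exp x) (norm (?F z))) \<partial>lborel) \<partial>lborel) =
      (\<integral>\<^sup>+z. (\<integral>\<^sup>+x. ennreal (exp (q * x) * tail_power p p1 (exp x) (norm (?F z))) \<partial>lborel) \<partial>lborel)"
    using lborel_pair.Fubini'[OF mz] by simp
  also have "\<dots> = (\<integral>\<^sup>+z. ennreal (norm (?F z) powr q) * \<kappa> \<partial>lborel)" by (simp add: \<kappa>(3))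
  also have "\<dots> = (\<integral>\<^sup>+z. ennreal (norm (?F z) powr q) \<partial>lborel) * \<kappa>" by (rule nn_integral_multc) measurable
  also have "(\<integral>\<^sup>+z. ennreal (norm (?F z) powr q) \<partial>lborel) = ennreal (nrm (Mod q) f powr q)"
    using Fq q by (subst nn_integral_eq_integral) (auto simp: Mod_nrm Lp_norm_powr)
  also have "ennreal C * (ennreal (nrm (Mod q) f powr q) * \<kappa>) = ennreal (C * nrm (Mod q) f powr q) * \<kappa>"
    using C0 by (simp add: ennreal_mult mult.assoc)
  finally have "ennreal (\<Sum>i\<in>A. a i powr q) \<le> ennreal (C * nrm (Mod q) f powr q)"
    using \<kappa>(1,2) ennreal_mult_le_mult_iff[of \<kappa>] by (simp add: mult.commute)
  then have "(\<Sum>i\<in>A. a i powr q) \<le> C * nrm (Mod q) f powr q"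
    using C0 by simp
  \<comment> \<open>The root of order \<open>q\<close> of \<open>C\<close> is at most
    \<open>max 1 C\<close> for every \<open>q > 1\<close>, which removes \<open>q\<close> from the
    constant.\<close>
  also have "\<dots> \<le> max 1 C powr q * nrm (Mod q) f powr q"
  proof (rule mult_right_mono)
    have "max 1 C powr 1 \<le> max 1 C powr q" using q by (intro powr_mono) auto
    then show "C \<le> max 1 C powr q" by simp
  qed simp
  also have "\<dots> = (max 1 C * nrm (Mod q) f) powr q"
    by (simp add: powr_mult Mod_nrm le_max_iff_disj)
  finally have "(\<Sum>i\<in>A. a i powr q) powr (1 / q) \<le> ((max 1 C * nrm (Mod q) f) powr q) powr (1 / q)"
    using q by (intro powr_mono2) (auto intro: sum_nonneg)
  then show "(\<Sum>i\<in>A. norm (?P f (h i)) powr q) powr (1 / q) \<le> max 1 C * nrm (Mod q) f"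
    using q by (simp add: a_def powr_powr Mod_nrm le_max_iff_disj)
qed

end

section \<open>Square integrable functions as distributions\<close>

lemma square_integrable_iff: "f \<in> square_integrable \<longleftrightarrow> f \<in> Lp lborel 2"
  by (simp add: square_integrable_def Lp_def powr_numeral)

lemma fun_L2_norm_eq: "fun_L2_norm f = Lp_norm lborel 2 f"
  by (simp add: fun_L2_norm_def Lp_norm_def powr_half_sqrt powr_numeral Bochner_Integration.integral_nonneg)

lemma Holder_mult_two:
  assumes "f \<in> Lp M 2" "g \<in> Lp M 2"
  shows "integrable M (\<lambda>z. f z * g z)" "norm (\<integral>z. f z * g z \<partial>M) \<le> Lp_norm M 2 f * Lp_norm M 2 g"
  using Holder_mult[OF assms] by simp_all

lemma Schwartz_Lp2: "\<phi> \<in> Schwartz \<Longrightarrow> \<phi> \<in> Lp lborel 2"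
  using integrable_norm[OF integrable_Schwartz_mult[of \<phi> \<phi>]] Schwartz_measurable[of \<phi>]
  by (simp add: Lp_def powr_numeral norm_mult power2_eq_square)

text \<open>For \<open>h > 0\<close> and growing \<open>m\<close> these functions tend to the
  indicator of the interval with centre \<open>c\<close> and half-width \<open>h\<close>, except at
  its endpoints. They are an explicit alternative to smooth cut-offs of compact support.\<close>

definition bump :: "real \<Rightarrow> real \<Rightarrow> nat \<Rightarrow> real \<Rightarrow> complex" where
  "bump c h m t = of_real (exp (- (((t - c) / h) ^ (2 * m))))"

lemma power_le_exp_square: "\<exists>C. \<forall>s::real. (1 + \<bar>s\<bar>) ^ k * exp (- (s\<^sup>2)) \<le> C"
proof -
  \<comment> \<open>The exponential is written as the \<open>n\<close>-th power of
    \<open>exp (s\<^sup>2 / real n)\<close>, so \<open>n\<close> must be positive while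
    \<open>k\<close> may be 0.\<close>
  define n where "n = Suc k"
  have "(1 + \<bar>s\<bar>) ^ k * exp (- (s\<^sup>2)) \<le> (2 * real n) ^ n" for s :: real
  proof -
    have "0 \<le> (\<bar>s\<bar> - 1)\<^sup>2" by simp
    then have "2 * \<bar>s\<bar> \<le> 1 + s\<^sup>2" by (simp add: power2_diff)
    moreover have "x \<le> 1 + 2 * y" if "2 * x \<le> 1 + y" "0 \<le> y" for x y :: real using that by linarith
    ultimately have "\<bar>s\<bar> \<le> 1 + 2 * s\<^sup>2" using zero_le_power2 by blast
    then have "1 + \<bar>s\<bar> \<le> 2 * (1 + s\<^sup>2)" by (simp add: distrib_left)
    also have "1 + s\<^sup>2 \<le> real n * (1 + s\<^sup>2 / real n)" by (simp add: n_def field_simps)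
    finally have "1 + \<bar>s\<bar> \<le> 2 * real n * (1 + s\<^sup>2 / real n)" by simp
    also have "\<dots> \<le> 2 * real n * exp (s\<^sup>2 / real n)"
      by (intro mult_left_mono exp_ge_add_one_self) simp
    finally have "(1 + \<bar>s\<bar>) ^ n \<le> (2 * real n * exp (s\<^sup>2 / real n)) ^ n" by (intro power_mono) auto
    also have "\<dots> = (2 * real n) ^ n * exp (s\<^sup>2)"
      unfolding power_mult_distrib exp_of_nat_mult[symmetric] by (simp add: n_def)
    finally have "(1 + \<bar>s\<bar>) ^ n * exp (- (s\<^sup>2)) \<le> (2 * real n) ^ n"
      by (simp add: exp_minus divide_simps)
    moreover have "(1 + \<bar>s\<bar>) ^ k \<le> (1 + \<bar>s\<bar>) ^ n" by (intro power_increasing) (auto simp: n_def)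
    ultimately show ?thesis by (meson exp_ge_zero mult_right_mono order_trans)
  qed
  then show ?thesis by blast
qed

text \<open>Polynomials in the rescaled variable times the bump form a class stable under
  differentiation; decay is compared with a Gaussian through
  \<open>s^2 - 1 \<le> s^(2 * m)\<close>.\<close>

lemma Schwartz_bump:
  assumes h: "h > 0" and m: "m \<ge> 1"
  shows "bump c h m \<in> Schwartz"
proof (rule Schwartz_coinduct[of _ "{\<lambda>t. of_real (poly P ((t - c) / h)) * bump c h m t | P. True}"])
  show "bump c h m \<in> {\<lambda>t. of_real (poly P ((t - c) / h)) * bump c h m t | P. True}"
    by (intro CollectI exI[of _ "[:1:]"]) auto
next
  fix \<eta> k assume "\<eta> \<in> {\<lambda>t. of_real (poly P ((t - c) / h)) * bump c h m t | P. True}"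
  then obtain P where \<eta>: "\<eta> = (\<lambda>t. of_real (poly P ((t - c) / h)) * bump c h m t)" by blast
  have poly: "\<exists>A n. \<forall>s::real. \<bar>poly P s\<bar> \<le> A * (1 + \<bar>s\<bar>) ^ n" for P
  proof (induction P)
    case (pCons a P)
    then obtain A n where A: "\<And>s. \<bar>poly P s\<bar> \<le> A * (1 + \<bar>s\<bar>) ^ n" by blast
    have "\<bar>poly (pCons a P) s\<bar> \<le> (\<bar>a\<bar> + A) * (1 + \<bar>s\<bar>) ^ Suc n" for s
    proof -
      have "\<bar>poly (pCons a P) s\<bar> \<le> \<bar>a\<bar> + \<bar>s\<bar> * \<bar>poly P s\<bar>"
        using abs_triangle_ineq[of a "s * poly P s"] by (simp add: abs_mult)
      also have "\<dots> \<le> \<bar>a\<bar> * (1 + \<bar>s\<bar>) ^ Suc n + (1 + \<bar>s\<bar>) * (A * (1 + \<bar>s\<bar>) ^ n)"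
        using one_le_power[of "1 + \<bar>s\<bar>" "Suc n"] A[of s]
        by (intro add_mono mult_mono) (auto simp: mult_le_cancel_left1)
      finally show ?thesis by (simp add: algebra_simps)
    qed
    then show ?case by blast
  qed (auto intro: exI[of _ 0])
  obtain A n where A: "\<And>s. \<bar>poly P s\<bar> \<le> A * (1 + \<bar>s\<bar>) ^ n" using poly by blast
  obtain C where C: "\<And>s::real. (1 + \<bar>s\<bar>) ^ (k + n) * exp (- (s\<^sup>2)) \<le> C" using power_le_exp_square by blast
  have A0: "A \<ge> 0" using A[of 0] by simp
  have "\<bar>t\<bar> ^ k * norm (\<eta> t) \<le> (\<bar>c\<bar> + h) ^ k * A * exp 1 * C" for t
  proof -
    define s where "s = (t - c) / h"
    have t: "t = c + h * s" using h by (simp add: s_def)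
    have "\<bar>t\<bar> \<le> (\<bar>c\<bar> + h) * (1 + \<bar>s\<bar>)"
    proof -
      have "\<bar>t\<bar> \<le> \<bar>c\<bar> + h * \<bar>s\<bar>"
        using h abs_triangle_ineq[of c "h * s"] by (simp add: t abs_mult)
      also have "\<dots> \<le> (\<bar>c\<bar> + h * \<bar>s\<bar>) + (h + \<bar>c\<bar> * \<bar>s\<bar>)" using h by simp
      finally show ?thesis by (simp add: algebra_simps)
    qed
    then have t1: "\<bar>t\<bar> ^ k \<le> (\<bar>c\<bar> + h) ^ k * (1 + \<bar>s\<bar>) ^ k"
      unfolding power_mult_distrib[symmetric] by (rule power_mono) simp
    have "s\<^sup>2 - 1 \<le> s ^ (2 * m)"
    proof (cases "s\<^sup>2 \<le> 1")
      case True
      then show ?thesis by (simp add: power_mult order_trans[of _ 0])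
    next
      case False
      then have "(s\<^sup>2) ^ 1 \<le> (s\<^sup>2) ^ m" using m by (intro power_increasing) auto
      then show ?thesis by (simp add: power_mult)
    qed
    then have "norm (bump c h m t) \<le> exp 1 * exp (- (s\<^sup>2))"
      by (simp add: bump_def s_def[symmetric] exp_add[symmetric])
    then have "norm (\<eta> t) \<le> A * (1 + \<bar>s\<bar>) ^ n * (exp 1 * exp (- (s\<^sup>2)))"
      unfolding \<eta> norm_mult s_def[symmetric] using A[of s] A0 by (intro mult_mono) auto
    then have "\<bar>t\<bar> ^ k * norm (\<eta> t) \<le> ((\<bar>c\<bar> + h) ^ k * (1 + \<bar>s\<bar>) ^ k) * (A * (1 + \<bar>s\<bar>) ^ n * (exp 1 * exp (- (s\<^sup>2))))"
      using t1 h by (intro mult_mono) auto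
    also have "\<dots> = (\<bar>c\<bar> + h) ^ k * A * exp 1 * ((1 + \<bar>s\<bar>) ^ (k + n) * exp (- (s\<^sup>2)))"
      by (simp add: power_add mult_ac)
    also have "\<dots> \<le> (\<bar>c\<bar> + h) ^ k * A * exp 1 * C"
      using A0 h by (intro mult_left_mono C) auto
    finally show ?thesis .
  qed
  then show "\<exists>C. \<forall>t. \<bar>t\<bar> ^ k * norm (\<eta> t) \<le> C" by blast
next
  fix \<eta> assume "\<eta> \<in> {\<lambda>t. of_real (poly P ((t - c) / h)) * bump c h m t | P. True}"
  then obtain P where \<eta>: "\<eta> = (\<lambda>t. of_real (poly P ((t - c) / h)) * bump c h m t)" by blast
  define P' where "P' = smult (1 / h) (pderiv P) - smult (real (2 * m) / h) (P * [:0, 1:] ^ (2 * m - 1))"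
  have "(\<eta> has_vector_derivative of_real (poly P' ((t - c) / h)) * bump c h m t) (at t)" for t
  proof -
    have "((\<lambda>t. poly P ((t - c) / h) * exp (- (((t - c) / h) ^ (2 * m)))) has_real_derivative
        poly P' ((t - c) / h) * exp (- (((t - c) / h) ^ (2 * m)))) (at t)"
    proof -
      have l: "((\<lambda>t. (t - c) / h) has_real_derivative 1 / h) (at t)"
        using h by (auto intro!: derivative_eq_intros)
      show ?thesis
        by (rule DERIV_cong[OF DERIV_mult[OF DERIV_chain2[OF poly_DERIV l]
            DERIV_chain2[OF DERIV_exp DERIV_minus[OF DERIV_power[OF l]]]]])
          (simp add: P'_def poly_power algebra_simps)
    qed
    from has_vector_derivative_of_real[OF this]
    show ?thesis by (simp add: \<eta> bump_def)
  qed
  then show "\<exists>\<eta>'\<in>{\<lambda>t. of_real (poly P ((t - c) / h)) * bump c h m t | P. True}. \<forall>t. (\<eta> has_vector_derivative \<eta>' t) (at t)"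
    by (intro bexI[of _ "\<lambda>t. of_real (poly P' ((t - c) / h)) * bump c h m t"]) blast+
qed

text \<open>Half-lines generate the Borel sets and are stable under intersection, so a pi-lambda
  argument makes all integrals over Borel sets vanish. For complements the total integral is
  obtained as a limit over half-lines.\<close>

lemma AE_zero_of_atMost:
  fixes D :: "real \<Rightarrow> complex"
  assumes D: "integrable lborel D" and z: "\<And>a. (\<integral>t. indicator {..a} t *\<^sub>R D t \<partial>lborel) = 0"
  shows "AE t in lborel. D t = 0"
proof (rule sigma_finite_measure.density_zero[OF sigma_finite_lborel D])
  fix A :: "real set" assume "A \<in> sets lborel"
  then have A: "A \<in> sigma_sets UNIV (range atMost)"
    by (simp add: borel_eq_atMost)
  have ints: "Int_stable (range (atMost :: real \<Rightarrow> real set))"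
    by (auto simp: Int_stable_def)
  have sub: "range (atMost :: real \<Rightarrow> real set) \<subseteq> Pow UNIV" by simp
  have sets: "A \<in> sets lborel" if "A \<in> sigma_sets UNIV (range (atMost :: real \<Rightarrow> real set))" for A
    using that by (simp add: borel_eq_atMost)
  have si: "set_integrable lborel A D" if "A \<in> sets lborel" for A
    unfolding set_integrable_def by (rule integrable_mult_indicator[OF that D])
  have all: "(\<integral>t. D t \<partial>lborel) = 0"
  proof -
    have "(\<lambda>n. \<integral>t. indicator {..real n} t *\<^sub>R D t \<partial>lborel) \<longlonglongrightarrow> (\<integral>t. D t \<partial>lborel)"
    proof (rule integral_dominated_convergence[where w = "\<lambda>t. norm (D t)"])
      show "AE t in lborel. (\<lambda>n. indicator {..real n} t *\<^sub>R D t) \<longlonglongrightarrow> D t"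
      proof (rule AE_I2)
        fix t :: real
        obtain N where "t \<le> real N" using real_arch_simple by blast
        then have "\<And>n. n \<ge> N \<Longrightarrow> indicator {..real n} t *\<^sub>R D t = D t" by (auto simp: indicator_def)
        then show "(\<lambda>n. indicator {..real n} t *\<^sub>R D t) \<longlonglongrightarrow> D t"
          by (intro tendsto_eventually) (auto simp: eventually_sequentially)
      qed
    qed (use D in \<open>auto simp: indicator_def\<close>)
    then show ?thesis unfolding z by (simp add: LIMSEQ_const_iff)
  qed
  show "set_lebesgue_integral lborel A D = 0"
    using ints sub A
  proof (induction rule: sigma_sets_induct_disjoint)
    case (basic A)
    then show ?case using z by (auto simp: set_lebesgue_integral_def)
  next
    case empty
    then show ?case by (simp add: set_lebesgue_integral_def)
  next
    case (compl A)
    have "set_lebesgue_integral lborel A D + set_lebesgue_integral lborel (UNIV - A) D = set_lebesgue_integral lborel (A \<union> (UNIV - A)) D"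
      using sets[OF compl(1)] by (intro set_integral_Un[symmetric] si) auto
    then show ?case using compl(2) all by (simp add: set_lebesgue_integral_def)
  next
    case (union A)
    have "set_lebesgue_integral lborel (\<Union>i. A i) D = (\<Sum>i. set_lebesgue_integral lborel (A i) D)"
    proof (rule lebesgue_integral_countable_add)
      show m: "A i \<in> sets lborel" for i using union(2) sets by blast
      show "A i \<inter> A j = {}" if "i \<noteq> j" for i j using union(1) that by (auto simp: disjoint_family_on_def)
      show "set_integrable lborel (\<Union>i. A i) D" using m by (intro si) blast
    qed
    then show ?case using union(3) by simp
  qed
qed

text \<open>Bumps tend to indicators of intervals, so the integral of \<open>d\<close> over every
  bounded interval vanishes. As \<open>d\<close> may fail to be integrable on the line, it is cut to
  \<open>[-n, n]\<close> before half-lines are used.\<close>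

lemma L2_Schwartz_separating:
  assumes d: "d \<in> Lp lborel 2" and z: "\<And>\<eta>. \<eta> \<in> Schwartz \<Longrightarrow> (\<integral>t. d t * \<eta> t \<partial>lborel) = 0"
  shows "AE t in lborel. d t = 0"
proof -
  have [measurable]: "d \<in> borel_measurable borel" using LpD[OF d] by simp
  have hold: "integrable lborel (\<lambda>t. d t * \<eta> t)" if "\<eta> \<in> Lp lborel 2" for \<eta>
    by (rule Holder_mult_two(1)[OF d that])
  have ind: "(\<lambda>t. indicator S t) \<in> Lp lborel 2" if "S \<in> sets borel" "emeasure lborel S < \<infinity>" for S :: "real set"
  proof -
    have "norm (indicator S t :: complex) powr 2 = indicator S t" for t by (auto simp: indicator_def)
    then show ?thesis using that by (simp add: Lp_def)
  qed
  note emeasure_lborel_Icc_eq[simp]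
  have iv: "(\<integral>t. d t * indicator {a..b} t \<partial>lborel) = 0" if "a < b" for a b
  proof -
    define c where "c = (a + b) / 2"
    define h where "h = (b - a) / 2"
    have h: "h > 0" using that by (simp add: h_def)
    \<comment> \<open>A common majorant: inside the interval all bumps are at most 1, and outside
      they decrease in \<open>m\<close>, so they stay below the first one.\<close>
    define W where "W = (\<lambda>t. norm (d t) * (indicator {a..b} t + norm (bump c h 1 t)))"
    have b1: "bump c h 1 \<in> Schwartz" by (rule Schwartz_bump[OF h]) simp
    have "integrable lborel (\<lambda>t. norm (d t * indicator {a..b} t) + norm (d t * bump c h 1 t))"
      by (intro Bochner_Integration.integrable_add integrable_norm hold ind Schwartz_Lp2 b1) auto
    then have W: "integrable lborel W"
      by (rule Bochner_Integration.integrable_cong[THEN iffD1, rotated -1]) (auto simp: W_def norm_mult distrib_left indicator_def)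
    have "(\<lambda>n. \<integral>t. d t * bump c h (Suc n) t \<partial>lborel) \<longlonglongrightarrow> (\<integral>t. d t * indicator {a..b} t \<partial>lborel)"
    proof (rule integral_dominated_convergence[where w = W])
      have s: "\<bar>(t - c) / h\<bar> < 1 \<longleftrightarrow> a < t \<and> t < b" "\<bar>(t - c) / h\<bar> = 1 \<longleftrightarrow> t = a \<or> t = b" for t
        using h by (auto simp: c_def h_def abs_if field_simps)
      have "AE t in lborel. t \<noteq> a \<and> t \<noteq> b"
        using AE_lborel_singleton[of a] AE_lborel_singleton[of b] by eventually_elim auto
      then show "AE t in lborel. (\<lambda>n. d t * bump c h (Suc n) t) \<longlonglongrightarrow> d t * indicator {a..b} t"
      proof eventually_elim
        fix t assume t: "t \<noteq> a \<and> t \<noteq> b"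
        define x where "x = ((t - c) / h)\<^sup>2"
        have x0: "x \<ge> 0" by (simp add: x_def)
        have be: "bump c h (Suc n) t = of_real (exp (- (x ^ Suc n)))" for n
          by (simp only: bump_def x_def power_mult)
        have "(\<lambda>n. bump c h (Suc n) t) \<longlonglongrightarrow> indicator {a..b} t"
        proof (cases "a < t \<and> t < b")
          case True
          then have "\<bar>(t - c) / h\<bar> < 1" using s by blast
          then have "x < 1" unfolding x_def using abs_square_less_1 by blast
          then have "(\<lambda>n. x ^ Suc n) \<longlonglongrightarrow> 0" using x0 by (intro LIMSEQ_Suc LIMSEQ_realpow_zero) auto
          then have "(\<lambda>n. complex_of_real (exp (- (x ^ Suc n)))) \<longlonglongrightarrow> of_real (exp (- 0))" by (intro tendsto_intros)
          then show ?thesis using True by (simp add: be del: power_Suc)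
        next
          case False
          then have "\<bar>(t - c) / h\<bar> > 1" using s[of t] t by linarith
          then have "x > 1" unfolding x_def by (metis abs_square_le_1 not_le)
          then have "filterlim (\<lambda>n. x ^ n) at_top sequentially" by real_asymp
          then have "filterlim (\<lambda>n. x ^ Suc n) at_top sequentially" using filterlim_sequentially_Suc by blast
          then have "(\<lambda>n. exp (- (x ^ Suc n))) \<longlonglongrightarrow> 0"
            by (intro filterlim_compose[OF exp_at_bot] filterlim_compose[OF filterlim_uminus_at_bot_at_top])
          then have "(\<lambda>n. complex_of_real (exp (- (x ^ Suc n)))) \<longlonglongrightarrow> of_real 0" by (rule tendsto_of_real)
          moreover have "t \<notin> {a..b}" using False t by auto
          ultimately show ?thesis by (simp add: be del: power_Suc)
        qed
        then show "(\<lambda>n. d t * bump c h (Suc n) t) \<longlonglongrightarrow> d t * indicator {a..b} t" by (rule tendsto_mult_left)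
      qed
      show "AE t in lborel. norm (d t * bump c h (Suc n) t) \<le> W t" for n
      proof (rule AE_I2)
        fix t
        have "norm (bump c h (Suc n) t) \<le> indicator {a..b} t + norm (bump c h 1 t)"
        proof (cases "t \<in> {a..b}")
          case True
          have "((t - c) / h) ^ (2 * Suc n) \<ge> 0" unfolding power_mult by simp
          then have "norm (bump c h (Suc n) t) \<le> 1" by (simp add: bump_def del: power_Suc)
          then show ?thesis using True by (simp add: add_increasing2)
        next
          case False
          then have "\<not> \<bar>(t - c) / h\<bar> < 1" using s[of t] by auto
          then have "1 \<le> ((t - c) / h)\<^sup>2" using abs_square_less_1[of "(t - c) / h"] by linarith
          then have "(((t - c) / h)\<^sup>2) ^ 1 \<le> (((t - c) / h)\<^sup>2) ^ Suc n" by (intro power_increasing) auto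
          then have "exp (- ((((t - c) / h)\<^sup>2) ^ Suc n)) \<le> exp (- ((((t - c) / h)\<^sup>2) ^ 1))" by simp

          then show ?thesis using False by (simp only: bump_def power_mult norm_of_real abs_exp_cancel) auto
        qed
        then show "norm (d t * bump c h (Suc n) t) \<le> W t"
          unfolding W_def norm_mult by (intro mult_left_mono) auto
      qed
      have "(\<lambda>t. bump c h (Suc n) t) \<in> borel_measurable borel" for n
        using Schwartz_measurable[OF Schwartz_bump[OF h]] by simp
      then show "(\<lambda>t. d t * bump c h (Suc n) t) \<in> borel_measurable lborel" for n by simp
    qed (use W in auto)
    moreover have "(\<integral>t. d t * bump c h (Suc n) t \<partial>lborel) = 0" for n
      by (rule z[OF Schwartz_bump[OF h]]) simp
    ultimately show ?thesis by (simp add: LIMSEQ_const_iff)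
  qed
  have "AE t in lborel. \<forall>n::nat. d t * indicator {- real n..real n} t = 0"
    unfolding AE_all_countable
  proof
    fix n :: nat
    show "AE t in lborel. d t * indicator {- real n..real n} t = 0"
    proof (rule AE_zero_of_atMost)
      show "integrable lborel (\<lambda>t. d t * indicator {- real n..real n} t)"
        by (intro hold ind) auto
      fix a
      have eq: "indicator {..a} t *\<^sub>R (d t * indicator {- real n..real n} t) = d t * indicator {- real n..min a (real n)} t" for t
        by (auto simp: indicator_def)
      show "(\<integral>t. indicator {..a} t *\<^sub>R (d t * indicator {- real n..real n} t) \<partial>lborel) = 0"
      proof (cases "- real n < min a (real n)")
        case True
        then show ?thesis unfolding eq by (rule iv)
      next
        case False
        have "AE t in lborel. d t * indicator {- real n..min a (real n)} t = 0"
          using AE_lborel_singleton[of "- real n"] by eventually_elim (use False in \<open>auto simp: indicator_def\<close>)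
        then show ?thesis unfolding eq by (rule integral_eq_zero_AE)
      qed
    qed
  qed
  then show ?thesis
  proof eventually_elim
    fix t assume a: "\<forall>n::nat. d t * indicator {- real n..real n} t = 0"
    obtain n where "\<bar>t\<bar> \<le> real n" using real_arch_simple by blast
    then have "t \<in> {- real n..real n}" by auto
    then show "d t = 0" using a[rule_format, of n] by (simp add: indicator_def)
  qed
qed

section \<open>Linear structure, bounds and shifts of square integrable distributions\<close>

lemma dist_of_fun_integrable: "f \<in> Lp lborel 2 \<Longrightarrow> \<phi> \<in> Schwartz \<Longrightarrow> integrable lborel (\<lambda>t. f t * \<phi> t)"
  by (rule Holder_mult_two(1)[OF _ Schwartz_Lp2])

lemma L2_rep:
  assumes "u \<in> vectors L2_space"
  shows "L2_rep u \<in> Lp lborel 2" "dist_of_fun (L2_rep u) = u"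
proof -
  have "\<exists>f. f \<in> square_integrable \<and> dist_of_fun f = u"
    using assms by (auto simp: L2_space_def)
  from someI_ex[OF this] show "L2_rep u \<in> Lp lborel 2" "dist_of_fun (L2_rep u) = u"
    by (simp_all add: L2_rep_def square_integrable_iff)
qed

lemma dist_of_fun_L2: "f \<in> Lp lborel 2 \<Longrightarrow> dist_of_fun f \<in> vectors L2_space"
  by (simp add: L2_space_def square_integrable_iff)

text \<open>The choice in \<open>L2_rep\<close> is determined up to a null set, because Schwartz
  functions separate square integrable ones.\<close>

lemma L2_rep_dist_of_fun:
  assumes f: "f \<in> Lp lborel 2"
  shows "AE t in lborel. L2_rep (dist_of_fun f) t = f t"
proof -
  note R = L2_rep[OF dist_of_fun_L2[OF f]]
  have "AE t in lborel. L2_rep (dist_of_fun f) t - f t = 0"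
  proof (rule L2_Schwartz_separating)
    show "(\<lambda>t. L2_rep (dist_of_fun f) t - f t) \<in> Lp lborel 2" by (rule Lp_diff[OF R(1) f]) simp
    fix \<eta> assume \<eta>: "\<eta> \<in> Schwartz"
    have "(\<integral>t. L2_rep (dist_of_fun f) t * \<eta> t \<partial>lborel) = (\<integral>t. f t * \<eta> t \<partial>lborel)"
      using fun_cong[OF R(2), of \<eta>] \<eta> by (simp add: dist_of_fun_def)
    then show "(\<integral>t. (L2_rep (dist_of_fun f) t - f t) * \<eta> t \<partial>lborel) = 0"
      using dist_of_fun_integrable[OF R(1) \<eta>] dist_of_fun_integrable[OF f \<eta>] by (simp add: left_diff_distrib)
  qed
  then show ?thesis by simp
qed

lemma L2_add: "u \<in> vectors L2_space \<Longrightarrow> v \<in> vectors L2_space \<Longrightarrow> (\<lambda>s. u s + v s) \<in> vectors L2_space"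
proof -
  assume "u \<in> vectors L2_space" "v \<in> vectors L2_space"
  then obtain f g where f: "f \<in> Lp lborel 2" "u = dist_of_fun f" and g: "g \<in> Lp lborel 2" "v = dist_of_fun g"
    by (auto simp: L2_space_def square_integrable_iff)
  have "(\<lambda>s. u s + v s) = dist_of_fun (\<lambda>t. f t + g t)"
    using dist_of_fun_integrable[OF f(1)] dist_of_fun_integrable[OF g(1)]
    by (auto simp: f g dist_of_fun_def distrib_right)
  then show ?thesis using dist_of_fun_L2[OF Lp_add[OF f(1) g(1)]] by simp
qed

lemma L2_scale: "u \<in> vectors L2_space \<Longrightarrow> (\<lambda>s. c * u s) \<in> vectors L2_space"
proof -
  assume "u \<in> vectors L2_space"
  then obtain f where f: "f \<in> Lp lborel 2" "u = dist_of_fun f"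
    by (auto simp: L2_space_def square_integrable_iff)
  have "(\<lambda>s. c * u s) = dist_of_fun (\<lambda>t. c * f t)"
    by (auto simp: f dist_of_fun_def mult.assoc)
  then show ?thesis using dist_of_fun_L2[OF Lp_scale(1)[OF f(1)]] by simp
qed

lemma L2_zero: "(\<lambda>_. 0) \<in> vectors L2_space"
proof -
  have "(\<lambda>_. 0) = dist_of_fun (\<lambda>_. 0)" by (auto simp: dist_of_fun_def)
  then show ?thesis using dist_of_fun_L2[of "\<lambda>_. 0"] by (simp add: Lp_def)
qed

lemma L2_sum: "(\<And>i. i \<in> I \<Longrightarrow> u i \<in> vectors L2_space) \<Longrightarrow> (\<lambda>s. \<Sum>i\<in>I. u i s) \<in> vectors L2_space"
  by (induction I rule: infinite_finite_induct) (auto simp: L2_zero L2_add)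

lemma L2_diff: "u \<in> vectors L2_space \<Longrightarrow> v \<in> vectors L2_space \<Longrightarrow> (\<lambda>s. u s - v s) \<in> vectors L2_space"
  using L2_add[OF _ L2_scale[of v "-1"], of u] by simp

lemma L2_bound:
  assumes "u \<in> vectors L2_space" "\<phi> \<in> Schwartz"
  shows "norm (u \<phi>) \<le> nrm L2_space u * Lp_norm lborel 2 \<phi>"
proof -
  note R = L2_rep[OF assms(1)]
  have "u \<phi> = (\<integral>t. L2_rep u t * \<phi> t \<partial>lborel)"
    using fun_cong[OF R(2), of \<phi>] assms(2) by (simp add: dist_of_fun_def)
  also have "norm \<dots> \<le> Lp_norm lborel 2 (L2_rep u) * Lp_norm lborel 2 \<phi>"
    by (rule Holder_mult_two(2)[OF R(1) Schwartz_Lp2[OF assms(2)]])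
  finally show ?thesis by (simp add: L2_space_def fun_L2_norm_eq)
qed

lemma L2_translate: "u \<in> vectors L2_space \<Longrightarrow> dist_translate a u \<in> vectors L2_space"
proof -
  assume "u \<in> vectors L2_space"
  then obtain f where f: "f \<in> Lp lborel 2" "u = dist_of_fun f"
    by (auto simp: L2_space_def square_integrable_iff)
  have f': "translate a f \<in> Lp lborel 2"
    using Lp_integrable[OF f(1)] LpD[OF f(1)] lborel_translate(2)[of "\<lambda>t. norm (f t) powr 2" "- a"]
    by (simp add: Lp_def translate_def)
  have "dist_translate a u = dist_of_fun (translate a f)"
  proof
    fix \<phi>
    have S: "translate (- a) \<phi> \<in> Schwartz \<longleftrightarrow> \<phi> \<in> Schwartz"
      using Schwartz_translate[of \<phi> "- a"] Schwartz_translate[of "translate (- a) \<phi>" a]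
      by (auto simp: translate_def)
    have "(\<integral>t. f t * \<phi> (t + a) \<partial>lborel) = (\<integral>t. f (t - a) * \<phi> t \<partial>lborel)"
      using lborel_translate(1)[of "\<lambda>t. f (t - a) * \<phi> t" a] by simp
    then show "dist_translate a u \<phi> = dist_of_fun (translate a f) \<phi>"
      using S by (simp add: dist_translate_def f(2) dist_of_fun_def translate_def)
  qed
  then show ?thesis using dist_of_fun_L2[OF f'] by simp
qed

lemma L2_modulate: "u \<in> vectors L2_space \<Longrightarrow> dist_modulate b u \<in> vectors L2_space"
proof -
  assume "u \<in> vectors L2_space"
  then obtain f where f: "f \<in> Lp lborel 2" "u = dist_of_fun f"
    by (auto simp: L2_space_def square_integrable_iff)
  have [measurable]: "f \<in> borel_measurable borel" using LpD[OF f(1)] by simp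
  have "(\<lambda>t. exp (2 * of_real pi * \<i> * of_real b * of_real t)) \<in> borel_measurable borel"
    by (intro borel_measurable_continuous_onI continuous_intros)
  then have f': "modulate b f \<in> Lp lborel 2"
    using Lp_integrable[OF f(1)] by (simp add: Lp_def) (simp add: modulate_def[abs_def])
  have "dist_modulate b u = dist_of_fun (modulate b f)"
  proof
    fix \<phi>
    have inv: "modulate (- b) (modulate b \<phi>) = \<phi>"
      by (rule ext) (simp add: modulate_def mult.assoc[symmetric] exp_add[symmetric])
    have S: "modulate b \<phi> \<in> Schwartz \<longleftrightarrow> \<phi> \<in> Schwartz"
      using Schwartz_modulate[of \<phi> b] Schwartz_modulate[of "modulate b \<phi>" "- b"] inv by auto
    show "dist_modulate b u \<phi> = dist_of_fun (modulate b f) \<phi>"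
      using S by (simp add: dist_modulate_def f(2) dist_of_fun_def modulate_def mult_ac)
  qed
  then show ?thesis using dist_of_fun_L2[OF f'] by simp
qed

lemma L2_gabor_iff: "gabor \<alpha> \<beta> \<gamma> i \<in> vectors L2_space \<longleftrightarrow> \<gamma> \<in> vectors L2_space"
proof
  let ?a = "\<alpha> * of_int (fst i)" and ?b = "\<beta> * of_int (snd i)"
  have g: "gabor \<alpha> \<beta> \<gamma> i = dist_modulate ?b (dist_translate ?a \<gamma>)" by (simp add: gabor_def case_prod_unfold)
  have inv1: "dist_modulate (- b) (dist_modulate b u) = u" for b u
    by (rule ext) (simp add: dist_modulate_def modulate_def mult.assoc[symmetric] exp_add[symmetric])
  have inv2: "dist_translate (- a) (dist_translate a u) = u" for a u
    by (rule ext) (simp add: dist_translate_def translate_def)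
  show "\<gamma> \<in> vectors L2_space" if "gabor \<alpha> \<beta> \<gamma> i \<in> vectors L2_space"
    using L2_translate[OF L2_modulate[OF that[unfolded g], of "- ?b"], of "- ?a"] by (simp add: inv1 inv2)
  show "gabor \<alpha> \<beta> \<gamma> i \<in> vectors L2_space" if "\<gamma> \<in> vectors L2_space"
    unfolding g by (intro L2_modulate L2_translate that)
qed

section \<open>Comparison with the modulation space of exponent 2\<close>

context window
begin

lemma coef_Lp_mem: "\<phi> \<in> Schwartz \<Longrightarrow> r > 1 \<Longrightarrow> coef \<psi> \<phi> \<in> Lp lborel r"
  using coef_Lp by metis

lemma tempered_eq_integral:
  "u \<in> tempered \<Longrightarrow> \<phi> \<in> Schwartz \<Longrightarrow> u \<phi> = (\<integral>z. stft \<psi> u z * coef \<psi> \<phi> z \<partial>lborel) / of_real energy"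
  using fun_cong[OF synth_stft[of u], of \<phi>] by (simp add: synth_def)

lemma norm_Mod_le:
  assumes "u \<in> vectors (Mod q)" "q > 1" "1 / q + 1 / r = 1" "\<phi> \<in> Schwartz"
  shows "norm (u \<phi>) \<le> nrm (Mod q) u * Lp_norm lborel r (coef \<psi> \<phi>) / energy"
  unfolding tempered_eq_integral[OF Mod_tempered[OF assms(1)] assms(4)] norm_divide Mod_nrm
  using Holder_mult(2)[OF Mod_Lp[OF assms(1)] coef_Lp_mem[OF assms(4)] assms(2,3)]
    conj_exponent_eqs(1)[OF assms(2,3)] energy_pos
  by (simp add: divide_right_mono)

lemma stft_dist_of_fun:
  assumes "\<phi> \<in> Schwartz"
  shows "stft \<psi> (dist_of_fun \<phi>) z = cnj (coef \<psi> (\<lambda>t. cnj (\<phi> t)) z)"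
proof -
  have "atom cw z \<in> Schwartz"
    unfolding atom_def by (intro Schwartz_modulate Schwartz_translate cw)
  then have "stft \<psi> (dist_of_fun \<phi>) z = (\<integral>t. cnj (cnj (atom cw z t) * cnj (\<phi> t)) \<partial>lborel)"
    by (simp add: stft_eq dist_of_fun_def mult.commute)
  then show ?thesis unfolding coef_eq by (simp only: Bochner_Integration.integral_cnj)
qed

text \<open>The inversion formula at the conjugate test function. It ties the pairing of modulation
  spaces, an integral over the plane, to the inner product that it extends.\<close>

lemma dist_pairing_eq_modulation_pairing:
  assumes u: "u \<in> tempered" and \<phi>: "\<phi> \<in> Schwartz"
  shows "dist_pairing u \<phi> = modulation_pairing \<psi> u (dist_of_fun \<phi>)"
  unfolding dist_pairing_def pairing_eq stft_dist_of_fun[OF \<phi>]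
  by (simp add: tempered_eq_integral[OF u Schwartz_cnj[OF \<phi>]])

text \<open>The squared \<open>L^2\<close> norm of \<open>\<phi>\<close> is the pairing of
  \<open>dist_of_fun \<phi>\<close> with itself, which is at most its squared norm in
  \<open>M^2\<close> divided by \<open>energy\<close>.\<close>

lemma Lp_norm_two_le:
  assumes \<phi>: "\<phi> \<in> Schwartz" and D: "dist_of_fun \<phi> \<in> vectors (Mod 2)"
  shows "Lp_norm lborel 2 \<phi> \<le> nrm (Mod 2) (dist_of_fun \<phi>) / sqrt energy"
proof -
  let ?N = "Lp_norm lborel 2 \<phi>" and ?D = "dist_of_fun \<phi>"
  have N0: "?N \<ge> 0" by (simp add: Lp_norm_def)
  have "dist_pairing ?D \<phi> = (\<integral>t. of_real ((norm (\<phi> t))\<^sup>2) \<partial>lborel)"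
    using Schwartz_cnj[OF \<phi>] by (simp add: dist_pairing_def dist_of_fun_def complex_norm_square del: of_real_power)
  also have "\<dots> = of_real (\<integral>t. (norm (\<phi> t))\<^sup>2 \<partial>lborel)" by (rule integral_complex_of_real)
  also have "(\<integral>t. (norm (\<phi> t))\<^sup>2 \<partial>lborel) = ?N\<^sup>2"
    using Lp_norm_powr[of 2 lborel \<phi>] N0 by (simp add: powr_numeral)
  finally have "?N\<^sup>2 = norm (modulation_pairing \<psi> ?D ?D)"
    using dist_pairing_eq_modulation_pairing[OF Mod_tempered[OF D] \<phi>] by (simp add: norm_power)
  also have "\<dots> \<le> (nrm (Mod 2) ?D)\<^sup>2 / energy"
    using pairing_bound[OF D D] by (simp add: power2_eq_square)
  also have "\<dots> = (nrm (Mod 2) ?D / sqrt energy)\<^sup>2"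
    using energy_pos by (simp add: power_divide)
  finally show ?thesis
    by (rule power2_le_imp_le) (use energy_pos in \<open>simp add: Mod_nrm Lp_norm_def\<close>)
qed

text \<open>\<open>u\<close> is approximated in \<open>M^2\<close> by Schwartz functions with error
  \<open>(1/2)^n\<close>. By \<open>Lp_norm_two_le\<close> their successive differences are summable
  in \<open>L^2\<close>, which produces a square integrable limit; testing with Schwartz functions
  identifies it with \<open>u\<close>.\<close>

lemma Mod_two_subset_L2:
  assumes u: "u \<in> vectors (Mod 2)"
  shows "u \<in> vectors L2_space"
proof -
  interpret M: normed_fspace "Mod 2" by (rule normed_Mod) simp
  interpret L: normed_fspace "Lp_space lborel 2" by (rule normed_Lp) simp
  have "\<exists>F. F \<in> moments \<and> F \<in> Lp lborel 2 \<and> nrm (Mod 2) (\<lambda>s. u s - synth F s) \<le> (1 / 2) ^ n" for n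
  proof -
    obtain F where F: "\<And>n. F n \<in> moments" "\<And>n. F n \<in> Lp lborel 2"
      "(\<lambda>n. nrm (Mod 2) (\<lambda>s. u s - synth (F n) s)) \<longlonglongrightarrow> 0"
      by (rule moments_approx[OF u]) (use that in auto)
    obtain m where "nrm (Mod 2) (\<lambda>s. u s - synth (F m) s) < (1 / 2) ^ n"
      using eventually_happens[OF order_tendstoD(2)[OF F(3), of "(1 / 2) ^ n"]] by auto
    then show ?thesis using F(1,2) less_imp_le by blast
  qed
  then obtain F where F: "\<And>n. F n \<in> moments" "\<And>n. F n \<in> Lp lborel 2"
    "\<And>n. nrm (Mod 2) (\<lambda>s. u s - synth (F n) s) \<le> (1 / 2) ^ n" by metis
  define \<phi> where "\<phi> n = wave (F n)" for n
  have \<phi>: "\<phi> n \<in> Schwartz" for n unfolding \<phi>_def by (rule Schwartz_wave[OF F(1)])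
  have syn: "synth (F n) = dist_of_fun (\<phi> n)" for n unfolding \<phi>_def by (rule synth_wave[OF F(1)])
  have syn_Mod: "dist_of_fun (\<phi> n) \<in> vectors (Mod 2)" for n
    using synth_Mod(1)[OF F(2)[of n]] by (simp add: syn)
  define a where "a n = (\<lambda>t. \<phi> (Suc n) t - \<phi> n t)" for n
  have aS: "a n \<in> Schwartz" for n unfolding a_def by (intro Schwartz_diff \<phi>)
  have aD: "dist_of_fun (a n) = (\<lambda>s. dist_of_fun (\<phi> (Suc n)) s - dist_of_fun (\<phi> n) s)" for n
    using integrable_Schwartz_mult[OF \<phi>] by (auto simp: dist_of_fun_def a_def left_diff_distrib)
  have aM: "dist_of_fun (a n) \<in> vectors (Mod 2)" for n
    unfolding aD by (intro M.diff_mem syn_Mod)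
  have a_le: "Lp_norm lborel 2 (a n) \<le> 2 * (1 / 2) ^ n / sqrt energy" for n
  proof -
    let ?e = "\<lambda>n s. u s - dist_of_fun (\<phi> n) s"
    have e: "?e n \<in> vectors (Mod 2)" for n by (intro M.diff_mem u syn_Mod)
    have "nrm (Mod 2) (dist_of_fun (a n)) = nrm (Mod 2) (\<lambda>s. ?e n s + (- 1) * ?e (Suc n) s)"
      unfolding aD by (simp add: algebra_simps)
    also have "\<dots> \<le> nrm (Mod 2) (?e n) + nrm (Mod 2) (?e (Suc n))"
      using M.nrm_triangle[OF e[of n] M.scale_mem[OF e[of "Suc n"], of "- 1"]] M.nrm_scale[OF e[of "Suc n"], of "- 1"]
      by simp
    also have "\<dots> \<le> (1 / 2) ^ n + (1 / 2) ^ Suc n"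
      using F(3)[of n] F(3)[of "Suc n"] by (simp only: syn add_mono)
    also have "\<dots> \<le> 2 * (1 / 2) ^ n" by simp
    finally show ?thesis
      using Lp_norm_two_le[OF aS aM, of n] energy_pos
      by (intro order_trans[OF Lp_norm_two_le[OF aS aM]] divide_right_mono) auto
  qed
  have "summable (\<lambda>n. Lp_norm lborel 2 (a n))"
  proof (rule summable_comparison_test')
    show "summable (\<lambda>n. 2 / sqrt energy * (1 / 2) ^ n)" by (intro summable_mult summable_geometric) simp
    show "norm (Lp_norm lborel 2 (a n)) \<le> 2 / sqrt energy * (1 / 2) ^ n" for n
      using a_le[of n] L.nrm_nonneg[of "a n"] Schwartz_Lp2[OF aS] by simp
  qed
  from Lp_complete[OF _ Schwartz_Lp2[OF aS] this] obtain f where f: "f \<in> Lp lborel 2"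
    "(\<lambda>N. Lp_norm lborel 2 (\<lambda>z. f z - (\<Sum>n<N. a n z))) \<longlonglongrightarrow> 0" by auto
  have "(\<Sum>n<N. a n t) = \<phi> N t - \<phi> 0 t" for N t unfolding a_def by (rule sum_lessThan_telescope)
  then have "(\<lambda>t. f t - (\<Sum>n<N. a n t)) = (\<lambda>t. (f t + \<phi> 0 t) - \<phi> N t)" for N by (simp add: diff_diff_eq2)
  then have lim: "(\<lambda>N. Lp_norm lborel 2 (\<lambda>t. (f t + \<phi> 0 t) - \<phi> N t)) \<longlonglongrightarrow> 0"
    using f(2) by simp
  define h where "h = (\<lambda>t. f t + \<phi> 0 t)"
  have h: "h \<in> Lp lborel 2" unfolding h_def by (intro Lp_add f Schwartz_Lp2 \<phi>) simp
  have "u \<eta> = dist_of_fun h \<eta>" for \<eta>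
  proof (cases "\<eta> \<in> Schwartz")
    case \<eta>: True
    have le: "norm (u \<eta> - dist_of_fun (\<phi> n) \<eta>) \<le> (1 / 2) ^ n * (Lp_norm lborel 2 (coef \<psi> \<eta>) / energy)" for n
    proof -
      have "norm (u \<eta> - dist_of_fun (\<phi> n) \<eta>) \<le> nrm (Mod 2) (\<lambda>s. u s - dist_of_fun (\<phi> n) s) * (Lp_norm lborel 2 (coef \<psi> \<eta>) / energy)"
        using norm_Mod_le[OF M.diff_mem[OF u syn_Mod[of n]] _ _ \<eta>, of 2] by simp
      also have "\<dots> \<le> (1 / 2) ^ n * (Lp_norm lborel 2 (coef \<psi> \<eta>) / energy)"
        using F(3)[of n] energy_pos by (intro mult_right_mono) (auto simp: syn Lp_norm_def)
      finally show ?thesis .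
    qed
    have "(\<lambda>n. u \<eta> - dist_of_fun (\<phi> n) \<eta>) \<longlonglongrightarrow> 0"
    proof (rule Lim_null_comparison[OF always_eventually[OF allI[OF le]]])
      show "(\<lambda>n. (1 / 2) ^ n * (Lp_norm lborel 2 (coef \<psi> \<eta>) / energy)) \<longlonglongrightarrow> 0"
        by (intro tendsto_mult_left_zero LIMSEQ_realpow_zero) auto
    qed
    from tendsto_diff[OF tendsto_const this, of "u \<eta>"]
    have 1: "(\<lambda>n. dist_of_fun (\<phi> n) \<eta>) \<longlonglongrightarrow> u \<eta>" by simp
    have "(\<lambda>n. dist_of_fun h \<eta> - dist_of_fun (\<phi> n) \<eta>) \<longlonglongrightarrow> 0"
    proof (rule Lim_null_comparison[OF always_eventually])
      show "(\<lambda>n. Lp_norm lborel 2 (\<lambda>t. h t - \<phi> n t) * Lp_norm lborel 2 \<eta>) \<longlonglongrightarrow> 0"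
        using tendsto_mult_left_zero[OF lim] by (simp add: h_def)
      show "\<forall>n. norm (dist_of_fun h \<eta> - dist_of_fun (\<phi> n) \<eta>) \<le> Lp_norm lborel 2 (\<lambda>t. h t - \<phi> n t) * Lp_norm lborel 2 \<eta>"
      proof
        fix n
        have "dist_of_fun h \<eta> - dist_of_fun (\<phi> n) \<eta> = (\<integral>t. (h t - \<phi> n t) * \<eta> t \<partial>lborel)"
          using dist_of_fun_integrable[OF h \<eta>] integrable_Schwartz_mult[OF \<phi> \<eta>] \<eta>
          by (simp add: dist_of_fun_def left_diff_distrib)
        then show "norm (dist_of_fun h \<eta> - dist_of_fun (\<phi> n) \<eta>) \<le> Lp_norm lborel 2 (\<lambda>t. h t - \<phi> n t) * Lp_norm lborel 2 \<eta>"
          using Holder_mult_two(2)[OF Lp_diff[OF h Schwartz_Lp2[OF \<phi>]] Schwartz_Lp2[OF \<eta>]] by simp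
      qed
    qed
    from tendsto_diff[OF tendsto_const this, of "dist_of_fun h \<eta>"]
    have "(\<lambda>n. dist_of_fun (\<phi> n) \<eta>) \<longlonglongrightarrow> dist_of_fun h \<eta>" by simp
    with 1 show ?thesis by (rule LIMSEQ_unique)
  next
    case False
    then show ?thesis using tempered_outside[OF Mod_tempered[OF u]] by (simp add: dist_of_fun_def)
  qed
  then have "u = dist_of_fun h" by blast
  then show ?thesis using dist_of_fun_L2[OF h] by simp
qed

text \<open>A Schwartz function in one slot reduces the inner product to an evaluation of the
  distribution \<open>v\<close>, which the pairing reproduces.\<close>

lemma L2_inner_eq_pairing:
  assumes \<phi>: "\<phi> \<in> Schwartz" and v: "v \<in> vectors L2_space" "v \<in> tempered"
  shows "L2_inner (dist_of_fun \<phi>) v = modulation_pairing \<psi> (dist_of_fun \<phi>) v"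
proof -
  note R = L2_rep[OF v(1)]
  have [measurable]: "cnj \<in> borel_measurable borel"
    by (intro borel_measurable_continuous_onI continuous_intros)
  have [measurable]: "L2_rep v \<in> borel_measurable borel" "\<phi> \<in> borel_measurable borel"
    "L2_rep (dist_of_fun \<phi>) \<in> borel_measurable borel"
    using LpD[OF R(1)] Schwartz_measurable[OF \<phi>] LpD[OF L2_rep(1)[OF dist_of_fun_L2[OF Schwartz_Lp2[OF \<phi>]]]] by auto
  have "L2_inner (dist_of_fun \<phi>) v = (\<integral>t. \<phi> t * cnj (L2_rep v t) \<partial>lborel)"
    unfolding L2_inner_def
    by (rule integral_cong_AE; (measurable)?)
      (use L2_rep_dist_of_fun[OF Schwartz_Lp2[OF \<phi>]] in \<open>eventually_elim, simp\<close>)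
  also have "\<dots> = (\<integral>t. cnj (L2_rep v t * cnj (\<phi> t)) \<partial>lborel)" by (simp add: mult.commute)
  also have "\<dots> = cnj (dist_pairing (dist_of_fun (L2_rep v)) \<phi>)"
    using Schwartz_cnj[OF \<phi>] by (simp only: dist_pairing_def dist_of_fun_def Bochner_Integration.integral_cnj) simp
  also have "\<dots> = modulation_pairing \<psi> (dist_of_fun \<phi>) v"
    unfolding R(2) dist_pairing_eq_modulation_pairing[OF v(2) \<phi>] by (rule pairing_cnj)
  finally show ?thesis .
qed

text \<open>Norm convergence in \<open>L^2\<close> implies convergence of the values at a fixed test
  function, here the conjugate of \<open>\<theta>\<close>, and these values are pairings. This
  transfers the frame hypothesis to modulation spaces.\<close>

lemma frame_identity_Schwartz:
  assumes SF: "Schauder_frame L2_space x (\<lambda>j f. L2_inner f (y j))"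
    and x: "\<And>j. x j \<in> tempered" and y: "\<And>j. y j \<in> vectors L2_space" "\<And>j. y j \<in> tempered"
    and \<phi>: "\<phi> \<in> Schwartz" "dist_of_fun \<phi> \<in> tempered" and \<theta>: "\<theta> \<in> Schwartz"
  shows "(\<lambda>N. \<Sum>j<N. modulation_pairing \<psi> (dist_of_fun \<phi>) (y j) * cnj (modulation_pairing \<psi> (dist_of_fun \<theta>) (x j)))
    \<longlonglongrightarrow> modulation_pairing \<psi> (dist_of_fun \<phi>) (dist_of_fun \<theta>)"
proof -
  let ?f = "dist_of_fun \<phi>" and ?\<eta> = "\<lambda>t. cnj (\<theta> t)"
  have f: "?f \<in> vectors L2_space" by (intro dist_of_fun_L2 Schwartz_Lp2 \<phi>)
  have xL: "x j \<in> vectors L2_space" for j using SF by (auto simp: Schauder_frame_def)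
  define S where "S N = (\<lambda>s. ?f s - (\<Sum>j<N. modulation_pairing \<psi> ?f (y j) * x j s))" for N
  have S: "S N \<in> vectors L2_space" for N unfolding S_def by (intro L2_diff f L2_sum L2_scale xL)
  have "(\<lambda>N. nrm L2_space (\<lambda>s. ?f s - (\<Sum>j<N. L2_inner ?f (y j) * x j s))) \<longlonglongrightarrow> 0"
    using SF f unfolding Schauder_frame_def series_converges_to_def by blast
  then have "(\<lambda>N. nrm L2_space (S N)) \<longlonglongrightarrow> 0"
    unfolding S_def L2_inner_eq_pairing[OF \<phi>(1) y] .
  from tendsto_mult_left_zero[OF this, of "Lp_norm lborel 2 ?\<eta>"]
  have "(\<lambda>N. S N ?\<eta>) \<longlonglongrightarrow> 0"
    by (rule Lim_null_comparison[OF always_eventually, rotated]) (intro allI L2_bound S Schwartz_cnj \<theta>)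
  from tendsto_diff[OF tendsto_const this, of "?f ?\<eta>"]
  have "(\<lambda>N. \<Sum>j<N. modulation_pairing \<psi> ?f (y j) * x j ?\<eta>) \<longlonglongrightarrow> ?f ?\<eta>" by (simp add: S_def)
  then show ?thesis
    using dist_pairing_eq_modulation_pairing[OF x \<theta>] dist_pairing_eq_modulation_pairing[OF \<phi>(2) \<theta>]
    by (simp add: dist_pairing_def pairing_cnj)
qed

end

section \<open>Gabor frames\<close>

text \<open>Conjugation maps the interval from \<open>p\<close> to its conjugate to itself, so
  bounds at \<open>q\<close> and at the conjugate of \<open>q\<close> are available
  together.\<close>

lemma conj_exponent_range:
  fixes p q :: real
  assumes "1 < p" "p \<le> 2" "q \<in> {p..p / (p - 1)}"
  shows "q > 1" "1 / q + 1 / (q / (q - 1)) = 1" "q / (q - 1) \<in> {p..p / (p - 1)}" "q / (q - 1) > 1"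
    "1 / (q / (q - 1)) + 1 / q = 1" "q / (q - 1) / (q / (q - 1) - 1) = q"
proof -
  show q: "q > 1" using assms by simp
  have "p * (q - 1) \<le> q" using assms by (simp add: field_simps)
  then show "q / (q - 1) \<in> {p..p / (p - 1)}"
    using assms q by (auto simp: field_simps)
qed (use assms in \<open>auto simp: field_simps\<close>)

context window
begin

text \<open>Duality: \<open>f\<close> is tested against a norming \<open>h\<close>, the identity
  turns the pairing into a sum over both coefficient sequences, and the Bessel bound for
  \<open>h\<close> goes into the constant.\<close>

lemma analysis_lower_bound:
  assumes q: "q > 1" "1 / q + 1 / r = 1"
    and B: "bessel q \<Gamma> B" "B \<ge> 0" "bessel r G B'" "B' \<ge> 0" and f: "f \<in> vectors (Mod q)"
    and id: "\<And>h. h \<in> vectors (Mod r) \<Longrightarrow>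
      ((\<lambda>i. modulation_pairing \<psi> f (\<Gamma> i) * cnj (modulation_pairing \<psi> h (G i))) has_sum modulation_pairing \<psi> f h) UNIV"
  shows "nrm (Mod q) f \<le> kmass * B' * nrm (lq_space q) (analysis_operator \<psi> \<Gamma> f)"
proof -
  obtain h where h: "h \<in> vectors (Mod r)" "nrm (Mod r) h \<le> kmass / energy"
    "modulation_pairing \<psi> f h = of_real (nrm (Mod q) f / energy)"
    using norming_Mod[OF f q] by blast
  let ?a = "\<lambda>i. modulation_pairing \<psi> f (\<Gamma> i)" and ?b = "\<lambda>i. modulation_pairing \<psi> h (G i)"
  let ?N = "nrm (lq_space q) (analysis_operator \<psi> \<Gamma> f)"
  have fin: "norm (\<Sum>i\<in>F. ?a i * cnj (?b i)) \<le> ?N * (B' * (kmass / energy))" if F: "finite F" for F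
  proof -
    have "norm (\<Sum>i\<in>F. ?a i * cnj (?b i)) \<le>
        (\<Sum>i\<in>F. norm (?a i) powr q) powr (1 / q) * (\<Sum>i\<in>F. norm (?b i) powr r) powr (1 / r)"
      using Holder_sum_complex[OF F q, of ?a ?b] by (intro order_trans[OF norm_sum]) (simp add: norm_mult)
    also have "\<dots> \<le> ?N * (B' * nrm (Mod r) h)"
      by (intro mult_mono analysis_norm_bessel(3)[OF B(1,2) q(1) f F] besselD[OF B(3) h(1) F])
        (auto simp: lq_space_def)
    also have "\<dots> \<le> ?N * (B' * (kmass / energy))"
      using B(4) h(2) by (intro mult_left_mono) (auto simp: lq_space_def)
    finally show ?thesis .
  qed
  have "norm (modulation_pairing \<psi> f h) \<le> ?N * (B' * (kmass / energy))"
  proof (rule tendsto_upperbound)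
    show "((\<lambda>F. norm (\<Sum>i\<in>F. ?a i * cnj (?b i))) \<longlongrightarrow> norm (modulation_pairing \<psi> f h)) (finite_subsets_at_top UNIV)"
      using id[OF h(1)] unfolding has_sum_def by (rule tendsto_norm)
    show "\<forall>\<^sub>F F in finite_subsets_at_top UNIV. norm (\<Sum>i\<in>F. ?a i * cnj (?b i)) \<le> ?N * (B' * (kmass / energy))"
      by (intro eventually_finite_subsets_at_top_weakI fin)
  qed simp
  moreover have "norm (modulation_pairing \<psi> f h) = nrm (Mod q) f / energy"
    unfolding h(3) norm_of_real using energy_pos by (simp add: Mod_nrm Lp_norm_def)
  ultimately show ?thesis using energy_pos by (simp add: field_simps)
qed

text \<open>The hypothesis allows a different constant for each exponent. The two ends keep theirs,
  and interpolation between them supplies a constant free of \<open>q\<close> in between.\<close>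

lemma bessel_uniform:
  assumes p: "1 < p" "p \<le> 2" and h: "\<And>i. h i \<in> vectors (Mod p)"
    and b: "\<And>q. q \<in> {p..p / (p - 1)} \<Longrightarrow> \<exists>B\<ge>0. bessel q h B"
  shows "\<exists>B>0. \<forall>q\<in>{p..p / (p - 1)}. bessel q h B"
proof -
  let ?p' = "p / (p - 1)"
  have I: "p \<in> {p..?p'}" "?p' \<in> {p..?p'}" using p by (auto simp: field_simps mult_le_cancel_left1)
  obtain B0 where B0: "B0 \<ge> 0" "bessel p h B0" using b[OF I(1)] by blast
  obtain B1 where B1: "B1 \<ge> 0" "bessel ?p' h B1" using b[OF I(2)] by blast
  define C where "C = 2 powr ?p' * max ((B0 * (kmass / energy)) powr p) ((B1 * (kmass / energy)) powr ?p')"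
  define B where "B = max (max B0 B1) (max 1 C)"
  have h': "h i \<in> vectors (Mod (?p' / (?p' - 1)))" for i
    using h conj_exponent_range(6)[OF p I(1)] by simp
  have "bessel q h B" if q: "q \<in> {p..?p'}" for q
  proof -
    consider "q = p" | "q = ?p'" | "p < q" "q < ?p'" using q by fastforce
    then show ?thesis
    proof cases
      case 1
      then show ?thesis using bessel_mono[OF B0(2), of B] p by (simp add: B_def)
    next
      case 2
      then show ?thesis using bessel_mono[OF B1(2), of B] conj_exponent_range(1)[OF p I(2)] by (simp add: B_def)
    next
      case 3
      then show ?thesis
        using bessel_mono[OF bessel_interpolation[OF p(1) 3 h' B0(2) B1(2) B0(1) B1(1) C_def], of B] p
        by (simp add: B_def)
    qed
  qed
  then show ?thesis by (intro exI[of _ B]) (auto simp: B_def less_max_iff_disj)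
qed

text \<open>Coefficient functions with moments synthesise Schwartz functions, on which the
  \<open>L^2\<close> expansion can be tested. Membership of \<open>\<gamma>\<close> in
  \<open>M^2\<close> puts its shifts into \<open>L^2\<close>.\<close>

lemma gabor_frame_identity:
  assumes q: "q > 1" "1 / q + 1 / r = 1"
    and g: "g \<in> vectors (Mod q)" and \<gamma>: "\<gamma> \<in> vectors (Mod r)" "\<gamma> \<in> vectors (Mod 2)"
    and \<sigma>: "bij (\<sigma> :: nat \<Rightarrow> int \<times> int)"
    and SF: "Schauder_frame L2_space (\<lambda>j. gabor \<alpha> \<beta> g (\<sigma> j)) (\<lambda>j f. L2_inner f (gabor \<alpha> \<beta> \<gamma> (\<sigma> j)))"
    and B: "bessel q (gabor \<alpha> \<beta> \<gamma>) B" "bessel r (gabor \<alpha> \<beta> g) B'" "B \<ge> 0" "B' \<ge> 0"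
    and f: "f \<in> vectors (Mod q)" and h: "h \<in> vectors (Mod r)"
  shows "((\<lambda>i. modulation_pairing \<psi> f (gabor \<alpha> \<beta> \<gamma> i) * cnj (modulation_pairing \<psi> h (gabor \<alpha> \<beta> g i)))
    has_sum modulation_pairing \<psi> f h) UNIV"
proof (rule frame_identity_extension[OF q _ _ B \<sigma> _ f h])
  note r = conj_exponent_eqs(1)[OF q]
  show \<Gamma>: "gabor \<alpha> \<beta> \<gamma> i \<in> vectors (Mod r)" for i by (rule gabor_Mod[OF \<gamma>(1) r])
  show G: "gabor \<alpha> \<beta> g i \<in> vectors (Mod q)" for i by (rule gabor_Mod[OF g q(1)])
  fix F H assume F: "F \<in> moments" "F \<in> Lp lborel q" and H: "H \<in> moments"
  have "dist_of_fun (wave F) \<in> tempered"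
    using synth_tempered[OF F(2) q(1)] by (simp add: synth_wave[OF F(1)])
  from frame_identity_Schwartz[OF SF Mod_tempered[OF G] _ Mod_tempered[OF \<Gamma>] Schwartz_wave[OF F(1)] this Schwartz_wave[OF H]]
  show "(\<lambda>N. \<Sum>j<N. modulation_pairing \<psi> (synth F) (gabor \<alpha> \<beta> \<gamma> (\<sigma> j)) *
      cnj (modulation_pairing \<psi> (synth H) (gabor \<alpha> \<beta> g (\<sigma> j)))) \<longlonglongrightarrow> modulation_pairing \<psi> (synth F) (synth H)"
    unfolding synth_wave[OF F(1)] synth_wave[OF H] using Mod_two_subset_L2[OF \<gamma>(2)] by (simp add: L2_gabor_iff)
qed

lemma weakly_unconditional_of_frame:
  assumes "q > 1" and G: "\<And>i. G i \<in> vectors (Mod q)" and \<sigma>: "bij (\<sigma> :: nat \<Rightarrow> int \<times> int)"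
    and "unconditional_Schauder_frame (Mod q) (\<lambda>j. G (\<sigma> j)) (\<lambda>j f. modulation_pairing \<psi> f (\<Gamma> (\<sigma> j)))"
    and f: "f \<in> vectors (Mod q)"
  shows "weakly_unconditionally_convergent (Mod q) (\<lambda>i s. modulation_pairing \<psi> f (\<Gamma> i) * G i s)"
proof -
  interpret normed_fspace "Mod q" by (rule normed_Mod[OF assms(1)])
  show ?thesis
    using assms(4) f
    by (intro weakly_unconditionally_convergent_of_unconditional[OF \<sigma>] scale_mem G) (simp add: unconditional_Schauder_frame_def)
qed

end

theorem proposition5p2:
  fixes \<alpha> \<beta> p :: real and \<psi> :: "real \<Rightarrow> complex" and g \<gamma> :: distribution
  assumes "\<psi> \<in> Schwartz" and "\<psi> \<noteq> (\<lambda>_. 0)"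
    and "\<alpha> > 0" and "\<beta> > 0"
    and "1 < p" and "p \<le> 2"
    and "g \<in> vectors (modulation_space \<psi> p) - vectors (modulation_space \<psi> 1)"
    and "\<gamma> \<in> vectors (modulation_space \<psi> p) - vectors (modulation_space \<psi> 1)"
    and "\<exists>\<sigma>::nat \<Rightarrow> int \<times> int. bij \<sigma> \<and>
           Schauder_frame L2_space (\<lambda>j. gabor \<alpha> \<beta> g (\<sigma> j))
             (\<lambda>j f. L2_inner f (gabor \<alpha> \<beta> \<gamma> (\<sigma> j)))"
  shows
    "let p' = p / (p - 1);
         M = modulation_space \<psi>;
         G = gabor \<alpha> \<beta> g;
         \<Gamma> = gabor \<alpha> \<beta> \<gamma>;
         a = (\<forall>q\<in>{p..p'}. \<forall>\<sigma>::nat \<Rightarrow> int \<times> int. bij \<sigma> \<longrightarrow>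
                unconditional_Schauder_frame (M q) (\<lambda>j. G (\<sigma> j))
                  (\<lambda>j f. modulation_pairing \<psi> f (\<Gamma> (\<sigma> j))));
         b = (\<forall>q\<in>{p..p'}. \<forall>\<sigma>::nat \<Rightarrow> int \<times> int. bij \<sigma> \<longrightarrow>
                unconditional_Schauder_frame (M q) (\<lambda>j. \<Gamma> (\<sigma> j))
                  (\<lambda>j f. modulation_pairing \<psi> f (G (\<sigma> j))));
         c = (\<forall>q\<in>{p..p'}. \<forall>f\<in>vectors (M q).
                weakly_unconditionally_convergent (M q)
                  (\<lambda>i s. modulation_pairing \<psi> f (\<Gamma> i) * G i s));
         d = (\<forall>q\<in>{p..p'}. \<forall>f\<in>vectors (M q).
                weakly_unconditionally_convergent (M q)
                  (\<lambda>i s. modulation_pairing \<psi> f (G i) * \<Gamma> i s));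
         e = (\<forall>q\<in>{p..p'}.
                bounded_operator (M q) (lq_space q) (analysis_operator \<psi> G) \<and>
                bounded_operator (M q) (lq_space q) (analysis_operator \<psi> \<Gamma>));
         e' = (\<exists>A>0. \<exists>B>0. \<forall>q\<in>{p..p'}. \<forall>f\<in>vectors (M q).
                A * nrm (M q) f \<le> nrm (lq_space q) (analysis_operator \<psi> G f) \<and>
                nrm (lq_space q) (analysis_operator \<psi> G f) \<le> B * nrm (M q) f \<and>
                A * nrm (M q) f \<le> nrm (lq_space q) (analysis_operator \<psi> \<Gamma> f) \<and>
                nrm (lq_space q) (analysis_operator \<psi> \<Gamma> f) \<le> B * nrm (M q) f)
     in (a \<longleftrightarrow> b) \<and> (a \<longleftrightarrow> c) \<and> (a \<longleftrightarrow> d) \<and> (a \<longleftrightarrow> e) \<and> (e \<longrightarrow> e')"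
proof -
  interpret window \<psi> by unfold_locales fact+
  note p = \<open>1 < p\<close> \<open>p \<le> 2\<close>
  obtain \<sigma>0 :: "nat \<Rightarrow> int \<times> int" where \<sigma>0: "bij \<sigma>0"
    and SF: "Schauder_frame L2_space (\<lambda>j. gabor \<alpha> \<beta> g (\<sigma>0 j)) (\<lambda>j f. L2_inner f (gabor \<alpha> \<beta> \<gamma> (\<sigma>0 j)))"
    using assms(9) by blast
  define I where "I = {p..p / (p - 1)}"
  define G where "G = gabor \<alpha> \<beta> g"
  define \<Gamma> where "\<Gamma> = gabor \<alpha> \<beta> \<gamma>"
  have g: "g \<in> vectors (Mod q)" and \<gamma>: "\<gamma> \<in> vectors (Mod q)" if "p \<le> q" for q
    using assms(7,8) Mod_mono[OF _ p(1) that] by auto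
  obtain z1 z2 where z: "stft \<psi> g z1 \<noteq> 0" "stft \<psi> \<gamma> z2 \<noteq> 0"
    using assms(7,8) stft_nonzero by (metis Diff_iff)
  have I: "q > 1" "1 / q + 1 / (q / (q - 1)) = 1" "q / (q - 1) \<in> I" "p \<le> q" "p \<le> q / (q - 1)"
    "q / (q - 1) > 1" "1 / (q / (q - 1)) + 1 / q = 1" if "q \<in> I" for q
    using conj_exponent_range[OF p that[unfolded I_def]] that by (auto simp: I_def)
  have G: "G i \<in> vectors (Mod q)" and \<Gamma>: "\<Gamma> i \<in> vectors (Mod q)" if "p \<le> q" for q i
    using gabor_Mod[OF g] gabor_Mod[OF \<gamma>] that p unfolding G_def \<Gamma>_def by auto
  define bes where "bes h \<longleftrightarrow> (\<forall>q\<in>I. \<exists>B\<ge>0. bessel q h B)" for h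
  have op_iff: "bounded_operator (Mod q) (lq_space q) (analysis_operator \<psi> G) \<longleftrightarrow> (\<exists>B\<ge>0. bessel q G B)"
    "bounded_operator (Mod q) (lq_space q) (analysis_operator \<psi> \<Gamma>) \<longleftrightarrow> (\<exists>B\<ge>0. bessel q \<Gamma> B)" if "q \<in> I" for q
    using bounded_operator_iff_bessel[OF _ I(1,2)[OF that]] G[OF I(5)[OF that]] \<Gamma>[OF I(5)[OF that]] by simp_all
  have e_iff: "(\<forall>q\<in>I. bounded_operator (Mod q) (lq_space q) (analysis_operator \<psi> G) \<and>
      bounded_operator (Mod q) (lq_space q) (analysis_operator \<psi> \<Gamma>)) \<longleftrightarrow> bes G \<and> bes \<Gamma>"
    unfolding bes_def using op_iff by blast
  have wuc1: "bes G \<and> bes \<Gamma>" if c: "\<forall>q\<in>I. \<forall>f\<in>vectors (Mod q).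
      weakly_unconditionally_convergent (Mod q) (\<lambda>i s. modulation_pairing \<psi> f (\<Gamma> i) * G i s)"
  proof -
    \<comment> \<open>The condition at \<open>q\<close> bounds one system at \<open>q\<close> and
      the other at the conjugate exponent. As \<open>q\<close> runs through \<open>I\<close>, so
      does its conjugate, and both systems are bounded throughout.\<close>
    have *: "(\<exists>B\<ge>0. bessel q \<Gamma> B) \<and> (\<exists>B\<ge>0. bessel r G B)"
      if "q \<in> I" "r \<in> I" "1 / q + 1 / r = 1" for q r
      using bessel_of_weakly_unconditional[OF I(1)[OF that(1)] that(3) \<open>\<alpha> > 0\<close> \<open>\<beta> > 0\<close>
          g[OF I(4)] g[OF I(4)] z(1) \<gamma>[OF I(4)] \<gamma>[OF I(4)] z(2)] that c
      unfolding G_def \<Gamma>_def by blast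
    show ?thesis unfolding bes_def using *[OF _ I(3) I(2)] *[OF I(3) _ I(7)] by blast
  qed
  have wuc2: "bes G \<and> bes \<Gamma>" if c: "\<forall>q\<in>I. \<forall>f\<in>vectors (Mod q).
      weakly_unconditionally_convergent (Mod q) (\<lambda>i s. modulation_pairing \<psi> f (G i) * \<Gamma> i s)"
  proof -
    have *: "(\<exists>B\<ge>0. bessel q G B) \<and> (\<exists>B\<ge>0. bessel r \<Gamma> B)"
      if "q \<in> I" "r \<in> I" "1 / q + 1 / r = 1" for q r
      using bessel_of_weakly_unconditional[OF I(1)[OF that(1)] that(3) \<open>\<alpha> > 0\<close> \<open>\<beta> > 0\<close>
          \<gamma>[OF I(4)] \<gamma>[OF I(4)] z(2) g[OF I(4)] g[OF I(4)] z(1)] that c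
      unfolding G_def \<Gamma>_def by blast
    show ?thesis unfolding bes_def using *[OF _ I(3) I(2)] *[OF I(3) _ I(7)] by blast
  qed
  have id1: "((\<lambda>i. modulation_pairing \<psi> f (\<Gamma> i) * cnj (modulation_pairing \<psi> h (G i))) has_sum modulation_pairing \<psi> f h) UNIV"
    if b: "bes G" "bes \<Gamma>" and q: "q \<in> I" "r \<in> I" "1 / q + 1 / r = 1"
      and fh: "f \<in> vectors (Mod q)" "h \<in> vectors (Mod r)" for f h q r
  proof -
    obtain B B' where "bessel q \<Gamma> B" "B \<ge> 0" "bessel r G B'" "B' \<ge> 0" using b q unfolding bes_def by blast
    then show ?thesis
      using gabor_frame_identity[OF I(1)[OF q(1)] q(3) g[OF I(4)[OF q(1)]] \<gamma>[OF I(4)[OF q(2)]] \<gamma>[OF p(2)] \<sigma>0 SF _ _ _ _ fh]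
      unfolding G_def \<Gamma>_def by blast
  qed
  have id2: "((\<lambda>i. modulation_pairing \<psi> f (G i) * cnj (modulation_pairing \<psi> h (\<Gamma> i))) has_sum modulation_pairing \<psi> f h) UNIV"
    if b: "bes G" "bes \<Gamma>" and q: "q \<in> I" "r \<in> I" "1 / q + 1 / r = 1"
      and fh: "f \<in> vectors (Mod q)" "h \<in> vectors (Mod r)" for f h q r
  proof -
    \<comment> \<open>The identity with the two systems exchanged is the conjugate of
      \<open>id1\<close>, with \<open>f\<close> and \<open>h\<close> and their exponents
      interchanged.\<close>
    have "1 / r + 1 / q = 1" using q(3) by simp
    from has_sum_cnj_iff[THEN iffD2, OF id1[OF b q(2,1) this fh(2,1)]] show ?thesis
      by (simp add: pairing_cnj mult.commute)
  qed
  have a: "unconditional_Schauder_frame (Mod q) (\<lambda>j. G (\<sigma> j)) (\<lambda>j f. modulation_pairing \<psi> f (\<Gamma> (\<sigma> j)))"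
    and b: "unconditional_Schauder_frame (Mod q) (\<lambda>j. \<Gamma> (\<sigma> j)) (\<lambda>j f. modulation_pairing \<psi> f (G (\<sigma> j)))"
    if b: "bes G \<and> bes \<Gamma>" and q: "q \<in> I" and \<sigma>: "bij (\<sigma> :: nat \<Rightarrow> int \<times> int)" for q \<sigma>
  proof -
    let ?r = "q / (q - 1)"
    obtain B B' C C' where B: "bessel q \<Gamma> B" "bessel ?r G B'" "B \<ge> 0" "B' \<ge> 0"
      and C: "bessel q G C" "bessel ?r \<Gamma> C'" "C \<ge> 0" "C' \<ge> 0"
      using b q I(3)[OF q] unfolding bes_def by blast
    show "unconditional_Schauder_frame (Mod q) (\<lambda>j. G (\<sigma> j)) (\<lambda>j f. modulation_pairing \<psi> f (\<Gamma> (\<sigma> j)))"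
      using b by (intro unconditional_frame_of_identity[OF I(1,2)[OF q] \<Gamma>[OF I(5)[OF q]] G[OF I(4)[OF q]] B _ \<sigma>]
          id1[OF _ _ q I(3)[OF q] I(2)[OF q]]) auto
    show "unconditional_Schauder_frame (Mod q) (\<lambda>j. \<Gamma> (\<sigma> j)) (\<lambda>j f. modulation_pairing \<psi> f (G (\<sigma> j)))"
      using b by (intro unconditional_frame_of_identity[OF I(1,2)[OF q] G[OF I(5)[OF q]] \<Gamma>[OF I(4)[OF q]] C _ \<sigma>]
          id2[OF _ _ q I(3)[OF q] I(2)[OF q]]) auto
  qed
  have "\<exists>A>0. \<exists>B>0. \<forall>q\<in>I. \<forall>f\<in>vectors (Mod q).
      A * nrm (Mod q) f \<le> nrm (lq_space q) (analysis_operator \<psi> G f) \<and>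
      nrm (lq_space q) (analysis_operator \<psi> G f) \<le> B * nrm (Mod q) f \<and>
      A * nrm (Mod q) f \<le> nrm (lq_space q) (analysis_operator \<psi> \<Gamma> f) \<and>
      nrm (lq_space q) (analysis_operator \<psi> \<Gamma> f) \<le> B * nrm (Mod q) f" if b: "bes G" "bes \<Gamma>"
  proof -
    have "\<exists>B>0. \<forall>q\<in>I. bessel q G B"
      unfolding I_def by (rule bessel_uniform[OF p G[OF order_refl]]) (rule bspec[OF b(1)[unfolded bes_def I_def]])
    then obtain B where B: "B > 0" "\<And>q. q \<in> I \<Longrightarrow> bessel q G B" by blast
    have "\<exists>B>0. \<forall>q\<in>I. bessel q \<Gamma> B"
      unfolding I_def by (rule bessel_uniform[OF p \<Gamma>[OF order_refl]]) (rule bspec[OF b(2)[unfolded bes_def I_def]])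
    then obtain C where C: "C > 0" "\<And>q. q \<in> I \<Longrightarrow> bessel q \<Gamma> C" by blast
    \<comment> \<open>The summand 1 secures \<open>K > 0\<close>, as \<open>kmass\<close> is only
      known to be nonnegative. The lower bound for one system uses the upper bound of the other,
      hence \<open>max B C\<close>.\<close>
    define K where "K = kmass * max B C + 1"
    have "0 \<le> kmass * max B C" using kmass_nonneg B(1) by simp
    moreover have "kmass * B \<le> kmass * max B C" "kmass * C \<le> kmass * max B C"
      using kmass_nonneg by (simp_all add: mult_left_mono)
    ultimately have K: "K > 0" "kmass * B \<le> K" "kmass * C \<le> K" unfolding K_def by linarith+
    have nn: "0 \<le> nrm (lq_space q) (analysis_operator \<psi> h f)" for q h f by (simp add: lq_space_def)
    have "1 / K * nrm (Mod q) f \<le> nrm (lq_space q) (analysis_operator \<psi> G f) \<and>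
        nrm (lq_space q) (analysis_operator \<psi> G f) \<le> max B C * nrm (Mod q) f \<and>
        1 / K * nrm (Mod q) f \<le> nrm (lq_space q) (analysis_operator \<psi> \<Gamma> f) \<and>
        nrm (lq_space q) (analysis_operator \<psi> \<Gamma> f) \<le> max B C * nrm (Mod q) f"
      if q: "q \<in> I" and f: "f \<in> vectors (Mod q)" for q f
    proof (intro conjI)
      note r = I(3)[OF q]
      have "nrm (Mod q) f \<le> K * nrm (lq_space q) (analysis_operator \<psi> \<Gamma> f)"
        using analysis_lower_bound[OF I(1,2)[OF q] C(2)[OF q] less_imp_le[OF C(1)] B(2)[OF r] less_imp_le[OF B(1)] f
            id1[OF b q r I(2)[OF q] f]] mult_right_mono[OF K(2) nn] by (rule order_trans)
      then show "1 / K * nrm (Mod q) f \<le> nrm (lq_space q) (analysis_operator \<psi> \<Gamma> f)"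
        using K(1) by (simp add: field_simps)
      have "nrm (Mod q) f \<le> K * nrm (lq_space q) (analysis_operator \<psi> G f)"
        using analysis_lower_bound[OF I(1,2)[OF q] B(2)[OF q] less_imp_le[OF B(1)] C(2)[OF r] less_imp_le[OF C(1)] f
            id2[OF b q r I(2)[OF q] f]] mult_right_mono[OF K(3) nn] by (rule order_trans)
      then show "1 / K * nrm (Mod q) f \<le> nrm (lq_space q) (analysis_operator \<psi> G f)"
        using K(1) by (simp add: field_simps)
      have n: "0 \<le> nrm (Mod q) f" by (simp add: Mod_nrm Lp_norm_def)
      show "nrm (lq_space q) (analysis_operator \<psi> G f) \<le> max B C * nrm (Mod q) f"
        by (rule order_trans[OF analysis_norm_bessel(2)[OF B(2)[OF q] less_imp_le[OF B(1)] I(1)[OF q] f]])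
          (intro mult_right_mono n, simp)
      show "nrm (lq_space q) (analysis_operator \<psi> \<Gamma> f) \<le> max B C * nrm (Mod q) f"
        by (rule order_trans[OF analysis_norm_bessel(2)[OF C(2)[OF q] less_imp_le[OF C(1)] I(1)[OF q] f]])
          (intro mult_right_mono n, simp)
    qed
    moreover have "1 / K > 0" "max B C > 0" using K(1) B(1) by auto
    ultimately show ?thesis by blast
  qed
  moreover have "weakly_unconditionally_convergent (Mod q) (\<lambda>i s. modulation_pairing \<psi> f (\<Gamma> i) * G i s)"
    if "\<forall>q\<in>I. \<forall>\<sigma>::nat \<Rightarrow> int \<times> int. bij \<sigma> \<longrightarrow>
        unconditional_Schauder_frame (Mod q) (\<lambda>j. G (\<sigma> j)) (\<lambda>j f. modulation_pairing \<psi> f (\<Gamma> (\<sigma> j)))"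
      "q \<in> I" "f \<in> vectors (Mod q)" for q f
    using that \<sigma>0 by (intro weakly_unconditional_of_frame[OF I(1) G[OF I(4)] \<sigma>0]) auto
  moreover have "weakly_unconditionally_convergent (Mod q) (\<lambda>i s. modulation_pairing \<psi> f (G i) * \<Gamma> i s)"
    if "\<forall>q\<in>I. \<forall>\<sigma>::nat \<Rightarrow> int \<times> int. bij \<sigma> \<longrightarrow>
        unconditional_Schauder_frame (Mod q) (\<lambda>j. \<Gamma> (\<sigma> j)) (\<lambda>j f. modulation_pairing \<psi> f (G (\<sigma> j)))"
      "q \<in> I" "f \<in> vectors (Mod q)" for q f
    using that \<sigma>0 by (intro weakly_unconditional_of_frame[OF I(1) \<Gamma>[OF I(4)] \<sigma>0]) auto
  ultimately show ?thesis
    unfolding Let_def G_def[symmetric] \<Gamma>_def[symmetric] I_def[symmetric] e_iff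
    using wuc1 wuc2 a b by (intro conjI iffI impI) (blast | meson)+
qed

end
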